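(* Let $k,\ell\ge 1$ be coprime integers, $n\ge 1$, let $f=xy\prod_{i=1}^n(y^k-f_ix^\ell)$ with $f_1,\dots,f_n\in\mathbb{C}^*$ pairwise distinct, and let $d=k\ell n+k+\ell$. Let $\omega_d\in\mathcal{Q}^d(f)$ satisfy the generic condition (defined in the context), so that $$\omega_d=c_0\,xy\prod_{i=1}^n(y^k-c_ix^\ell)\left(\sum_{i=1}^n\lambda_i\frac{d(y^k-c_ix^\ell)}{y^k-c_ix^\ell}+(\ell\lambda_0+\ell-u)\frac{dx}{x}+(k\lambda_\infty+v)\frac{dy}{y}\right)$$ with $c_0\in\mathbb{C}^*$, $c_1,\dots,c_n\in\mathbb{C}^*$ pairwise distinct and $\lambda_0,\lambda_1,\dots,\lambda_n,\lambda_\infty$ the associated Camacho–Sad indices. Then every $\omega\in\mathcal{Q}(\omega_d)$ is strictly formally orbitally equivalent to a unique form $\omega_{h,s}$ of the type $$\omega_{h,s}=\omega_d+d(xy\,h)+s\,(\ell y\,dx-kx\,dy),$$ where $$h(x,y)=\sum_{\substack{ki+\ell j\ge k\ell n+1\\ 0\le i\le \ell n-1\\ 0\le j\le kn-1}}h_{ij}x^iy^j,\qquad s(x,y)=\sum_{j=0}^{kn-1}s_j(x)\,x^{\ell n+1+\left]\frac{1-\ell j}{k}\right]}\,y^j,$$ with $h_{ij}\in\mathbb{C}$ and $s_j(x)\in\mathbb{C}[[x]]$ formal power series.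
   Context: Strict integer part: for $a\in\mathbb{R}$, $]a]$ is the integer with $]a]<a\le\, ]a]+1$. Equivalence: two germs of $1$-forms $\omega,\omega'$ at $0\in\mathbb{C}^2$ are strictly formally orbitally equivalent if there are a formal change of coordinates $\phi$ with $\phi(0)=0$, $D\phi(0)=\mathrm{Id}$, and a formal power series $w$ with $w(0)=1$, such that $w\cdot\phi^*\omega=\omega'$. Integers $u,v$: the nonnegative integers with $ku-\ell v=1$, $u\le\ell$, $v\le k$. Quasi-homogeneity: a polynomial is $(k,\ell)$-quasi-homogeneous of degree $m$ if all its monomials $x^iy^j$ satisfy $ki+\ell j=m$. For a germ $g$, $g_m$ denotes its $(k,\ell)$-quasi-homogeneous component of degree $m$. Desingularization: $\sigma:(\mathcal{M},\mathcal{D})\to(\mathbb{C}^2,0)$ is the minimal desingularization (composition of point blow-ups) of the curve $\{f=0\}$. All branches $\{y^k=f_ix^\ell\}$ ("cuspidal branches") meet the same component $D_c$ of $\mathcal{D}$ (the principal component) after $\sigma$, and there is a chart $(x_c,y_c)$ in which $\sigma$ is $(x,y)=(x_c^{k-v}y_c^k,\;x_c^{\ell-u}y_c^\ell)$ and $D_c=\{y_c=0\}$; thus $x_c=x^\ell/y^k$. $\mathcal{Q}(f)$: the set of germs at $0\in\mathbb{C}^2$ of holomorphic $1$-forms $\omega=a\,dx+b\,dy$ (with $a,b$ without common factor) defining a non-dicritical foliation $\mathcal{F}$ such that: after desingularization of $\mathcal{F}$ no singularity is a saddle-node; the union of the separatrices of $\mathcal{F}$ is topologically conjugate (as a germ of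 curve) to $\{f=0\}$; the (minimal) desingularization map of $\mathcal{F}$ is $\sigma$; and $\{xy=0\}$ is invariant by $\mathcal{F}$. Each $\omega\in\mathcal{Q}(f)$ decomposes as $\omega=\omega_d+\omega_{d+1}+\cdots$ with $\omega_m=a_{m-k}\,dx+b_{m-\ell}\,dy$ and $\omega_d\not\equiv0$; $\omega_d$ is its initial part. $\mathcal{Q}^d(f)=\{\omega_d=a_{d-k}\,dx+b_{d-\ell}\,dy:\ \omega_d\in\mathcal{Q}(f)\}$, and for $\omega_d\in\mathcal{Q}^d(f)$, $\mathcal{Q}(\omega_d)$ is the set of elements of $\mathcal{Q}(f)$ with initial part $\omega_d$. Indices: for $\omega_d=a_{d-k}dx+b_{d-\ell}dy\in\mathcal{Q}^d(f)$ put $q_d=kxa_{d-k}+\ell yb_{d-\ell}$. It equals a nonzero constant (namely $-c_0$ in the notation of the claim) times $xy\prod_{i=1}^n(y^k-c_ix^\ell)$, with $c_i\in\mathbb{C}^*$ pairwise distinct. Writing $\sigma^*\omega_d=\hat a\,dx_c+\hat b\,dy_c$, the Camacho–Sad indices along $D_c$ are $\lambda_i=-\mathrm{Res}_{x_c=1/c_i}\,\partial_{y_c}(\hat a/\hat b)(x_c,0)$ for $1\le i\le n$, $\lambda_0$ is given by the same formula at $x_c=0$, and $\lambda_\infty$ is the index at the point $x_c=\infty$ of $D_c$; they satisfy $\lambda_0+\lambda_\infty+\sum_{i=1}^n\lambda_i=-1$. Generic condition on $\omega_d\in\mathcal{Q}^d(f)$: (1) $\lambda_i\notin\mathbb{Q}$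 for all $i\in\{0,1,\dots,n,\infty\}$; (2) for every $m=1,\dots,k\ell n-1$, $\det M_m\ne0$, where $M_m$ is defined as follows. Let $A=ma_{d-k}+\partial_xq_d$, $B=mb_{d-\ell}+\partial_yq_d$, and write $A/y=\sum_{i=0}^nA_ix^{\ell(n-i)}y^{ki}$, $B/x=\sum_{i=0}^nB_ix^{\ell i}y^{k(n-i)}$. Let $e_m=\#\{(i,j)\in\mathbb{Z}_{\ge0}^2: ki+\ell j=m\}$. Then $M_m$ is the $2e_m\times2e_m$ matrix consisting of four $e_m\times e_m$ blocks whose $(r,t)$ entries ($0\le r,t\le e_m-1$) are: upper left $A_{r-t}$, upper right $B_{n-r+t}$, lower left $A_{n+r-t}$, lower right $B_{t-r}$, with the convention $A_i=B_i=0$ if $i\notin\{0,\dots,n\}$ (and $\det M_m=1$ if $e_m=0$). *)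

theory Defs
  imports
    "HOL-Complex_Analysis.Complex_Analysis"
    "Jordan_Normal_Form.Char_Poly"
begin

section \<open>Power series in two variables\<close>

text \<open>
  The ring \<open>C[[x,y]]\<close> is rendered as \<open>C[[x]][[y]]\<close>: the outer variable is \<open>y\<close>. A germ of a
  holomorphic function at the origin of \<open>C\<^sup>2\<close> is a convergent series.
\<close>

type_synonym series2 = "complex fps fps"

definition cf :: "series2 \<Rightarrow> nat \<Rightarrow> nat \<Rightarrow> complex" where
  \<comment> \<open>the coefficient of \<open>x\<^sup>i y\<^sup>j\<close>\<close>
  "cf F i j = fps_nth (fps_nth F j) i"

definition fps2 :: "(nat \<Rightarrow> nat \<Rightarrow> complex) \<Rightarrow> series2" where
  "fps2 c = Abs_fps (\<lambda>j. Abs_fps (\<lambda>i. c i j))"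

lemma cf_fps2 [simp]: "cf (fps2 c) i j = c i j"
  by (simp add: cf_def fps2_def)

lemma series2_eqI: "(\<And>i j. cf F i j = cf G i j) \<Longrightarrow> F = G"
  by (simp add: cf_def fps_eq_iff)

definition varx :: series2 where "varx = fps_const fps_X"
definition vary :: series2 where "vary = fps_X"
definition cst :: "complex \<Rightarrow> series2" where "cst c = fps_const (fps_const c)"

definition dx2 :: "series2 \<Rightarrow> series2" where
  "dx2 F = fps2 (\<lambda>i j. of_nat (Suc i) * cf F (Suc i) j)"

definition dy2 :: "series2 \<Rightarrow> series2" where
  "dy2 F = fps2 (\<lambda>i j. of_nat (Suc j) * cf F i (Suc j))"

text \<open>
  Substitution \<open>F(P,Q)\<close>, for \<open>P\<close> and \<open>Q\<close> without constant term: then \<open>P\<^sup>p Q\<^sup>q\<close> has order at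
  least \<open>p + q\<close>, so only the indices \<open>p, q \<le> i + j\<close> contribute to the coefficient of \<open>x\<^sup>i y\<^sup>j\<close>.
\<close>

definition subst2 :: "series2 \<Rightarrow> series2 \<Rightarrow> series2 \<Rightarrow> series2" where
  "subst2 F P Q = fps2 (\<lambda>i j. \<Sum>p\<le>i+j. \<Sum>q\<le>i+j. cf F p q * cf (P ^ p * Q ^ q) i j)"

definition convergent2 :: "series2 \<Rightarrow> bool" where
  "convergent2 F \<longleftrightarrow> (\<exists>C R. \<forall>i j. norm (cf F i j) \<le> C * R ^ (i + j))"

definition conv_dom2 :: "series2 \<Rightarrow> (complex \<times> complex) set" where
  "conv_dom2 F = {(x,y). (\<lambda>(i,j). norm (cf F i j * x ^ i * y ^ j)) summable_on UNIV}"

definition eval2 :: "series2 \<Rightarrow> complex \<times> complex \<Rightarrow> complex" where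
  "eval2 F = (\<lambda>(x,y). infsum (\<lambda>(i,j). cf F i j * x ^ i * y ^ j) UNIV)"

text \<open>Divisibility, units and irreducibility in the ring of convergent series.\<close>

definition gdvd :: "series2 \<Rightarrow> series2 \<Rightarrow> bool" where
  "gdvd g F \<longleftrightarrow> (\<exists>h. convergent2 h \<and> F = g * h)"

definition gunit :: "series2 \<Rightarrow> bool" where
  "gunit g \<longleftrightarrow> convergent2 g \<and> cf g 0 0 \<noteq> 0"

definition girreducible :: "series2 \<Rightarrow> bool" where
  "girreducible g \<longleftrightarrow> convergent2 g \<and> g \<noteq> 0 \<and> \<not> gunit g \<and>
     (\<forall>p q. convergent2 p \<and> convergent2 q \<and> g = p * q \<longrightarrow> gunit p \<or> gunit q)"


section \<open>One-forms\<close>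

text \<open>The pair \<open>(a,b)\<close> stands for \<open>a dx + b dy\<close>.\<close>

type_synonym form2 = "series2 \<times> series2"

definition smul :: "series2 \<Rightarrow> form2 \<Rightarrow> form2" where
  "smul g \<omega> = (g * fst \<omega>, g * snd \<omega>)"

definition ext_d :: "series2 \<Rightarrow> form2" where
  "ext_d F = (dx2 F, dy2 F)"

definition pullback :: "series2 \<times> series2 \<Rightarrow> form2 \<Rightarrow> form2" where
  "pullback \<phi> \<omega> =
     smul (subst2 (fst \<omega>) (fst \<phi>) (snd \<phi>)) (ext_d (fst \<phi>)) +
     smul (subst2 (snd \<omega>) (fst \<phi>) (snd \<phi>)) (ext_d (snd \<phi>))"

text \<open>Germs of holomorphic one-forms whose coefficients have no common factor.\<close>

definition coprime_form :: "form2 \<Rightarrow> bool" where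
  "coprime_form \<omega> \<longleftrightarrow> convergent2 (fst \<omega>) \<and> convergent2 (snd \<omega>) \<and>
     (\<forall>g. convergent2 g \<and> gdvd g (fst \<omega>) \<and> gdvd g (snd \<omega>) \<longrightarrow> gunit g)"

text \<open>The curve \<open>{g = 0}\<close> is invariant iff \<open>g\<close> divides the coefficient of \<open>\<omega> \<and> dg\<close>.\<close>

definition invariant_curve :: "form2 \<Rightarrow> series2 \<Rightarrow> bool" where
  "invariant_curve \<omega> g \<longleftrightarrow> gdvd g (fst \<omega> * dy2 g - snd \<omega> * dx2 g)"

definition strictly_formally_orbitally_equivalent :: "form2 \<Rightarrow> form2 \<Rightarrow> bool" where
  "strictly_formally_orbitally_equivalent \<omega> \<omega>' \<longleftrightarrow>
     (\<exists>P Q w. cf P 0 0 = 0 \<and> cf P 1 0 = 1 \<and> cf P 0 1 = 0 \<and>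
              cf Q 0 0 = 0 \<and> cf Q 1 0 = 0 \<and> cf Q 0 1 = 1 \<and>
              cf w 0 0 = 1 \<and> smul w (pullback (P, Q) \<omega>) = \<omega>')"


section \<open>Singularities\<close>

definition singular_form :: "form2 \<Rightarrow> bool" where
  "singular_form \<omega> \<longleftrightarrow> cf (fst \<omega>) 0 0 = 0 \<and> cf (snd \<omega>) 0 0 = 0"

text \<open>The linear part at the origin of the vector field \<open>-b \<partial>\<^sub>x + a \<partial>\<^sub>y\<close>, which spans the kernel
  of \<open>a dx + b dy\<close>.\<close>

definition linear_part :: "form2 \<Rightarrow> complex Matrix.mat" where
  "linear_part \<omega> = mat_of_rows_list 2
     [[- cf (snd \<omega>) 1 0, - cf (snd \<omega>) 0 1],
      [  cf (fst \<omega>) 1 0,   cf (fst \<omega>) 0 1]]"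

definition eigenvalue_pair :: "form2 \<Rightarrow> complex \<Rightarrow> complex \<Rightarrow> bool" where
  "eigenvalue_pair \<omega> \<mu> \<nu> \<longleftrightarrow> char_poly (linear_part \<omega>) = [:- \<mu>, 1:] * [:- \<nu>, 1:]"

definition reduced_singularity :: "form2 \<Rightarrow> bool" where
  "reduced_singularity \<omega> \<longleftrightarrow> singular_form \<omega> \<and>
     (\<exists>\<mu> \<nu>. eigenvalue_pair \<omega> \<mu> \<nu> \<and> \<nu> \<noteq> 0 \<and> (\<forall>r::rat. r > 0 \<longrightarrow> \<mu> / \<nu> \<noteq> of_rat r))"

definition saddle_node :: "form2 \<Rightarrow> bool" where
  "saddle_node \<omega> \<longleftrightarrow> singular_form \<omega> \<and> (\<exists>\<nu>. eigenvalue_pair \<omega> 0 \<nu> \<and> \<nu> \<noteq> 0)"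


section \<open>Compositions of point blow-ups\<close>

text \<open>
  An infinitely near point is a list of directions, the first blow-up coming first: \<open>p @ [t]\<close> is
  the point with direction \<open>t \<in> P\<^sup>1\<close> of the exceptional divisor created by blowing up \<open>p\<close>
  (\<open>None\<close> is the direction of \<open>x = 0\<close>). The blow-up is \<open>(x, y) \<mapsto> (x, x (y + t))\<close> in the local
  coordinates at \<open>Some t\<close>, where the exceptional divisor is \<open>x = 0\<close>, and \<open>(x, y) \<mapsto> (x y, y)\<close> at
  \<open>None\<close>, where it is \<open>y = 0\<close>. A composition of point blow-ups over the origin is given by the
  finite prefix-closed set of the infinitely near points that are blown up; two compositions are
  isomorphic over the origin iff these sets coincide.
\<close>

type_synonym point = "complex option list"

fun blowup_map :: "point \<Rightarrow> series2 \<times> series2" where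
  "blowup_map [] = (varx, vary)"
| "blowup_map (Some t # ts) = (case blowup_map ts of (P, Q) \<Rightarrow> (P, P * (Q + cst t)))"
| "blowup_map (None # ts) = (case blowup_map ts of (P, Q) \<Rightarrow> (P * Q, Q))"

fun exc_eq :: "complex option \<Rightarrow> series2" where
  "exc_eq (Some t) = varx"
| "exc_eq None = vary"

definition blowup_tree :: "point set \<Rightarrow> bool" where
  "blowup_tree T \<longleftrightarrow> finite T \<and> (\<forall>p t. p @ [t] \<in> T \<longrightarrow> p \<in> T)"

text \<open>The points of the fibre over the origin once all points of \<open>T\<close> have been blown up.\<close>

definition fibre :: "point set \<Rightarrow> point set" where
  "fibre T = {p. p \<notin> T \<and> (p = [] \<or> butlast p \<in> T)}"


subsection \<open>Desingularization of curves\<close>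

definition normal_crossing :: "series2 \<Rightarrow> bool" where
  "normal_crossing F \<longleftrightarrow> (\<exists>U X Y a b. gunit U \<and> convergent2 X \<and> convergent2 Y \<and>
     cf X 0 0 = 0 \<and> cf Y 0 0 = 0 \<and> cf X 1 0 * cf Y 0 1 - cf X 0 1 * cf Y 1 0 \<noteq> 0 \<and>
     F = U * X ^ a * Y ^ b)"

definition desing_curve :: "series2 \<Rightarrow> point set \<Rightarrow> bool" where
  \<comment> \<open>the total transform of \<open>{F = 0}\<close>, hence also the exceptional divisor, has normal crossings\<close>
  "desing_curve F T \<longleftrightarrow> blowup_tree T \<and>
     (\<forall>p\<in>fibre T. normal_crossing (subst2 F (fst (blowup_map p)) (snd (blowup_map p))))"

definition minimal_desing_curve :: "series2 \<Rightarrow> point set \<Rightarrow> bool" where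
  "minimal_desing_curve F T \<longleftrightarrow>
     desing_curve F T \<and> (\<forall>T'. desing_curve F T' \<longrightarrow> T \<subseteq> T')"


subsection \<open>Desingularization of foliations\<close>

text \<open>\<open>\<omega>'\<close> defines, near the infinitely near point \<open>p\<close>, the pullback of the foliation of \<open>\<omega>\<close>;
  it is unique up to a unit.\<close>

definition foliation_at :: "form2 \<Rightarrow> point \<Rightarrow> form2 \<Rightarrow> bool" where
  "foliation_at \<omega> p \<omega>' \<longleftrightarrow> coprime_form \<omega>' \<and>
     (\<exists>g. convergent2 g \<and> g \<noteq> 0 \<and> pullback (blowup_map p) \<omega> = smul g \<omega>')"

definition desing_foliation :: "form2 \<Rightarrow> point set \<Rightarrow> bool" where
  "desing_foliation \<omega> T \<longleftrightarrow> blowup_tree T \<and>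
     (\<forall>p\<in>fibre T. \<exists>\<omega>'. foliation_at \<omega> p \<omega>' \<and> (singular_form \<omega>' \<longrightarrow> reduced_singularity \<omega>'))"

definition minimal_desing_foliation :: "form2 \<Rightarrow> point set \<Rightarrow> bool" where
  "minimal_desing_foliation \<omega> T \<longleftrightarrow>
     desing_foliation \<omega> T \<and> (\<forall>T'. desing_foliation \<omega> T' \<longrightarrow> T \<subseteq> T')"

text \<open>Every component of the exceptional divisor is invariant.\<close>

definition nondicritical :: "form2 \<Rightarrow> point set \<Rightarrow> bool" where
  "nondicritical \<omega> T \<longleftrightarrow>
     (\<forall>p\<in>T. \<forall>t. \<exists>\<omega>'. foliation_at \<omega> (p @ [t]) \<omega>' \<and> invariant_curve \<omega>' (exc_eq t))"

definition no_saddle_nodes :: "form2 \<Rightarrow> point set \<Rightarrow> bool" where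
  "no_saddle_nodes \<omega> T \<longleftrightarrow> (\<forall>p\<in>fibre T. \<exists>\<omega>'. foliation_at \<omega> p \<omega>' \<and> \<not> saddle_node \<omega>')"


section \<open>Separatrices and topological conjugacy\<close>

definition separatrix :: "form2 \<Rightarrow> series2 \<Rightarrow> bool" where
  "separatrix \<omega> g \<longleftrightarrow> girreducible g \<and> invariant_curve \<omega> g"

text \<open>\<open>{G = 0}\<close> is the union of the separatrices (as a set: multiplicities in \<open>G\<close> are irrelevant).\<close>

definition separatrix_union :: "form2 \<Rightarrow> series2 \<Rightarrow> bool" where
  "separatrix_union \<omega> G \<longleftrightarrow> convergent2 G \<and> G \<noteq> 0 \<and>
     (\<forall>g. girreducible g \<longrightarrow> (gdvd g G \<longleftrightarrow> separatrix \<omega> g))"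

definition top_conjugate :: "series2 \<Rightarrow> series2 \<Rightarrow> bool" where
  "top_conjugate F G \<longleftrightarrow> (\<exists>U V h h'. open U \<and> open V \<and> (0, 0) \<in> U \<and> (0, 0) \<in> V \<and>
     U \<subseteq> conv_dom2 F \<and> V \<subseteq> conv_dom2 G \<and>
     homeomorphism U V h h' \<and> h (0, 0) = (0, 0) \<and>
     h ` {z \<in> U. eval2 F z = 0} = {z \<in> V. eval2 G z = 0})"


section \<open>The classes of forms\<close>

definition cusp :: "nat \<Rightarrow> nat \<Rightarrow> complex \<Rightarrow> series2" where
  "cusp k l c = vary ^ k - cst c * varx ^ l"

definition curve_eq :: "nat \<Rightarrow> nat \<Rightarrow> nat \<Rightarrow> (nat \<Rightarrow> complex) \<Rightarrow> series2" where
  "curve_eq k l n c = varx * vary * (\<Prod>i=1..n. cusp k l (c i))"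

definition Qset :: "series2 \<Rightarrow> form2 set" where
  "Qset f = {\<omega>. coprime_form \<omega> \<and>
     (\<exists>T. minimal_desing_curve f T \<and> minimal_desing_foliation \<omega> T \<and>
          nondicritical \<omega> T \<and> no_saddle_nodes \<omega> T) \<and>
     (\<exists>G. separatrix_union \<omega> G \<and> top_conjugate G f) \<and>
     invariant_curve \<omega> (varx * vary)}"

text \<open>The quasi-homogeneous part of degree \<open>m\<close> of a form; \<open>dx\<close> has weight \<open>k\<close> and \<open>dy\<close> weight \<open>l\<close>.\<close>

definition form_part :: "nat \<Rightarrow> nat \<Rightarrow> nat \<Rightarrow> form2 \<Rightarrow> form2" where
  "form_part k l m \<omega> =
     (fps2 (\<lambda>i j. if k * i + l * j + k = m then cf (fst \<omega>) i j else 0),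
      fps2 (\<lambda>i j. if k * i + l * j + l = m then cf (snd \<omega>) i j else 0))"

definition Qd :: "nat \<Rightarrow> nat \<Rightarrow> nat \<Rightarrow> series2 \<Rightarrow> form2 set" where
  "Qd k l d f = {\<omega> \<in> Qset f. form_part k l d \<omega> = \<omega>}"

definition Qinit :: "nat \<Rightarrow> nat \<Rightarrow> nat \<Rightarrow> series2 \<Rightarrow> form2 \<Rightarrow> form2 set" where
  "Qinit k l d f \<omega>\<^sub>d =
     {\<omega> \<in> Qset f. (\<forall>m<d. form_part k l m \<omega> = 0) \<and> form_part k l d \<omega> = \<omega>\<^sub>d}"


section \<open>Camacho--Sad indices and the generic condition\<close>

definition q_of :: "nat \<Rightarrow> nat \<Rightarrow> form2 \<Rightarrow> series2" where
  "q_of k l \<omega> = of_nat k * varx * fst \<omega> + of_nat l * vary * snd \<omega>"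

text \<open>
  The chart \<open>(x\<^sub>c, y\<^sub>c)\<close>, and the chart at the point \<open>x\<^sub>c = \<infinity>\<close> of the principal component with
  coordinates \<open>(1 / x\<^sub>c, x\<^sub>c y\<^sub>c)\<close>; by \<open>k u - l v = 1\<close> the latter has the exponents below.
\<close>

definition chart_c :: "nat \<Rightarrow> nat \<Rightarrow> nat \<Rightarrow> nat \<Rightarrow> series2 \<times> series2" where
  "chart_c k l u v = (varx ^ (k - v) * vary ^ k, varx ^ (l - u) * vary ^ l)"

definition chart_inf :: "nat \<Rightarrow> nat \<Rightarrow> nat \<Rightarrow> nat \<Rightarrow> series2 \<times> series2" where
  "chart_inf k l u v = (varx ^ v * vary ^ k, varx ^ u * vary ^ l)"

text \<open>
  The index at the point \<open>(t, 0)\<close> of \<open>y\<^sub>c = 0\<close>, for a polynomial form. Both coefficients of the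
  pullback contain a power of \<open>y\<^sub>c\<close>, so at \<open>y\<^sub>c = 0\<close> the quotient below is \<open>0 / 0 = 0\<close>; this is also
  the value of its continuous extension, since \<open>y\<^sub>c = 0\<close> is invariant.
\<close>

definition cs_index :: "series2 \<times> series2 \<Rightarrow> form2 \<Rightarrow> complex \<Rightarrow> complex" where
  "cs_index \<sigma> \<omega> t = - residue (\<lambda>x. deriv (\<lambda>y.
     eval2 (fst (pullback \<sigma> \<omega>)) (x, y) / eval2 (snd (pullback \<sigma> \<omega>)) (x, y)) 0) t"

definition e_num :: "nat \<Rightarrow> nat \<Rightarrow> nat \<Rightarrow> nat" where
  "e_num k l m = card {(i::nat, j::nat). k * i + l * j = m}"

text \<open>\<open>A\<^sub>i\<close> and \<open>B\<^sub>i\<close> are the coefficients of \<open>x\<^bsup>l(n-i)\<^esup> y\<^bsup>ki\<^esup>\<close> in \<open>A / y\<close> and of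
  \<open>x\<^bsup>li\<^esup> y\<^bsup>k(n-i)\<^esup>\<close> in \<open>B / x\<close>.\<close>

definition A_coef :: "nat \<Rightarrow> nat \<Rightarrow> nat \<Rightarrow> form2 \<Rightarrow> nat \<Rightarrow> int \<Rightarrow> complex" where
  "A_coef k l n \<omega> m i = (if 0 \<le> i \<and> i \<le> int n
     then cf (of_nat m * fst \<omega> + dx2 (q_of k l \<omega>)) (l * (n - nat i)) (k * nat i + 1) else 0)"

definition B_coef :: "nat \<Rightarrow> nat \<Rightarrow> nat \<Rightarrow> form2 \<Rightarrow> nat \<Rightarrow> int \<Rightarrow> complex" where
  "B_coef k l n \<omega> m i = (if 0 \<le> i \<and> i \<le> int n
     then cf (of_nat m * snd \<omega> + dy2 (q_of k l \<omega>)) (l * nat i + 1) (k * (n - nat i)) else 0)"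

definition M_mat :: "nat \<Rightarrow> nat \<Rightarrow> nat \<Rightarrow> form2 \<Rightarrow> nat \<Rightarrow> complex Matrix.mat" where
  "M_mat k l n \<omega> m =
     (let e = e_num k l m; A = A_coef k l n \<omega> m; B = B_coef k l n \<omega> m in
      four_block_mat
        (Matrix.mat e e (\<lambda>(r, t). A (int r - int t)))
        (Matrix.mat e e (\<lambda>(r, t). B (int n - int r + int t)))
        (Matrix.mat e e (\<lambda>(r, t). A (int n + int r - int t)))
        (Matrix.mat e e (\<lambda>(r, t). B (int t - int r))))"

text \<open>The numbers \<open>c\<^sub>1, \<dots>, c\<^sub>n\<close> are the nonzero \<open>c\<close> such that \<open>y\<^sup>k - c x\<^sup>l\<close> divides \<open>q\<^sub>d\<close>.\<close>

definition generic :: "nat \<Rightarrow> nat \<Rightarrow> nat \<Rightarrow> nat \<Rightarrow> nat \<Rightarrow> form2 \<Rightarrow> bool" where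
  "generic k l n u v \<omega> \<longleftrightarrow>
     cs_index (chart_c k l u v) \<omega> 0 \<notin> \<rat> \<and>
     cs_index (chart_inf k l u v) \<omega> 0 \<notin> \<rat> \<and>
     (\<forall>c. c \<noteq> 0 \<and> cusp k l c dvd q_of k l \<omega> \<longrightarrow> cs_index (chart_c k l u v) \<omega> (1 / c) \<notin> \<rat>) \<and>
     (\<forall>m. 1 \<le> m \<and> m < k * l * n \<longrightarrow> Determinant.det (M_mat k l n \<omega> m) \<noteq> 0)"

text \<open>
  \<open>c\<^sub>0 x y \<Prod>\<^sub>i g\<^sub>i (\<Sum>\<^sub>i \<lambda>\<^sub>i dg\<^sub>i / g\<^sub>i + \<alpha> dx / x + \<beta> dy / y)\<close> with \<open>g\<^sub>i = y\<^sup>k - c\<^sub>i x\<^sup>l\<close>, multiplied out.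
\<close>

definition log_form :: "nat \<Rightarrow> nat \<Rightarrow> nat \<Rightarrow> complex \<Rightarrow> (nat \<Rightarrow> complex) \<Rightarrow>
    (nat \<Rightarrow> complex) \<Rightarrow> complex \<Rightarrow> complex \<Rightarrow> form2" where
  "log_form k l n c\<^sub>0 c lam \<alpha> \<beta> = smul (cst c\<^sub>0)
     ((\<Sum>i=1..n. smul (cst (lam i) * varx * vary * (\<Prod>j\<in>{1..n}-{i}. cusp k l (c j)))
                      (ext_d (cusp k l (c i)))) +
      smul (cst \<alpha> * vary * (\<Prod>j=1..n. cusp k l (c j))) (ext_d varx) +
      smul (cst \<beta> * varx * (\<Prod>j=1..n. cusp k l (c j))) (ext_d vary))"


section \<open>Normal forms\<close>

definition strict_floor :: "real \<Rightarrow> int" where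
  "strict_floor a = \<lceil>a\<rceil> - 1"

lemma strict_floor_unique:
  "strict_floor a = z \<longleftrightarrow> of_int z < a \<and> a \<le> of_int z + 1"
  unfolding strict_floor_def by linarith

definition h_set :: "nat \<Rightarrow> nat \<Rightarrow> nat \<Rightarrow> series2 set" where
  "h_set k l n = {h. \<forall>i j. cf h i j \<noteq> 0 \<longrightarrow>
     k * i + l * j \<ge> k * l * n + 1 \<and> i < l * n \<and> j < k * n}"

definition s_exponent :: "nat \<Rightarrow> nat \<Rightarrow> nat \<Rightarrow> nat \<Rightarrow> int" where
  "s_exponent k l n j = int (l * n) + 1 + strict_floor ((1 - real l * real j) / real k)"

lemma s_exponent_pos:
  assumes "k \<ge> 1" "l \<ge> 1" "j < k * n"
  shows "s_exponent k l n j > 0"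
proof -
  have "j + 1 \<le> k * n" using assms by simp
  hence "l * (j + 1) \<le> l * (k * n)" by (rule mult_le_mono2)
  hence "real l * real j + real l \<le> real k * real (l * n)"
    by (metis (no_types, lifting) distrib_left mult.left_commute mult.right_neutral
        of_nat_add of_nat_le_iff of_nat_mult)
  moreover have "real l \<ge> 1" using assms by simp
  ultimately have "(1 - real l * real j) / real k > - real (l * n)"
    using assms by (simp add: field_simps)
  thus ?thesis unfolding s_exponent_def strict_floor_def by linarith
qed

definition s_series :: "nat \<Rightarrow> nat \<Rightarrow> nat \<Rightarrow> (nat \<Rightarrow> complex fps) \<Rightarrow> series2" where
  "s_series k l n s =
     (\<Sum>j<k*n. fps_const (s j) * varx ^ nat (s_exponent k l n j) * vary ^ j)"

definition omega_hs :: "nat \<Rightarrow> nat \<Rightarrow> form2 \<Rightarrow> series2 \<Rightarrow> series2 \<Rightarrow> form2" where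
  "omega_hs k l \<omega>\<^sub>d h s =
     \<omega>\<^sub>d + ext_d (varx * vary * h) + smul s (of_nat l * vary, - (of_nat k * varx))"

definition normal_forms :: "nat \<Rightarrow> nat \<Rightarrow> nat \<Rightarrow> form2 \<Rightarrow> form2 set" where
  "normal_forms k l n \<omega>\<^sub>d = {omega_hs k l \<omega>\<^sub>d h (s_series k l n s) | h s. h \<in> h_set k l n}"

end

theory Submission
  imports Defs "HOL-Number_Theory.Cong" "HOL-Computational_Algebra.Field_as_Ring" "HOL-Library.Sublist"
begin

text \<open>
  Write \<open>\<omega>\<^sub>d = y \<alpha> dx + x \<beta> dy\<close> with \<open>\<alpha>\<close> and \<open>\<beta>\<close> binary forms of degree \<open>n\<close> in \<open>x\<^sup>l\<close>, \<open>y\<^sup>k\<close>. Euclid's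
  algorithm on \<open>(k, l)\<close> gives the blow-ups that create the principal component; as no saddle-node lies
  on it, \<open>P = k \<alpha> + l \<beta>\<close> has \<open>n\<close> distinct nonzero roots, and the logarithmic expression of \<open>\<omega>\<^sub>d\<close> follows
  by comparing two polynomials of degree \<open>n\<close> at these roots.

  A coordinate change \<open>(x + p, y + q)\<close> and a unit \<open>1 + w\<close>, where \<open>p, q, w\<close> have relative weight \<open>m\<close>,
  change \<open>\<omega>\<^sub>d + \<dots>\<close> in weight \<open>d + m\<close> by a linear operator in \<open>(p, q, w)\<close>. For \<open>m < k l n\<close> the
  condition \<open>det M\<^sub>m \<noteq> 0\<close> makes the normal form a complement of the image. For larger \<open>m\<close> this follows
  from Bezout's identity and from a triangular system whose diagonal does not vanish because the
  indices are irrational. Solving weight by weight gives existence. The kernel of the operator consists of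
  the fields tangent to the foliation; their flows preserve \<open>\<omega>\<close> up to a unit, so that an equivalence of
  two normal forms can be corrected to be the identity to any order, which gives uniqueness.
\<close>
section \<open>Power series in two variables\<close>

text \<open>Two filtrations compete. Strictness concerns the ordinary degree, the normal form the
  weights (k, l), and a change tangent to the identity may contain y^r with l r < k and so lower the
  weight. An equivalence of forms with initial part \<open>wd\<close> is therefore first shown to be
  of the shape (x P, y Q); only then can it be compared weight by weight. The summands h and s come
  from the Euler field R = k x d/dx + l y d/dy. For a form theta of weight W, Cartan's formula reads
  W theta = d(i_R theta) - curl(theta) (l y dx - k x dy), so the contraction \<open>q_of\<close> and
  the \<open>curl\<close> determine theta. They also decouple the linear operator: a field g R
  together with the unit -(m + d) g leaves the contraction alone and moves only the curl. What
  remains is a problem in (p, q) for the contraction, then one in g for the curl. On the monomials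
  of one weight, multiplication by a binary form is multiplication of polynomials in z = y^k / x^l.
  The matrices M_m are truncated Sylvester matrices; from m = k l n on nothing is truncated and
  coprimality decides. The same variable z is, up to inversion, the coordinate on the principal
  component.\<close>

declare One_nat_def [simp del]

subsection \<open>Coefficients and weights\<close>

lemma cf_add [simp]: "cf (F + G) i j = cf F i j + cf G i j"
  by (simp add: cf_def)

lemma cf_diff [simp]: "cf (F - G) i j = cf F i j - cf G i j"
  by (simp add: cf_def)

lemma cf_uminus [simp]: "cf (- F) i j = - cf F i j"
  by (simp add: cf_def)

lemma cf_0 [simp]: "cf 0 i j = 0"
  by (simp add: cf_def)

lemma cf_sum [simp]: "cf (sum f A) i j = (\<Sum>a\<in>A. cf (f a) i j)"
  by (induction A rule: infinite_finite_induct) auto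

lemma cf_cst_mult [simp]: "cf (cst c * F) i j = c * cf F i j"
  by (simp add: cf_def cst_def)

lemma cf_mult_cst [simp]: "cf (F * cst c) i j = cf F i j * c"
  by (subst mult.commute) simp

lemma cf_mult: "cf (F * G) i j = (\<Sum>p\<le>i. \<Sum>q\<le>j. cf F p q * cf G (i - p) (j - q))"
proof -
  have "cf (F * G) i j = (\<Sum>q\<le>j. \<Sum>p\<le>i. cf F p q * cf G (i - p) (j - q))"
    by (simp add: cf_def fps_mult_nth fps_sum_nth atLeast0AtMost)
  thus ?thesis by (subst sum.swap)
qed

lemma cst_simps [simp]: "cst 0 = 0" "cst 1 = 1" "cst (a + b) = cst a + cst b"
    "cst (a * b) = cst a * cst b" "cst (- a) = - cst a" "cst (a - b) = cst a - cst b"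
  by (simp_all add: cst_def fps_const_neg [symmetric] fps_const_sub [symmetric]
      fps_const_add [symmetric] fps_const_mult [symmetric]
      del: fps_const_add fps_const_sub fps_const_mult fps_const_neg)

lemma cst_of_nat: "cst (of_nat m) = of_nat m"
  by (induction m) simp_all

lemma cst_power: "cst (a ^ m) = cst a ^ m"
  by (induction m) simp_all

lemma cf_1: "cf 1 i j = (if i = 0 \<and> j = 0 then 1 else 0)"
  by (simp add: cf_def)

lemma cf_cst: "cf (cst c) i j = (if i = 0 \<and> j = 0 then c else 0)"
  using cf_cst_mult[of c 1 i j] by (simp add: cf_1)

lemma cf_of_nat_mult [simp]: "cf (of_nat m * F) i j = of_nat m * cf F i j"
  using cf_cst_mult[of "of_nat m"] by (simp add: cst_of_nat)

lemma cf_varx_mult: "cf (varx * F) i j = (if i = 0 then 0 else cf F (i - 1) j)"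
  by (simp add: cf_def varx_def)

lemma cf_vary_mult: "cf (vary * F) i j = (if j = 0 then 0 else cf F i (j - 1))"
  by (simp add: cf_def vary_def)

definition mon :: "nat \<Rightarrow> nat \<Rightarrow> series2" where
  "mon p q = varx ^ p * vary ^ q"

lemma cf_mon_mult: "cf (mon p q * F) i j = (if p \<le> i \<and> q \<le> j then cf F (i - p) (j - q) else 0)"
proof -
  have y: "cf (vary ^ q * G) i j = (if q \<le> j then cf G i (j - q) else 0)" for G i j
    by (induction q arbitrary: i j) (auto simp: cf_vary_mult mult.assoc One_nat_def)
  have "cf (varx ^ p * G) i j = (if p \<le> i then cf G (i - p) j else 0)" for G i j
    by (induction p arbitrary: i j) (auto simp: cf_varx_mult mult.assoc One_nat_def)
  thus ?thesis by (simp add: mon_def mult.assoc y)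
qed

lemma cf_mon: "cf (mon p q) i j = (if i = p \<and> j = q then 1 else 0)"
  using cf_mon_mult[of p q 1 i j] by (auto simp: cf_1)

lemma mon_00 [simp]: "mon 0 0 = 1"
  by (simp add: mon_def)

lemma mon_mult: "mon p q * mon p' q' = mon (p + p') (q + q')"
  by (simp add: mon_def power_add mult_ac)

lemma varx_mon: "varx = mon 1 0" and vary_mon: "vary = mon 0 1"
  by (simp_all add: mon_def)

lemma cf_varx: "cf varx i j = (if i = 1 \<and> j = 0 then 1 else 0)"
  by (simp add: varx_mon cf_mon)

lemma cf_vary: "cf vary i j = (if i = 0 \<and> j = 1 then 1 else 0)"
  by (simp add: vary_mon cf_mon)

lemma cf_dx2 [simp]: "cf (dx2 F) i j = of_nat (Suc i) * cf F (Suc i) j"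
  by (simp add: dx2_def)

lemma cf_dy2 [simp]: "cf (dy2 F) i j = of_nat (Suc j) * cf F i (Suc j)"
  by (simp add: dy2_def)

text \<open>Every monomial of \<open>F\<close> has weight at least \<open>m\<close>, where \<open>x\<close> has weight \<open>a\<close> and \<open>y\<close> has
  weight \<open>b\<close>. The bound is an integer because differentiation lowers it.\<close>

definition wge :: "nat \<Rightarrow> nat \<Rightarrow> int \<Rightarrow> series2 \<Rightarrow> bool" where
  "wge a b m F \<longleftrightarrow> (\<forall>i j. cf F i j \<noteq> 0 \<longrightarrow> m \<le> int (a * i + b * j))"

lemma wgeI: "(\<And>i j. cf F i j \<noteq> 0 \<Longrightarrow> m \<le> int (a * i + b * j)) \<Longrightarrow> wge a b m F"
  by (simp add: wge_def)

lemma wgeD: "wge a b m F \<Longrightarrow> int (a * i + b * j) < m \<Longrightarrow> cf F i j = 0"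
  by (force simp: wge_def)

lemma wge_mono: "wge a b m F \<Longrightarrow> m' \<le> m \<Longrightarrow> wge a b m' F"
  by (force simp: wge_def)

lemma wge_zero [simp]: "wge a b m 0"
  by (simp add: wge_def)

lemma wge_trivial: "m \<le> 0 \<Longrightarrow> wge a b m F"
  by (meson wgeI of_nat_0_le_iff order_trans)

lemma wge_add: "wge a b m F \<Longrightarrow> wge a b m G \<Longrightarrow> wge a b m (F + G)"
  by (force simp: wge_def)

lemma wge_diff: "wge a b m F \<Longrightarrow> wge a b m G \<Longrightarrow> wge a b m (F - G)"
  by (force simp: wge_def)

lemma wge_uminus: "wge a b m F \<Longrightarrow> wge a b m (- F)"
  by (force simp: wge_def)

lemma wge_sum: "(\<And>x. x \<in> A \<Longrightarrow> wge a b m (f x)) \<Longrightarrow> wge a b m (sum f A)"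
  by (induction A rule: infinite_finite_induct) (auto intro: wge_add)

lemma wge_cst_mult: "wge a b m F \<Longrightarrow> wge a b m (cst c * F)"
  by (force simp: wge_def)

lemma wge_of_nat_mult: "wge a b m F \<Longrightarrow> wge a b m (of_nat c * F)"
  by (force simp: wge_def)

lemma wge_mult: 
  assumes "wge a b m F" "wge a b m' G"
  shows "wge a b (m + m') (F * G)"
proof (rule wgeI)
  fix i j assume "cf (F * G) i j \<noteq> 0"
  then obtain p where p: "p \<le> i" "(\<Sum>q\<le>j. cf F p q * cf G (i - p) (j - q)) \<noteq> 0"
    unfolding cf_mult by (metis (no_types, lifting) atMost_iff sum.not_neutral_contains_not_neutral)
  then obtain q where q: "q \<le> j" "cf F p q * cf G (i - p) (j - q) \<noteq> 0"
    by (metis (no_types, lifting) atMost_iff sum.not_neutral_contains_not_neutral)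
  have "m \<le> int (a * p + b * q)" "m' \<le> int (a * (i - p) + b * (j - q))"
    using q assms unfolding wge_def by (metis mult_eq_0_iff)+
  moreover have "a * p + b * q + (a * (i - p) + b * (j - q)) = a * i + b * j"
  proof -
    obtain i' j' where "i = p + i'" "j = q + j'" using p q le_Suc_ex by metis
    thus ?thesis by (simp add: algebra_simps)
  qed
  ultimately show "m + m' \<le> int (a * i + b * j)" by linarith
qed

lemma wge_multI: "wge a b m F \<Longrightarrow> wge a b m' G \<Longrightarrow> M \<le> m + m' \<Longrightarrow> wge a b M (F * G)"
  using wge_mult wge_mono by blast

lemma wge_mon: "m \<le> int (a * p + b * q) \<Longrightarrow> wge a b m (mon p q)"
  by (auto simp: wge_def cf_mon split: if_splits)

lemma wge_power:
  assumes "wge a b m F"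
  shows "wge a b (int p * m) (F ^ p)"
proof (induction p)
  case 0
  show ?case by (auto simp: wge_def)
next
  case (Suc p)
  show ?case using wge_mult[OF assms Suc] by (simp add: algebra_simps)
qed

lemma wge_dx2: "wge a b m F \<Longrightarrow> wge a b (m - int a) (dx2 F)"
proof (rule wgeI)
  fix i j assume "wge a b m F" "cf (dx2 F) i j \<noteq> 0"
  hence "m \<le> int (a * Suc i + b * j)" unfolding wge_def by (metis cf_dx2 mult_zero_right)
  thus "m - int a \<le> int (a * i + b * j)" by simp
qed

lemma wge_dy2: "wge a b m F \<Longrightarrow> wge a b (m - int b) (dy2 F)"
proof (rule wgeI)
  fix i j assume "wge a b m F" "cf (dy2 F) i j \<noteq> 0"
  hence "m \<le> int (a * i + b * Suc j)" unfolding wge_def by (metis cf_dy2 mult_zero_right)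
  thus "m - int b \<le> int (a * i + b * j)" by simp
qed

lemma wge_const_free: "cf P 0 0 = 0 \<Longrightarrow> wge 1 1 1 P"
proof (rule wgeI)
  fix i j assume "cf P 0 0 = 0" "cf P i j \<noteq> 0"
  hence "0 < i + j" by (cases "i + j") auto
  thus "1 \<le> int (1 * i + 1 * j)" by linarith
qed

lemma wge_powers: 
  assumes "wge a b (int a) P" "wge a b (int b) Q"
  shows "wge a b (int (a * p + b * q)) (P ^ p * Q ^ q)"
  using wge_mult[OF wge_power[OF assms(1), of p] wge_power[OF assms(2), of q]]
  by (simp add: algebra_simps)

subsection \<open>Continuous linear operators\<close>

text \<open>Such operators lower the order by a bounded amount and are therefore determined by their
  values on monomials. This is how the product rule, the chain rule and the composition law are
  reduced to monomials.\<close>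

definition lincont :: "(series2 \<Rightarrow> series2) \<Rightarrow> bool" where
  "lincont \<Phi> \<longleftrightarrow> (\<forall>F G. \<Phi> (F + G) = \<Phi> F + \<Phi> G) \<and> (\<forall>c F. \<Phi> (cst c * F) = cst c * \<Phi> F) \<and>
     (\<exists>r::nat. \<forall>B F. wge 1 1 (B + int r) F \<longrightarrow> wge 1 1 B (\<Phi> F))"

lemma lincontI:
  assumes "\<And>F G. \<Phi> (F + G) = \<Phi> F + \<Phi> G" "\<And>c F. \<Phi> (cst c * F) = cst c * \<Phi> F"
    "\<And>B F. wge 1 1 (B + int r) F \<Longrightarrow> wge 1 1 B (\<Phi> F)"
  shows "lincont \<Phi>"
  using assms unfolding lincont_def by blast

lemma lincont_add: "lincont \<Phi> \<Longrightarrow> \<Phi> (F + G) = \<Phi> F + \<Phi> G"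
  and lincont_cst: "lincont \<Phi> \<Longrightarrow> \<Phi> (cst c * F) = cst c * \<Phi> F"
  by (auto simp: lincont_def)

lemma lincont_0: "lincont \<Phi> \<Longrightarrow> \<Phi> 0 = 0"
  using lincont_cst[of \<Phi> 0 0] by simp

lemma lincont_uminus: "lincont \<Phi> \<Longrightarrow> \<Phi> (- F) = - \<Phi> F"
  using lincont_cst[of \<Phi> "-1" F] by simp

lemma lincont_diff: "lincont \<Phi> \<Longrightarrow> \<Phi> (F - G) = \<Phi> F - \<Phi> G"
  using lincont_add[of \<Phi> F "- G"] by (simp add: lincont_uminus)

lemma lincont_sum: "lincont \<Phi> \<Longrightarrow> \<Phi> (sum f A) = (\<Sum>a\<in>A. \<Phi> (f a))"
  by (induction A rule: infinite_finite_induct) (auto simp: lincont_0 lincont_add)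

lemma lincont_comp:
  assumes "lincont \<Phi>" "lincont \<Psi>"
  shows "lincont (\<lambda>F. \<Phi> (\<Psi> F))"
proof -
  obtain r s :: nat where r: "\<And>B F. wge 1 1 (B + int r) F \<Longrightarrow> wge 1 1 B (\<Phi> F)"
    and s: "\<And>B F. wge 1 1 (B + int s) F \<Longrightarrow> wge 1 1 B (\<Psi> F)"
    using assms unfolding lincont_def by blast
  show ?thesis
  proof (rule lincontI[where r = "r + s"])
    fix B F assume "wge 1 1 (B + int (r + s)) F"
    hence "wge 1 1 (B + int r + int s) F" by (simp add: add.assoc)
    thus "wge 1 1 B (\<Phi> (\<Psi> F))" by (intro r s)
  qed (use assms in \<open>auto simp: lincont_add lincont_cst\<close>)
qed

lemma lincont_plus:
  assumes "lincont \<Phi>" "lincont \<Psi>"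
  shows "lincont (\<lambda>F. \<Phi> F + \<Psi> F)"
proof -
  obtain r s :: nat where r: "\<And>B F. wge 1 1 (B + int r) F \<Longrightarrow> wge 1 1 B (\<Phi> F)"
    and s: "\<And>B F. wge 1 1 (B + int s) F \<Longrightarrow> wge 1 1 B (\<Psi> F)"
    using assms unfolding lincont_def by blast
  show ?thesis
  proof (rule lincontI[where r = "r + s"])
    fix B F assume F: "wge 1 1 (B + int (r + s)) F"
    show "wge 1 1 B (\<Phi> F + \<Psi> F)"
      by (intro wge_add r s wge_mono[OF F]) simp_all
  qed (use assms in \<open>auto simp: lincont_add lincont_cst distrib_left add_ac\<close>)
qed

lemma lincont_mult: "lincont (\<lambda>F. G * F)"
proof (rule lincontI[where r = 0])
  fix B F assume "wge 1 1 (B + int 0) F"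
  thus "wge 1 1 B (G * F)" using wge_mult[of 1 1 0 G B F] by (simp add: wge_trivial)
qed (simp_all add: algebra_simps)

lemma lincont_mult_right: "lincont \<Phi> \<Longrightarrow> lincont (\<lambda>F. \<Phi> F * G)"
  using lincont_comp[OF lincont_mult[of G]] by (simp add: mult.commute)

lemma lincont_id: "lincont (\<lambda>F. F)"
  by (rule lincontI[where r = 0]) auto

lemma lincont_dx2: "lincont dx2"
  by (rule lincontI[where r = 1])
    (auto intro: series2_eqI simp: algebra_simps dest: wge_dx2)

lemma lincont_dy2: "lincont dy2"
  by (rule lincontI[where r = 1])
    (auto intro: series2_eqI simp: algebra_simps dest: wge_dy2)

lemma truncation:
  "wge 1 1 (int B + 1) (F - (\<Sum>p\<le>B. \<Sum>q\<le>B. cst (cf F p q) * mon p q))"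
proof (rule wgeI, rule ccontr)
  fix i j assume nz: "cf (F - (\<Sum>p\<le>B. \<Sum>q\<le>B. cst (cf F p q) * mon p q)) i j \<noteq> 0"
    and "\<not> int B + 1 \<le> int (1 * i + 1 * j)"
  hence "i \<le> B" "j \<le> B" by simp_all
  have "(\<Sum>q\<le>B. cf F p q * (if i = p \<and> j = q then 1 else 0)) = (if i = p then cf F p j else 0)" for p
    using \<open>j \<le> B\<close> by (cases "i = p") (simp_all add: if_distrib[where f = "\<lambda>z. _ * z"] cong: if_cong)
  hence "(\<Sum>p\<le>B. \<Sum>q\<le>B. cf F p q * (if i = p \<and> j = q then 1 else 0)) = cf F i j"
    using \<open>i \<le> B\<close> by simp
  thus False using nz by (simp add: cf_mon)
qed

text \<open>Both operators see a fixed coefficient only through a finite truncation of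
  \<open>F\<close>, which is a linear combination of monomials. The order of truncation has to
  exceed the coefficient's order by the losses \<open>r\<close> and \<open>s\<close>.\<close>

lemma lincont_ext:
  assumes \<Phi>: "lincont \<Phi>" and \<Psi>: "lincont \<Psi>" and eq: "\<And>p q. \<Phi> (mon p q) = \<Psi> (mon p q)"
  shows "\<Phi> F = \<Psi> F"
proof (rule series2_eqI)
  fix i j
  obtain r s :: nat where r: "\<And>B F. wge 1 1 (B + int r) F \<Longrightarrow> wge 1 1 B (\<Phi> F)"
    and s: "\<And>B F. wge 1 1 (B + int s) F \<Longrightarrow> wge 1 1 B (\<Psi> F)"
    using assms unfolding lincont_def by blast
  define B where "B = i + j + r + s"
  define T where "T = (\<Sum>p\<le>B. \<Sum>q\<le>B. cst (cf F p q) * mon p q)"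
  have T: "wge 1 1 (int B + 1) (F - T)" unfolding T_def by (rule truncation)
  have "wge 1 1 (int (i + j) + 1) (\<Phi> (F - T))" "wge 1 1 (int (i + j) + 1) (\<Psi> (F - T))"
    by (auto intro!: r s wge_mono[OF T] simp: B_def)
  hence "cf (\<Phi> (F - T)) i j = 0" "cf (\<Psi> (F - T)) i j = 0"
    by (auto elim!: wgeD)
  moreover have "\<Phi> T = \<Psi> T" unfolding T_def
    by (simp add: lincont_sum[OF \<Phi>] lincont_sum[OF \<Psi>] lincont_cst[OF \<Phi>] lincont_cst[OF \<Psi>] eq)
  ultimately show "cf (\<Phi> F) i j = cf (\<Psi> F) i j"
    using lincont_diff[OF \<Phi>, of F T] lincont_diff[OF \<Psi>, of F T] by simp
qed

lemma dy2_mon: "dy2 (mon p q) = of_nat q * mon p (q - 1)"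
  by (rule series2_eqI) (cases q; auto simp: cf_mon simp del: of_nat_Suc)

lemma dx2_mon: "dx2 (mon p q) = of_nat p * mon (p - 1) q"
  by (rule series2_eqI) (cases p; auto simp: cf_mon simp del: of_nat_Suc)

lemmas dx2_add [simp] = lincont_add[OF lincont_dx2]
  and dy2_add [simp] = lincont_add[OF lincont_dy2]
  and dx2_diff [simp] = lincont_diff[OF lincont_dx2]
  and dy2_diff [simp] = lincont_diff[OF lincont_dy2]
  and dx2_uminus [simp] = lincont_uminus[OF lincont_dx2]
  and dy2_uminus [simp] = lincont_uminus[OF lincont_dy2]
  and dx2_0 [simp] = lincont_0[OF lincont_dx2]
  and dy2_0 [simp] = lincont_0[OF lincont_dy2]
  and dx2_cst_mult [simp] = lincont_cst[OF lincont_dx2]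
  and dy2_cst_mult [simp] = lincont_cst[OF lincont_dy2]

lemma dx2_mult: "dx2 (F * G) = dx2 F * G + F * dx2 G"
proof -
  have m: "dx2 (mon p q * mon p' q') = dx2 (mon p q) * mon p' q' + mon p q * dx2 (mon p' q')"
    for p q p' q'
    by (cases p; cases p') (simp_all add: mon_mult dx2_mon mult.assoc mult.left_commute algebra_simps)
  have g: "dx2 (mon p q * G) = dx2 (mon p q) * G + mon p q * dx2 G" for p q
    by (rule lincont_ext[where \<Phi> = "\<lambda>G. dx2 (mon p q * G)"
        and \<Psi> = "\<lambda>G. dx2 (mon p q) * G + mon p q * dx2 G"])
      (rule lincont_plus lincont_mult lincont_comp[OF lincont_dx2 lincont_mult]
        lincont_comp[OF lincont_mult lincont_dx2] m)+
  show ?thesis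
    by (rule lincont_ext[where \<Phi> = "\<lambda>F. dx2 (F * G)"
        and \<Psi> = "\<lambda>F. dx2 F * G + F * dx2 G"])
      (rule lincont_plus lincont_dx2 lincont_id lincont_mult_right lincont_comp[OF lincont_dx2] g)+
qed

lemma dy2_mult: "dy2 (F * G) = dy2 F * G + F * dy2 G"
proof -
  have m: "dy2 (mon p q * mon p' q') = dy2 (mon p q) * mon p' q' + mon p q * dy2 (mon p' q')"
    for p q p' q'
    by (cases q; cases q') (simp_all add: mon_mult dy2_mon mult.assoc mult.left_commute algebra_simps)
  have g: "dy2 (mon p q * G) = dy2 (mon p q) * G + mon p q * dy2 G" for p q
    by (rule lincont_ext[where \<Phi> = "\<lambda>G. dy2 (mon p q * G)"
        and \<Psi> = "\<lambda>G. dy2 (mon p q) * G + mon p q * dy2 G"])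
      (rule lincont_plus lincont_mult lincont_comp[OF lincont_dy2 lincont_mult]
        lincont_comp[OF lincont_mult lincont_dy2] m)+
  show ?thesis
    by (rule lincont_ext[where \<Phi> = "\<lambda>F. dy2 (F * G)"
        and \<Psi> = "\<lambda>F. dy2 F * G + F * dy2 G"])
      (rule lincont_plus lincont_dy2 lincont_id lincont_mult_right lincont_comp[OF lincont_dy2] g)+
qed

lemma d2_simps [simp]: "dx2 varx = 1" "dy2 varx = 0" "dx2 vary = 0" "dy2 vary = 1"
    "dx2 (cst c) = 0" "dy2 (cst c) = 0" "dx2 1 = 0" "dy2 1 = 0"
    "dx2 (of_nat m) = 0" "dy2 (of_nat m) = 0"
proof -
  show c: "dx2 (cst c) = 0" "dy2 (cst c) = 0" for c
    by (auto intro!: series2_eqI simp: cf_cst)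
  show "dx2 1 = 0" "dy2 1 = 0" "dx2 (of_nat m) = 0" "dy2 (of_nat m) = 0"
    using c[of 1] c[of "of_nat m"] by (simp_all add: cst_of_nat)
qed (auto intro!: series2_eqI simp: cf_varx cf_vary cf_1)

lemma dx2_power: "dx2 (F ^ p) = of_nat p * F ^ (p - 1) * dx2 F"
proof (induction p)
  case (Suc p)
  show ?case by (cases p) (use Suc in \<open>simp_all add: dx2_mult algebra_simps\<close>)
qed simp

lemma dy2_power: "dy2 (F ^ p) = of_nat p * F ^ (p - 1) * dy2 F"
proof (induction p)
  case (Suc p)
  show ?case by (cases p) (use Suc in \<open>simp_all add: dy2_mult algebra_simps\<close>)
qed simp

lemma dx2_dy2: "dx2 (dy2 F) = dy2 (dx2 F)"
  by (rule series2_eqI) (simp add: algebra_simps)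

subsection \<open>Substitution\<close>

lemma cf_subst2: "cf (subst2 F P Q) i j =
    (\<Sum>p\<le>i+j. \<Sum>q\<le>i+j. cf F p q * cf (P ^ p * Q ^ q) i j)"
  by (simp add: subst2_def)

lemma wge_subst2:
  assumes "wge a b (int a) P" "wge a b (int b) Q" "wge a b m F"
  shows "wge a b m (subst2 F P Q)"
proof (rule wgeI)
  fix i j assume "cf (subst2 F P Q) i j \<noteq> 0"
  then obtain p where p: "(\<Sum>q\<le>i+j. cf F p q * cf (P ^ p * Q ^ q) i j) \<noteq> 0"
    unfolding cf_subst2 by (meson sum.not_neutral_contains_not_neutral)
  then obtain q where q: "cf F p q * cf (P ^ p * Q ^ q) i j \<noteq> 0"
    by (meson sum.not_neutral_contains_not_neutral)
  have "m \<le> int (a * p + b * q)" using q assms(3) by (auto simp: wge_def)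
  moreover have "int (a * p + b * q) \<le> int (a * i + b * j)"
    using q wge_powers[OF assms(1,2), of p q] unfolding wge_def by fastforce
  ultimately show "m \<le> int (a * i + b * j)" by linarith
qed

context
  fixes P Q :: series2
  assumes PQ: "cf P 0 0 = 0" "cf Q 0 0 = 0"
begin

lemma lincont_subst2: "lincont (\<lambda>F. subst2 F P Q)"
proof (rule lincontI[where r = 0])
  show "wge 1 1 B (subst2 F P Q)" if "wge 1 1 (B + int 0) F" for B F
    using wge_subst2[of 1 1 P Q B F] that PQ[THEN wge_const_free] by simp
qed (auto intro!: series2_eqI simp: cf_subst2 sum.distrib algebra_simps sum_distrib_left)

lemma subst2_mon: "subst2 (mon p q) P Q = P ^ p * Q ^ q"
proof (rule series2_eqI)
  fix i j
  have w: "wge 1 1 (int (1 * p + 1 * q)) (P ^ p * Q ^ q)"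
    by (rule wge_powers) (use PQ[THEN wge_const_free] in simp_all)
  have "(\<Sum>q'\<le>i+j. (if p' = p \<and> q' = q then 1 else 0) * cf (P ^ p' * Q ^ q') i j) =
      (if p' = p \<and> q \<le> i + j then cf (P ^ p * Q ^ q) i j else 0)" for p'
    by (cases "p' = p") (simp_all add: if_distrib[where f = "\<lambda>z. z * _"] cong: if_cong)
  hence "cf (subst2 (mon p q) P Q) i j =
    (\<Sum>p'\<le>i+j. if p' = p then (if q \<le> i + j then cf (P ^ p * Q ^ q) i j else 0) else 0)"
    unfolding cf_subst2 cf_mon by (auto intro!: sum.cong)
  also have "\<dots> = cf (P ^ p * Q ^ q) i j"
    using wgeD[OF w, of i j] by auto
  finally show "cf (subst2 (mon p q) P Q) i j = cf (P ^ p * Q ^ q) i j" .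
qed

lemma subst2_mult: "subst2 (F * G) P Q = subst2 F P Q * subst2 G P Q"
proof -
  have m: "subst2 (mon p q * mon p' q') P Q = subst2 (mon p q) P Q * subst2 (mon p' q') P Q"
    for p q p' q'
    by (simp add: mon_mult subst2_mon power_add mult_ac)
  have g: "subst2 (mon p q * G) P Q = subst2 (mon p q) P Q * subst2 G P Q" for p q
    by (rule lincont_ext[where \<Phi> = "\<lambda>G. subst2 (mon p q * G) P Q"
        and \<Psi> = "\<lambda>G. subst2 (mon p q) P Q * subst2 G P Q"])
      (rule lincont_comp[OF lincont_subst2 lincont_mult]
        lincont_comp[OF lincont_mult lincont_subst2] m)+
  show ?thesis
    by (rule lincont_ext[where \<Phi> = "\<lambda>F. subst2 (F * G) P Q"
        and \<Psi> = "\<lambda>F. subst2 F P Q * subst2 G P Q"])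
      (rule lincont_id lincont_subst2 lincont_mult_right lincont_comp[OF lincont_subst2] g)+
qed

lemma subst2_varx [simp]: "subst2 varx P Q = P" 
  and subst2_vary [simp]: "subst2 vary P Q = Q"
  and subst2_1 [simp]: "subst2 1 P Q = 1"
  using subst2_mon[of 1 0] subst2_mon[of 0 1] subst2_mon[of 0 0] by (simp_all add: varx_mon vary_mon)

lemma subst2_power: "subst2 (F ^ m) P Q = subst2 F P Q ^ m"
  by (induction m) (simp_all add: subst2_mult)

lemmas subst2_add [simp] = lincont_add[OF lincont_subst2]
  and subst2_diff [simp] = lincont_diff[OF lincont_subst2]
  and subst2_uminus [simp] = lincont_uminus[OF lincont_subst2]
  and subst2_cst_mult [simp] = lincont_cst[OF lincont_subst2]
  and subst2_0 [simp] = lincont_0[OF lincont_subst2]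
  and subst2_sum = lincont_sum[OF lincont_subst2]

lemma subst2_cst [simp]: "subst2 (cst c) P Q = cst c"
  using subst2_cst_mult[of c 1] by simp

lemma subst2_prod: "subst2 (prod f A) P Q = (\<Prod>a\<in>A. subst2 (f a) P Q)"
  by (induction A rule: infinite_finite_induct) (auto simp: subst2_mult)

lemma subst2_of_nat_mult [simp]: "subst2 (of_nat m * F) P Q = of_nat m * subst2 F P Q"
  using subst2_cst_mult[of "of_nat m"] by (simp add: cst_of_nat)

lemma dx2_subst2: "dx2 (subst2 F P Q) = subst2 (dx2 F) P Q * dx2 P + subst2 (dy2 F) P Q * dx2 Q"
proof (rule lincont_ext[where \<Phi> = "\<lambda>F. dx2 (subst2 F P Q)"
      and \<Psi> = "\<lambda>F. subst2 (dx2 F) P Q * dx2 P + subst2 (dy2 F) P Q * dx2 Q"])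
  fix p q
  show "dx2 (subst2 (mon p q) P Q) =
      subst2 (dx2 (mon p q)) P Q * dx2 P + subst2 (dy2 (mon p q)) P Q * dx2 Q"
    by (simp add: subst2_mon dx2_mon dy2_mon dx2_mult dx2_power)
qed (rule lincont_plus lincont_dx2 lincont_dy2 lincont_subst2 lincont_mult_right
      lincont_comp[OF lincont_dx2] lincont_comp[OF lincont_subst2])+

lemma dy2_subst2: "dy2 (subst2 F P Q) = subst2 (dx2 F) P Q * dy2 P + subst2 (dy2 F) P Q * dy2 Q"
proof (rule lincont_ext[where \<Phi> = "\<lambda>F. dy2 (subst2 F P Q)"
      and \<Psi> = "\<lambda>F. subst2 (dx2 F) P Q * dy2 P + subst2 (dy2 F) P Q * dy2 Q"])
  fix p q
  show "dy2 (subst2 (mon p q) P Q) =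
      subst2 (dx2 (mon p q)) P Q * dy2 P + subst2 (dy2 (mon p q)) P Q * dy2 Q"
    by (simp add: subst2_mon dx2_mon dy2_mon dy2_mult dy2_power)
qed (rule lincont_plus lincont_dx2 lincont_dy2 lincont_subst2 lincont_mult_right
      lincont_comp[OF lincont_dy2] lincont_comp[OF lincont_subst2])+

end

lemma cf_00_mult [simp]: "cf (F * G) 0 0 = cf F 0 0 * cf G 0 0"
  by (simp add: cf_mult)

lemma cf_00_power [simp]: "cf (F ^ m) 0 0 = cf F 0 0 ^ m"
  by (induction m) (simp_all add: cf_1)

lemma cf_00_subst2 [simp]: "cf (subst2 F P Q) 0 0 = cf F 0 0"
  by (simp add: cf_subst2 cf_1)

lemma subst2_compose:
  assumes "cf P 0 0 = 0" "cf Q 0 0 = 0" "cf R 0 0 = 0" "cf S 0 0 = 0"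
  shows "subst2 (subst2 F P Q) R S = subst2 F (subst2 P R S) (subst2 Q R S)"
  by (rule lincont_ext[where \<Phi> = "\<lambda>F. subst2 (subst2 F P Q) R S"
      and \<Psi> = "\<lambda>F. subst2 F (subst2 P R S) (subst2 Q R S)"])
    (rule lincont_subst2 lincont_comp[OF lincont_subst2] | use assms in
       \<open>simp add: subst2_mon subst2_mult subst2_power\<close>)+

lemma subst2_id: "subst2 F varx vary = F"
  by (rule lincont_ext[where \<Phi> = "\<lambda>F. subst2 F varx vary" and \<Psi> = "\<lambda>F. F"])
    (auto intro!: lincont_subst2 lincont_id simp: subst2_mon cf_varx cf_vary simp flip: mon_def)

subsection \<open>Pullback of forms\<close>

lemma pullback_simps [simp]:
  "fst (pullback (P, Q) \<omega>) = subst2 (fst \<omega>) P Q * dx2 P + subst2 (snd \<omega>) P Q * dx2 Q"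
  "snd (pullback (P, Q) \<omega>) = subst2 (fst \<omega>) P Q * dy2 P + subst2 (snd \<omega>) P Q * dy2 Q"
  by (simp_all add: pullback_def smul_def ext_d_def)

lemma smul_simps [simp]: "fst (smul g \<omega>) = g * fst \<omega>" "snd (smul g \<omega>) = g * snd \<omega>"
  by (simp_all add: smul_def)

lemma smul_smul: "smul g (smul h \<omega>) = smul (g * h) \<omega>"
  by (simp add: smul_def mult.assoc)

lemma pullback_compose:
  assumes "cf P 0 0 = 0" "cf Q 0 0 = 0" "cf R 0 0 = 0" "cf S 0 0 = 0"
  shows "pullback (R, S) (pullback (P, Q) \<omega>) = pullback (subst2 P R S, subst2 Q R S) \<omega>"
  by (rule prod_eqI)
    (use assms in \<open>simp_all add: subst2_mult subst2_compose dx2_subst2 dy2_subst2 algebra_simps\<close>)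

lemma pullback_smul:
  assumes "cf P 0 0 = 0" "cf Q 0 0 = 0"
  shows "pullback (P, Q) (smul g \<omega>) = smul (subst2 g P Q) (pullback (P, Q) \<omega>)"
  by (rule prod_eqI) (use assms in \<open>simp_all add: subst2_mult algebra_simps\<close>)

subsection \<open>First order perturbation of a pullback\<close>

lemma lincont_minus: "lincont \<Phi> \<Longrightarrow> lincont \<Psi> \<Longrightarrow> lincont (\<lambda>F. \<Phi> F - \<Psi> F)"
  using lincont_plus[of \<Phi> "\<lambda>F. cst (-1) * \<Psi> F"] lincont_comp[OF lincont_mult[of "cst (-1)"], of \<Psi>]
  by simp

text \<open>Continuity refers to the ordinary order, the bound to arbitrary weights
  \<open>a\<close>, \<open>b\<close>: truncating far beyond the coefficient in question leaves a
  combination of monomials of \<open>F\<close>, on which the bound is assumed.\<close>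

lemma lincont_wge:
  assumes \<Phi>: "lincont \<Phi>" and mon: "\<And>p q. cf F p q \<noteq> 0 \<Longrightarrow> wge a b M (\<Phi> (mon p q))"
  shows "wge a b M (\<Phi> F)"
proof (rule wgeI, rule ccontr)
  fix i j assume nz: "cf (\<Phi> F) i j \<noteq> 0" and lt: "\<not> M \<le> int (a * i + b * j)"
  obtain r :: nat where r: "\<And>B F. wge 1 1 (B + int r) F \<Longrightarrow> wge 1 1 B (\<Phi> F)"
    using \<Phi> unfolding lincont_def by blast
  define B where "B = i + j + r"
  define T where "T = (\<Sum>p\<le>B. \<Sum>q\<le>B. cst (cf F p q) * mon p q)"
  have T: "wge 1 1 (int B + 1) (F - T)" unfolding T_def by (rule truncation)
  have "wge 1 1 (int (i + j) + 1) (\<Phi> (F - T))"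
    by (auto intro!: r wge_mono[OF T] simp: B_def)
  hence "cf (\<Phi> (F - T)) i j = 0" by (auto elim!: wgeD)
  moreover have "wge a b M (\<Phi> T)"
    unfolding T_def lincont_sum[OF \<Phi>] lincont_cst[OF \<Phi>]
  proof (intro wge_sum)
    fix p q show "wge a b M (cst (cf F p q) * \<Phi> (mon p q))"
      by (cases "cf F p q = 0") (simp_all add: wge_cst_mult mon)
  qed
  hence "cf (\<Phi> T) i j = 0" using lt by (auto elim!: wgeD)
  ultimately show False using nz lincont_diff[OF \<Phi>, of F T] by simp
qed

text \<open>The perturbation \<open>u \<leadsto> u'\<close> of a quantity with initial part \<open>u\<^sub>0\<close> of weight \<open>c\<close> has initial part
  \<open>\<eta>\<close>, of weight \<open>c + m\<close>.\<close>

definition pert :: "nat \<Rightarrow> nat \<Rightarrow> int \<Rightarrow> int \<Rightarrow> series2 \<Rightarrow> series2 \<Rightarrow> series2 \<Rightarrow> series2 \<Rightarrow> bool" where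
  "pert a b m c u u' u\<^sub>0 \<eta> \<longleftrightarrow> wge a b c u\<^sub>0 \<and> wge a b (c + m) \<eta> \<and>
     wge a b (c + 1) (u - u\<^sub>0) \<and> wge a b (c + m + 1) (u' - u - \<eta>)"

lemma pert_add:
  assumes "pert a b m c u u' u\<^sub>0 \<eta>" "pert a b m c v v' v\<^sub>0 \<theta>"
  shows "pert a b m c (u + v) (u' + v') (u\<^sub>0 + v\<^sub>0) (\<eta> + \<theta>)"
proof -
  have eq: "u + v - (u\<^sub>0 + v\<^sub>0) = (u - u\<^sub>0) + (v - v\<^sub>0)"
    "u' + v' - (u + v) - (\<eta> + \<theta>) = (u' - u - \<eta>) + (v' - v - \<theta>)" by simp_all
  show ?thesis using assms unfolding pert_def eq by (auto intro: wge_add)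
qed

lemma pert_mult:
  assumes "pert a b m c u u' u\<^sub>0 \<eta>" "pert a b m d v v' v\<^sub>0 \<theta>" "m \<ge> 1"
  shows "pert a b m (c + d) (u * v) (u' * v') (u\<^sub>0 * v\<^sub>0) (\<eta> * v\<^sub>0 + u\<^sub>0 * \<theta>)"
proof -
  have u: "wge a b c u\<^sub>0" "wge a b (c + m) \<eta>" "wge a b (c + 1) (u - u\<^sub>0)" "wge a b (c + m + 1) (u' - u - \<eta>)"
   and v: "wge a b d v\<^sub>0" "wge a b (d + m) \<theta>" "wge a b (d + 1) (v - v\<^sub>0)" "wge a b (d + m + 1) (v' - v - \<theta>)"
    using assms by (simp_all add: pert_def)
  have u1: "wge a b c u" using wge_add[OF u(1) wge_mono[OF u(3)], of] by simp
  have "wge a b (d + m) (v' - v)"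
    using wge_add[OF v(2) wge_mono[OF v(4), of "d + m"]] by simp
  hence v2: "wge a b (d + 1) (v' - v\<^sub>0)"
    using wge_add[OF v(3) wge_mono[of _ _ "d + m" "v' - v" "d + 1"]] \<open>m \<ge> 1\<close> by simp
  have v3: "wge a b d v'" using wge_add[OF v(1) wge_mono[OF v2, of d]] by simp
  \<comment> \<open>A telescoping in which each product contains exactly one factor whose weight
    exceeds the expected one. For \<open>v' - v\<^sub>0\<close> this rests on m being at least
    1.\<close>
  have "u' * v' - u * v - (\<eta> * v\<^sub>0 + u\<^sub>0 * \<theta>) = (u' - u - \<eta>) * v' + \<eta> * (v' - v\<^sub>0) +
      u * (v' - v - \<theta>) + (u - u\<^sub>0) * \<theta>" by (simp add: algebra_simps)
  moreover have "wge a b (c + d + m + 1) \<dots>"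
    by (intro wge_add wge_multI[OF u(4) v3] wge_multI[OF u(2) v2] wge_multI[OF u1 v(4)]
        wge_multI[OF u(3) v(2)]) simp_all
  moreover have "u * v - u\<^sub>0 * v\<^sub>0 = (u - u\<^sub>0) * v\<^sub>0 + u * (v - v\<^sub>0)" by (simp add: algebra_simps)
  moreover have "wge a b (c + d + 1) \<dots>"
    by (intro wge_add wge_multI[OF u(3) v(1)] wge_multI[OF u1 v(3)]) simp_all
  ultimately show ?thesis unfolding pert_def
    by (auto intro!: wge_mult wge_add wge_multI[OF u(2) v(1)] wge_multI[OF u(1) v(2)] u v)
qed

lemma pert_power:
  assumes "pert a b m c u u' u\<^sub>0 \<eta>" "m \<ge> 1"
  shows "pert a b m (int p * c) (u ^ p) (u' ^ p) (u\<^sub>0 ^ p) (of_nat p * u\<^sub>0 ^ (p - 1) * \<eta>)"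
proof (induction p)
  case 0
  show ?case by (auto simp: pert_def wge_def)
next
  case (Suc p)
  have e: "of_nat (Suc p) * u\<^sub>0 ^ (Suc p - 1) * \<eta> = \<eta> * u\<^sub>0 ^ p + u\<^sub>0 * (of_nat p * u\<^sub>0 ^ (p - 1) * \<eta>)"
    by (cases p) (simp_all add: algebra_simps)
  have i: "int (Suc p) * c = c + int p * c" by (simp add: algebra_simps)
  show ?case unfolding e i power_Suc by (rule pert_mult[OF assms(1) Suc assms(2)])
qed

lemma pert_change_initial:
  assumes "pert a b m c u u' u\<^sub>0 \<eta>" "wge a b c v\<^sub>0" "wge a b (c + 1) (u\<^sub>0 - v\<^sub>0)" "wge a b (c + m) \<theta>"
    "wge a b (c + m + 1) (\<eta> - \<theta>)"
  shows "pert a b m c u u' v\<^sub>0 \<theta>"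
proof -
  have "u - v\<^sub>0 = (u - u\<^sub>0) + (u\<^sub>0 - v\<^sub>0)" "u' - u - \<theta> = (u' - u - \<eta>) + (\<eta> - \<theta>)" by simp_all
  thus ?thesis using assms by (simp only: pert_def wge_add)
qed

text \<open>Taylor expansion to first order. The derivatives of \<open>F\<close> may be taken at (x,
  y) instead of (P, Q), because the two points differ by higher weight. On monomials the claim is
  the product and power rule for \<open>pert\<close>.\<close>

lemma subst2_pert:
  assumes a: "a \<ge> 1" and b: "b \<ge> 1" and m: "m \<ge> 1"
    and P: "wge a b (int a + 1) (P - varx)" and Q: "wge a b (int b + 1) (Q - vary)"
    and P': "wge a b (int a + m) (P' - P)" and Q': "wge a b (int b + m) (Q' - Q)"
    and F: "wge a b M F"
  shows "wge a b (M + m + 1) (subst2 F P' Q' - subst2 F P Q - (dx2 F * (P' - P) + dy2 F * (Q' - Q)))"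
proof -
  have c: "cf P 0 0 = 0" "cf Q 0 0 = 0" "cf P' 0 0 = 0" "cf Q' 0 0 = 0"
    using wgeD[OF P, of 0 0] wgeD[OF Q, of 0 0] wgeD[OF P', of 0 0] wgeD[OF Q', of 0 0] m
    by (simp_all add: cf_varx cf_vary)
  have pP: "pert a b m (int a) P P' varx (P' - P)" and pQ: "pert a b m (int b) Q Q' vary (Q' - Q)"
    using P Q P' Q' by (auto simp: pert_def varx_mon vary_mon intro: wge_mon)
  show ?thesis
  proof (rule lincont_wge[of "\<lambda>F. subst2 F P' Q' - subst2 F P Q - (dx2 F * (P' - P) + dy2 F * (Q' - Q))"])
    show "lincont (\<lambda>F. subst2 F P' Q' - subst2 F P Q - (dx2 F * (P' - P) + dy2 F * (Q' - Q)))"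
      by (intro lincont_minus lincont_plus lincont_mult_right lincont_dx2 lincont_dy2 lincont_subst2 c)
    fix p q assume nz: "cf F p q \<noteq> 0"
    have M: "M \<le> int (a * p + b * q)" using F nz by (auto simp: wge_def)
    have "pert a b m (int p * int a + int q * int b) (P ^ p * Q ^ q) (P' ^ p * Q' ^ q) (varx ^ p * vary ^ q)
      (of_nat p * varx ^ (p - 1) * (P' - P) * vary ^ q + varx ^ p * (of_nat q * vary ^ (q - 1) * (Q' - Q)))"
      by (intro pert_mult pert_power pP pQ m)
    moreover have "dx2 (mon p q) * (P' - P) + dy2 (mon p q) * (Q' - Q) =
      of_nat p * varx ^ (p - 1) * (P' - P) * vary ^ q + varx ^ p * (of_nat q * vary ^ (q - 1) * (Q' - Q))"
      by (simp add: dx2_mon dy2_mon) (simp add: mon_def algebra_simps)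
    ultimately have "wge a b (int (a * p + b * q) + m + 1) (subst2 (mon p q) P' Q' - subst2 (mon p q) P Q -
        (dx2 (mon p q) * (P' - P) + dy2 (mon p q) * (Q' - Q)))"
      by (simp add: subst2_mon c pert_def mult.commute)
    thus "wge a b (M + m + 1) (subst2 (mon p q) P' Q' - subst2 (mon p q) P Q -
        (dx2 (mon p q) * (P' - P) + dy2 (mon p q) * (Q' - Q)))"
      by (rule wge_mono) (use M in simp)
  qed
qed

lemma subst2_initial:
  assumes "a \<ge> 1" "b \<ge> 1" "wge a b (int a + 1) (P - varx)" "wge a b (int b + 1) (Q - vary)" "wge a b M F"
  shows "wge a b (M + 1) (subst2 F P Q - F)"
proof -
  have "wge a b (M + 1 + 1) (subst2 F P Q - subst2 F varx vary - (dx2 F * (P - varx) + dy2 F * (Q - vary)))"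
    by (rule subst2_pert) (use assms in simp_all)
  hence 1: "wge a b (M + 1) (subst2 F P Q - subst2 F varx vary - (dx2 F * (P - varx) + dy2 F * (Q - vary)))"
    by (rule wge_mono) simp
  have "wge a b (M + 1) (dx2 F * (P - varx) + dy2 F * (Q - vary))"
    by (intro wge_add wge_multI[OF wge_dx2[OF assms(5)] assms(3)] wge_multI[OF wge_dy2[OF assms(5)] assms(4)])
      simp_all
  from wge_add[OF 1 this] show ?thesis by (simp add: subst2_id)
qed

text \<open>The Lie derivative of \<open>a dx + b dy\<close> along \<open>p \<partial>\<^sub>x + q \<partial>\<^sub>y\<close>, plus \<open>w (a dx + b dy)\<close>.\<close>

definition lie :: "form2 \<Rightarrow> series2 \<Rightarrow> series2 \<Rightarrow> series2 \<Rightarrow> form2" where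
  "lie \<omega> p q w =
    (dx2 (fst \<omega>) * p + dy2 (fst \<omega>) * q + fst \<omega> * dx2 p + snd \<omega> * dx2 q + w * fst \<omega>,
     dx2 (snd \<omega>) * p + dy2 (snd \<omega>) * q + fst \<omega> * dy2 p + snd \<omega> * dy2 q + w * snd \<omega>)"

text \<open>\<open>a dx + b dy\<close> has weight at least \<open>D\<close>, where \<open>dx\<close> and \<open>dy\<close> carry the weights of \<open>x\<close> and \<open>y\<close>.\<close>

definition wgef :: "nat \<Rightarrow> nat \<Rightarrow> int \<Rightarrow> form2 \<Rightarrow> bool" where
  "wgef k l D \<omega> \<longleftrightarrow> wge k l (D - int k) (fst \<omega>) \<and> wge k l (D - int l) (snd \<omega>)"

lemma wgef_add: "wgef k l D \<omega> \<Longrightarrow> wgef k l D \<eta> \<Longrightarrow> wgef k l D (\<omega> + \<eta>)"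
  by (simp add: wgef_def wge_add)

lemma wgef_mono: "wgef k l D \<omega> \<Longrightarrow> D' \<le> D \<Longrightarrow> wgef k l D' \<omega>"
  by (auto simp: wgef_def elim: wge_mono)

definition near_id :: "nat \<Rightarrow> nat \<Rightarrow> series2 \<Rightarrow> series2 \<Rightarrow> series2 \<Rightarrow> bool" where
  "near_id k l P Q w \<longleftrightarrow> wge k l (int k + 1) (P - varx) \<and> wge k l (int l + 1) (Q - vary) \<and>
     wge k l 1 (w - 1)"

definition close :: "nat \<Rightarrow> nat \<Rightarrow> int \<Rightarrow> series2 \<Rightarrow> series2 \<Rightarrow> series2 \<Rightarrow> bool" where
  "close k l m p q w \<longleftrightarrow> wge k l (int k + m) p \<and> wge k l (int l + m) q \<and> wge k l m w"

text \<open>In weight D + m only the initial part of the form and the change of (P, Q, w) are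
  visible; the base point (P, Q, w) enters in higher weight. Hence one linear operator,
  \<open>lie\<close> of the initial part, governs every step of the construction and of the
  uniqueness proof.\<close>

lemma pullback_pert:
  assumes k: "k \<ge> 1" and l: "l \<ge> 1" and m: "m \<ge> 1"
    and near: "near_id k l P Q w" and cl: "close k l m (P' - P) (Q' - Q) (w' - w)"
    and \<omega>: "wgef k l D \<omega>" and \<omega>\<^sub>d: "wgef k l (D + 1) (\<omega> - \<omega>\<^sub>d)"
  shows "wgef k l (D + m + 1) (smul w' (pullback (P', Q') \<omega>) - smul w (pullback (P, Q) \<omega>) -
           lie \<omega>\<^sub>d (P' - P) (Q' - Q) (w' - w))"
proof -
  have N: "wge k l (int k + 1) (P - varx)" "wge k l (int l + 1) (Q - vary)" "wge k l 1 (w - 1)"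
    and C: "wge k l (int k + m) (P' - P)" "wge k l (int l + m) (Q' - Q)" "wge k l m (w' - w)"
    using near cl by (auto simp: near_id_def close_def)
  have w: "pert k l m 0 w w' 1 (w' - w)"
    using N C by (auto simp: pert_def wge_trivial)
  have s: "pert k l m c (subst2 f P Q) (subst2 f P' Q') g (dx2 g * (P' - P) + dy2 g * (Q' - Q))"
    if f: "wge k l c f" and g: "wge k l (c + 1) (f - g)" for f g c
  proof (rule pert_change_initial[where u\<^sub>0 = f and \<eta> = "dx2 f * (P' - P) + dy2 f * (Q' - Q)"])
    have g': "wge k l c g" using wge_diff[OF f wge_mono[OF g, of c]] by simp
    have \<theta>: "wge k l (c + m) (dx2 g * (P' - P) + dy2 g * (Q' - Q))" if "wge k l c g" for g c
      by (intro wge_add wge_multI[OF wge_dx2[OF that] C(1)] wge_multI[OF wge_dy2[OF that] C(2)]) simp_all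
    show "pert k l m c (subst2 f P Q) (subst2 f P' Q') f (dx2 f * (P' - P) + dy2 f * (Q' - Q))"
      unfolding pert_def using f \<theta>[OF f] subst2_pert[OF k l m N(1,2) C(1,2) f] subst2_initial[OF k l N(1,2) f]
      by simp
    show "wge k l (c + m) (dx2 g * (P' - P) + dy2 g * (Q' - Q))" by (rule \<theta>[OF g'])
    have "dx2 f * (P' - P) + dy2 f * (Q' - Q) - (dx2 g * (P' - P) + dy2 g * (Q' - Q)) =
        dx2 (f - g) * (P' - P) + dy2 (f - g) * (Q' - Q)" by (simp add: algebra_simps)
    thus "wge k l (c + m + 1) (dx2 f * (P' - P) + dy2 f * (Q' - Q) - (dx2 g * (P' - P) + dy2 g * (Q' - Q)))"
      using \<theta>[OF g] by (simp add: add_ac)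
  qed (use g f in \<open>auto intro: wge_diff[OF f wge_mono[OF g, of c], simplified]\<close>)
  have x: "pert k l m (c - int k) (dx2 R) (dx2 R') (dx2 R\<^sub>0) (dx2 (R' - R))"
   and y: "pert k l m (c - int l) (dy2 R) (dy2 R') (dy2 R\<^sub>0) (dy2 (R' - R))"
    if "wge k l c R\<^sub>0" "wge k l (c + 1) (R - R\<^sub>0)" "wge k l (c + m) (R' - R)" for c R R' R\<^sub>0
    using that[THEN wge_dx2] that[THEN wge_dy2] by (auto simp: pert_def algebra_simps)
  have vx: "wge k l (int k) varx" and vy: "wge k l (int l) vary"
    by (auto simp: varx_mon vary_mon intro: wge_mon)
  note s1 = s[of "D - int k" "fst \<omega>" "fst \<omega>\<^sub>d"] and s2 = s[of "D - int l" "snd \<omega>" "snd \<omega>\<^sub>d"]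
  have f: "wge k l (D - int k) (fst \<omega>)" "wge k l (D - int k + 1) (fst \<omega> - fst \<omega>\<^sub>d)"
    "wge k l (D - int l) (snd \<omega>)" "wge k l (D - int l + 1) (snd \<omega> - snd \<omega>\<^sub>d)"
    using \<omega> \<omega>\<^sub>d by (auto simp: wgef_def algebra_simps)
  have 1: "pert k l m (0 + (D - int k)) (w * (subst2 (fst \<omega>) P Q * dx2 P + subst2 (snd \<omega>) P Q * dx2 Q))
     (w' * (subst2 (fst \<omega>) P' Q' * dx2 P' + subst2 (snd \<omega>) P' Q' * dx2 Q'))
     (1 * (fst \<omega>\<^sub>d * dx2 varx + snd \<omega>\<^sub>d * dx2 vary)) 
     ((w' - w) * (fst \<omega>\<^sub>d * dx2 varx + snd \<omega>\<^sub>d * dx2 vary) + 1 *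
      (((dx2 (fst \<omega>\<^sub>d) * (P' - P) + dy2 (fst \<omega>\<^sub>d) * (Q' - Q)) * dx2 varx + fst \<omega>\<^sub>d * dx2 (P' - P)) +
       ((dx2 (snd \<omega>\<^sub>d) * (P' - P) + dy2 (snd \<omega>\<^sub>d) * (Q' - Q)) * dx2 vary + snd \<omega>\<^sub>d * dx2 (Q' - Q))))"
    using pert_mult[OF s1[OF f(1,2)] x[OF vx N(1) C(1)] m] pert_mult[OF s2[OF f(3,4)] x[OF vy N(2) C(2)] m]
    by (intro pert_mult[OF w _ m] pert_add) (simp_all add: algebra_simps)
  have 2: "pert k l m (0 + (D - int l)) (w * (subst2 (fst \<omega>) P Q * dy2 P + subst2 (snd \<omega>) P Q * dy2 Q))
     (w' * (subst2 (fst \<omega>) P' Q' * dy2 P' + subst2 (snd \<omega>) P' Q' * dy2 Q'))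
     (1 * (fst \<omega>\<^sub>d * dy2 varx + snd \<omega>\<^sub>d * dy2 vary)) 
     ((w' - w) * (fst \<omega>\<^sub>d * dy2 varx + snd \<omega>\<^sub>d * dy2 vary) + 1 *
      (((dx2 (fst \<omega>\<^sub>d) * (P' - P) + dy2 (fst \<omega>\<^sub>d) * (Q' - Q)) * dy2 varx + fst \<omega>\<^sub>d * dy2 (P' - P)) +
       ((dx2 (snd \<omega>\<^sub>d) * (P' - P) + dy2 (snd \<omega>\<^sub>d) * (Q' - Q)) * dy2 vary + snd \<omega>\<^sub>d * dy2 (Q' - Q))))"
    using pert_mult[OF s1[OF f(1,2)] y[OF vx N(1) C(1)] m] pert_mult[OF s2[OF f(3,4)] y[OF vy N(2) C(2)] m]
    by (intro pert_mult[OF w _ m] pert_add) (simp_all add: algebra_simps)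
  show ?thesis using 1 2 unfolding pert_def wgef_def
    by (simp add: lie_def algebra_simps)
qed

text \<open>This is the perturbation estimate at the identity with m = 1: a change close to the
  identity preserves the initial part.\<close>

lemma pullback_initial:
  assumes k: "k \<ge> 1" and l: "l \<ge> 1" and near: "near_id k l P Q w" and \<omega>: "wgef k l D \<omega>"
  shows "wgef k l (D + 1) (smul w (pullback (P, Q) \<omega>) - \<omega>)"
proof -
  have "wgef k l (D + 1 + 1) (smul w (pullback (P, Q) \<omega>) - smul 1 (pullback (varx, vary) \<omega>) -
           lie \<omega> (P - varx) (Q - vary) (w - 1))"
    by (rule pullback_pert) (use assms in \<open>auto simp: near_id_def close_def wgef_def zero_prod_def\<close>)
  moreover have "smul 1 (pullback (varx, vary) \<omega>) = \<omega>"
    by (rule prod_eqI) (simp_all add: subst2_id)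
  moreover have "wgef k l (D + 1) (lie \<omega> (P - varx) (Q - vary) (w - 1))"
  proof -
    have N: "wge k l (int k + 1) (P - varx)" "wge k l (int l + 1) (Q - vary)" "wge k l 1 (w - 1)"
      and f: "wge k l (D - int k) (fst \<omega>)" "wge k l (D - int l) (snd \<omega>)"
      using near \<omega> by (auto simp: near_id_def wgef_def)
    show ?thesis unfolding wgef_def lie_def fst_conv snd_conv
      by (intro conjI wge_add wge_multI[OF wge_dx2[OF f(1)] N(1)] wge_multI[OF wge_dy2[OF f(1)] N(2)]
       wge_multI[OF wge_dx2[OF f(2)] N(1)] wge_multI[OF wge_dy2[OF f(2)] N(2)]
       wge_multI[OF f(1) wge_dx2[OF N(1)]] wge_multI[OF f(2) wge_dx2[OF N(2)]]
       wge_multI[OF f(1) wge_dy2[OF N(1)]] wge_multI[OF f(2) wge_dy2[OF N(2)]]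
       wge_multI[OF N(3) f(1)] wge_multI[OF N(3) f(2)]) simp_all
  qed
  ultimately show ?thesis
    using wgef_add[OF wgef_mono[of k l "D + 1 + 1" _ "D + 1"]] by fastforce
qed

declare One_nat_def [simp]

section \<open>The homological equation\<close>

definition homog :: "nat \<Rightarrow> nat \<Rightarrow> nat \<Rightarrow> series2 \<Rightarrow> bool" where
  "homog k l m F \<longleftrightarrow> (\<forall>i j. cf F i j \<noteq> 0 \<longrightarrow> k * i + l * j = m)"

lemma homog_add: "homog k l m F \<Longrightarrow> homog k l m G \<Longrightarrow> homog k l m (F + G)"
  and homog_diff: "homog k l m F \<Longrightarrow> homog k l m G \<Longrightarrow> homog k l m (F - G)"
  and homog_uminus: "homog k l m F \<Longrightarrow> homog k l m (- F)"
  and homog_cst_mult: "homog k l m F \<Longrightarrow> homog k l m (cst c * F)"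
  and homog_0 [simp]: "homog k l m 0"
  by (force simp: homog_def)+

lemma homog_wge: "homog k l m F \<Longrightarrow> wge k l (int m) F"
  by (force simp: homog_def wge_def)

lemma homog_mult:
  assumes "homog k l m F" "homog k l m' G"
  shows "homog k l (m + m') (F * G)"
  unfolding homog_def
proof (intro allI impI)
  fix i j assume "cf (F * G) i j \<noteq> 0"
  then obtain p where p: "p \<le> i" "(\<Sum>q\<le>j. cf F p q * cf G (i - p) (j - q)) \<noteq> 0"
    unfolding cf_mult by (metis (no_types, lifting) atMost_iff sum.not_neutral_contains_not_neutral)
  then obtain q where q: "q \<le> j" "cf F p q * cf G (i - p) (j - q) \<noteq> 0"
    by (metis (no_types, lifting) atMost_iff sum.not_neutral_contains_not_neutral)
  have "m = k * p + l * q" "m' = k * (i - p) + l * (j - q)"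
    using q assms unfolding homog_def by (metis mult_eq_0_iff)+
  moreover obtain i' j' where "i = p + i'" "j = q + j'" using p q le_Suc_ex by metis
  ultimately show "k * i + l * j = m + m'" by (simp add: algebra_simps)
qed

lemma homog_euler: "homog k l m F \<Longrightarrow>
    of_nat k * (varx * dx2 F) + of_nat l * (vary * dy2 F) = of_nat m * F"
proof (rule series2_eqI)
  fix i j assume F: "homog k l m F"
  have "of_nat k * (of_nat i * cf F i j) + of_nat l * (of_nat j * cf F i j) = of_nat m * cf F i j"
  proof (cases "cf F i j = 0")
    case False
    hence "m = k * i + l * j" using F by (auto simp: homog_def)
    thus ?thesis by (simp add: algebra_simps)
  qed simp
  thus "cf (of_nat k * (varx * dx2 F) + of_nat l * (vary * dy2 F)) i j = cf (of_nat m * F) i j"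
    by (cases i; cases j) (simp_all add: cf_varx_mult cf_vary_mult del: cf_00_mult)
qed

definition curl :: "form2 \<Rightarrow> series2" where
  "curl \<theta> = dx2 (snd \<theta>) - dy2 (fst \<theta>)"

definition axes_invariant :: "form2 \<Rightarrow> bool" where
  "axes_invariant \<theta> \<longleftrightarrow> (\<forall>i. cf (fst \<theta>) i 0 = 0) \<and> (\<forall>j. cf (snd \<theta>) 0 j = 0)"

text \<open>The shape d(x y h) + s (l y dx - k x dy) expressed by contraction and curl. In each
  weight the contraction is that weight times x y h, as R annihilates the second summand, and the
  curl is minus that weight times s. So the conditions bound the exponents in h and the y-degree of
  s. They are linear and pass to quasi-homogeneous parts; the lower bound on the weight is kept
  apart, in \<open>wgef\<close>.\<close>

definition nf :: "nat \<Rightarrow> nat \<Rightarrow> nat \<Rightarrow> form2 \<Rightarrow> bool" where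
  "nf k l n \<theta> \<longleftrightarrow> axes_invariant \<theta> \<and>
     (\<forall>i j. l * n \<le> i \<or> k * n \<le> j \<longrightarrow> cf (q_of k l \<theta>) (Suc i) (Suc j) = 0) \<and>
     (\<forall>i j. k * n \<le> j \<longrightarrow> cf (curl \<theta>) i j = 0)"

definition homogf :: "nat \<Rightarrow> nat \<Rightarrow> nat \<Rightarrow> form2 \<Rightarrow> bool" where
  "homogf k l D \<theta> \<longleftrightarrow> (\<forall>i j. cf (fst \<theta>) i j \<noteq> 0 \<longrightarrow> k * i + l * j + k = D) \<and>
     (\<forall>i j. cf (snd \<theta>) i j \<noteq> 0 \<longrightarrow> k * i + l * j + l = D)"

text \<open>The homogenization of the polynomial with coefficients \<open>c i\<close> in z = y^k /
  x^l; the index counts powers of y^k.\<close>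

definition hs :: "nat \<Rightarrow> nat \<Rightarrow> nat \<Rightarrow> (nat \<Rightarrow> complex) \<Rightarrow> series2" where
  "hs k l n c = (\<Sum>i\<le>n. cst (c i) * mon (l * (n - i)) (k * i))"

lemma hs_add: "hs k l n f + hs k l n g = hs k l n (\<lambda>i. f i + g i)"
  and hs_diff: "hs k l n f - hs k l n g = hs k l n (\<lambda>i. f i - g i)"
  and hs_cst: "cst c * hs k l n f = hs k l n (\<lambda>i. c * f i)"
  by (simp_all add: hs_def sum.distrib sum_subtractf algebra_simps sum_distrib_left)

lemma hs_of_nat: "of_nat c * hs k l n f = hs k l n (\<lambda>i. of_nat c * f i)"
  using hs_cst[of "of_nat c"] by (simp add: cst_of_nat)

lemma hs_cong: "(\<And>i. i \<le> n \<Longrightarrow> f i = g i) \<Longrightarrow> hs k l n f = hs k l n g"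
  by (simp add: hs_def)

lemma homog_hs: "homog k l (k * l * n) (hs k l n c)"
  unfolding homog_def
proof (intro allI impI)
  fix i j assume "cf (hs k l n c) i j \<noteq> 0"
  then obtain s where "s \<le> n" "cf (cst (c s) * mon (l * (n - s)) (k * s)) i j \<noteq> 0"
    unfolding hs_def cf_sum by (metis (no_types, lifting) atMost_iff sum.not_neutral_contains_not_neutral)
  hence "s \<le> n" "i = l * (n - s)" "j = k * s" by (auto simp: cf_mon split: if_splits)
  moreover have "l * (n - s) + l * s = l * n" using \<open>s \<le> n\<close> by (metis add_mult_distrib2 le_add_diff_inverse2)
  ultimately show "k * i + l * j = k * l * n"
    by (metis add_mult_distrib2 mult.assoc mult.left_commute)
qed

lemma dx2_varx_hs: "dx2 (varx * hs k l n c) = hs k l n (\<lambda>i. (1 + of_nat (l * (n - i))) * c i)"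
proof -
  have "dx2 (varx * (cst z * mon p q)) = cst ((1 + of_nat p) * z) * mon p q" for z p q
    by (rule series2_eqI) (auto simp: cf_varx_mult cf_mon simp del: cst_simps)
  thus ?thesis by (simp add: hs_def sum_distrib_left lincont_sum[OF lincont_dx2] del: of_nat_mult cst_simps)
qed

lemma dy2_vary_hs: "dy2 (vary * hs k l n c) = hs k l n (\<lambda>i. (1 + of_nat (k * i)) * c i)"
proof -
  have "dy2 (vary * (cst z * mon p q)) = cst ((1 + of_nat q) * z) * mon p q" for z p q
    by (rule series2_eqI) (auto simp: cf_vary_mult cf_mon simp del: cst_simps)
  thus ?thesis by (simp add: hs_def sum_distrib_left lincont_sum[OF lincont_dy2] del: of_nat_mult cst_simps)
qed

lemma dx2_vary_mult: "dx2 (vary * F) = vary * dx2 F" and dy2_varx_mult: "dy2 (varx * F) = varx * dy2 F"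
  by (simp_all add: dx2_mult dy2_mult)

lemma triangular_system:
  fixes D :: "nat \<Rightarrow> complex"
  assumes "\<And>t. t < e \<Longrightarrow> D t \<noteq> 0"
  shows "\<exists>g. \<forall>r<e. D r * g r + (\<Sum>t\<in>{r<..<e}. c r t * g t) = h r"
proof -
  \<comment> \<open>Back substitution: the last \<open>s\<close> equations are solved first.\<close>
  have "\<exists>g. \<forall>r<e. e \<le> r + s \<longrightarrow> D r * g r + (\<Sum>t\<in>{r<..<e}. c r t * g t) = h r" for s
  proof (induction s)
    case (Suc s)
    then obtain g where g: "\<And>r. r < e \<Longrightarrow> e \<le> r + s \<Longrightarrow> D r * g r + (\<Sum>t\<in>{r<..<e}. c r t * g t) = h r"
      by blast
    define r\<^sub>0 where "r\<^sub>0 = e - Suc s"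
    define g' where "g' = g(r\<^sub>0 := (h r\<^sub>0 - (\<Sum>t\<in>{r\<^sub>0<..<e}. c r\<^sub>0 t * g t)) / D r\<^sub>0)"
    have s: "(\<Sum>t\<in>{r<..<e}. c r t * g' t) = (\<Sum>t\<in>{r<..<e}. c r t * g t)" if "r \<ge> r\<^sub>0" for r
      using that by (intro sum.cong) (auto simp: g'_def)
    have "D r * g' r + (\<Sum>t\<in>{r<..<e}. c r t * g' t) = h r" if "r < e" "e \<le> r + Suc s" for r
    proof (cases "r = r\<^sub>0")
      case True
      thus ?thesis using assms[of r\<^sub>0] that s[of r\<^sub>0] by (simp add: g'_def)
    next
      case False
      hence "r > r\<^sub>0" "e \<le> r + s" using that by (auto simp: r\<^sub>0_def)
      thus ?thesis using g[OF that(1)] s[of r] by (simp add: g'_def)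
    qed
    thus ?case by blast
  qed auto
  from this[of e] show ?thesis by auto
qed

lemma triangular_system_unique:
  fixes D :: "nat \<Rightarrow> complex"
  assumes "\<And>t. t < e \<Longrightarrow> D t \<noteq> 0" "\<And>r. r < e \<Longrightarrow> D r * g r + (\<Sum>t\<in>{r<..<e}. c r t * g t) = 0"
  shows "r < e \<Longrightarrow> g r = 0"
proof (induction "e - r" arbitrary: r rule: less_induct)
  case less
  have "(\<Sum>t\<in>{r<..<e}. c r t * g t) = 0"
    by (rule sum.neutral) (use less in auto)
  thus ?case using assms(1)[OF less.prems] assms(2)[OF less.prems] by simp
qed

locale homological =
  fixes k l n :: nat and al be :: "nat \<Rightarrow> complex"
  assumes k: "k \<ge> 1" and l: "l \<ge> 1" and n: "n \<ge> 1" and kl: "coprime k l"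
    and Pn: "of_nat k * al n + of_nat l * be n \<noteq> 0"
    and irr_n: "\<And>i j :: int. int k * i + int l * j \<noteq> 0 \<Longrightarrow> be n * of_int i \<noteq> al n * of_int j"
    and irr_0: "\<And>i j :: int. int k * i + int l * j \<noteq> 0 \<Longrightarrow> be 0 * of_int i \<noteq> al 0 * of_int j"
    and det: "\<And>m. 1 \<le> m \<Longrightarrow> m < k * l * n \<Longrightarrow>
        Determinant.det (M_mat k l n (vary * hs k l n al, varx * hs k l n be) m) \<noteq> 0"
    and cop: "\<And>m z. m \<ge> 1 \<Longrightarrow>
       (\<Sum>i\<le>n. (of_nat m * al i + (1 + of_nat (l * (n - i))) * (of_nat k * al i + of_nat l * be i)) * z ^ i) = 0 \<Longrightarrow>
       (\<Sum>i\<le>n. (of_nat m * be i + (1 + of_nat (k * i)) * (of_nat k * al i + of_nat l * be i)) * z ^ i) \<noteq> 0"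
begin

abbreviation "H \<equiv> hs k l n"

definition "N = k * l * n"
definition "d = N + k + l"
definition "Pc i = of_nat k * al i + of_nat l * be i"
text \<open>\<open>ah m\<close> and \<open>bh m\<close> are the coefficients of A / y and B / x in
  the generic condition, both indexed by the power of y^k. Thus \<open>bh m i\<close> is
  B_{n-i}.\<close>

definition "ah m i = of_nat m * al i + (1 + of_nat (l * (n - i))) * Pc i"
definition "bh m i = of_nat m * be i + (1 + of_nat (k * i)) * Pc i"
definition "wd = (vary * H al, varx * H be)"

text \<open>Euler's identity in the form k x A + l y B = (m + d) q. It shows that the effect of a
  unit w on the contraction is also produced by (p, q) = w (k, l) / (m + d).\<close>

lemma hat_relation: "i \<le> n \<Longrightarrow> of_nat k * ah m i + of_nat l * bh m i = of_nat (m + d) * Pc i"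
  by (simp add: ah_def bh_def d_def N_def Pc_def of_nat_diff algebra_simps)

lemma q_of_wd: "q_of k l wd = varx * vary * H Pc"
proof -
  have "H Pc = of_nat k * H al + of_nat l * H be"
    by (simp add: hs_of_nat hs_add Pc_def[abs_def])
  thus ?thesis by (simp add: q_of_def wd_def algebra_simps)
qed

lemma ah_series: "of_nat m * fst wd + dx2 (q_of k l wd) = vary * H (ah m)"
proof -
  have "q_of k l wd = vary * (varx * H Pc)" by (simp add: q_of_wd)
  hence "dx2 (q_of k l wd) = vary * H (\<lambda>i. (1 + of_nat (l * (n - i))) * Pc i)"
    by (simp only: dx2_vary_mult dx2_varx_hs)
  moreover have "of_nat m * fst wd = vary * H (\<lambda>i. of_nat m * al i)"
    by (simp add: wd_def hs_of_nat[symmetric])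
  ultimately show ?thesis by (simp only: distrib_left[symmetric] hs_add ah_def[abs_def])
qed

lemma bh_series: "of_nat m * snd wd + dy2 (q_of k l wd) = varx * H (bh m)"
proof -
  have "q_of k l wd = varx * (vary * H Pc)" by (simp add: q_of_wd mult.assoc)
  hence "dy2 (q_of k l wd) = varx * H (\<lambda>i. (1 + of_nat (k * i)) * Pc i)"
    by (simp only: dy2_varx_mult dy2_vary_hs)
  moreover have "of_nat m * snd wd = varx * H (\<lambda>i. of_nat m * be i)"
    by (simp add: wd_def hs_of_nat[symmetric])
  ultimately show ?thesis by (simp only: distrib_left[symmetric] hs_add bh_def[abs_def])
qed

lemma cf_hs_mult: "cf (H c * F) i j =
    (\<Sum>s\<le>n. if l * (n - s) \<le> i \<and> k * s \<le> j then c s * cf F (i - l * (n - s)) (j - k * s) else 0)"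
  by (simp add: hs_def sum_distrib_right mult.assoc cf_mon_mult if_distrib cong: if_cong)

lemma cf_hs: "s \<le> n \<Longrightarrow> cf (H c) (l * (n - s)) (k * s) = c s"
proof -
  assume s: "s \<le> n"
  have "cf (H c) (l * (n - s)) (k * s) = (\<Sum>i\<le>n. if i = s then c s else 0)"
    unfolding hs_def cf_sum by (rule sum.cong) (use k s in \<open>auto simp: cf_mon\<close>)
  thus ?thesis using s by simp
qed

subsection \<open>Enumeration of the monomials of a given weight\<close>

text \<open>The monomial of weight N + m with the least power of y. Trading x^l for y^k gives the
  others, (I - l r, J + k r), so one index enumerates a weight. The monomials of weight m are (I - l
  (n + t), J + k t).\<close>

definition base :: "nat \<Rightarrow> nat \<Rightarrow> nat \<Rightarrow> bool" where
  "base m I J \<longleftrightarrow> k * I + l * J = N + m \<and> J < k"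

lemma base_exists: "\<exists>I J. base m I J"
proof -
  obtain J where J: "J < k" "[l * J = N + m] (mod k)"
  proof -
    obtain y where "[l * y = 1] (mod k)"
      using cong_solve_coprime_nat[of l k] kl by (auto simp: coprime_commute One_nat_def)
    hence "[l * y * (N + m) = 1 * (N + m)] (mod k)" by (rule cong_scalar_right)
    then obtain x where "[l * x = N + m] (mod k)" by (metis mult.assoc nat_mult_1)
    hence "[l * (x mod k) = N + m] (mod k)" by (simp add: cong_def mod_mult_right_eq)
    thus ?thesis using that[of "x mod k"] k by simp
  qed
  \<comment> \<open>Ensures that N + m - l J is a true difference of natural numbers.\<close>
  have "l * J \<le> N"
  proof -
    have "l * J \<le> l * k" using J by simp
    also have "\<dots> \<le> N" using n by (simp add: N_def mult.commute)
    finally show ?thesis .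
  qed
  hence "k dvd N + m - l * J"
    using J(2) mod_eq_dvd_iff_nat[of "l * J" "N + m" k] by (simp add: cong_def)
  then obtain I where "N + m - l * J = k * I" by blast
  hence "k * I + l * J = N + m" using \<open>l * J \<le> N\<close> by simp
  thus ?thesis using J by (auto simp: base_def)
qed

context
  fixes m I J :: nat
  assumes bs: "base m I J"
begin

lemma k_pos: "k > 0" and l_pos: "l > 0" using k l by simp_all

lemma k_cancel: "k * a < k + k * b \<Longrightarrow> a \<le> b"
  using mult_less_cancel1[of k a "Suc b"] by simp

lemma wt_Nm: "k * i + l * j = N + m \<longleftrightarrow> (\<exists>r. I = i + l * r \<and> j = J + k * r)"
proof
  assume h: "k * i + l * j = N + m"
  hence e: "k * i + l * j = k * I + l * J" using bs by (simp add: base_def)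
  have "[l * j = l * J] (mod k)"
    using e by (metis cong_def mod_mult_self4)
  hence "[j = J] (mod k)" using kl by (metis cong_mult_lcancel_nat coprime_commute)
  hence jJ: "j mod k = J" using bs by (simp add: base_def cong_def)
  define r where "r = j div k"
  have j: "j = J + k * r" using jJ unfolding r_def by (metis mod_mult_div_eq)
  have "k * (i + l * r) = k * I" using e unfolding j by (simp add: algebra_simps)
  hence "I = i + l * r" using k_pos by simp
  thus "\<exists>r. I = i + l * r \<and> j = J + k * r" using j by blast
next
  assume "\<exists>r. I = i + l * r \<and> j = J + k * r"
  thus "k * i + l * j = N + m" using bs by (auto simp: base_def algebra_simps)
qed

lemma wt_m: "k * i + l * j = m \<longleftrightarrow> (\<exists>r. I = i + l * (n + r) \<and> j = J + k * r)"
proof -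
  have "k * i + l * j = m \<longleftrightarrow> k * (i + l * n) + l * j = N + m" by (simp add: N_def algebra_simps)
  thus ?thesis unfolding wt_Nm by (simp add: algebra_simps)
qed

text \<open>The number of monomials of weight m, while weight N + m has n + \<open>ee\<close> of
  them. The subtraction is exact by \<open>I_ge\<close>.\<close>

definition "ee = Suc (I div l) - n"

lemma I_ge: "n \<le> Suc (I div l)"
proof -
  have "k * (I + l) \<ge> k * (l * n)"
  proof -
    have "l * J \<le> l * k" using bs by (simp add: base_def)
    hence "k * I + l * k \<ge> N" using bs unfolding base_def by linarith
    thus ?thesis by (simp add: N_def algebra_simps)
  qed
  hence "l * n \<le> I + l" using k_pos by simp
  hence "n \<le> (I + l) div l" by (metis less_eq_div_iff_mult_less_eq mult.commute l_pos)
  moreover have "(I + l) div l = Suc (I div l)" using l_pos by simp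
  ultimately show ?thesis by metis
qed

lemma less_ee: "t < ee \<longleftrightarrow> l * (n + t) \<le> I"
proof -
  have "t < ee \<longleftrightarrow> n + t \<le> I div l" unfolding ee_def using I_ge by linarith
  thus ?thesis using l_pos by (simp add: less_eq_div_iff_mult_less_eq mult.commute)
qed

lemma less_een: "r < n + ee \<longleftrightarrow> l * r \<le> I"
proof -
  have "r < n + ee \<longleftrightarrow> r \<le> I div l" unfolding ee_def using I_ge by linarith
  thus ?thesis using l_pos by (simp add: less_eq_div_iff_mult_less_eq mult.commute)
qed

definition "im t = I - l * (n + t)"
definition "jm t = J + k * t"

lemma im_jm: "t < ee \<Longrightarrow> k * im t + l * jm t = m"
  unfolding wt_m im_def jm_def by (rule exI[of _ t]) (simp add: less_ee)

lemma homog_eqI: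
  assumes "homog k l m F" "homog k l m G" "\<And>t. t < ee \<Longrightarrow> cf F (im t) (jm t) = cf G (im t) (jm t)"
  shows "F = G"
proof (rule series2_eqI)
  fix i j
  show "cf F i j = cf G i j"
  proof (cases "k * i + l * j = m")
    case True
    then obtain r where r: "I = i + l * (n + r)" "j = J + k * r" using wt_m by blast
    hence "r < ee" unfolding less_ee by simp
    moreover have "i = im r" "j = jm r" unfolding im_def jm_def using r by linarith+
    ultimately show ?thesis using assms(3) by simp
  next
    case False
    thus ?thesis using assms(1,2) unfolding homog_def by metis
  qed
qed

lemma e_num_ee: "e_num k l m = ee"
proof -
  have "{(i, j). k * i + l * j = m} = (\<lambda>t. (im t, jm t)) ` {..<ee}"
  proof (rule Set.set_eqI)
    fix z :: "nat \<times> nat"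
    obtain i j where z: "z = (i, j)" by (cases z)
    show "(z \<in> {(i, j). k * i + l * j = m}) = (z \<in> (\<lambda>t. (im t, jm t)) ` {..<ee})"
      unfolding z
    proof
      assume "(i, j) \<in> {(i, j). k * i + l * j = m}"
      then obtain r where r: "I = i + l * (n + r)" "j = J + k * r" using wt_m[of i j] by auto
      hence "r < ee" unfolding less_ee by simp
      moreover have "i = im r" "j = jm r" unfolding im_def jm_def using r by linarith+
      ultimately show "(i, j) \<in> (\<lambda>t. (im t, jm t)) ` {..<ee}" by auto
    qed (auto simp: im_jm)
  qed
  moreover have "inj_on (\<lambda>t. (im t, jm t)) {..<ee}"
    using k_pos by (auto simp: inj_on_def jm_def)
  ultimately show ?thesis by (simp add: e_num_def card_image)
qed

definition "ser p = (\<Sum>t<ee. cst (p t) * mon (im t) (jm t))"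

lemma homog_ser: "homog k l m (ser p)"
  unfolding homog_def
proof (intro allI impI)
  fix i j assume "cf (ser p) i j \<noteq> 0"
  then obtain t where "t < ee" "cf (cst (p t) * mon (im t) (jm t)) i j \<noteq> 0"
    unfolding ser_def cf_sum by (metis (no_types, lifting) lessThan_iff sum.not_neutral_contains_not_neutral)
  thus "k * i + l * j = m" using im_jm by (auto simp: cf_mon split: if_splits)
qed

lemma cf_ser: "t < ee \<Longrightarrow> cf (ser p) (im t) (jm t) = p t"
proof -
  assume t: "t < ee"
  have "cf (ser p) (im t) (jm t) = (\<Sum>s<ee. if s = t then p t else 0)"
    unfolding ser_def cf_sum by (rule sum.cong) (use k_pos in \<open>auto simp: cf_mon jm_def\<close>)
  thus ?thesis using t by simp
qed

text \<open>Indices add: the monomial s of \<open>H c\<close> times the monomial t of weight m is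
  the monomial s + t of weight N + m. Multiplication by \<open>H c\<close> is therefore a
  convolution.\<close>

lemma cf_hs_conv:
  assumes r: "r < n + ee"
  shows "cf (H c * F) (I - l * r) (J + k * r) =
    (\<Sum>s\<le>n. if s \<le> r \<and> r - s < ee then c s * cf F (im (r - s)) (jm (r - s)) else 0)"
  unfolding cf_hs_mult
proof (rule sum.cong)
  fix s assume "s \<in> {..n}"
  hence s: "s \<le> n" by simp
  have lr: "l * r \<le> I" using r by (simp add: less_een)
  have ks: "k * s \<le> J + k * r \<longleftrightarrow> s \<le> r"
  proof
    assume "k * s \<le> J + k * r"
    also have "\<dots> < k + k * r" using bs by (simp add: base_def)
    finally show "s \<le> r" by (rule k_cancel)
  qed (simp add: trans_le_add2)
  show "(if l * (n - s) \<le> I - l * r \<and> k * s \<le> J + k * r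
      then c s * cf F (I - l * r - l * (n - s)) (J + k * r - k * s) else 0) =
    (if s \<le> r \<and> r - s < ee then c s * cf F (im (r - s)) (jm (r - s)) else 0)"
  proof (cases "s \<le> r")
    case True
    then obtain t where t: "r = s + t" using le_Suc_ex by blast
    obtain u where u: "n = s + u" using s le_Suc_ex by blast
    have "l * (n - s) \<le> I - l * r \<longleftrightarrow> l * (n + (r - s)) \<le> I"
      using lr unfolding t u by (auto simp: algebra_simps)
    thus ?thesis unfolding ks less_ee im_def jm_def using lr unfolding t u by (simp add: algebra_simps)
  qed (simp add: ks)
qed simp

text \<open>On the chain of weight N + m the monomials divisible by x^(l n) are those with r <
  \<open>ee\<close>, and those divisible by y^(k n) have n <= r. So the forbidden monomials form a
  segment at either end of the chain.\<close>

lemma normal_iff: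
  assumes "homog k l (N + m) G"
  shows "(\<forall>i j. l * n \<le> i \<or> k * n \<le> j \<longrightarrow> cf G i j = 0) \<longleftrightarrow>
    (\<forall>r < n + ee. r < ee \<or> n \<le> r \<longrightarrow> cf G (I - l * r) (J + k * r) = 0)"
proof -
  have 1: "l * n \<le> i \<longleftrightarrow> r < ee" "k * n \<le> j \<longleftrightarrow> n \<le> r" "r < n + ee" if "I = i + l * r" "j = J + k * r" for i j r
  proof -
    show "l * n \<le> i \<longleftrightarrow> r < ee" unfolding less_ee distrib_left using that(1) by linarith
    show "r < n + ee" unfolding less_een using that(1) by linarith
    show "k * n \<le> j \<longleftrightarrow> n \<le> r"
    proof
      assume "k * n \<le> j"
      also have "j < k + k * r" using that bs by (simp add: base_def)
      finally show "n \<le> r" by (rule k_cancel)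
    qed (use that in \<open>simp add: trans_le_add2\<close>)
  qed
  show ?thesis
  proof (intro iffI allI impI)
    fix r assume h: "\<forall>i j. l * n \<le> i \<or> k * n \<le> j \<longrightarrow> cf G i j = 0" "r < n + ee" "r < ee \<or> n \<le> r"
    have e: "I = (I - l * r) + l * r" using h(2) by (simp add: less_een)
    show "cf G (I - l * r) (J + k * r) = 0" using h(1)[rule_format, of "I - l * r" "J + k * r"] h(3) 1(1,2)[OF e refl] by blast
  next
    fix i j assume h: "\<forall>r < n + ee. r < ee \<or> n \<le> r \<longrightarrow> cf G (I - l * r) (J + k * r) = 0"
      "l * n \<le> i \<or> k * n \<le> j"
    show "cf G i j = 0"
    proof (rule ccontr)
      assume "cf G i j \<noteq> 0"
      hence "k * i + l * j = N + m" using assms by (simp add: homog_def)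
      then obtain r where r: "I = i + l * r" "j = J + k * r" unfolding wt_Nm by blast
      hence "cf G (I - l * r) (J + k * r) = 0" using h 1[OF r] by blast
      moreover have "I - l * r = i" using r(1) by linarith
      ultimately show False using \<open>cf G i j \<noteq> 0\<close> r(2) by metis
    qed
  qed
qed

lemma homog_eq_0_iff:
  assumes "homog k l (N + m) G"
  shows "(\<forall>i j. k * n \<le> j \<longrightarrow> cf G i j = 0) \<longleftrightarrow>
    (\<forall>t < ee. cf G (im t) (J + k * (n + t)) = 0)"
proof (intro iffI allI impI)
  fix t assume "\<forall>i j. k * n \<le> j \<longrightarrow> cf G i j = 0"
  moreover have "k * n \<le> J + k * (n + t)" by (simp add: algebra_simps)
  ultimately show "cf G (im t) (J + k * (n + t)) = 0" by blast
next
  fix i j assume h: "\<forall>t < ee. cf G (im t) (J + k * (n + t)) = 0" "k * n \<le> j"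
  show "cf G i j = 0"
  proof (rule ccontr)
    assume "cf G i j \<noteq> 0"
    hence "k * i + l * j = N + m" using assms by (simp add: homog_def)
    then obtain r where r: "I = i + l * r" "j = J + k * r" unfolding wt_Nm by blast
    have "k * n < k + k * r" using r h(2) bs by (simp add: base_def)
    hence "n \<le> r" by (rule k_cancel)
    then obtain t where t: "r = n + t" using le_Suc_ex by blast
    have "l * (n + t) \<le> I" using r t by simp
    hence "cf G (im t) (J + k * (n + t)) = 0" using h less_ee by blast
    moreover have "im t = i" unfolding im_def using r(1)[unfolded t] by linarith
    ultimately show False using \<open>cf G i j \<noteq> 0\<close> r(2) t by metis
  qed
qed

end

end

text \<open>Reducing the first Bezout factor modulo \<open>b\<close> brings its degree below n. Then
  b q = h - a p has degree below n + e, and deg b = n leaves less than e for q.\<close>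

lemma bezout_degree:
  fixes a b h :: "complex poly"
  assumes cop: "coprime a b" and b: "degree b = n" and a: "degree a \<le> n" and n: "n \<ge> 1" "n \<le> e"
    and h: "\<And>r. r \<ge> n + e \<Longrightarrow> coeff h r = 0"
  shows "\<exists>p q. a * p + b * q = h \<and> (\<forall>t\<ge>e. coeff p t = 0) \<and> (\<forall>t\<ge>e. coeff q t = 0)"
proof -
  define x where "x = fst (bezout_coefficients a b)"
  define y where "y = snd (bezout_coefficients a b)"
  have "x * a + y * b = 1"
    using bezout_coefficients_fst_snd[of a b] cop by (simp add: x_def y_def)
  hence "h * (x * a + y * b) = h" by simp
  hence xy: "a * (h * x) + b * (h * y) = h" by (simp add: algebra_simps)
  define p where "p = (h * x) mod b"
  define q where "q = h * y + (h * x) div b * a"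
  have "b \<noteq> 0" using b n by auto
  have "a * p + b * q = a * ((h * x) div b * b + (h * x) mod b) + b * (h * y)"
    unfolding p_def q_def by (simp only: distrib_left distrib_right mult.commute mult.left_commute add.commute add.left_commute)
  hence eq: "a * p + b * q = h" using xy unfolding div_mult_mod_eq by simp
  have p: "coeff p t = 0" if "t \<ge> n" for t
    using that degree_mod_less[OF \<open>b \<noteq> 0\<close>, of "h * x"] b by (auto simp: p_def coeff_eq_0)
  have "coeff q t = 0" if t: "t \<ge> e" for t
  proof (rule ccontr)
    assume nz: "coeff q t \<noteq> 0"
    hence "q \<noteq> 0" "t \<le> degree q" by (auto simp: le_degree)
    hence "degree (b * q) \<ge> n + e" using t b \<open>b \<noteq> 0\<close> by (simp add: degree_mult_eq)
    moreover have "coeff (b * q) r = 0" if "r \<ge> n + e" for r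
    proof -
      have "coeff (a * p) r = 0"
      proof (cases "a * p = 0")
        case False
        hence "p \<noteq> 0" by auto
        hence "degree p < n" using p by (metis leading_coeff_0_iff not_le_imp_less)
        hence "degree (a * p) < n + e" using a n degree_mult_le[of a p] by linarith
        thus ?thesis using that by (simp add: coeff_eq_0)
      qed (simp only: coeff_0)
      moreover have "b * q = h - a * p" using eq by (simp add: algebra_simps)
      ultimately show ?thesis using h that by simp
    qed
    ultimately show False using \<open>b \<noteq> 0\<close> \<open>q \<noteq> 0\<close> by (metis leading_coeff_0_iff mult_eq_0_iff)
  qed
  thus ?thesis using eq p n by (intro exI[of _ p] exI[of _ q]) auto
qed

lemma det_nonzero_inverse:
  fixes M :: "complex Matrix.mat"
  assumes M: "M \<in> carrier_mat e e" and "Determinant.det M \<noteq> 0"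
  obtains M' where "M' \<in> carrier_mat e e" "M * M' = 1\<^sub>m e" "M' * M = 1\<^sub>m e"
  using det_non_zero_imp_unit[OF assms, of "()"] that by (auto simp: Units_def ring_mat_def)

section \<open>One weight: solving for the contraction, then for the curl\<close>

context homological
begin

context
  fixes m I J :: nat
  assumes bs: "base m I J" and m1: "m \<ge> 1"
begin

abbreviation "e \<equiv> ee I"

text \<open>The coefficient of z^r in the product of the polynomials with coefficients c_0, ..., c_n
  and p_0, ..., p_{e-1}.\<close>

definition "cv c p r = (\<Sum>s\<le>n. if s \<le> r \<and> r - s < e then c s * p (r - s) else (0::complex))"

text \<open>Sorted by the unknowns \<open>p t\<close>, this is a row of a Toeplitz matrix, the shape
  of the blocks of \<open>M_mat\<close>.\<close>

lemma cv_alt: "cv c p r = (\<Sum>t<e. if t \<le> r \<and> r \<le> n + t then c (r - t) * p t else 0)"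
proof -
  have "cv c p r = (\<Sum>s\<le>n. \<Sum>t<e. if s + t = r then c s * p t else 0)"
    unfolding cv_def
  proof (rule sum.cong)
    fix s
    have "(\<Sum>t<e. if s + t = r then c s * p t else 0) = (\<Sum>t<e. if t = r - s then (if s \<le> r then c s * p t else 0) else 0)"
      by (rule sum.cong) auto
    thus "(if s \<le> r \<and> r - s < e then c s * p (r - s) else 0) = (\<Sum>t<e. if s + t = r then c s * p t else 0)"
      by simp
  qed simp
  also have "\<dots> = (\<Sum>t<e. \<Sum>s\<le>n. if s + t = r then c s * p t else 0)" by (rule sum.swap)
  also have "\<dots> = (\<Sum>t<e. if t \<le> r \<and> r \<le> n + t then c (r - t) * p t else 0)"
  proof (rule sum.cong)
    fix t
    have "(\<Sum>s\<le>n. if s + t = r then c s * p t else 0) = (\<Sum>s\<le>n. if s = r - t then (if t \<le> r then c s * p t else 0) else 0)"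
      by (rule sum.cong) auto
    thus "(\<Sum>s\<le>n. if s + t = r then c s * p t else 0) = (if t \<le> r \<and> r \<le> n + t then c (r - t) * p t else 0)"
      by auto
  qed simp
  finally show ?thesis .
qed

lemma cf_conv: "r < n + e \<Longrightarrow> cf (H c * F) (I - l * r) (J + k * r) = cv c (\<lambda>t. cf F (im I t) (jm J t)) r"
  unfolding cv_def by (rule cf_hs_conv[OF bs])

lemma cv_poly: 
  assumes p: "\<And>t. t \<ge> e \<Longrightarrow> coeff p t = 0"
  shows "coeff ((\<Sum>i\<le>n. Polynomial.monom (c i) i) * p) r = cv c (coeff p) r"
proof -
  have "coeff ((\<Sum>i\<le>n. Polynomial.monom (c i) i) * p) r = (\<Sum>i\<le>n. coeff (Polynomial.monom (c i) i * p) r)"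
    by (simp add: sum_distrib_right coeff_sum)
  also have "\<dots> = cv c (coeff p) r"
    unfolding cv_def by (rule sum.cong) (use p in \<open>auto simp: coeff_monom_mult not_less\<close>)
  finally show ?thesis .
qed

lemma cv_cong: "(\<And>t. t < e \<Longrightarrow> p t = q t) \<Longrightarrow> cv c p r = cv c q r"
  unfolding cv_def by (rule sum.cong) auto

lemma A_coef: "A_coef k l n wd m i = (if 0 \<le> i \<and> i \<le> int n then ah m (nat i) else 0)"
proof (cases "0 \<le> i \<and> i \<le> int n")
  case True
  thus ?thesis unfolding A_coef_def ah_series by (simp add: cf_vary_mult cf_hs nat_le_iff)
qed (simp only: A_coef_def if_False)

lemma B_coef: "B_coef k l n wd m i = (if 0 \<le> i \<and> i \<le> int n then bh m (n - nat i) else 0)"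
proof (cases "0 \<le> i \<and> i \<le> int n")
  case True
  hence "cf (H (bh m)) (l * (n - (n - nat i))) (k * (n - nat i)) = bh m (n - nat i)"
    by (intro cf_hs) simp
  thus ?thesis using True unfolding B_coef_def bh_series by (simp add: cf_varx_mult nat_le_iff)
qed (simp only: B_coef_def if_False)

definition "Mm = M_mat k l n wd m"

lemma Mm_carrier: "Mm \<in> carrier_mat (e + e) (e + e)"
  by (simp add: Mm_def M_mat_def Let_def e_num_ee[OF bs])

text \<open>The upper blocks give the coefficients r < e of A p + B q and the lower ones those with
  n <= r < n + e. By \<open>normal_iff\<close> these are the coefficients that the normal form
  forbids.\<close>

lemma Mm_mult:
  "Mm *\<^sub>v (Matrix.vec e p @\<^sub>v Matrix.vec e q) =
    Matrix.vec e (\<lambda>r. cv (ah m) p r + cv (bh m) q r) @\<^sub>v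
    Matrix.vec e (\<lambda>r. cv (ah m) p (n + r) + cv (bh m) q (n + r))"
proof -
  let ?A = "A_coef k l n wd m" and ?B = "B_coef k l n wd m"
  have "Mm *\<^sub>v (Matrix.vec e p @\<^sub>v Matrix.vec e q) =
    (Matrix.mat e e (\<lambda>(r, t). ?A (int r - int t)) *\<^sub>v Matrix.vec e p +
     Matrix.mat e e (\<lambda>(r, t). ?B (int n - int r + int t)) *\<^sub>v Matrix.vec e q) @\<^sub>v
    (Matrix.mat e e (\<lambda>(r, t). ?A (int n + int r - int t)) *\<^sub>v Matrix.vec e p +
     Matrix.mat e e (\<lambda>(r, t). ?B (int t - int r)) *\<^sub>v Matrix.vec e q)"
    unfolding Mm_def M_mat_def Let_def e_num_ee[OF bs]
    by (rule four_block_mat_mult_vec[of _ e e _ e _ e]) auto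
  moreover have "Matrix.mat e e (\<lambda>(r, t). ?A (int r - int t)) *\<^sub>v Matrix.vec e p +
     Matrix.mat e e (\<lambda>(r, t). ?B (int n - int r + int t)) *\<^sub>v Matrix.vec e q =
     Matrix.vec e (\<lambda>r. cv (ah m) p r + cv (bh m) q r)"
    by (rule eq_vecI)
      (auto simp: scalar_prod_def cv_alt A_coef B_coef atLeast0LessThan nat_diff_distrib intro!: sum.cong arg_cong2[of _ _ _ _ "(+)"] arg_cong[of _ _ "bh m"])
  moreover have "Matrix.mat e e (\<lambda>(r, t). ?A (int n + int r - int t)) *\<^sub>v Matrix.vec e p +
     Matrix.mat e e (\<lambda>(r, t). ?B (int t - int r)) *\<^sub>v Matrix.vec e q =
     Matrix.vec e (\<lambda>r. cv (ah m) p (n + r) + cv (bh m) q (n + r))"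
    by (rule eq_vecI)
      (auto simp: scalar_prod_def cv_alt A_coef B_coef atLeast0LessThan nat_diff_distrib intro!: sum.cong arg_cong2[of _ _ _ _ "(+)"] arg_cong[of _ _ "bh m"] arg_cong[of _ _ "ah m"])
  ultimately show ?thesis by simp
qed

lemma vec_split: "(v :: complex Matrix.vec) \<in> carrier_vec (e + e) \<Longrightarrow>
    v = Matrix.vec e (\<lambda>t. Matrix.vec_index v t) @\<^sub>v Matrix.vec e (\<lambda>t. Matrix.vec_index v (e + t))"
  by (rule eq_vecI) auto

lemma small_solve:
  assumes "m < N"
  shows "\<exists>p q. \<forall>r<n+e. r < e \<or> n \<le> r \<longrightarrow> h r + cv (ah m) p r + cv (bh m) q r = 0"
proof -
  have "Determinant.det Mm \<noteq> 0" using det[OF m1] assms by (simp add: Mm_def wd_def N_def)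
  then obtain M' where M': "M' \<in> carrier_mat (e + e) (e + e)" "Mm * M' = 1\<^sub>m (e + e)"
    using det_nonzero_inverse[OF Mm_carrier] by metis
  define w where "w = Matrix.vec e (\<lambda>r. - h r) @\<^sub>v Matrix.vec e (\<lambda>r. - h (n + r))"
  have w: "w \<in> carrier_vec (e + e)" by (simp add: w_def)
  define v where "v = M' *\<^sub>v w"
  have v: "v \<in> carrier_vec (e + e)" using M' w by (simp add: v_def)
  have "Mm *\<^sub>v v = w"
    unfolding v_def using M' w Mm_carrier by (metis assoc_mult_mat_vec one_mult_mat_vec)
  define p where "p = (\<lambda>t. Matrix.vec_index v t)"
  define q where "q = (\<lambda>t. Matrix.vec_index v (e + t))"
  have "Mm *\<^sub>v (Matrix.vec e p @\<^sub>v Matrix.vec e q) = w"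
    using vec_split[OF v] \<open>Mm *\<^sub>v v = w\<close> by (simp add: p_def q_def)
  hence eq: "Matrix.vec e (\<lambda>r. cv (ah m) p r + cv (bh m) q r) @\<^sub>v
    Matrix.vec e (\<lambda>r. cv (ah m) p (n + r) + cv (bh m) q (n + r)) = w"
    by (simp add: Mm_mult)
  have 1: "cv (ah m) p r + cv (bh m) q r = - h r" if "r < e" for r
    using arg_cong[OF eq, of "\<lambda>v. Matrix.vec_index v r"] that by (simp add: w_def)
  have 2: "cv (ah m) p (n + r) + cv (bh m) q (n + r) = - h (n + r)" if "r < e" for r
    using arg_cong[OF eq, of "\<lambda>v. Matrix.vec_index v (e + r)"] that by (simp add: w_def)
  show ?thesis
  proof (intro exI allI impI)
    fix r assume "r < n + e" "r < e \<or> n \<le> r"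
    thus "h r + cv (ah m) p r + cv (bh m) q r = 0"
    proof (cases "r < e")
      case False
      then obtain r' where "r = n + r'" using \<open>r < e \<or> n \<le> r\<close> le_Suc_ex by blast
      thus ?thesis using 2[of r'] \<open>r < n + e\<close> by (simp add: add.assoc)
    qed (use 1[of r] in \<open>simp add: add.assoc\<close>)
  qed
qed

lemma small_unique:
  assumes "m < N" and eq: "\<And>r. r < n + e \<Longrightarrow> r < e \<or> n \<le> r \<Longrightarrow> cv (ah m) p r + cv (bh m) q r = 0"
    and t: "t < e"
  shows "p t = 0 \<and> q t = 0"
proof -
  have "Determinant.det Mm \<noteq> 0" using det[OF m1] assms by (simp add: Mm_def wd_def N_def)
  then obtain M' where M': "M' \<in> carrier_mat (e + e) (e + e)" "M' * Mm = 1\<^sub>m (e + e)"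
    using det_nonzero_inverse[OF Mm_carrier] by metis
  define v where "v = Matrix.vec e p @\<^sub>v Matrix.vec e q"
  have v: "v \<in> carrier_vec (e + e)" by (simp add: v_def)
  have "Mm *\<^sub>v v = 0\<^sub>v (e + e)"
    unfolding v_def Mm_mult
  proof (rule eq_vecI)
    fix i assume i: "i < dim_vec (0\<^sub>v (e + e))"
    have "n + i - e < n + e" "n \<le> n + i - e" if "\<not> i < e" using i that by auto
    with i show "Matrix.vec_index (Matrix.vec e (\<lambda>r. cv (ah m) p r + cv (bh m) q r) @\<^sub>v
      Matrix.vec e (\<lambda>r. cv (ah m) p (n + r) + cv (bh m) q (n + r))) i = Matrix.vec_index (0\<^sub>v (e + e)) i"
      using eq[of i] eq[of "n + i - e"] by (cases "i < e") auto
  qed simp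
  hence "v = M' *\<^sub>v 0\<^sub>v (e + e)"
    using M' v Mm_carrier by (metis assoc_mult_mat_vec one_mult_mat_vec)
  hence v0: "v = 0\<^sub>v (e + e)" using M' by (auto intro!: eq_vecI simp: scalar_prod_def)
  show ?thesis
    using arg_cong[OF v0, of "\<lambda>v. Matrix.vec_index v t"] arg_cong[OF v0, of "\<lambda>v. Matrix.vec_index v (e + t)"] t
    by (simp add: v_def)
qed

definition "pa = (\<Sum>i\<le>n. Polynomial.monom (ah m i) i)"
definition "pb = (\<Sum>i\<le>n. Polynomial.monom (bh m i) i)"

lemma coeff_pab: "coeff pa i = (if i \<le> n then ah m i else 0)" "coeff pb i = (if i \<le> n then bh m i else 0)"
  by (simp_all add: pa_def pb_def coeff_sum coeff_monom)

text \<open>Otherwise \<open>hat_relation\<close> would give P_n = 0. So at least one of the two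
  polynomials has full degree n and can serve as the modulus in Bezout's identity.\<close>

lemma top_nonzero: "ah m n \<noteq> 0 \<or> bh m n \<noteq> 0"
proof (rule ccontr)
  assume "\<not> ?thesis"
  hence "of_nat (m + d) * Pc n = 0" using hat_relation[of n m] by simp
  thus False using Pn m1 by (simp add: Pc_def del: of_nat_add)
qed

lemma degrees: "degree pa \<le> n" "degree pb \<le> n" "ah m n \<noteq> 0 \<Longrightarrow> degree pa = n" "bh m n \<noteq> 0 \<Longrightarrow> degree pb = n"
proof -
  show a: "degree pa \<le> n" and b: "degree pb \<le> n" by (auto intro!: degree_le simp: coeff_pab)
  show "ah m n \<noteq> 0 \<Longrightarrow> degree pa = n" "bh m n \<noteq> 0 \<Longrightarrow> degree pb = n"
    using a b by (auto intro!: antisym le_degree simp: coeff_pab)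
qed

lemma coprime_pab: "coprime pa pb"
proof (rule ccontr)
  assume "\<not> coprime pa pb"
  then obtain c where c: "c dvd pa" "c dvd pb" "\<not> is_unit c" by (rule not_coprimeE)
  have "pa \<noteq> 0 \<or> pb \<noteq> 0" using top_nonzero coeff_pab by (metis coeff_0 order_refl)
  hence "c \<noteq> 0" using c by auto
  hence "\<not> constant (poly c)" using c(3) by (simp add: constant_degree is_unit_iff_degree)
  then obtain z where "poly c z = 0" using fundamental_theorem_of_algebra by blast
  hence "poly pa z = 0" "poly pb z = 0" using c(1,2) by (auto elim!: dvdE)
  thus False using cop[OF m1, of z] by (simp add: pa_def pb_def poly_sum poly_monom ah_def bh_def Pc_def)
qed

text \<open>From this weight on the two forbidden segments cover the whole chain: the function part
  has to be removed completely.\<close>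

lemma e_ge_n: "N \<le> m \<Longrightarrow> n \<le> e"
proof -
  assume "N \<le> m"
  have "l * J \<le> l * k" using bs by (simp add: base_def)
  hence "k * I + l * k \<ge> N + N" using bs \<open>N \<le> m\<close> unfolding base_def by linarith
  hence "k * (I + l) \<ge> k * (l * (n + n))" by (simp add: N_def algebra_simps)
  hence I: "l * (n + n) \<le> I + l" using k by simp
  obtain n' where n': "n = Suc n'" using n by (cases n) auto
  have "l * (n + n') \<le> I" using I by (simp add: n' algebra_simps)
  hence "n' < e" unfolding less_ee[OF bs] .
  thus ?thesis by (simp add: n')
qed

lemma large_solve:
  assumes "N \<le> m"
  shows "\<exists>p q. \<forall>r<n+e. h r + cv (ah m) p r + cv (bh m) q r = 0"
proof -
  define hh where "hh = - (\<Sum>r<n+e. Polynomial.monom (h r) r)"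
  have hh: "coeff hh r = (if r < n + e then - h r else 0)" for r
    by (simp add: hh_def coeff_sum coeff_monom)
  have "\<exists>p q. pa * p + pb * q = hh \<and> (\<forall>t\<ge>e. coeff p t = 0) \<and> (\<forall>t\<ge>e. coeff q t = 0)"
  \<comment> \<open>The modulus must have degree exactly n; if the top coefficient of
    \<open>pb\<close> vanishes, the roles of \<open>pa\<close> and \<open>pb\<close> are
    exchanged.\<close>
  proof (cases "bh m n = 0")
    case False
    show ?thesis by (rule bezout_degree[of _ _ n])
      (use False degrees coprime_pab n e_ge_n[OF assms] hh in auto)
  next
    case True
    hence "ah m n \<noteq> 0" using top_nonzero by simp
    hence "\<exists>q p. pb * q + pa * p = hh \<and> (\<forall>t\<ge>e. coeff q t = 0) \<and> (\<forall>t\<ge>e. coeff p t = 0)"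
      by (intro bezout_degree[of _ _ n])
        (use degrees coprime_pab n e_ge_n[OF assms] hh in \<open>auto simp: coprime_commute\<close>)
    thus ?thesis by (metis add.commute)
  qed
  then obtain p q where pq: "pa * p + pb * q = hh" "\<And>t. t \<ge> e \<Longrightarrow> coeff p t = 0" "\<And>t. t \<ge> e \<Longrightarrow> coeff q t = 0"
    by blast
  have "h r + cv (ah m) (coeff p) r + cv (bh m) (coeff q) r = 0" if "r < n + e" for r
    using arg_cong[OF pq(1), of "\<lambda>p. coeff p r"] cv_poly[OF pq(2), of "ah m" r] cv_poly[OF pq(3), of "bh m" r] hh that
    by (simp add: pa_def pb_def add.assoc)
  thus ?thesis by blast
qed

text \<open>The syzygies of two coprime polynomials are the multiples of (pb, -pa). The degree bound
  on p and q leaves e - n coefficients for the cofactor g.\<close>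

lemma large_unique:
  assumes "N \<le> m" and eq: "\<And>r. r < n + e \<Longrightarrow> cv (ah m) p r + cv (bh m) q r = 0"
  shows "\<exists>g. (\<forall>t. e \<le> t + n \<longrightarrow> coeff g t = 0) \<and>
    (\<forall>t<e. p t = coeff (pb * g) t \<and> q t = - coeff (pa * g) t)"
proof -
  define pp where "pp = (\<Sum>t<e. Polynomial.monom (p t) t)"
  define qq where "qq = (\<Sum>t<e. Polynomial.monom (q t) t)"
  have c: "coeff pp t = (if t < e then p t else 0)" "coeff qq t = (if t < e then q t else 0)" for t
    by (simp_all add: pp_def qq_def coeff_sum coeff_monom)
  have "pa * pp + pb * qq = 0"
  proof (rule poly_eqI)
    fix r
    have "coeff (pa * pp) r = cv (ah m) (coeff pp) r" "coeff (pb * qq) r = cv (bh m) (coeff qq) r"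
      unfolding pa_def pb_def by (rule cv_poly; simp add: c)+
    moreover have "cv (ah m) (coeff pp) r = cv (ah m) p r" "cv (bh m) (coeff qq) r = cv (bh m) q r"
      by (rule cv_cong; simp add: c)+
    moreover have "cv c p r = 0" if "\<not> r < n + e" for c p
      unfolding cv_def by (rule sum.neutral) (use that in auto)
    ultimately show "coeff (pa * pp + pb * qq) r = coeff 0 r" using eq[of r] by (cases "r < n + e") auto
  qed
  hence eq': "pa * pp = - (pb * qq)" by (simp add: eq_neg_iff_add_eq_0)
  hence "pb dvd pa * pp" by simp
  hence "pb dvd pp" using coprime_pab by (simp add: coprime_commute coprime_dvd_mult_right_iff)
  then obtain g where g: "pp = pb * g" by blast
  have "pa \<noteq> 0 \<or> pb \<noteq> 0" using top_nonzero coeff_pab by (metis coeff_0 order_refl)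
  \<comment> \<open>If it were 0, coprimality would make \<open>pa\<close> a nonzero constant,
    although its degree would be n.\<close>
  have "pb \<noteq> 0"
  proof
    assume "pb = 0"
    hence "is_unit pa" "degree pa = n"
      using coprime_pab degrees(3) top_nonzero coeff_pab(2)[of n] by auto
    thus False using n by (auto simp: is_unit_iff_degree[OF \<open>_ \<or> _\<close>[unfolded \<open>pb = 0\<close>, simplified]])
  qed
  have "pb * (pa * g) = pb * (- qq)" using eq' g by (simp add: algebra_simps)
  hence q: "qq = - (pa * g)" using \<open>pb \<noteq> 0\<close> by (metis mult_cancel_left minus_minus)
  have "coeff g t = 0" if t: "e \<le> t + n" for t
  proof (rule ccontr)
    assume nz: "coeff g t \<noteq> 0"
    hence "g \<noteq> 0" "t \<le> degree g" by (auto simp: le_degree)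
    have "coeff pp (degree pp) = 0 \<or> degree pp < e" "coeff qq (degree qq) = 0 \<or> degree qq < e"
      by (simp_all add: c)
    hence d: "pp = 0 \<or> degree pp < e" "qq = 0 \<or> degree qq < e" by simp_all
    show False
    proof (cases "bh m n = 0")
      case False
      hence "degree pp = n + degree g" using g \<open>g \<noteq> 0\<close> \<open>pb \<noteq> 0\<close> degrees(4) by (simp add: degree_mult_eq)
      thus False using d(1) g \<open>g \<noteq> 0\<close> \<open>pb \<noteq> 0\<close> \<open>t \<le> degree g\<close> t by auto
    next
      case True
      hence an: "degree pa = n" using degrees(3) top_nonzero by simp
      hence "pa \<noteq> 0" using n by auto
      hence "degree qq = n + degree g" using q \<open>g \<noteq> 0\<close> an by (simp add: degree_mult_eq)
      thus False using d(2) q \<open>g \<noteq> 0\<close> \<open>pa \<noteq> 0\<close> \<open>t \<le> degree g\<close> t by auto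
    qed
  qed
  moreover have "p t = coeff (pb * g) t \<and> q t = - coeff (pa * g) t" if "t < e" for t
    using c[of t] that g q by (metis coeff_minus)
  ultimately show ?thesis by blast
qed

subsection \<open>Solving for the function part\<close>

lemma solve_function_part:
  assumes G: "homog k l (N + m) G"
  shows "\<exists>p q. homog k l m p \<and> homog k l m q \<and>
     (\<forall>i j. l * n \<le> i \<or> k * n \<le> j \<longrightarrow> cf (G + H (ah m) * p + H (bh m) * q) i j = 0)"
proof -
  have "\<exists>p q. \<forall>r<n+e. r < e \<or> n \<le> r \<longrightarrow>
      cf G (I - l * r) (J + k * r) + cv (ah m) p r + cv (bh m) q r = 0"
    using small_solve[of "\<lambda>r. cf G (I - l * r) (J + k * r)"]
      large_solve[of "\<lambda>r. cf G (I - l * r) (J + k * r)"] by (cases "m < N") (fastforce, auto)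
  then obtain p q where pq: "\<And>r. r < n + e \<Longrightarrow> r < e \<or> n \<le> r \<Longrightarrow>
      cf G (I - l * r) (J + k * r) + cv (ah m) p r + cv (bh m) q r = 0" by blast
  have hp: "homog k l m (ser I J p)" "homog k l m (ser I J q)" by (rule homog_ser[OF bs])+
  have hG: "homog k l (N + m) (G + H (ah m) * ser I J p + H (bh m) * ser I J q)"
    using homog_mult[OF homog_hs hp(1)] homog_mult[OF homog_hs hp(2)] G by (simp add: homog_add N_def)
  have "cv c (\<lambda>t. cf (ser I J p) (im I t) (jm J t)) r = cv c p r" for c p r
    by (rule cv_cong) (simp add: cf_ser[OF bs])
  hence "\<forall>r<n+e. r < e \<or> n \<le> r \<longrightarrow>
      cf (G + H (ah m) * ser I J p + H (bh m) * ser I J q) (I - l * r) (J + k * r) = 0"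
    using pq by (simp add: cf_conv)
  thus ?thesis using hp normal_iff[OF bs hG] by blast
qed

text \<open>The cofactor of \<open>large_unique\<close> has to be read as a series of weight m - N.
  The chain of that weight has the same J and is shorter by n, matching the degree bound on the
  cofactor.\<close>

lemma base_shift: "N \<le> m \<Longrightarrow> base (m - N) (I - l * n) J \<and> ee (I - l * n) = e - n \<and> l * n \<le> I"
proof -
  assume m: "N \<le> m"
  have "0 < e" using e_ge_n[OF m] n by simp
  hence I: "l * n \<le> I" using less_ee[OF bs, of 0] by simp
  have "k * (I - l * n) + l * J = N + (m - N)"
  proof -
    obtain I' where I': "I = l * n + I'" using I le_Suc_ex by blast
    show ?thesis using bs m by (simp add: I' base_def N_def algebra_simps)
  qed
  hence b: "base (m - N) (I - l * n) J" using bs by (simp add: base_def)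
  have "t < ee (I - l * n) \<longleftrightarrow> t < e - n" for t
  proof -
    have "t < e - n \<longleftrightarrow> n + t < e" by auto
    thus ?thesis unfolding less_ee[OF b] less_ee[OF bs] using I by (auto simp: algebra_simps)
  qed
  hence "ee (I - l * n) = e - n" by (metis linorder_neqE_nat less_irrefl)
  thus ?thesis using b I by simp
qed

lemma unique_function_part:
  assumes p: "homog k l m p" and q: "homog k l m q"
    and eq: "\<And>i j. l * n \<le> i \<or> k * n \<le> j \<Longrightarrow> cf (H (ah m) * p + H (bh m) * q) i j = 0"
  shows "\<exists>g. (\<forall>i j. cf g i j \<noteq> 0 \<longrightarrow> k * i + l * j + N = m) \<and> p = H (bh m) * g \<and> q = - (H (ah m) * g)"
proof -
  have hG: "homog k l (N + m) (H (ah m) * p + H (bh m) * q)"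
    using homog_mult[OF homog_hs p] homog_mult[OF homog_hs q] by (simp add: homog_add N_def)
  define p' where "p' = (\<lambda>t. cf p (im I t) (jm J t))"
  define q' where "q' = (\<lambda>t. cf q (im I t) (jm J t))"
  have eq0: "\<forall>r<n + e. r < e \<or> n \<le> r \<longrightarrow> cf (H (ah m) * p + H (bh m) * q) (I - l * r) (J + k * r) = 0"
    using normal_iff[OF bs hG] eq by blast
  hence eq': "cv (ah m) p' r + cv (bh m) q' r = 0" if "r < n + e" "r < e \<or> n \<le> r" for r
    using eq0[rule_format, OF that] that(1) by (simp add: cf_conv p'_def q'_def)
  show ?thesis
  proof (cases "m < N")
    case True
    have "p = 0" "q = 0"
      by (rule homog_eqI[OF bs], use p q small_unique[OF True eq'] in \<open>auto simp: p'_def q'_def\<close>)+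
    thus ?thesis by (intro exI[of _ 0]) auto
  next
    case False
    hence m: "N \<le> m" by simp
    have eqs: "cv (ah m) p' r + cv (bh m) q' r = 0" if "r < n + e" for r
      by (rule eq'[OF that]) (use e_ge_n[OF m] in linarith)
    then obtain g where g: "\<And>t. e \<le> t + n \<Longrightarrow> coeff g t = 0"
      "\<And>t. t < e \<Longrightarrow> p' t = coeff (pb * g) t" "\<And>t. t < e \<Longrightarrow> q' t = - coeff (pa * g) t"
      using large_unique[OF m eqs] by meson
    define b' where "b' = (m - N)"
    define I' where "I' = I - l * n"
    have b: "base (m - N) I' J" and e': "ee I' = e - n" and I: "l * n \<le> I"
      using base_shift[OF m] by (auto simp: I'_def)
    define G where "G = ser I' J (coeff g)"
    have hGG: "homog k l (m - N) G" unfolding G_def by (rule homog_ser[OF b])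
    have "cf (H c * G) (im I t) (jm J t) = coeff ((\<Sum>i\<le>n. Polynomial.monom (c i) i) * g) t" if t: "t < e" for c t
    proof -
      have "im I t = I' - l * t" by (simp add: im_def[OF bs] I'_def algebra_simps)
      moreover have "t < n + ee I'" using t e' e_ge_n[OF m] by simp
      ultimately have "cf (H c * G) (im I t) (jm J t) =
          (\<Sum>s\<le>n. if s \<le> t \<and> t - s < ee I' then c s * cf G (im I' (t - s)) (jm J (t - s)) else 0)"
        using cf_hs_conv[OF b, of t c G] by (simp add: jm_def[OF bs])
      also have "\<dots> = (\<Sum>s\<le>n. if s \<le> t \<and> t - s < ee I' then c s * coeff g (t - s) else 0)"
        by (rule sum.cong) (auto simp: G_def cf_ser[OF b])
      also have "\<dots> = (\<Sum>i\<le>n. coeff (Polynomial.monom (c i) i * g) t)"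
        by (rule sum.cong) (use g(1) e' in \<open>auto simp: coeff_monom_mult not_less\<close>)
      also have "\<dots> = coeff ((\<Sum>i\<le>n. Polynomial.monom (c i) i) * g) t"
        by (simp add: sum_distrib_right coeff_sum)
      finally show ?thesis .
    qed
    note cfG = this[of _ "ah m", folded pa_def] this[of _ "bh m", folded pb_def]
    have h: "homog k l m (H c * G)" for c
      using homog_mult[OF homog_hs[of k l n c] hGG] m by (simp add: N_def)
    have "p = H (bh m) * G"
      by (rule homog_eqI[OF bs p h]) (use g(2) cfG(2) in \<open>simp add: p'_def\<close>)
    moreover have "q = - (H (ah m) * G)"
      by (rule homog_eqI[OF bs q]) (use g(3) cfG(1) h in \<open>simp_all add: q'_def homog_uminus\<close>)
    moreover have "k * i + l * j + N = m" if "cf G i j \<noteq> 0" for i j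
      using that hGG m by (auto simp: homog_def)
    ultimately show ?thesis by blast
  qed
qed

subsection \<open>Solving for the area part\<close>

definition "rad g = H be * (varx * dx2 g) - H al * (vary * dy2 g)"

lemma cf_euler: "cf (varx * dx2 g) i j = of_nat i * cf g i j" "cf (vary * dy2 g) i j = of_nat j * cf g i j"
  by (cases i; cases j; simp add: cf_varx_mult cf_vary_mult del: cf_00_mult)+

lemma homog_rad: "homog k l m g \<Longrightarrow> homog k l (N + m) (rad g)"
proof -
  assume g: "homog k l m g"
  have "homog k l m (varx * dx2 g)" "homog k l m (vary * dy2 g)"
    using g unfolding homog_def cf_euler by auto
  thus ?thesis unfolding rad_def N_def by (intro homog_diff homog_mult homog_hs)
qed

text \<open>The coefficient considered has index n + t. A binary form of degree n carries an unknown
  of index s there only if s >= t, and for s = t through its top coefficient. The system is thus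
  triangular, with the diagonal that \<open>irr_n\<close> controls.\<close>

lemma cf_rad:
  assumes "t < e"
  shows "cf (rad g) (im I t) (J + k * (n + t)) =
    (be n * of_nat (im I t) - al n * of_nat (jm J t)) * cf g (im I t) (jm J t) +
    (\<Sum>s\<in>{t<..<e}. (if s \<le> n + t then be (n + t - s) * of_nat (im I s) - al (n + t - s) * of_nat (jm J s) else 0)
       * cf g (im I s) (jm J s))"
proof -
  have i: "im I t = I - l * (n + t)" by (simp add: im_def[OF bs])
  have r: "n + t < n + e" using assms by simp
  have "cf (rad g) (im I t) (J + k * (n + t)) =
    cv be (\<lambda>t. cf (varx * dx2 g) (im I t) (jm J t)) (n + t) - cv al (\<lambda>t. cf (vary * dy2 g) (im I t) (jm J t)) (n + t)"
    unfolding rad_def i cf_diff using cf_conv[OF r] by simp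
  also have "\<dots> = (\<Sum>s<e. (if s \<le> n + t \<and> t \<le> s then be (n + t - s) * of_nat (im I s) - al (n + t - s) * of_nat (jm J s) else 0)
       * cf g (im I s) (jm J s))"
    unfolding cv_alt cf_euler sum_subtractf[symmetric] by (rule sum.cong) (auto simp: algebra_simps)
  also have "\<dots> = (\<Sum>s\<in>insert t {t<..<e}. (if s \<le> n + t \<and> t \<le> s then be (n + t - s) * of_nat (im I s) - al (n + t - s) * of_nat (jm J s) else 0)
       * cf g (im I s) (jm J s))"
    by (rule sum.mono_neutral_right) (use assms in auto)
  also have "\<dots> = (be n * of_nat (im I t) - al n * of_nat (jm J t)) * cf g (im I t) (jm J t) +
    (\<Sum>s\<in>{t<..<e}. (if s \<le> n + t then be (n + t - s) * of_nat (im I s) - al (n + t - s) * of_nat (jm J s) else 0)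
       * cf g (im I s) (jm J s))"
    by (subst sum.insert) (auto intro!: sum.cong)
  finally show ?thesis .
qed

lemma diagonal: "t < e \<Longrightarrow> be n * of_nat (im I t) - al n * of_nat (jm J t) \<noteq> 0"
proof -
  assume "t < e"
  hence "k * im I t + l * jm J t = m" by (rule im_jm[OF bs])
  hence "int k * int (im I t) + int l * int (jm J t) \<noteq> 0" using m1
    by (metis of_nat_add of_nat_mult of_nat_eq_0_iff not_one_le_zero)
  thus ?thesis using irr_n[of "int (im I t)" "int (jm J t)"] by simp
qed

lemma solve_area_part:
  assumes C: "homog k l (N + m) C"
  shows "\<exists>g. homog k l m g \<and> (\<forall>i j. k * n \<le> j \<longrightarrow> cf (C - rad g) i j = 0)"
proof -
  obtain g where g: "\<And>t. t < e \<Longrightarrow> (be n * of_nat (im I t) - al n * of_nat (jm J t)) * g t +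
    (\<Sum>s\<in>{t<..<e}. (if s \<le> n + t then be (n + t - s) * of_nat (im I s) - al (n + t - s) * of_nat (jm J s) else 0)
       * g s) = cf C (im I t) (J + k * (n + t))"
    using triangular_system[of e "\<lambda>t. be n * of_nat (im I t) - al n * of_nat (jm J t)"
      "\<lambda>t s. (if s \<le> n + t then be (n + t - s) * of_nat (im I s) - al (n + t - s) * of_nat (jm J s) else 0)"
      "\<lambda>t. cf C (im I t) (J + k * (n + t))"] diagonal by blast
  have "cf (rad (ser I J g)) (im I t) (J + k * (n + t)) = cf C (im I t) (J + k * (n + t))" if "t < e" for t
  proof -
    have "(\<Sum>s\<in>{t<..<e}. (if s \<le> n + t then be (n + t - s) * of_nat (im I s) - al (n + t - s) * of_nat (jm J s) else 0)
       * cf (ser I J g) (im I s) (jm J s)) = (\<Sum>s\<in>{t<..<e}. (if s \<le> n + t then be (n + t - s) * of_nat (im I s) - al (n + t - s) * of_nat (jm J s) else 0)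
       * g s)" by (rule sum.cong) (auto simp: cf_ser[OF bs])
    thus ?thesis unfolding cf_rad[OF that] using g[OF that] that by (simp add: cf_ser[OF bs])
  qed
  hence "\<forall>t<e. cf (C - rad (ser I J g)) (im I t) (J + k * (n + t)) = 0" by simp
  moreover have "homog k l (N + m) (C - rad (ser I J g))"
    by (intro homog_diff C homog_rad homog_ser[OF bs])
  ultimately show ?thesis using homog_eq_0_iff[OF bs] homog_ser[OF bs] by blast
qed

lemma unique_area_part:
  assumes g: "homog k l m g" and 0: "\<And>i j. k * n \<le> j \<Longrightarrow> cf (rad g) i j = 0"
  shows "g = 0"
proof (rule homog_eqI[OF bs g])
  fix t assume "t < e"
  have "\<forall>t<e. cf (rad g) (im I t) (J + k * (n + t)) = 0"
    using homog_eq_0_iff[OF bs homog_rad[OF g]] 0 by blast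
  hence "cf g (im I t) (jm J t) = 0"
    using triangular_system_unique[of e "\<lambda>t. be n * of_nat (im I t) - al n * of_nat (jm J t)"
      "\<lambda>t. cf g (im I t) (jm J t)" "\<lambda>t s. (if s \<le> n + t then be (n + t - s) * of_nat (im I s) - al (n + t - s) * of_nat (jm J s) else 0)"]
     diagonal \<open>t < e\<close> cf_rad[of _ g] by simp
  thus "cf g (im I t) (jm J t) = cf 0 (im I t) (jm J t)" by simp
qed simp

end

end

section \<open>Lie derivatives, invariant axes and quasi-homogeneous parts\<close>

lemma lie_simps:
  "fst (lie \<omega> p q w) = dx2 (fst \<omega>) * p + dy2 (fst \<omega>) * q + fst \<omega> * dx2 p + snd \<omega> * dx2 q + w * fst \<omega>"
  "snd (lie \<omega> p q w) = dx2 (snd \<omega>) * p + dy2 (snd \<omega>) * q + fst \<omega> * dy2 p + snd \<omega> * dy2 q + w * snd \<omega>"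
  by (simp_all add: lie_def)

lemma lie_add: "lie \<omega> (p + p') (q + q') (w + w') = lie \<omega> p q w + lie \<omega> p' q' w'"
  by (rule prod_eqI) (simp_all add: lie_simps algebra_simps)

lemma lie_diff: "lie \<omega> (p - p') (q - q') (w - w') = lie \<omega> p q w - lie \<omega> p' q' w'"
  by (rule prod_eqI) (simp_all add: lie_simps algebra_simps)

lemma q_of_add: "q_of k l (\<theta> + \<eta>) = q_of k l \<theta> + q_of k l \<eta>"
  and q_of_diff: "q_of k l (\<theta> - \<eta>) = q_of k l \<theta> - q_of k l \<eta>"
  and curl_add: "curl (\<theta> + \<eta>) = curl \<theta> + curl \<eta>"
  and curl_diff: "curl (\<theta> - \<eta>) = curl \<theta> - curl \<eta>"
  by (simp_all add: q_of_def curl_def algebra_simps)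

lemma nf_add: "nf k l n \<theta> \<Longrightarrow> nf k l n \<eta> \<Longrightarrow> nf k l n (\<theta> + \<eta>)"
  and nf_diff: "nf k l n \<theta> \<Longrightarrow> nf k l n \<eta> \<Longrightarrow> nf k l n (\<theta> - \<eta>)"
  by (simp_all add: nf_def axes_invariant_def q_of_add curl_add q_of_diff curl_diff)

lemma nf_0: "nf k l n 0"
  by (simp add: nf_def axes_invariant_def q_of_def curl_def)

text \<open>The field X = (-g b, g a) satisfies i_X omega = 0, so Cartan's formula leaves i_X d
  omega = -g curl(omega) omega, which the unit compensates.\<close>

lemma lie_tangent: "lie \<omega> (- (g * snd \<omega>)) (g * fst \<omega>) (g * curl \<omega>) = 0"
  by (rule prod_eqI) (simp_all add: lie_simps curl_def dx2_mult dy2_mult algebra_simps)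

lemma axes_invariant_iff: "axes_invariant \<omega> \<longleftrightarrow> (\<exists>A B. \<omega> = (vary * A, varx * B))"
proof
  assume a: "axes_invariant \<omega>"
  have "fst \<omega> = vary * fps2 (\<lambda>i j. cf (fst \<omega>) i (Suc j))"
    by (rule series2_eqI) (use a in \<open>auto simp: cf_vary_mult axes_invariant_def gr0_conv_Suc\<close>)
  moreover have "snd \<omega> = varx * fps2 (\<lambda>i j. cf (snd \<omega>) (Suc i) j)"
    by (rule series2_eqI) (use a in \<open>auto simp: cf_varx_mult axes_invariant_def gr0_conv_Suc\<close>)
  ultimately show "\<exists>A B. \<omega> = (vary * A, varx * B)" by (metis prod.collapse)
qed (auto simp: axes_invariant_def cf_vary_mult cf_varx_mult)

lemma axes_invariant_pullback:
  assumes "axes_invariant \<omega>"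
  shows "axes_invariant (smul w (pullback (varx * P, vary * Q) \<omega>))"
proof -
  obtain A B where \<omega>: "\<omega> = (vary * A, varx * B)" using assms axes_invariant_iff by auto
  define A' where "A' = subst2 A (varx * P) (vary * Q)"
  define B' where "B' = subst2 B (varx * P) (vary * Q)"
  have c: "cf (varx * P) 0 0 = 0" "cf (vary * Q) 0 0 = 0" by (simp_all add: cf_varx cf_vary)
  have "smul w (pullback (varx * P, vary * Q) \<omega>) =
    (vary * (w * (Q * A' * dx2 (varx * P) + varx * P * B' * dx2 Q)),
     varx * (w * (vary * Q * A' * dy2 P + P * B' * dy2 (vary * Q))))"
    unfolding \<omega> by (rule prod_eqI)
      (simp_all add: subst2_mult[OF c] subst2_varx[OF c] subst2_vary[OF c] A'_def[symmetric] B'_def[symmetric]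
        dx2_vary_mult dy2_varx_mult algebra_simps)
  thus ?thesis using axes_invariant_iff by blast
qed

subsection \<open>Homogeneous parts of a form\<close>

lemma cf_form_part:
  "cf (fst (form_part k l D \<theta>)) i j = (if k * i + l * j + k = D then cf (fst \<theta>) i j else 0)"
  "cf (snd (form_part k l D \<theta>)) i j = (if k * i + l * j + l = D then cf (snd \<theta>) i j else 0)"
  by (simp_all add: form_part_def)

lemma form2_eqI:
  assumes "\<And>i j. cf (fst \<theta>) i j = cf (fst \<eta>) i j" "\<And>i j. cf (snd \<theta>) i j = cf (snd \<eta>) i j"
  shows "(\<theta> :: form2) = \<eta>"
  by (rule prod_eqI) (use assms in \<open>auto intro: series2_eqI\<close>)

lemma homogf_form_part: "homogf k l D (form_part k l D \<theta>)"
  by (auto simp: homogf_def cf_form_part split: if_splits)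

lemma form_part_homogf: "homogf k l D \<theta> \<Longrightarrow> form_part k l D \<theta> = \<theta>"
  by (rule form2_eqI) (auto simp: cf_form_part homogf_def)

lemma form_part_wgef: "wgef k l D' \<theta> \<Longrightarrow> int D < D' \<Longrightarrow> form_part k l D \<theta> = 0"
proof (rule form2_eqI)
  fix i j assume h: "wgef k l D' \<theta>" "int D < D'"
  show "cf (fst (form_part k l D \<theta>)) i j = cf (fst 0) i j"
    using h wgeD[of k l "D' - int k" "fst \<theta>" i j] by (auto simp: cf_form_part wgef_def)
  show "cf (snd (form_part k l D \<theta>)) i j = cf (snd 0) i j"
    using h wgeD[of k l "D' - int l" "snd \<theta>" i j] by (auto simp: cf_form_part wgef_def)
qed

lemma form_part_add: "form_part k l D (\<theta> + \<eta>) = form_part k l D \<theta> + form_part k l D \<eta>"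
  and form_part_diff: "form_part k l D (\<theta> - \<eta>) = form_part k l D \<theta> - form_part k l D \<eta>"
  by (rule form2_eqI; simp add: cf_form_part)+

lemma form_part_eq: "wgef k l D' (\<theta> - \<eta>) \<Longrightarrow> int D < D' \<Longrightarrow> form_part k l D \<theta> = form_part k l D \<eta>"
  using form_part_wgef[of k l D' "\<theta> - \<eta>" D] by (simp add: form_part_diff)

lemma axes_invariant_form_part: "axes_invariant \<theta> \<Longrightarrow> axes_invariant (form_part k l D \<theta>)"
  by (simp add: axes_invariant_def cf_form_part)

lemma cf_q_of: "cf (q_of k l \<theta>) (Suc i) (Suc j) = of_nat k * cf (fst \<theta>) i (Suc j) + of_nat l * cf (snd \<theta>) (Suc i) j"
  by (simp add: q_of_def mult.assoc cf_varx_mult cf_vary_mult)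

lemma cf_curl: "cf (curl \<theta>) i j = of_nat (Suc i) * cf (snd \<theta>) (Suc i) j - of_nat (Suc j) * cf (fst \<theta>) i (Suc j)"
  by (simp add: curl_def)

lemma cf_form_part_parts:
  "cf (q_of k l (form_part k l D \<theta>)) (Suc i) (Suc j) =
     (if k * Suc i + l * Suc j = D then cf (q_of k l \<theta>) (Suc i) (Suc j) else 0)"
  "cf (curl (form_part k l D \<theta>)) i j = (if k * Suc i + l * Suc j = D then cf (curl \<theta>) i j else 0)"
  by (simp_all add: cf_q_of cf_curl cf_form_part algebra_simps)

lemma nf_form_part: "nf k l n \<theta> \<Longrightarrow> nf k l n (form_part k l D \<theta>)"
  by (simp add: nf_def axes_invariant_form_part cf_form_part_parts)

lemma nf_parts:
  assumes "\<And>D. nf k l n (form_part k l D \<theta>)"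
  shows "nf k l n \<theta>"
  unfolding nf_def axes_invariant_def
proof (intro conjI allI impI)
  fix i j
  show "cf (fst \<theta>) i 0 = 0" using assms[of "k * i + l * 0 + k"]
    unfolding nf_def axes_invariant_def cf_form_part by metis
  show "cf (snd \<theta>) 0 j = 0" using assms[of "k * 0 + l * j + l"]
    unfolding nf_def axes_invariant_def cf_form_part by metis
  show "cf (q_of k l \<theta>) (Suc i) (Suc j) = 0" if "l * n \<le> i \<or> k * n \<le> j"
    using assms[of "k * Suc i + l * Suc j"] that unfolding nf_def cf_form_part_parts by metis
  show "cf (curl \<theta>) i j = 0" if "k * n \<le> j"
    using assms[of "k * Suc i + l * Suc j"] that unfolding nf_def cf_form_part_parts by metis
qed

lemma wgef_parts_eq:
  assumes "\<And>m::nat. wgef k l (int m) (\<theta> - \<eta>)"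
  shows "\<theta> = \<eta>"
proof -
  have w: "wge k l (int (Suc (k * i + l * j))) (fst \<theta> - fst \<eta>)" "wge k l (int (Suc (k * i + l * j))) (snd \<theta> - snd \<eta>)" for i j
    using assms[of "Suc (k * i + l * j) + k"] assms[of "Suc (k * i + l * j) + l"] unfolding wgef_def by auto
  have "cf (fst \<theta> - fst \<eta>) i j = 0" "cf (snd \<theta> - snd \<eta>) i j = 0" for i j
    using wgeD[OF w(1)[of i j], of i j] wgeD[OF w(2)[of i j], of i j] by simp_all
  thus ?thesis by (intro form2_eqI) simp_all
qed

lemma wgef_lie:
  assumes "wgef k l D \<omega>" "close k l m p q w"
  shows "wgef k l (D + m) (lie \<omega> p q w)"
proof -
  have f: "wge k l (D - int k) (fst \<omega>)" "wge k l (D - int l) (snd \<omega>)"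
    and N: "wge k l (int k + m) p" "wge k l (int l + m) q" "wge k l m w"
    using assms by (auto simp: wgef_def close_def)
  show ?thesis unfolding wgef_def lie_simps
    by (intro conjI wge_add wge_multI[OF wge_dx2[OF f(1)] N(1)] wge_multI[OF wge_dy2[OF f(1)] N(2)]
       wge_multI[OF wge_dx2[OF f(2)] N(1)] wge_multI[OF wge_dy2[OF f(2)] N(2)]
       wge_multI[OF f(1) wge_dx2[OF N(1)]] wge_multI[OF f(2) wge_dx2[OF N(2)]]
       wge_multI[OF f(1) wge_dy2[OF N(1)]] wge_multI[OF f(2) wge_dy2[OF N(2)]]
       wge_multI[OF N(3) f(1)] wge_multI[OF N(3) f(2)]) simp_all
qed

lemma pullback_close:
  assumes k: "k \<ge> 1" and l: "l \<ge> 1" and m: "m \<ge> 1"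
    and near: "near_id k l P Q w" and cl: "close k l m (P' - P) (Q' - Q) (w' - w)"
    and \<omega>: "wgef k l D \<omega>"
  shows "wgef k l (D + m) (smul w' (pullback (P', Q') \<omega>) - smul w (pullback (P, Q) \<omega>))"
proof -
  have "wgef k l (D + m + 1) (smul w' (pullback (P', Q') \<omega>) - smul w (pullback (P, Q) \<omega>) -
           lie \<omega> (P' - P) (Q' - Q) (w' - w))"
    by (rule pullback_pert[OF k l m near cl \<omega>]) (simp add: wgef_def)
  from wgef_add[OF wgef_mono[OF this, of "D + m"] wgef_lie[OF \<omega> cl]] show ?thesis by simp
qed

lemma homog_varx: "homog k l k varx" and homog_vary: "homog k l l vary"
  by (auto simp: homog_def cf_varx cf_vary split: if_splits)

lemma homog_of_nat_mult: "homog k l m F \<Longrightarrow> homog k l m (of_nat c * F)"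
  by (auto simp: homog_def)

lemma homog_dx2: "homog k l (m + k) F \<Longrightarrow> homog k l m (dx2 F)"
  unfolding homog_def
proof (intro allI impI)
  fix i j assume "\<forall>i j. cf F i j \<noteq> 0 \<longrightarrow> k * i + l * j = m + k" "cf (dx2 F) i j \<noteq> 0"
  hence "k * Suc i + l * j = m + k" by (metis cf_dx2 mult_zero_right)
  thus "k * i + l * j = m" by simp
qed

lemma homog_dy2: "homog k l (m + l) F \<Longrightarrow> homog k l m (dy2 F)"
  unfolding homog_def
proof (intro allI impI)
  fix i j assume "\<forall>i j. cf F i j \<noteq> 0 \<longrightarrow> k * i + l * j = m + l" "cf (dy2 F) i j \<noteq> 0"
  hence "k * i + l * Suc j = m + l" by (metis cf_dy2 mult_zero_right)
  thus "k * i + l * j = m" by simp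
qed

text \<open>The curl of this form is minus the divergence of s R, which Euler's identity
  evaluates.\<close>

lemma curl_radial:
  assumes "homog k l m s"
  shows "curl (smul s (of_nat l * vary, - (of_nat k * varx))) = - (of_nat (m + k + l) * s)"
proof -
  have "curl (smul s (of_nat l * vary, - (of_nat k * varx))) =
    - (of_nat k * (varx * dx2 s) + of_nat l * (vary * dy2 s)) - of_nat k * s - of_nat l * s"
    by (simp add: curl_def dx2_mult dy2_mult algebra_simps)
  also have "\<dots> = - (of_nat (m + k + l) * s)"
    unfolding homog_euler[OF assms] by (simp add: algebra_simps)
  finally show ?thesis .
qed

section \<open>The homological operator: contraction, curl, solution and kernel\<close>

context homological
begin

lemma homog_wd: "homog k l (N + l) (fst wd)" "homog k l (N + k) (snd wd)"
  using homog_mult[OF homog_vary[of k l] homog_hs[of k l n al]] homog_mult[OF homog_varx[of k l] homog_hs[of k l n be]]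
  by (simp_all add: wd_def N_def add.commute)

lemma wgef_wd: "wgef k l (int d) wd"
  using homog_wd[THEN homog_wge] by (simp add: wgef_def d_def)

lemma axes_invariant_wd: "axes_invariant wd"
  using axes_invariant_iff wd_def by blast

lemma homogf_lie:
  assumes "homog k l (m + k) p" "homog k l (m + l) q" "homog k l m w"
  shows "homogf k l (m + d) (lie wd p q w)"
proof -
  have "homog k l (m + d - k) (fst (lie wd p q w))"
  proof -
    have x: "homog k l (N + l - k) (dx2 (fst wd))" if "k \<le> N + l"
      using homog_wd(1) that by (intro homog_dx2) simp
    have kN: "k \<le> N" using l n by (simp add: N_def)
    have "homog k l (N + l - k + (m + k)) (dx2 (fst wd) * p)"
      "homog k l (N + (m + l)) (dy2 (fst wd) * q)"
      "homog k l (N + l + m) (fst wd * dx2 p)"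
      "homog k l (m + (N + l)) (w * fst wd)"
      by (rule homog_mult[OF x assms(1)] homog_mult[OF homog_dy2[OF homog_wd(1)] assms(2)]
        homog_mult[OF homog_wd(1) homog_dx2[OF assms(1)]] homog_mult[OF assms(3) homog_wd(1)] | use kN in simp)+
    \<comment> \<open>The weight m + l - k of \<open>dx2 q\<close> may be negative. Therefore x
      times the product is examined, where all weights are natural numbers.\<close>
    moreover have "homog k l (N + l + m) (snd wd * dx2 q)"
      unfolding homog_def
    proof (intro allI impI)
      fix i j assume "cf (snd wd * dx2 q) i j \<noteq> 0"
      hence "cf (varx * (snd wd * dx2 q)) (Suc i) j \<noteq> 0" by (simp add: cf_varx_mult)
      moreover have "homog k l (m + l) (varx * dx2 q)"
        using assms(2) unfolding homog_def by (auto simp: cf_varx_mult split: if_splits)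
      hence "homog k l ((N + k) + (m + l)) (varx * (snd wd * dx2 q))"
        unfolding mult.left_commute[of "varx" "snd wd"] by (rule homog_mult[OF homog_wd(2)])
      ultimately have "k * Suc i + l * j = (N + k) + (m + l)" unfolding homog_def by blast
      thus "k * i + l * j = N + l + m" by simp
    qed
    ultimately show ?thesis unfolding lie_simps using kN by (intro homog_add) (simp_all add: d_def add_ac)
  qed
  moreover have "homog k l (m + d - l) (snd (lie wd p q w))"
  proof -
    have lN: "l \<le> N" using k n by (simp add: N_def)
    have y: "homog k l (N + k - l) (dy2 (snd wd))"
      using homog_wd(2) lN by (intro homog_dy2) simp
    have "homog k l (N + k - l + (m + l)) (dy2 (snd wd) * q)"
      "homog k l (N + (m + k)) (dx2 (snd wd) * p)"
      "homog k l (N + k + m) (snd wd * dy2 q)"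
      "homog k l (m + (N + k)) (w * snd wd)"
      by (rule homog_mult[OF y assms(2)] homog_mult[OF homog_dx2[OF homog_wd(2)] assms(1)]
        homog_mult[OF homog_wd(2) homog_dy2[OF assms(2)]] homog_mult[OF assms(3) homog_wd(2)])+
    moreover have "homog k l (N + k + m) (fst wd * dy2 p)"
      unfolding homog_def
    proof (intro allI impI)
      fix i j assume "cf (fst wd * dy2 p) i j \<noteq> 0"
      hence "cf (vary * (fst wd * dy2 p)) i (Suc j) \<noteq> 0" by (simp add: cf_vary_mult)
      moreover have "homog k l (m + k) (vary * dy2 p)"
        using assms(1) unfolding homog_def by (auto simp: cf_vary_mult split: if_splits)
      hence "homog k l ((N + l) + (m + k)) (vary * (fst wd * dy2 p))"
        unfolding mult.left_commute[of "vary" "fst wd"] by (rule homog_mult[OF homog_wd(1)])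
      ultimately have "k * i + l * Suc j = (N + l) + (m + k)" unfolding homog_def by blast
      thus "k * i + l * j = N + k + m" by simp
    qed
    ultimately show ?thesis unfolding lie_simps using lN by (intro homog_add) (simp_all add: d_def add_ac)
  qed
  ultimately show ?thesis unfolding homogf_def homog_def by (force simp: d_def)
qed

text \<open>For a field X of relative weight m one has [R, X] = m X, hence i_R(L_X omega + w omega)
  = X(q) + m omega(X) + w q. This is the origin of A = m a + dq/dx and B = m b + dq/dy in the
  generic condition.\<close>

lemma q_of_lie:
  assumes p: "homog k l m p" and q: "homog k l m q"
  shows "q_of k l (lie wd (varx * p) (vary * q) w) = varx * (vary * (H (ah m) * p + H (bh m) * q + H Pc * w))"
proof -
  define a where "a = fst wd"
  define b where "b = snd wd"
  define P where "P = varx * p"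
  define Q where "Q = vary * q"
  have EP: "of_nat k * (varx * dx2 P) + of_nat l * (vary * dy2 P) = of_nat (k + m) * P"
    unfolding P_def by (intro homog_euler homog_mult homog_varx p)
  have EQ: "of_nat k * (varx * dx2 Q) + of_nat l * (vary * dy2 Q) = of_nat (l + m) * Q"
    unfolding Q_def by (intro homog_euler homog_mult homog_vary q)
  have Dx: "dx2 (q_of k l wd) = of_nat k * a + of_nat k * varx * dx2 a + of_nat l * vary * dx2 b"
    and Dy: "dy2 (q_of k l wd) = of_nat l * b + of_nat k * varx * dy2 a + of_nat l * vary * dy2 b"
    by (simp_all add: q_of_def a_def b_def dx2_mult dy2_mult algebra_simps)
  have "q_of k l (lie wd P Q w) = P * (dx2 (q_of k l wd) - of_nat k * a) + Q * (dy2 (q_of k l wd) - of_nat l * b)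
     + a * (of_nat k * (varx * dx2 P) + of_nat l * (vary * dy2 P)) 
     + b * (of_nat k * (varx * dx2 Q) + of_nat l * (vary * dy2 Q)) + w * q_of k l wd"
    unfolding Dx Dy by (simp add: q_of_def lie_simps a_def[symmetric] b_def[symmetric] algebra_simps)
  also have "\<dots> = P * (of_nat m * fst wd + dx2 (q_of k l wd)) + Q * (of_nat m * snd wd + dy2 (q_of k l wd)) + w * q_of k l wd"
    unfolding EP EQ by (simp add: a_def b_def algebra_simps)
  also have "\<dots> = varx * (vary * (H (ah m) * p + H (bh m) * q + H Pc * w))"
    unfolding ah_series bh_series unfolding q_of_wd P_def Q_def by (simp add: algebra_simps)
  finally show ?thesis by (simp add: P_def Q_def)
qed

text \<open>The coefficient of dg wedge \<open>wd\<close>. It is \<open>rad\<close>, freed from the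
  parameters of the context in which that was studied.\<close>

definition "area g = H be * (varx * dx2 g) - H al * (vary * dy2 g)"

lemma homog_area: "homog k l m g \<Longrightarrow> homog k l (N + m) (area g)"
proof -
  assume g: "homog k l m g"
  have "homog k l m (varx * dx2 g)" "homog k l m (vary * dy2 g)"
    using g unfolding homog_def by (auto simp: cf_varx_mult cf_vary_mult split: if_splits)
  thus ?thesis unfolding area_def N_def by (intro homog_diff homog_mult homog_hs)
qed

text \<open>For X = g R the Lie derivative of \<open>wd\<close> is d g \<open>wd\<close> + q dg,
  where d is the weight of \<open>wd\<close>. Subtracting (m + d) g \<open>wd\<close> leaves q dg -
  m g \<open>wd\<close>, which R annihilates by Euler's identity; such a form is a multiple of l y
  dx - k x dy.\<close>

lemma lie_radial:
  assumes g: "homog k l m g"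
  shows "lie wd (varx * (of_nat k * g)) (vary * (of_nat l * g)) (- (of_nat (m + d) * g)) =
    smul (area g) (of_nat l * vary, - (of_nat k * varx))"
proof -
  define a where "a = fst wd"
  define b where "b = snd wd"
  have Ea: "of_nat k * (varx * dx2 a) + of_nat l * (vary * dy2 a) = of_nat (N + l) * a"
    and Eb: "of_nat k * (varx * dx2 b) + of_nat l * (vary * dy2 b) = of_nat (N + k) * b"
    unfolding a_def b_def by (rule homog_euler[OF homog_wd(1)] homog_euler[OF homog_wd(2)])+
  have Eg: "of_nat k * (varx * dx2 g) + of_nat l * (vary * dy2 g) = of_nat m * g"
    by (rule homog_euler[OF g])
  have ab: "area g = b * dx2 g - a * dy2 g" by (simp add: area_def a_def b_def wd_def algebra_simps)
  have "fst (lie wd (varx * (of_nat k * g)) (vary * (of_nat l * g)) (- (of_nat (m + d) * g))) =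
    g * (of_nat k * (varx * dx2 a) + of_nat l * (vary * dy2 a)) + of_nat k * a * g
    + a * (of_nat k * (varx * dx2 g) + of_nat l * (vary * dy2 g)) + of_nat l * vary * (b * dx2 g - a * dy2 g) - of_nat (m + d) * g * a"
    by (simp add: lie_simps a_def[symmetric] b_def[symmetric] dx2_mult dy2_mult algebra_simps)
  also have "\<dots> = area g * (of_nat l * vary)"
    unfolding Ea Eg ab by (simp add: d_def algebra_simps)
  finally have 1: "fst (lie wd (varx * (of_nat k * g)) (vary * (of_nat l * g)) (- (of_nat (m + d) * g))) = area g * (of_nat l * vary)" .
  have "snd (lie wd (varx * (of_nat k * g)) (vary * (of_nat l * g)) (- (of_nat (m + d) * g))) =
    g * (of_nat k * (varx * dx2 b) + of_nat l * (vary * dy2 b)) + of_nat l * b * g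
    + b * (of_nat k * (varx * dx2 g) + of_nat l * (vary * dy2 g)) - of_nat k * varx * (b * dx2 g - a * dy2 g) - of_nat (m + d) * g * b"
    by (simp add: lie_simps a_def[symmetric] b_def[symmetric] dx2_mult dy2_mult algebra_simps)
  also have "\<dots> = area g * (- (of_nat k * varx))"
    unfolding Eb Eg ab by (simp add: d_def algebra_simps)
  finally show ?thesis using 1 by (intro prod_eqI) simp_all
qed

lemma homog_part:
  assumes "homogf k l (m + d) \<theta>" "axes_invariant \<theta>"
  shows "\<exists>G. homog k l (N + m) G \<and> q_of k l \<theta> = varx * (vary * G)"
proof -
  obtain A B where \<theta>: "\<theta> = (vary * A, varx * B)" using assms axes_invariant_iff by auto
  have "homog k l (N + m) A"
    unfolding homog_def
  proof (intro allI impI)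
    fix i j assume "cf A i j \<noteq> 0"
    hence "cf (fst \<theta>) i (Suc j) \<noteq> 0" by (simp add: \<theta> cf_vary_mult)
    hence "k * i + l * Suc j + k = m + d" using assms(1) unfolding homogf_def by blast
    thus "k * i + l * j = N + m" by (simp add: d_def)
  qed
  moreover have "homog k l (N + m) B"
    unfolding homog_def
  proof (intro allI impI)
    fix i j assume "cf B i j \<noteq> 0"
    hence "cf (snd \<theta>) (Suc i) j \<noteq> 0" by (simp add: \<theta> cf_varx_mult)
    hence "k * Suc i + l * j + l = m + d" using assms(1) unfolding homogf_def by blast
    thus "k * i + l * j = N + m" by (simp add: d_def)
  qed
  ultimately have "homog k l (N + m) (of_nat k * A + of_nat l * B)"
    by (intro homog_add homog_of_nat_mult)
  moreover have "q_of k l \<theta> = varx * (vary * (of_nat k * A + of_nat l * B))"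
    by (simp add: q_of_def \<theta> algebra_simps)
  ultimately show ?thesis by blast
qed

lemma homog_curl:
  assumes "homogf k l (m + d) \<theta>"
  shows "homog k l (N + m) (curl \<theta>)"
  unfolding homog_def
proof (intro allI impI)
  fix i j assume "cf (curl \<theta>) i j \<noteq> 0"
  hence "cf (snd \<theta>) (Suc i) j \<noteq> 0 \<or> cf (fst \<theta>) i (Suc j) \<noteq> 0" by (auto simp: cf_curl)
  hence "k * Suc i + l * j + l = m + d \<or> k * i + l * Suc j + k = m + d"
    using assms unfolding homogf_def by blast
  thus "k * i + l * j = N + m" by (auto simp: d_def)
qed

lemma cf_xy_mult: "cf (varx * (vary * G)) (Suc i) (Suc j) = cf G i j"
  by (simp add: cf_varx_mult cf_vary_mult)

lemma axes_invariant_lie: "axes_invariant (lie wd (varx * p) (vary * q) w)"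
proof -
  have "lie wd (varx * p) (vary * q) w =
    (vary * (dx2 (H al) * (varx * p) + dy2 (vary * H al) * q + H al * dx2 (varx * p) + varx * H be * dx2 q + w * H al),
     varx * (dx2 (varx * H be) * p + dy2 (H be) * (vary * q) + vary * H al * dy2 p + H be * dy2 (vary * q) + w * H be))"
    by (rule prod_eqI) (simp_all add: lie_simps wd_def dx2_vary_mult dy2_varx_mult algebra_simps)
  thus ?thesis using axes_invariant_iff by blast
qed

lemma axes_invariant_add: "axes_invariant \<theta> \<Longrightarrow> axes_invariant \<eta> \<Longrightarrow> axes_invariant (\<theta> + \<eta>)"
  by (simp add: axes_invariant_def)

text \<open>A pair (p, q) without unit normalizes the contraction. A radial field then normalizes
  the curl and cannot disturb the contraction, because its effect is annihilated by R.\<close>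

theorem homological_solve:
  assumes m: "m \<ge> 1" and \<theta>: "homogf k l (m + d) \<theta>" "axes_invariant \<theta>"
  shows "\<exists>p q w. homog k l m p \<and> homog k l m q \<and> homog k l m w \<and> 
    nf k l n (\<theta> + lie wd (varx * p) (vary * q) w)"
proof -
  obtain I J where bs: "base m I J" using base_exists by blast
  obtain G where G: "homog k l (N + m) G" "q_of k l \<theta> = varx * (vary * G)" using homog_part[OF \<theta>] by blast
  obtain p q where pq: "homog k l m p" "homog k l m q"
    "\<And>i j. l * n \<le> i \<or> k * n \<le> j \<Longrightarrow> cf (G + H (ah m) * p + H (bh m) * q) i j = 0"
    using solve_function_part[OF bs m G(1)] by blast
  define L where "L = lie wd (varx * p) (vary * q) 0"
  have "homogf k l (m + d) L" unfolding L_def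
    using homog_mult[OF homog_varx[of k l] pq(1)] homog_mult[OF homog_vary[of k l] pq(2)]
    by (intro homogf_lie) (simp_all add: add.commute)
  hence C: "homog k l (N + m) (curl (\<theta> + L))"
    unfolding curl_add by (intro homog_add homog_curl \<theta>)
  \<comment> \<open>By \<open>curl_radial\<close> the radial correction contributes -(m + d)
    \<open>area g\<close> to the curl, whence this right-hand side.\<close>
  define C' where "C' = cst (1 / of_nat (m + d)) * curl (\<theta> + L)"
  have nz: "(of_nat (m + d) :: complex) \<noteq> 0" using m unfolding of_nat_eq_0_iff by simp
  obtain g where g: "homog k l m g" "\<And>i j. k * n \<le> j \<Longrightarrow> cf (C' - rad g) i j = 0"
    using solve_area_part[OF bs m homog_cst_mult[OF C]] unfolding C'_def by blast
  have rad: "rad g = area g" by (simp add: rad_def[OF bs m] area_def)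
  define R where "R = lie wd (varx * (of_nat k * g)) (vary * (of_nat l * g)) (- (of_nat (m + d) * g))"
  have R: "R = smul (area g) (of_nat l * vary, - (of_nat k * varx))" unfolding R_def by (rule lie_radial[OF g(1)])
  have "curl R = - (of_nat (m + d) * area g)"
    unfolding R using curl_radial[OF homog_area[OF g(1)]] by (simp add: d_def add_ac)
  hence cR: "cf (curl (\<theta> + L + R)) i j = 0" if "k * n \<le> j" for i j
    using g(2)[OF that, of i] nz unfolding rad C'_def curl_add[of "\<theta> + L"]
    by (simp add: field_simps del: of_nat_add)
  have "q_of k l R = 0" unfolding R by (simp add: q_of_def algebra_simps)
  moreover have "q_of k l L = varx * (vary * (H (ah m) * p + H (bh m) * q))"
    unfolding L_def using q_of_lie[OF pq(1,2), of 0] by simp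
  ultimately have "q_of k l (\<theta> + L + R) = varx * (vary * (G + H (ah m) * p + H (bh m) * q))"
    by (simp add: q_of_add G(2) algebra_simps)
  hence qR: "cf (q_of k l (\<theta> + L + R)) (Suc i) (Suc j) = 0" if "l * n \<le> i \<or> k * n \<le> j" for i j
    using pq(3)[OF that] by (simp only: cf_xy_mult)
  have "axes_invariant (\<theta> + L + R)" unfolding L_def R_def
    by (intro axes_invariant_add axes_invariant_lie \<theta>)
  hence "nf k l n (\<theta> + L + R)" using cR qR by (auto simp: nf_def)
  moreover have "L + R = lie wd (varx * (p + of_nat k * g)) (vary * (q + of_nat l * g)) (0 + - (of_nat (m + d) * g))"
    unfolding L_def R_def lie_add[symmetric] by (simp add: algebra_simps)
  moreover have "homog k l m (p + of_nat k * g)" "homog k l m (q + of_nat l * g)" "homog k l m (0 + - (of_nat (m + d) * g))"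
    using pq(1,2) g(1) by (auto intro!: homog_add homog_of_nat_mult homog_uminus simp del: of_nat_add)
  ultimately show ?thesis by (metis add.assoc)
qed

text \<open>Once the unit is absorbed into (p, q), the contraction part forces a multiple of (B / x,
  -A / y). Up to a field tangent to the foliation this is a radial field, and a radial field with
  normal curl vanishes by \<open>unique_area_part\<close>.\<close>

theorem homological_unique:
  assumes m: "m \<ge> 1" and p: "homog k l m p" and q: "homog k l m q" and w: "homog k l m w"
    and nf: "nf k l n (lie wd (varx * p) (vary * q) w)"
  shows "lie wd (varx * p) (vary * q) w = 0 \<and> (\<exists>g. (\<forall>i j. cf g i j \<noteq> 0 \<longrightarrow> k * i + l * j + N = m) \<and>
     varx * p = - (g * snd wd) \<and> vary * q = g * fst wd \<and> w = g * curl wd)"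
proof -
  obtain I J where bs: "base m I J" using base_exists by blast
  define c :: complex where "c = of_nat (m + d)"
  have c: "c \<noteq> 0" using m unfolding c_def of_nat_eq_0_iff by simp
  \<comment> \<open>Absorbs the unit into the field, as \<open>hat_relation\<close> permits.\<close>
  define p' where "p' = p + cst (of_nat k / c) * w"
  define q' where "q' = q + cst (of_nat l / c) * w"
  have hp: "homog k l m p'" "homog k l m q'"
    unfolding p'_def q'_def by (intro homog_add homog_cst_mult p q w)+
  have hat: "H (ah m) * cst (of_nat k / c) + H (bh m) * cst (of_nat l / c) = H Pc"
  proof -
    have "H (ah m) * cst (of_nat k / c) + H (bh m) * cst (of_nat l / c) =
       H (\<lambda>i. of_nat k / c * ah m i + of_nat l / c * bh m i)"
      by (simp only: mult.commute[of _ "cst _"] hs_cst hs_add)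
    also have "\<dots> = H Pc"
    proof (rule hs_cong)
      fix i assume "i \<le> n"
      show "of_nat k / c * ah m i + of_nat l / c * bh m i = Pc i"
        using hat_relation[OF \<open>i \<le> n\<close>, of m] c unfolding c_def[symmetric] by (simp add: field_simps)
    qed
    finally show ?thesis .
  qed
  have "H (ah m) * p' + H (bh m) * q' = H (ah m) * p + H (bh m) * q + (H (ah m) * cst (of_nat k / c) + H (bh m) * cst (of_nat l / c)) * w"
    by (simp add: p'_def q'_def algebra_simps)
  hence "q_of k l (lie wd (varx * p) (vary * q) w) = varx * (vary * (H (ah m) * p' + H (bh m) * q'))"
    unfolding hat q_of_lie[OF p q] by simp
  hence "cf (H (ah m) * p' + H (bh m) * q') i j = 0" if "l * n \<le> i \<or> k * n \<le> j" for i j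
    using nf that unfolding nf_def by (metis cf_xy_mult)
  then obtain g where g: "\<And>i j. cf g i j \<noteq> 0 \<Longrightarrow> k * i + l * j + N = m" "p' = H (bh m) * g" "q' = - (H (ah m) * g)"
    using unique_function_part[OF bs m hp] by meson
  \<comment> \<open>The factor comes from B / x = c \<open>H be\<close> - k \<open>curl wd\<close>
    and A / y = c \<open>H al\<close> + l \<open>curl wd\<close>: with it, what is left after
    subtracting the tangent field is proportional to (k, l).\<close>
  define \<gamma> where "\<gamma> = cst (- c) * g"
  have \<gamma>: "cf \<gamma> i j \<noteq> 0 \<Longrightarrow> k * i + l * j + N = m" for i j using g(1) c by (auto simp: \<gamma>_def)
  define p1 where "p1 = p + \<gamma> * H be"
  define q1 where "q1 = q - \<gamma> * H al"
  define w1 where "w1 = w - \<gamma> * curl wd"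
  have curl: "curl wd = H (\<lambda>i. (1 + of_nat (l * (n - i))) * be i - (1 + of_nat (k * i)) * al i)"
    by (simp add: curl_def wd_def dx2_varx_hs dy2_vary_hs hs_diff del: of_nat_mult)
  have scale: "p = cst (- a / c) * w" if "cst (1 / c) * (cst c * p) = cst (1 / c) * (- (cst a * w))" for p w a
  proof -
    have "cst (1 / c) * (cst c * p) = p" using c by (simp add: mult.assoc[symmetric] flip: cst_simps(4))
    moreover have "cst (- a / c) = - (cst (1 / c) * cst a)" by (simp flip: cst_simps(4,5))
    ultimately show ?thesis using that by (simp add: mult.assoc)
  qed
  have p1': "p1 = cst (- of_nat k / c) * w1"
  proof -
    have "H (bh m) = cst c * H be - cst (of_nat k) * curl wd"
      unfolding curl hs_cst hs_diff
      by (rule hs_cong) (simp add: c_def bh_def d_def N_def Pc_def of_nat_diff algebra_simps)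
    hence "cst c * p' = cst c * (cst c * H be - cst (of_nat k) * curl wd) * g" by (simp add: g(2) mult.assoc)
    moreover have "cst c * p' = cst c * p + cst (of_nat k) * w"
      using c by (simp add: p'_def distrib_left flip: mult.assoc cst_simps)
    ultimately have "cst c * p1 = - (cst (of_nat k) * w1)"
      by (simp add: p1_def w1_def \<gamma>_def algebra_simps)
    hence "cst (1 / c) * (cst c * p1) = cst (1 / c) * (- (cst (of_nat k) * w1))" by simp
    thus ?thesis by (rule scale)
  qed
  have q1': "q1 = cst (- of_nat l / c) * w1"
  proof -
    have "H (ah m) = cst c * H al + cst (of_nat l) * curl wd"
      unfolding curl hs_cst hs_add
      by (rule hs_cong) (simp add: c_def ah_def d_def N_def Pc_def of_nat_diff algebra_simps)
    hence "cst c * q' = - (cst c * (cst c * H al + cst (of_nat l) * curl wd) * g)" by (simp add: g(3) mult.assoc)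
    moreover have "cst c * q' = cst c * q + cst (of_nat l) * w"
      using c by (simp add: q'_def distrib_left flip: mult.assoc cst_simps)
    ultimately have "cst c * q1 = - (cst (of_nat l) * w1)"
      by (simp add: q1_def w1_def \<gamma>_def algebra_simps eq_neg_iff_add_eq_0)
    hence "cst (1 / c) * (cst c * q1) = cst (1 / c) * (- (cst (of_nat l) * w1))" by simp
    thus ?thesis by (rule scale)
  qed
  \<comment> \<open>The remainder (p1, q1, w1) is (k, l, -(m + d)) times this function, the triple
    of \<open>lie_radial\<close>.\<close>
  define g1 where "g1 = cst (- 1 / c) * w1"
  have "homog k l N (curl wd)" unfolding curl N_def by (rule homog_hs)
  have h\<gamma>: "homog k l m (\<gamma> * curl wd)"
  proof (cases "N \<le> m")
    case True
    hence "homog k l (m - N) \<gamma>" using \<gamma> unfolding homog_def by fastforce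
    from homog_mult[OF this \<open>homog k l N (curl wd)\<close>] show ?thesis using True by simp
  next
    case False
    hence "\<gamma> = 0" using \<gamma> by (intro series2_eqI) fastforce
    thus ?thesis by simp
  qed
  have hg1: "homog k l m g1" unfolding g1_def w1_def by (intro homog_cst_mult homog_diff w h\<gamma>)
  have "lie wd (varx * p) (vary * q) w - lie wd (- (\<gamma> * snd wd)) (\<gamma> * fst wd) (\<gamma> * curl wd) =
     lie wd (varx * p1) (vary * q1) w1"
    unfolding lie_diff[symmetric] by (simp add: p1_def q1_def w1_def wd_def algebra_simps)
  moreover have gk: "of_nat a * g1 = cst (- of_nat a / c) * w1" for a
    by (simp add: g1_def mult.assoc[symmetric] flip: cst_simps(4) cst_of_nat)
  have "p1 = of_nat k * g1" "q1 = of_nat l * g1" by (simp_all only: gk p1' q1')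
  moreover have "w1 = - (of_nat (m + d) * g1)"
    unfolding gk c_def[symmetric] using c by simp
  ultimately have L: "lie wd (varx * p) (vary * q) w = smul (area g1) (of_nat l * vary, - (of_nat k * varx))"
    using lie_radial[OF hg1] by (simp add: lie_tangent)
  have "cf (area g1) i j = 0" if "k * n \<le> j" for i j
  proof -
    have "cf (curl (smul (area g1) (of_nat l * vary, - (of_nat k * varx)))) i j = 0"
      using nf that unfolding L nf_def by blast
    thus ?thesis unfolding curl_radial[OF homog_area[OF hg1]] using k by (simp del: of_nat_add)
  qed
  hence "g1 = 0" using unique_area_part[OF bs m hg1] by (simp add: rad_def[OF bs m] area_def)
  hence "p1 = 0" "q1 = 0" "w1 = 0"
    using \<open>p1 = _ * g1\<close> \<open>q1 = _ * g1\<close> \<open>w1 = - _\<close> by simp_all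
  hence "varx * p = - (\<gamma> * snd wd)" "vary * q = \<gamma> * fst wd" "w = \<gamma> * curl wd"
    unfolding p1_def q1_def w1_def by (simp_all add: wd_def eq_neg_iff_add_eq_0 algebra_simps flip: distrib_left)
  thus ?thesis using \<gamma> lie_tangent[of wd \<gamma>] by metis
qed

end

section \<open>Existence of the normal form\<close>

text \<open>The strict integer part is a ceiling minus one, so \<open>s_exponent\<close> is the
  least i for which x^i y^j has weight at least k l n + 1. The exponents in s thus encode nothing
  but the bound on the weight.\<close>

lemma s_exponent_le:
  assumes "k \<ge> 1"
  shows "s_exponent k l n j \<le> int i \<longleftrightarrow> k * l * n + 1 \<le> k * i + l * j"
proof -
  have "s_exponent k l n j \<le> int i \<longleftrightarrow> \<lceil>(1 - real l * real j) / real k\<rceil> \<le> int i - int (l * n)"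
    by (auto simp: s_exponent_def strict_floor_def)
  also have "\<dots> \<longleftrightarrow> (1 - real l * real j) / real k \<le> real i - real (l * n)"
    by (simp add: ceiling_le_iff)
  also have "\<dots> \<longleftrightarrow> 1 - real l * real j \<le> real k * (real i - real (l * n))"
    using assms by (simp add: divide_le_eq mult.commute)
  also have "\<dots> \<longleftrightarrow> real (k * l * n + 1) \<le> real (k * i + l * j)"
    by (simp add: algebra_simps)
  finally show ?thesis by (simp only: of_nat_le_iff)
qed

lemma cf_s_series:
  assumes "k \<ge> 1"
  shows "cf (s_series k l n s) i j = (if j < k * n \<and> k * l * n + 1 \<le> k * i + l * j
     then fps_nth (s j) (i - nat (s_exponent k l n j)) else 0)"
proof -
  have 1: "cf (fps_const g) i j = (if j = 0 then fps_nth g i else 0)" for g i j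
    by (simp add: cf_def)
  have "cf (s_series k l n s) i j = (\<Sum>j'<k*n. if j' = j then
      (if nat (s_exponent k l n j) \<le> i then fps_nth (s j) (i - nat (s_exponent k l n j)) else 0) else 0)"
    unfolding s_series_def cf_sum
  proof (rule sum.cong)
    fix j'
    have e: "fps_const (s j') * varx ^ nat (s_exponent k l n j') * vary ^ j' =
        mon (nat (s_exponent k l n j')) j' * fps_const (s j')" by (simp add: mon_def)
    show "cf (fps_const (s j') * varx ^ nat (s_exponent k l n j') * vary ^ j') i j =
      (if j' = j then (if nat (s_exponent k l n j) \<le> i then fps_nth (s j) (i - nat (s_exponent k l n j)) else 0) else 0)"
      unfolding e by (auto simp: cf_mon_mult 1)
  qed simp
  also have "\<dots> = (if j < k * n \<and> nat (s_exponent k l n j) \<le> i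
     then fps_nth (s j) (i - nat (s_exponent k l n j)) else 0)" by simp
  finally show ?thesis using s_exponent_le[OF assms, of l n j i] by (simp add: nat_le_iff)
qed

context homological
begin

lemma normal_forms_imp:
  assumes "\<eta> \<in> normal_forms k l n wd"
  shows "wgef k l (int d + 1) (\<eta> - wd) \<and> nf k l n (\<eta> - wd)"
proof -
  obtain h s where h: "h \<in> h_set k l n" and \<eta>: "\<eta> = omega_hs k l wd h (s_series k l n s)"
    using assms by (auto simp: normal_forms_def)
  define S where "S = s_series k l n s"
  define G where "G = varx * (vary * h)"
  define \<theta> where "\<theta> = ext_d G + smul S (of_nat l * vary, - (of_nat k * varx))"
  have \<theta>: "\<eta> - wd = \<theta>" by (simp add: \<eta> omega_hs_def \<theta>_def S_def G_def mult.assoc)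
  have f: "fst \<theta> = dx2 G + of_nat l * (vary * S)" "snd \<theta> = dy2 G - of_nat k * (varx * S)"
    by (simp_all add: \<theta>_def ext_d_def algebra_simps)
  have S: "cf S i j \<noteq> 0 \<Longrightarrow> j < k * n \<and> N + 1 \<le> k * i + l * j" for i j
    using cf_s_series[OF k, of l n s i j] by (auto simp: S_def N_def split: if_splits)
  have h': "cf h i j \<noteq> 0 \<Longrightarrow> N + 1 \<le> k * i + l * j \<and> i < l * n \<and> j < k * n" for i j
    using h by (auto simp: h_set_def N_def)
  have wS: "wge k l (int N + 1) S" 
  proof (rule wgeI)
    fix i j assume "cf S i j \<noteq> 0"
    hence "N + 1 \<le> k * i + l * j" using S by blast
    thus "int N + 1 \<le> int (k * i + l * j)" by linarith
  qed
  have wh: "wge k l (int N + 1) h" 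
  proof (rule wgeI)
    fix i j assume "cf h i j \<noteq> 0"
    hence "N + 1 \<le> k * i + l * j" using h' by blast
    thus "int N + 1 \<le> int (k * i + l * j)" by linarith
  qed
  have vx: "wge k l (int k) varx" and vy: "wge k l (int l) vary"
    by (auto simp: varx_mon vary_mon intro: wge_mon)
  have wG: "wge k l (int k + (int l + (int N + 1))) G" unfolding G_def by (intro wge_mult vx vy wh)
  have "wgef k l (int d + 1) \<theta>"
    unfolding wgef_def f
    by (intro conjI wge_add wge_diff wge_of_nat_mult wge_mono[OF wge_dx2[OF wG]] wge_mono[OF wge_dy2[OF wG]]
        wge_multI[OF vx wS] wge_multI[OF vy wS]) (simp_all add: d_def)
  moreover have "nf k l n \<theta>"
    unfolding nf_def axes_invariant_def
  proof (intro conjI allI impI)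
    fix i j
    show "cf (fst \<theta>) i 0 = 0" by (simp add: f G_def cf_varx_mult cf_vary_mult)
    show "cf (snd \<theta>) 0 j = 0" by (simp add: f G_def cf_varx_mult cf_vary_mult)
    show "cf (q_of k l \<theta>) (Suc i) (Suc j) = 0" if "l * n \<le> i \<or> k * n \<le> j"
    proof -
      have "cf h i j = 0" using h'[of i j] that by force
      thus ?thesis unfolding cf_q_of f by (simp add: G_def cf_varx_mult cf_vary_mult mult.left_commute)
    qed
    show "cf (curl \<theta>) i j = 0" if "k * n \<le> j"
    proof -
      have "cf S i j = 0" using S[of i j] that by force
      moreover have "cf (curl \<theta>) i j = - (of_nat k * (of_nat (Suc i) * cf S i j)) - of_nat l * (of_nat (Suc j) * cf S i j)"
        unfolding cf_curl f by (simp add: cf_varx_mult cf_vary_mult) (simp add: algebra_simps)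
      ultimately show ?thesis by simp
    qed
  qed
  ultimately show ?thesis by (simp add: \<theta>)
qed

text \<open>Cartan's formula is inverted coefficientwise: h is the contraction divided by x y and by
  the weight, s is minus the curl divided by the weight. The weight attached to (i, j) is that of
  x^(i+1) y^(j+1).\<close>

lemma imp_normal_forms:
  assumes w: "wgef k l (int d + 1) (\<eta> - wd)" and nf: "nf k l n (\<eta> - wd)"
  shows "\<eta> \<in> normal_forms k l n wd"
proof -
  define \<theta> where "\<theta> = \<eta> - wd"
  define a where "a = cf (fst \<theta>)"
  define b where "b = cf (snd \<theta>)"
  define W :: "nat \<Rightarrow> nat \<Rightarrow> complex" where "W i j = of_nat (k * Suc i + l * Suc j)" for i j
  have W: "W i j \<noteq> 0" for i j unfolding W_def of_nat_eq_0_iff using k by simp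
  define h where "h = fps2 (\<lambda>i j. cf (q_of k l \<theta>) (Suc i) (Suc j) / W i j)"
  define S where "S = fps2 (\<lambda>i j. - cf (curl \<theta>) i j / W i j)"
  define s where "s j = Abs_fps (\<lambda>r. cf S (r + nat (s_exponent k l n j)) j)" for j
  have w': "wge k l (int d + 1 - int k) (fst \<theta>)" "wge k l (int d + 1 - int l) (snd \<theta>)"
    using w by (simp_all add: wgef_def \<theta>_def)
  have ab: "a i j = 0" if "k * i + l * j + k < d + 1" for i j
    unfolding a_def by (rule wgeD[OF w'(1)]) (use that in linarith)
  have bb: "b i j = 0" if "k * i + l * j + l < d + 1" for i j
    unfolding b_def by (rule wgeD[OF w'(2)]) (use that in linarith)
  have wt: "cf (q_of k l \<theta>) (Suc i) (Suc j) = 0" "cf (curl \<theta>) i j = 0" if "k * i + l * j < N + 1" for i j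
    using that ab[of i "Suc j"] bb[of "Suc i" j] by (simp_all add: cf_q_of cf_curl a_def b_def d_def)
  have nf': "l * n \<le> i \<or> k * n \<le> j \<Longrightarrow> cf (q_of k l \<theta>) (Suc i) (Suc j) = 0"
    "k * n \<le> j \<Longrightarrow> cf (curl \<theta>) i j = 0" for i j
    using nf unfolding nf_def \<theta>_def by blast+
  have "h \<in> h_set k l n"
    unfolding h_set_def
  proof (clarsimp simp: h_def)
    fix i j assume "cf (q_of k l \<theta>) (Suc i) (Suc j) \<noteq> 0" 
    thus "Suc (k * l * n) \<le> k * i + l * j \<and> i < l * n \<and> j < k * n"
      using nf'(1)[of i j] wt(1)[of i j] by (force simp: N_def not_less)
  qed
  moreover have "s_series k l n s = S"
  proof (rule series2_eqI)
    fix i j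
    show "cf (s_series k l n s) i j = cf S i j"
    proof (cases "j < k * n \<and> k * l * n + 1 \<le> k * i + l * j")
      case True
      hence "nat (s_exponent k l n j) \<le> i" using s_exponent_le[OF k, of l n j i] by (simp add: nat_le_iff)
      thus ?thesis unfolding cf_s_series[OF k] using True by (simp add: s_def)
    next
      case False
      hence "cf (curl \<theta>) i j = 0" using nf'(2)[of j i] wt(2)[of i j] by (auto simp: N_def)
      thus ?thesis unfolding cf_s_series[OF k] using False by (auto simp: S_def)
    qed
  qed
  moreover have "\<theta> = ext_d (varx * vary * h) + smul S (of_nat l * vary, - (of_nat k * varx))"
  proof (rule form2_eqI)
    fix i j
    have ax: "a i 0 = 0" "b 0 j = 0" for i j
      using nf by (auto simp: nf_def axes_invariant_def a_def b_def \<theta>_def)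
    show "cf (fst \<theta>) i j = cf (fst (ext_d (varx * vary * h) + smul S (of_nat l * vary, - (of_nat k * varx)))) i j"
    proof (cases j)
      case 0
      thus ?thesis using ax[of i] by (simp add: ext_d_def mult.assoc mult.left_commute[of S] cf_varx_mult cf_vary_mult a_def
           mult.commute[of S])
    next
      case (Suc j')
      have "cf (fst (ext_d (varx * vary * h) + smul S (of_nat l * vary, - (of_nat k * varx)))) i j =
        of_nat (Suc i) * cf h i j' + of_nat l * cf S i j'"
        by (simp add: ext_d_def mult.assoc mult.left_commute[of S] mult.commute[of S] cf_varx_mult cf_vary_mult Suc)
      also have "\<dots> = a i j"
        unfolding h_def S_def cf_fps2 cf_q_of cf_curl a_def[symmetric] b_def[symmetric] Suc
        using W[of i j'] by (simp add: field_simps) (simp add: W_def algebra_simps)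
      finally show ?thesis by (simp add: a_def)
    qed
    show "cf (snd \<theta>) i j = cf (snd (ext_d (varx * vary * h) + smul S (of_nat l * vary, - (of_nat k * varx)))) i j"
    proof (cases i)
      case 0
      thus ?thesis using ax(2)[of j] by (simp add: ext_d_def mult.assoc mult.left_commute[of S] cf_varx_mult cf_vary_mult b_def
           mult.commute[of S])
    next
      case (Suc i')
      have "cf (snd (ext_d (varx * vary * h) + smul S (of_nat l * vary, - (of_nat k * varx)))) i j =
        of_nat (Suc j) * cf h i' j - of_nat k * cf S i' j"
        by (simp add: ext_d_def mult.assoc mult.left_commute[of S] mult.commute[of S] cf_varx_mult cf_vary_mult Suc)
      also have "\<dots> = b i j"
        unfolding h_def S_def cf_fps2 cf_q_of cf_curl a_def[symmetric] b_def[symmetric] Suc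
        using W[of i' j] by (simp add: field_simps) (simp add: W_def algebra_simps)
      finally show ?thesis by (simp add: b_def)
    qed
  qed
  hence "\<eta> = omega_hs k l wd h S" unfolding omega_hs_def \<theta>_def by (simp add: algebra_simps)
  ultimately show ?thesis unfolding normal_forms_def by blast
qed

context
  fixes \<omega> :: form2
  assumes \<omega>: "wgef k l (int d + 1) (\<omega> - wd)" and ax: "axes_invariant \<omega>"
begin

lemma wgef_\<omega>: "wgef k l (int d) \<omega>"
  using wgef_add[OF wgef_mono[OF \<omega>, of "int d"] wgef_wd] by simp

text \<open>The approximate change of coordinates is \<open>(x P, y Q)\<close>, and \<open>w\<close> is the factor.\<close>

definition stage :: "nat \<Rightarrow> series2 \<times> series2 \<times> series2 \<Rightarrow> bool" where
  "stage m = (\<lambda>(P, Q, w). wge k l 1 (P - 1) \<and> wge k l 1 (Q - 1) \<and> wge k l 1 (w - 1) \<and>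
     (\<forall>D \<le> d + m. nf k l n (form_part k l D (smul w (pullback (varx * P, vary * Q) \<omega>) - wd))))"

definition stage_step :: "nat \<Rightarrow> series2 \<times> series2 \<times> series2 \<Rightarrow> series2 \<times> series2 \<times> series2 \<Rightarrow> bool" where
  "stage_step m = (\<lambda>(P, Q, w) (P', Q', w').
     wge k l (int (Suc m)) (P' - P) \<and> wge k l (int (Suc m)) (Q' - Q) \<and> wge k l (int (Suc m)) (w' - w))"

lemma wge_varx: "wge k l (int k) varx" and wge_vary: "wge k l (int l) vary"
  by (auto simp: varx_mon vary_mon intro: wge_mon)

lemma near_id_stage:
  "wge k l 1 (P - 1) \<Longrightarrow> wge k l 1 (Q - 1) \<Longrightarrow> wge k l 1 (w - 1) \<Longrightarrow> near_id k l (varx * P) (vary * Q) w"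
  using wge_mult[OF wge_varx, of 1 "P - 1"] wge_mult[OF wge_vary, of 1 "Q - 1"]
  by (simp add: near_id_def algebra_simps)

lemma close_stage:
  "wge k l m (P' - P) \<Longrightarrow> wge k l m (Q' - Q) \<Longrightarrow> wge k l m (w' - w) \<Longrightarrow>
    close k l m (varx * P' - varx * P) (vary * Q' - vary * Q) (w' - w)"
  using wge_mult[OF wge_varx, of m "P' - P"] wge_mult[OF wge_vary, of m "Q' - Q"]
  by (simp add: close_def algebra_simps)

lemma stage_0: "stage 0 (1, 1, 1)"
proof -
  have "smul 1 (pullback (varx, vary) \<omega>) = \<omega>"
    by (rule prod_eqI) (simp_all add: subst2_id)
  moreover have "form_part k l D (\<omega> - wd) = 0" if "D \<le> d" for D
    by (rule form_part_wgef[OF \<omega>]) (use that in simp)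
  ultimately show ?thesis by (simp add: stage_def nf_0)
qed

text \<open>A correction of relative weight m + 1 changes the form in weight d + m + 1 by
  \<open>lie\<close> alone and not at all below, so the parts already normalized survive.\<close>

lemma stage_Suc:
  assumes "stage m (P, Q, w)"
  shows "\<exists>P' Q' w'. stage (Suc m) (P', Q', w') \<and> stage_step m (P, Q, w) (P', Q', w')"
proof -
  have PQ: "wge k l 1 (P - 1)" "wge k l 1 (Q - 1)" "wge k l 1 (w - 1)"
    and nf: "\<And>D. D \<le> d + m \<Longrightarrow> nf k l n (form_part k l D (smul w (pullback (varx * P, vary * Q) \<omega>) - wd))"
    using assms by (auto simp: stage_def)
  define \<eta> where "\<eta> = smul w (pullback (varx * P, vary * Q) \<omega>)"
  define \<theta> where "\<theta> = form_part k l (Suc m + d) (\<eta> - wd)"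
  have "axes_invariant (\<eta> - wd)"
    using axes_invariant_pullback[OF ax] axes_invariant_wd by (simp add: axes_invariant_def \<eta>_def)
  hence "axes_invariant \<theta>" unfolding \<theta>_def by (rule axes_invariant_form_part)
  then obtain p q v where pqv: "homog k l (Suc m) p" "homog k l (Suc m) q" "homog k l (Suc m) v"
    and n': "nf k l n (\<theta> + lie wd (varx * p) (vary * q) v)"
    using homological_solve[of "Suc m" \<theta>] homogf_form_part unfolding \<theta>_def by auto
  define \<eta>' where "\<eta>' = smul (w + v) (pullback (varx * (P + p), vary * (Q + q)) \<omega>)"
  note W = pqv[THEN homog_wge]
  have "wgef k l (int d + int (Suc m) + 1) (\<eta>' - \<eta> - lie wd (varx * (P + p) - varx * P) (vary * (Q + q) - vary * Q) (w + v - w))"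
    unfolding \<eta>_def \<eta>'_def
    by (rule pullback_pert[OF k l _ near_id_stage[OF PQ] close_stage wgef_\<omega> \<omega>])
      (use W in simp_all)
  hence diff: "wgef k l (int d + int (Suc m) + 1) ((\<eta>' - wd) - ((\<eta> - wd) + lie wd (varx * p) (vary * q) v))"
    by (simp add: algebra_simps)
  have L: "homogf k l (Suc m + d) (lie wd (varx * p) (vary * q) v)"
    using homog_mult[OF homog_varx[of k l] pqv(1)] homog_mult[OF homog_vary[of k l] pqv(2)] pqv(3)
    by (intro homogf_lie) (simp_all add: add.commute)
  have "nf k l n (form_part k l D (\<eta>' - wd))" if D: "D \<le> d + Suc m" for D
  proof -
    have "form_part k l D (\<eta>' - wd) = form_part k l D ((\<eta> - wd) + lie wd (varx * p) (vary * q) v)"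
      by (rule form_part_eq[OF diff]) (use D in simp)
    also have "\<dots> = form_part k l D (\<eta> - wd) + form_part k l D (lie wd (varx * p) (vary * q) v)"
      by (rule form_part_add)
    also have "nf k l n \<dots>"
    proof (cases "D = Suc m + d")
      case True
      thus ?thesis using n' form_part_homogf[OF L] by (simp add: \<theta>_def)
    next
      case False
      hence "form_part k l D (lie wd (varx * p) (vary * q) v) = 0"
        using L by (intro form2_eqI) (auto simp: cf_form_part homogf_def)
      thus ?thesis using nf[of D] False D by (simp add: \<eta>_def)
    qed
    finally show ?thesis .
  qed
  moreover have "wge k l 1 (P + p - 1)" "wge k l 1 (Q + q - 1)" "wge k l 1 (w + v - 1)"
    using PQ(1) PQ(2) PQ(3) W[THEN wge_mono, of 1] wge_add[of k l 1]
    by (simp_all add: diff_add_eq[symmetric])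
  ultimately have "stage (Suc m) (P + p, Q + q, w + v)" by (simp add: stage_def \<eta>'_def)
  moreover have "stage_step m (P, Q, w) (P + p, Q + q, w + v)" using W by (simp add: stage_step_def)
  ultimately show ?thesis by blast
qed

text \<open>Step m alters only weights above m, so a coefficient is final once the step number
  reaches its weight. The limit reads each coefficient from that approximant.\<close>

lemma stage_limit:
  assumes "\<And>m. wge k l (int (Suc m)) (F (Suc m) - F m)"
  shows "wge k l (int (Suc m)) (fps2 (\<lambda>i j. cf (F (k * i + l * j)) i j) - F m)"
proof (rule wgeI, rule ccontr)
  fix i j assume nz: "cf (fps2 (\<lambda>i j. cf (F (k * i + l * j)) i j) - F m) i j \<noteq> 0"
    and "\<not> int (Suc m) \<le> int (k * i + l * j)"
  hence le: "k * i + l * j \<le> m" by linarith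
  have "cf (F m') i j = cf (F (k * i + l * j)) i j" if "k * i + l * j \<le> m'" for m'
    using that
  proof (induction m' rule: dec_induct)
    case (step m')
    have "cf (F (Suc m') - F m') i j = 0"
      by (rule wgeD[OF assms]) (use step in linarith)
    thus ?case using step by simp
  qed simp
  from this[OF le] show False using nz by simp
qed

theorem normal_form_exists:
  "\<exists>P Q w. wge k l 1 (P - 1) \<and> wge k l 1 (Q - 1) \<and> wge k l 1 (w - 1) \<and>
     smul w (pullback (varx * P, vary * Q) \<omega>) \<in> normal_forms k l n wd"
proof -
  obtain S where S: "\<And>m. stage m (S m)" "\<And>m. stage_step m (S m) (S (Suc m))"
    using dependent_nat_choice[of stage stage_step] stage_0 stage_Suc
    by (metis (no_types, lifting) prod_cases3)
  define F where "F m = fst (S m)" for m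
  define G where "G m = fst (snd (S m))" for m
  define V where "V m = snd (snd (S m))" for m
  have S': "S m = (F m, G m, V m)" for m by (simp add: F_def G_def V_def)
  have st: "wge k l (int (Suc m)) (F (Suc m) - F m)" "wge k l (int (Suc m)) (G (Suc m) - G m)"
    "wge k l (int (Suc m)) (V (Suc m) - V m)" for m
    using S(2)[of m] by (simp_all add: S' stage_step_def)
  define P where "P = fps2 (\<lambda>i j. cf (F (k * i + l * j)) i j)"
  define Q where "Q = fps2 (\<lambda>i j. cf (G (k * i + l * j)) i j)"
  define w where "w = fps2 (\<lambda>i j. cf (V (k * i + l * j)) i j)"
  have lim: "wge k l (int (Suc m)) (P - F m)" "wge k l (int (Suc m)) (Q - G m)"
    "wge k l (int (Suc m)) (w - V m)" for m
    unfolding P_def Q_def w_def by (rule stage_limit[OF st(1)] stage_limit[OF st(2)] stage_limit[OF st(3)])+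
  have F1: "wge k l 1 (F m - 1)" "wge k l 1 (G m - 1)" "wge k l 1 (V m - 1)"
    and nf: "\<And>D. D \<le> d + m \<Longrightarrow> nf k l n (form_part k l D (smul (V m) (pullback (varx * F m, vary * G m) \<omega>) - wd))" for m
    using S(1)[of m] by (simp_all add: S' stage_def)
  have P1: "wge k l 1 (P - 1)" "wge k l 1 (Q - 1)" "wge k l 1 (w - 1)"
    using wge_add[OF lim(1)[of 0, simplified] F1(1)[of 0]] wge_add[OF lim(2)[of 0, simplified] F1(2)[of 0]]
      wge_add[OF lim(3)[of 0, simplified] F1(3)[of 0]] by simp_all
  define \<eta> where "\<eta> = smul w (pullback (varx * P, vary * Q) \<omega>)"
  have "nf k l n (form_part k l D (\<eta> - wd))" for D
  proof -
    \<comment> \<open>The limit and approximant number D yield forms that differ only above weight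
      D, so the part of weight D is inherited.\<close>
    have "wgef k l (int d + int (Suc D)) (\<eta> - smul (V D) (pullback (varx * F D, vary * G D) \<omega>))"
      unfolding \<eta>_def by (rule pullback_close[OF k l _ near_id_stage[OF F1] close_stage[OF lim] wgef_\<omega>]) simp
    hence "wgef k l (int d + int (Suc D)) ((\<eta> - wd) - (smul (V D) (pullback (varx * F D, vary * G D) \<omega>) - wd))"
      by simp
    hence "form_part k l D (\<eta> - wd) = form_part k l D (smul (V D) (pullback (varx * F D, vary * G D) \<omega>) - wd)"
      by (rule form_part_eq) simp
    thus ?thesis using nf[of D D] by simp
  qed
  hence "nf k l n (\<eta> - wd)" by (rule nf_parts)
  moreover have "wgef k l (int d + 1) (\<eta> - wd)"
    using wgef_add[OF pullback_initial[OF k l near_id_stage[OF P1] wgef_\<omega>] \<omega>] by (simp add: \<eta>_def)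
  ultimately show ?thesis using P1 imp_normal_forms unfolding \<eta>_def by blast
qed

end

end

declare One_nat_def [simp del]

section \<open>Flows of vector fields\<close>

text \<open>Order two makes the derivation raise the ordinary order by at least one, so that its
  exponential converges formally. The weights (k, l) appear only in the final estimate.\<close>

locale flow =
  fixes X Y :: series2
  assumes X: "wge 1 1 2 X" and Y: "wge 1 1 2 Y"
begin

definition "D F = X * dx2 F + Y * dy2 F"

lemma D_lincont: "lincont D"
proof -
  have "lincont (\<lambda>F. X * dx2 F + Y * dy2 F)"
    by (rule lincont_plus lincont_comp[OF lincont_mult lincont_dx2] lincont_comp[OF lincont_mult lincont_dy2])+
  thus ?thesis by (simp add: D_def[abs_def])
qed

lemmas D_add = lincont_add[OF D_lincont] and D_cst = lincont_cst[OF D_lincont]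

lemma D_mult: "D (F * G) = D F * G + F * D G"
  by (simp add: D_def dx2_mult dy2_mult algebra_simps)

lemma D_wge1: "wge 1 1 m F \<Longrightarrow> wge 1 1 (m + 1) (D F)"
  unfolding D_def by (rule wge_add; rule wge_multI[OF X wge_dx2] wge_multI[OF Y wge_dy2], assumption, simp)

lemma Dn_add: "(D ^^ r) (F + G) = (D ^^ r) F + (D ^^ r) G"
  by (induction r) (simp_all add: D_add)

lemma Dn_wge1: "wge 1 1 m F \<Longrightarrow> wge 1 1 (m + int r) ((D ^^ r) F)"
proof (induction r)
  case (Suc r)
  show ?case using D_wge1[OF Suc.IH[OF Suc.prems]] by (simp add: algebra_simps)
qed simp

text \<open>The flow at time \<open>t\<close>, as a power series in \<open>t\<close>.\<close>

definition "ef F = Abs_fps (\<lambda>r. cst (1 / fact r) * (D ^^ r) F)"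

lemma inverse_fact: "of_nat (Suc r) * cst (1 / fact (Suc r)) = cst (1 / fact r)"
proof -
  have "of_nat (Suc r) * cst (1 / fact (Suc r)) = cst (of_nat (Suc r) * (1 / fact (Suc r)))"
    by (simp only: cst_of_nat[symmetric] cst_simps(4))
  also have "of_nat (Suc r) * (1 / fact (Suc r)) = (1 / fact r :: complex)"
    by (simp add: field_simps del: of_nat_Suc)
  finally show ?thesis .
qed

lemma cancel_Suc: "of_nat (Suc r) * a = of_nat (Suc r) * b \<Longrightarrow> a = (b :: series2)"
  by (metis mult_left_cancel of_nat_eq_0_iff nat.distinct(1))

lemma ef_deriv: "fps_deriv (ef F) = ef (D F)"
proof (rule fps_ext)
  fix r
  have "fps_nth (fps_deriv (ef F)) r = (of_nat (Suc r) * cst (1 / fact (Suc r))) * (D ^^ Suc r) F"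
    by (simp add: ef_def mult.assoc One_nat_def del: of_nat_Suc funpow.simps)
  thus "fps_nth (fps_deriv (ef F)) r = fps_nth (ef (D F)) r"
    unfolding inverse_fact by (simp add: ef_def funpow_swap1)
qed

lemma ef_add: "ef (F + G) = ef F + ef G"
  by (rule fps_ext) (simp add: ef_def Dn_add algebra_simps)

text \<open>Both sides agree at time 0, and by the Leibniz rule their derivatives in t reduce to the
  same claim one order lower.\<close>

lemma ef_mult: "ef (F * G) = ef F * ef G"
proof (rule fps_ext)
  fix r show "fps_nth (ef (F * G)) r = fps_nth (ef F * ef G) r"
  proof (induction r arbitrary: F G)
    case (Suc r)
    have "of_nat (Suc r) * fps_nth (ef (F * G)) (Suc r) = fps_nth (ef (D F * G)) r + fps_nth (ef (F * D G)) r"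
      using arg_cong[OF ef_deriv[of "F * G"], of "\<lambda>f. fps_nth f r"] by (simp add: D_mult ef_add One_nat_def)
    also have "\<dots> = fps_nth (fps_deriv (ef F * ef G)) r"
      by (simp add: Suc ef_deriv add.commute del: fps_deriv_nth)
    also have "\<dots> = of_nat (Suc r) * fps_nth (ef F * ef G) (Suc r)"
      by (simp only: fps_deriv_nth Suc_eq_plus1)
    finally show ?case by (rule cancel_Suc)
  qed (simp add: ef_def)
qed

subsection \<open>Evaluation at time one\<close>

definition slow :: "series2 fps \<Rightarrow> bool" where
  "slow A \<longleftrightarrow> (\<forall>r. wge 1 1 (int r) (fps_nth A r))"

text \<open>For a \<open>slow\<close> series the terms with r > i + j do not reach the coefficient
  of x^i y^j, so the finite sum is the full value at t = 1.\<close>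

definition ev :: "series2 fps \<Rightarrow> series2" where
  "ev A = fps2 (\<lambda>i j. \<Sum>r\<le>i+j. cf (fps_nth A r) i j)"

lemma ev_trunc:
  assumes "slow A"
  shows "wge 1 1 (int M + 1) (ev A - (\<Sum>r\<le>M. fps_nth A r))"
proof (rule wgeI, rule ccontr)
  fix i j assume nz: "cf (ev A - (\<Sum>r\<le>M. fps_nth A r)) i j \<noteq> 0" and "\<not> int M + 1 \<le> int (1 * i + 1 * j)"
  hence le: "i + j \<le> M" by simp
  have "(\<Sum>r\<le>M. cf (fps_nth A r) i j) = (\<Sum>r\<le>i+j. cf (fps_nth A r) i j)"
  proof (rule sum.mono_neutral_right)
    show "\<forall>r\<in>{..M} - {..i + j}. cf (fps_nth A r) i j = 0"
      using assms unfolding slow_def by (auto intro!: wgeD[of 1 1])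
  qed (use le in auto)
  thus False using nz by (simp add: ev_def)
qed

lemma wge_all_eqI: "(\<And>M::nat. wge 1 1 (int M) (F - G)) \<Longrightarrow> F = G"
proof (rule series2_eqI)
  fix i j assume "\<And>M::nat. wge 1 1 (int M) (F - G)"
  from wgeD[OF this[of "i + j + 1"], of i j] show "cf F i j = cf G i j" by simp
qed

lemma ev_eqI:
  assumes "slow A" "\<And>M. wge 1 1 (int M + 1) (G - (\<Sum>r\<le>M. fps_nth A r))"
  shows "ev A = G"
proof (rule wge_all_eqI)
  fix M
  have "wge 1 1 (int M + 1) ((ev A - (\<Sum>r\<le>M. fps_nth A r)) - (G - (\<Sum>r\<le>M. fps_nth A r)))"
    by (intro wge_diff ev_trunc assms)
  thus "wge 1 1 (int M) (ev A - G)" by (auto elim: wge_mono)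
qed

lemma slow_mult: "slow A \<Longrightarrow> slow B \<Longrightarrow> slow (A * B)"
  unfolding slow_def fps_mult_nth
proof
  fix r assume "\<forall>r. wge 1 1 (int r) (fps_nth A r)" "\<forall>r. wge 1 1 (int r) (fps_nth B r)"
  thus "wge 1 1 (int r) (\<Sum>i = 0..r. fps_nth A i * fps_nth B (r - i))"
    by (intro wge_sum wge_multI[of 1 1 "int _" _ "int _"]) auto
qed

lemma ev_mult:
  assumes A: "slow A" and B: "slow B"
  shows "ev (A * B) = ev A * ev B"
proof (rule ev_eqI[OF slow_mult[OF A B]])
  fix M
  define TA where "TA = (\<Sum>r\<le>M. fps_nth A r)"
  define TB where "TB = (\<Sum>r\<le>M. fps_nth B r)"
  have a: "wge 1 1 (int M + 1) (ev A - TA)" and b: "wge 1 1 (int M + 1) (ev B - TB)"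
    unfolding TA_def TB_def by (intro ev_trunc A B)+
  define f where "f r s = fps_nth A r * fps_nth B s" for r s
  have f: "wge 1 1 (int r + int s) (f r s)" for r s
    using A B unfolding f_def slow_def by (intro wge_mult) auto
  have "(\<Sum>t\<le>M. fps_nth (A * B) t) = (\<Sum>(r, s)\<in>{(r, s). r + s \<le> M}. f r s)"
    unfolding fps_mult_nth sum.triangle_reindex_eq f_def by (simp add: atLeast0AtMost)
  moreover have "TA * TB = (\<Sum>(r, s)\<in>{..M} \<times> {..M}. f r s)"
    by (simp add: TA_def TB_def sum_product f_def sum.cartesian_product)
  moreover have "(\<Sum>(r, s)\<in>{..M} \<times> {..M}. f r s) =
      (\<Sum>(r, s)\<in>{..M} \<times> {..M} - {(r, s). r + s \<le> M}. f r s) + (\<Sum>(r, s)\<in>{(r, s). r + s \<le> M}. f r s)"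
    by (rule sum.subset_diff) auto
  moreover have "wge 1 1 (int M + 1) (\<Sum>(r, s)\<in>{..M} \<times> {..M} - {(r, s). r + s \<le> M}. f r s)"
    by (rule wge_sum) (auto intro: wge_mono[OF f])
  ultimately have c: "wge 1 1 (int M + 1) (TA * TB - (\<Sum>t\<le>M. fps_nth (A * B) t))" by simp
  have "ev A * ev B - (\<Sum>t\<le>M. fps_nth (A * B) t) =
     (ev A - TA) * ev B + TA * (ev B - TB) + (TA * TB - (\<Sum>t\<le>M. fps_nth (A * B) t))"
    by (simp add: algebra_simps)
  also have "wge 1 1 (int M + 1) \<dots>"
    by (intro wge_add c wge_multI[OF a wge_trivial[of 0]] wge_multI[OF wge_trivial[of 0] b]) simp_all
  finally show "wge 1 1 (int M + 1) (ev A * ev B - (\<Sum>t\<le>M. fps_nth (A * B) t))" .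
qed

lemma ev_add: "ev (A + B) = ev A + ev B"
  by (rule series2_eqI) (simp add: ev_def sum.distrib)

lemma ev_const_mult: "ev (Abs_fps (\<lambda>r. fps_nth A r * G)) = ev A * G" if "slow A"
proof (rule ev_eqI)
  show "slow (Abs_fps (\<lambda>r. fps_nth A r * G))"
    using that unfolding slow_def by (auto intro: wge_multI[OF _ wge_trivial[of 0]])
  fix M
  have "ev A * G - (\<Sum>r\<le>M. fps_nth (Abs_fps (\<lambda>r. fps_nth A r * G)) r) = (ev A - (\<Sum>r\<le>M. fps_nth A r)) * G"
    by (simp add: sum_distrib_right left_diff_distrib)
  also have "wge 1 1 (int M + 1) \<dots>"
    by (rule wge_multI[OF ev_trunc[OF that] wge_trivial[of 0]]) simp_all
  finally show "wge 1 1 (int M + 1) (ev A * G - (\<Sum>r\<le>M. fps_nth (Abs_fps (\<lambda>r. fps_nth A r * G)) r))" .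
qed

definition "E F = ev (ef F)"

lemma slow_ef: "slow (ef F)"
  unfolding slow_def using Dn_wge1[of 0 F] by (simp add: ef_def wge_cst_mult wge_trivial)

lemma E_mult: "E (F * G) = E F * E G"
  by (simp add: E_def ef_mult ev_mult slow_ef)

lemma E_add: "E (F + G) = E F + E G"
  by (simp add: E_def ef_add ev_add)

lemma D_const: "D (cst c) = 0"
  by (simp add: D_def)

lemma Dn_0 [simp]: "(D ^^ r) 0 = 0"
  by (induction r) (simp_all add: lincont_0[OF D_lincont])

lemma E_cst: "E (cst c) = cst c"
  unfolding E_def
proof (rule ev_eqI[OF slow_ef])
  fix M
  have "fps_nth (ef (cst c)) r = (if r = 0 then cst c else 0)" for r
    by (cases r) (simp_all add: ef_def funpow_swap1 D_const)
  thus "wge 1 1 (int M + 1) (cst c - (\<Sum>r\<le>M. fps_nth (ef (cst c)) r))" by simp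
qed

lemma E_lincont: "lincont E"
proof (rule lincontI[where r = 0])
  show "E (cst c * F) = cst c * E F" for c F by (simp add: E_mult E_cst)
  fix B F assume "wge 1 1 (B + int 0) F"
  hence F: "wge 1 1 B F" by simp
  show "wge 1 1 B (E F)"
  proof (rule wgeI, rule ccontr)
    fix i j assume "cf (E F) i j \<noteq> 0" "\<not> B \<le> int (1 * i + 1 * j)"
    then obtain r where "cf (fps_nth (ef F) r) i j \<noteq> 0"
      unfolding E_def ev_def cf_fps2 by (meson sum.not_neutral_contains_not_neutral)
    moreover have "wge 1 1 B (fps_nth (ef F) r)"
      unfolding ef_def fps_nth_Abs_fps by (intro wge_cst_mult wge_mono[OF Dn_wge1[OF F, of r]]) simp
    ultimately show False using \<open>\<not> B \<le> _\<close> by (auto simp: wge_def)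
  qed
qed (rule E_add)

lemma E_minus: "wge 1 1 (m + 1) (E F - F)" if F: "wge 1 1 m F" for m
proof (rule wgeI, rule ccontr)
  fix i j assume nz: "cf (E F - F) i j \<noteq> 0" and lt: "\<not> m + 1 \<le> int (1 * i + 1 * j)"
  have "cf (fps_nth (ef F) r) i j = (if r = 0 then cf F i j else 0)" for r
  proof (cases r)
    case (Suc r')
    have "wge 1 1 (m + 1) ((D ^^ r) F)"
      by (rule wge_mono[OF Dn_wge1[OF F, of r]]) (simp add: Suc)
    hence "cf ((D ^^ r) F) i j = 0" using lt by (auto elim!: wgeD)
    thus ?thesis by (simp add: ef_def Suc del: funpow.simps)
  qed (simp add: ef_def)
  thus False using nz by (simp add: E_def ev_def)
qed

lemma E_coordinates: "cf (E varx) 0 0 = 0" "cf (E vary) 0 0 = 0"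
proof -
  have "wge 1 1 1 varx" "wge 1 1 1 vary" by (auto simp: varx_mon vary_mon intro: wge_mon)
  from this[THEN E_minus] have "wge 1 1 (1 + 1) (E varx - varx)" "wge 1 1 (1 + 1) (E vary - vary)" .
  from wgeD[OF this(1), of 0 0] wgeD[OF this(2), of 0 0]
  show "cf (E varx) 0 0 = 0" "cf (E vary) 0 0 = 0" by (simp_all add: cf_varx cf_vary)
qed

text \<open>The exponential of a derivation is a continuous ring homomorphism over the constants and
  is hence determined by the images of x and y.\<close>

lemma E_subst2: "E F = subst2 F (E varx) (E vary)"
proof (rule lincont_ext[OF E_lincont lincont_subst2[OF E_coordinates]])
  fix p q
  have E1: "E 1 = 1" using E_cst[of 1] by simp
  have "E (F ^ m) = E F ^ m" for F m by (induction m) (simp_all add: E_mult E1)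
  hence "E (mon p q) = E varx ^ p * E vary ^ q" by (simp add: mon_def E_mult)
  thus "E (mon p q) = subst2 (mon p q) (E varx) (E vary)"
    by (simp add: subst2_mon[OF E_coordinates])
qed

subsection \<open>Pullback of a form by the flow\<close>

definition "L \<theta> = lie \<theta> X Y 0"

lemma L_add: "L (\<theta> + \<eta>) = L \<theta> + L \<eta>"
  by (rule prod_eqI) (simp_all add: L_def lie_simps algebra_simps)

lemma Ln_add: "(L ^^ r) (\<theta> + \<eta>) = (L ^^ r) \<theta> + (L ^^ r) \<eta>"
  by (induction r) (simp_all add: L_add)

lemma L_smul_ext: "L (smul F (ext_d G)) = smul (D F) (ext_d G) + smul F (ext_d (D G))"
  by (rule prod_eqI)
    (simp_all add: L_def lie_simps ext_d_def D_def dx2_mult dy2_mult dx2_dy2 algebra_simps)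

text \<open>The flow pulls F dG back to the exponential of its Lie derivatives. Here
  \<open>\<delta>\<close> is one of the partial derivatives and \<open>\<pi>\<close> the matching
  component of a form, so that both components are handled at once.\<close>

lemma E_pullback_component:
  fixes \<delta> :: "series2 \<Rightarrow> series2" and \<pi> :: "form2 \<Rightarrow> series2"
  assumes \<delta>: "lincont \<delta>" and \<pi>: "\<And>F G. \<pi> (smul F (ext_d G)) = F * \<delta> G" and \<pi>_add: "\<And>\<theta> \<eta>. \<pi> (\<theta> + \<eta>) = \<pi> \<theta> + \<pi> \<eta>"
  shows "fps_nth (ef F * Abs_fps (\<lambda>r. \<delta> (fps_nth (ef G) r))) r =
     cst (1 / fact r) * \<pi> ((L ^^ r) (smul F (ext_d G)))"
proof (induction r arbitrary: F G)
  case 0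
  show ?case by (simp add: ef_def \<pi>)
next
  case (Suc r)
  have d: "fps_deriv (Abs_fps (\<lambda>r. \<delta> (fps_nth (ef G) r))) = Abs_fps (\<lambda>r. \<delta> (fps_nth (ef (D G)) r))" for G
  proof (rule fps_ext)
    fix r
    have "fps_nth (fps_deriv (Abs_fps (\<lambda>r. \<delta> (fps_nth (ef G) r)))) r = \<delta> (cst (of_nat (Suc r)) * fps_nth (ef G) (Suc r))"
      by (subst lincont_cst[OF \<delta>]) (simp only: cst_of_nat fps_deriv_nth fps_nth_Abs_fps Suc_eq_plus1)
    also have "cst (of_nat (Suc r)) * fps_nth (ef G) (Suc r) = fps_nth (fps_deriv (ef G)) r"
      by (simp only: cst_of_nat fps_deriv_nth Suc_eq_plus1)
    finally show "fps_nth (fps_deriv (Abs_fps (\<lambda>r. \<delta> (fps_nth (ef G) r)))) r =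
       fps_nth (Abs_fps (\<lambda>r. \<delta> (fps_nth (ef (D G)) r))) r" by (simp add: ef_deriv)
  qed
  let ?W = "\<lambda>F G. ef F * Abs_fps (\<lambda>r. \<delta> (fps_nth (ef G) r))"
  have "of_nat (Suc r) * fps_nth (?W F G) (Suc r) = fps_nth (fps_deriv (?W F G)) r"
    by (simp only: fps_deriv_nth Suc_eq_plus1)
  also have "\<dots> = fps_nth (?W (D F) G) r + fps_nth (?W F (D G)) r"
    by (simp add: ef_deriv d add.commute del: fps_deriv_nth)
  also have "\<dots> = cst (1 / fact r) * \<pi> ((L ^^ r) (L (smul F (ext_d G))))"
    unfolding Suc L_smul_ext Ln_add \<pi>_add by (simp add: algebra_simps)
  also have "\<dots> = of_nat (Suc r) * (cst (1 / fact (Suc r)) * \<pi> ((L ^^ Suc r) (smul F (ext_d G))))"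
  proof -
    have "(L ^^ r) (L (smul F (ext_d G))) = (L ^^ Suc r) (smul F (ext_d G))" by (simp add: funpow_swap1)
    thus ?thesis by (simp only: mult.assoc[symmetric] inverse_fact)
  qed
  finally show ?case by (rule cancel_Suc)
qed

text \<open>Differentiation costs one order. The bound r + 1 makes up for it: the one additional
  term in the truncated sum for the differentiated series vanishes.\<close>

lemma ev_deriv:
  assumes "\<And>r. wge 1 1 (int r + 1) (fps_nth A r)"
  shows "ev (Abs_fps (\<lambda>r. dx2 (fps_nth A r))) = dx2 (ev A)" "slow (Abs_fps (\<lambda>r. dx2 (fps_nth A r)))"
    "ev (Abs_fps (\<lambda>r. dy2 (fps_nth A r))) = dy2 (ev A)" "slow (Abs_fps (\<lambda>r. dy2 (fps_nth A r)))"
proof -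
  have z: "cf (fps_nth A (Suc (i + j))) i' j' = 0" if "i' + j' = Suc (i + j)" for i j i' j'
    using wgeD[OF assms[of "Suc (i + j)"], of i' j'] that by simp
  show "ev (Abs_fps (\<lambda>r. dx2 (fps_nth A r))) = dx2 (ev A)" "ev (Abs_fps (\<lambda>r. dy2 (fps_nth A r))) = dy2 (ev A)"
    by (rule series2_eqI; simp add: ev_def sum_distrib_left z del: of_nat_Suc)+
  show "slow (Abs_fps (\<lambda>r. dx2 (fps_nth A r)))" "slow (Abs_fps (\<lambda>r. dy2 (fps_nth A r)))"
    unfolding slow_def using assms[THEN wge_dx2] assms[THEN wge_dy2] by simp_all
qed

lemma ef_coordinates: "wge 1 1 (int r + 1) (fps_nth (ef varx) r)" "wge 1 1 (int r + 1) (fps_nth (ef vary) r)"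
proof -
  have v: "wge 1 1 1 varx" "wge 1 1 1 vary" by (auto simp: varx_mon vary_mon intro: wge_mon)
  show "wge 1 1 (int r + 1) (fps_nth (ef varx) r)" "wge 1 1 (int r + 1) (fps_nth (ef vary) r)"
    using Dn_wge1[OF v(1), of r] Dn_wge1[OF v(2), of r] by (simp_all add: ef_def wge_cst_mult add.commute)
qed

end

text \<open>The field (g b, -g a) is tangent to the foliation, so its Lie derivative multiplies the
  form by a function, and its flow by a unit. The ordinary order keeps the flow tangent to the
  identity; the weights identify its leading term.\<close>

theorem tangent_flow:
  fixes \<omega> :: form2 and g :: series2
  assumes \<omega>: "wge 1 1 2 (fst \<omega>)" "wge 1 1 2 (snd \<omega>)"
    and k: "k \<ge> 1" and l: "l \<ge> 1" and m: "m \<ge> 1"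
    and gb: "wge k l (int k + m) (g * snd \<omega>)" and ga: "wge k l (int l + m) (g * fst \<omega>)"
    and f: "wge k l m (g * curl \<omega>)"
  shows "\<exists>P Q U. pullback (P, Q) \<omega> = smul U \<omega> \<and> wge 1 1 2 (P - varx) \<and> wge 1 1 2 (Q - vary) \<and>
     wge k l m (U - 1) \<and> wge k l (int k + m + 1) (P - varx - g * snd \<omega>) \<and>
     wge k l (int l + m + 1) (Q - vary + g * fst \<omega>)"
proof -
  define X' where "X' = g * snd \<omega>"
  define Y' where "Y' = - (g * fst \<omega>)"
  interpret flow X' Y'
    unfolding X'_def Y'_def
    by unfold_locales (auto intro!: wge_uminus wge_multI[OF wge_trivial[of 0]] \<omega>)
  have Dm: "wge k l (c + m) (D F)" if "wge k l c F" for c F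
  proof -
    have h: "wge k l (int k + m) X'" "wge k l (int l + m) Y'"
      using gb ga wge_uminus by (auto simp: X'_def Y'_def)
    show ?thesis unfolding D_def
      by (rule wge_add; rule wge_multI[OF h(1) wge_dx2[OF that]] wge_multI[OF h(2) wge_dy2[OF that]], linarith)
  qed
  have Dmr: "wge k l (c + int r * m) ((D ^^ r) F)" if "wge k l c F" for c F r
  proof (induction r)
    case (Suc r)
    thus ?case using Dm[OF Suc] by (simp add: algebra_simps)
  qed (use that in simp)
  \<comment> \<open>The terms of the exponential with r >= 2 have weight at least c + 2 m, hence at
    least c + m + 1.\<close>
  have Ediff: "wge k l (c + m + 1) (E F - F - D F)" if F: "wge k l c F" and F1: "wge 1 1 1 F" for c F
  proof (rule wgeI, rule ccontr)
    fix i j assume nz: "cf (E F - F - D F) i j \<noteq> 0" and lt: "\<not> c + m + 1 \<le> int (k * i + l * j)"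
    have "cf (fps_nth (ef F) r) i j = 0" if "r \<ge> 2" for r
    proof -
      have "1 \<le> int (r - 1) * m" using that m by (simp add: int_one_le_iff_zero_less)
      hence "c + m + 1 \<le> c + int r * m" using that by (simp add: of_nat_diff algebra_simps)
      hence "wge k l (c + m + 1) ((D ^^ r) F)" using Dmr[OF F, of r] wge_mono by blast
      thus ?thesis using lt by (auto simp: ef_def elim!: wgeD)
    qed
    note r2 = this
    have s1: "(\<Sum>r\<le>i+j. cf (fps_nth (ef F) r) i j) = (\<Sum>r\<in>{..i+j} \<inter> {0, 1}. cf (fps_nth (ef F) r) i j)"
    proof (intro sum.mono_neutral_right ballI)
      fix r assume "r \<in> {..i+j} - {..i+j} \<inter> {0, 1}"
      hence "r \<noteq> 0" "r \<noteq> 1" by auto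
      hence "r \<ge> 2" by linarith
      thus "cf (fps_nth (ef F) r) i j = 0" by (rule r2)
    qed auto
    have s2: "{..i+j} \<inter> {0, 1} = (if i + j = 0 then {0} else {0, 1})" by auto
    have "cf (E F) i j = (\<Sum>r\<in>(if i + j = 0 then {0} else {0, 1}). cf (fps_nth (ef F) r) i j)"
      unfolding E_def ev_def cf_fps2 s1 s2 ..
    moreover have "cf F i j = 0" "cf (D F) i j = 0" if "i + j = 0"
      using wgeD[OF F1, of i j] wgeD[OF D_wge1[OF F1], of i j] that by simp_all
    ultimately have "cf (E F) i j = cf F i j + cf (D F) i j"
      by (cases "i + j = 0") (simp_all add: ef_def One_nat_def)
    thus False using nz by simp
  qed
  have v: "wge 1 1 1 varx" "wge 1 1 1 vary" by (auto simp: varx_mon vary_mon intro: wge_mon)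
  have vk: "wge k l (int k) varx" "wge k l (int l) vary" by (auto simp: varx_mon vary_mon intro: wge_mon)
  have P: "wge k l (int k + m + 1) (E varx - varx - g * snd \<omega>)"
    and Q: "wge k l (int l + m + 1) (E vary - vary + g * fst \<omega>)"
  proof -
    have "D varx = X'" "D vary = Y'" by (simp_all add: D_def)
    moreover have X'': "g * snd \<omega> = X'" and Y'': "g * fst \<omega> = - Y'" by (simp_all add: X'_def Y'_def)
    ultimately show "wge k l (int k + m + 1) (E varx - varx - g * snd \<omega>)"
      "wge k l (int l + m + 1) (E vary - vary + g * fst \<omega>)"
      unfolding X'' Y'' using Ediff[OF vk(1) v(1)] Ediff[OF vk(2) v(2)] by simp_all
  qed
  have P1: "wge 1 1 2 (E varx - varx)" "wge 1 1 2 (E vary - vary)"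
    using E_minus[OF v(1)] E_minus[OF v(2)] by simp_all
  define f' where "f' = g * curl \<omega>"
  have f1: "wge 1 1 1 f'"
  proof -
    have "wge 1 1 1 (curl \<omega>)"
      using wge_diff[OF wge_dx2[OF \<omega>(2)] wge_dy2[OF \<omega>(1)]] by (simp add: curl_def)
    from wge_mult[OF wge_trivial[of 0] this] show ?thesis by (simp add: f'_def)
  qed
  \<comment> \<open>The r-th Lie derivative of the form is \<open>u r\<close> times the form; the
    recursion is the Leibniz rule with \<open>f'\<close> as the first multiplier.\<close>
  define u where "u = rec_nat (1 :: series2) (\<lambda>r ur. D ur + ur * f')"
  have u0: "u 0 = 1" and uS: "u (Suc r) = D (u r) + u r * f'" for r by (simp_all add: u_def)
  have "lie \<omega> X' Y' 0 = lie \<omega> (- ((-g) * snd \<omega>)) ((-g) * fst \<omega>) ((-g) * curl \<omega>) - smul ((-g) * curl \<omega>) \<omega>"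
    by (rule prod_eqI) (simp_all add: lie_simps X'_def Y'_def)
  also have "\<dots> = smul f' \<omega>" unfolding lie_tangent by (rule prod_eqI) (simp_all add: f'_def)
  finally have l0: "lie \<omega> X' Y' 0 = smul f' \<omega>" .
  have L\<omega>: "L (smul ur \<omega>) = smul (D ur + ur * f') \<omega>" for ur
  proof -
    have "L (smul ur \<omega>) = smul (D ur) \<omega> + smul ur (lie \<omega> X' Y' 0)"
      by (rule prod_eqI) (simp_all add: L_def lie_simps D_def dx2_mult dy2_mult algebra_simps)
    thus ?thesis unfolding l0 by (intro prod_eqI) (simp_all add: algebra_simps)
  qed
  have Ln: "(L ^^ r) \<omega> = smul (u r) \<omega>" for r
  proof (induction r)
    case 0
    show ?case by (rule prod_eqI) (simp_all add: u0)
  qed (simp add: L\<omega> uS)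
  define A where "A = Abs_fps (\<lambda>r. cst (1 / fact r) * u r)"
  have u1: "wge 1 1 (int r) (u r)" for r
  proof (induction r)
    case (Suc r)
    thus ?case using D_wge1[OF Suc] wge_mult[OF Suc f1] by (auto simp: uS algebra_simps intro: wge_add)
  qed (simp add: wge_trivial)
  have A: "slow A" unfolding slow_def A_def using u1 by (simp add: wge_cst_mult)
  have um: "wge k l m (u (Suc r))" for r
  proof (induction r)
    case 0
    show ?case using f D_const[of 1] by (simp add: uS u0 f'_def)
  next
    case (Suc r)
    have "wge k l m (D (u (Suc r)))" using Dm[OF Suc] m by (auto elim: wge_mono)
    moreover have "wge k l m (u (Suc r) * f')" using wge_multI[OF Suc f] m by (simp add: f'_def)
    ultimately show ?case unfolding uS[of "Suc r"] by (rule wge_add)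
  qed
  define U where "U = ev A"
  have U: "wge k l m (U - 1)"
  proof (rule wgeI, rule ccontr)
    fix i j assume nz: "cf (U - 1) i j \<noteq> 0" and lt: "\<not> m \<le> int (k * i + l * j)"
    have "cf (fps_nth A r) i j = (if r = 0 then cf 1 i j else 0)" for r
      using wgeD[OF um[of "r - 1"], of i j] lt by (cases r) (simp_all add: A_def u0 One_nat_def)
    thus False using nz by (simp add: U_def ev_def)
  qed
  have split: "\<omega> = smul (fst \<omega>) (ext_d varx) + smul (snd \<omega>) (ext_d vary)"
    by (rule prod_eqI) (simp_all add: ext_d_def)
  have comp: "E (fst \<omega>) * \<delta> (E varx) + E (snd \<omega>) * \<delta> (E vary) = U * \<pi> \<omega>"
    if \<delta>: "lincont \<delta>" and \<pi>: "\<And>F G. \<pi> (smul F (ext_d G)) = F * \<delta> G" and \<pi>_add: "\<And>\<theta> \<eta>. \<pi> (\<theta> + \<eta>) = \<pi> \<theta> + \<pi> \<eta>"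
      and \<pi>_smul: "\<And>F \<theta>. \<pi> (smul F \<theta>) = F * \<pi> \<theta>"
      and ev: "\<And>A. (\<And>r. wge 1 1 (int r + 1) (fps_nth A r)) \<Longrightarrow> ev (Abs_fps (\<lambda>r. \<delta> (fps_nth A r))) = \<delta> (ev A) \<and>
        slow (Abs_fps (\<lambda>r. \<delta> (fps_nth A r)))"
    for \<delta> :: "series2 \<Rightarrow> series2" and \<pi> :: "form2 \<Rightarrow> series2"
  proof -
    let ?Z = "\<lambda>F G. ef F * Abs_fps (\<lambda>r. \<delta> (fps_nth (ef G) r))"
    have "?Z (fst \<omega>) varx + ?Z (snd \<omega>) vary = Abs_fps (\<lambda>r. fps_nth A r * \<pi> \<omega>)"
    proof (rule fps_ext)
      fix r
      have "fps_nth (?Z (fst \<omega>) varx + ?Z (snd \<omega>) vary) r =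
         cst (1 / fact r) * \<pi> ((L ^^ r) (smul (fst \<omega>) (ext_d varx)) + (L ^^ r) (smul (snd \<omega>) (ext_d vary)))"
        unfolding fps_add_nth E_pullback_component[OF \<delta> \<pi> \<pi>_add] \<pi>_add by (simp add: distrib_left)
      also have "(L ^^ r) (smul (fst \<omega>) (ext_d varx)) + (L ^^ r) (smul (snd \<omega>) (ext_d vary)) = (L ^^ r) \<omega>"
        unfolding Ln_add[symmetric] split[symmetric] ..
      finally show "fps_nth (?Z (fst \<omega>) varx + ?Z (snd \<omega>) vary) r = fps_nth (Abs_fps (\<lambda>r. fps_nth A r * \<pi> \<omega>)) r"
        by (simp add: Ln \<pi>_smul A_def mult.assoc)
    qed
    from arg_cong[OF this, of ev] show ?thesis
      using ev[of "ef varx"] ev[of "ef vary"] ef_coordinates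
      by (simp add: ev_add ev_mult slow_ef ev_const_mult[OF A] U_def E_def)
  qed
  have "pullback (E varx, E vary) \<omega> = smul U \<omega>"
    using comp[of dx2 fst] comp[of dy2 snd] ev_deriv
    by (intro prod_eqI) (simp_all add: lincont_dx2 lincont_dy2 ext_d_def E_subst2[of "fst \<omega>"] E_subst2[of "snd \<omega>"])
  thus ?thesis using P Q P1 U by blast
qed

section \<open>Equivalences preserve the axes\<close>

text \<open>Equality of initial parts. The value 0 is allowed for the second series and then says
  that the first one starts in a higher weight.\<close>

definition approx :: "nat \<Rightarrow> nat \<Rightarrow> int \<Rightarrow> series2 \<Rightarrow> series2 \<Rightarrow> bool" where
  "approx a b c u u\<^sub>0 \<longleftrightarrow> wge a b c u\<^sub>0 \<and> wge a b (c + 1) (u - u\<^sub>0)"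

lemma approxD: "approx a b c u u\<^sub>0 \<Longrightarrow> int (a * i + b * j) < c + 1 \<Longrightarrow> cf u i j = cf u\<^sub>0 i j"
  using wgeD[of a b "c + 1" "u - u\<^sub>0" i j] by (simp add: approx_def)

lemma approx_wge: "approx a b c u u\<^sub>0 \<Longrightarrow> wge a b c u"
  using wge_add[of a b c "u - u\<^sub>0" u\<^sub>0] wge_mono[of a b "c + 1" "u - u\<^sub>0" c] by (auto simp: approx_def)

lemma approx_add: "approx a b c u u\<^sub>0 \<Longrightarrow> approx a b c v v\<^sub>0 \<Longrightarrow> approx a b c (u + v) (u\<^sub>0 + v\<^sub>0)"
  using wge_add[of a b "c + 1" "u - u\<^sub>0" "v - v\<^sub>0"] by (auto simp: approx_def wge_add algebra_simps)

lemma approx_mult: "approx a b c u u\<^sub>0 \<Longrightarrow> approx a b d v v\<^sub>0 \<Longrightarrow> approx a b (c + d) (u * v) (u\<^sub>0 * v\<^sub>0)"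
proof -
  assume u: "approx a b c u u\<^sub>0" and v: "approx a b d v v\<^sub>0"
  have "u * v - u\<^sub>0 * v\<^sub>0 = (u - u\<^sub>0) * v\<^sub>0 + u * (v - v\<^sub>0)" by (simp add: algebra_simps)
  moreover have "wge a b (c + d + 1) ((u - u\<^sub>0) * v\<^sub>0 + u * (v - v\<^sub>0))"
    using u v approx_wge[OF u] unfolding approx_def
    by (intro wge_add; elim conjE) (erule (1) wge_multI, simp)+
  ultimately show ?thesis using u v by (simp add: approx_def wge_mult)
qed

lemma approx_power: "approx a b c u u\<^sub>0 \<Longrightarrow> approx a b (int p * c) (u ^ p) (u\<^sub>0 ^ p)"
proof (induction p)
  case (Suc p)
  thus ?case using approx_mult[of a b c u u\<^sub>0 "int p * c" "u ^ p" "u\<^sub>0 ^ p"] by (simp add: algebra_simps)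
qed (auto simp: approx_def wge_def)

lemma approx_subst2:
  assumes P: "approx a b (int a) P P\<^sub>0" and Q: "approx a b (int b) Q Q\<^sub>0"
    and c: "cf P 0 0 = 0" "cf Q 0 0 = 0" "cf P\<^sub>0 0 0 = 0" "cf Q\<^sub>0 0 0 = 0"
    and F: "wge a b M F"
  shows "approx a b M (subst2 F P Q) (subst2 F P\<^sub>0 Q\<^sub>0)"
  unfolding approx_def
proof
  show "wge a b M (subst2 F P\<^sub>0 Q\<^sub>0)"
    using P Q F by (intro wge_subst2) (auto simp: approx_def)
  show "wge a b (M + 1) (subst2 F P Q - subst2 F P\<^sub>0 Q\<^sub>0)"
  proof (rule lincont_wge[of "\<lambda>F. subst2 F P Q - subst2 F P\<^sub>0 Q\<^sub>0"])
    show "lincont (\<lambda>F. subst2 F P Q - subst2 F P\<^sub>0 Q\<^sub>0)"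
      by (intro lincont_minus lincont_subst2 c)
    fix p q assume "cf F p q \<noteq> 0"
    hence M: "M \<le> int (a * p + b * q)" using F by (auto simp: wge_def)
    have "approx a b (int p * int a + int q * int b) (P ^ p * Q ^ q) (P\<^sub>0 ^ p * Q\<^sub>0 ^ q)"
      by (intro approx_mult approx_power P Q)
    hence "wge a b (int p * int a + int q * int b + 1) (subst2 (mon p q) P Q - subst2 (mon p q) P\<^sub>0 Q\<^sub>0)"
      by (simp add: approx_def subst2_mon c)
    thus "wge a b (M + 1) (subst2 (mon p q) P Q - subst2 (mon p q) P\<^sub>0 Q\<^sub>0)"
      by (rule wge_mono) (use M in \<open>simp add: mult.commute\<close>)
  qed
qed

lemma approx_subst2_mon:
  assumes P: "approx a b (int a) P P\<^sub>0" and Q: "approx a b (int b) Q Q\<^sub>0"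
    and c: "cf P 0 0 = 0" "cf Q 0 0 = 0"
    and F: "wge a b (int (a * p + b * q) + 1) (F - cst z * mon p q)"
  shows "approx a b (int (a * p + b * q)) (subst2 F P Q) (cst z * (P\<^sub>0 ^ p * Q\<^sub>0 ^ q))"
proof -
  have 1: "approx a b (int p * int a + int q * int b) (P ^ p * Q ^ q) (P\<^sub>0 ^ p * Q\<^sub>0 ^ q)"
    by (intro approx_mult approx_power P Q)
  have "approx a b (0 + (int p * int a + int q * int b)) (cst z * (P ^ p * Q ^ q)) (cst z * (P\<^sub>0 ^ p * Q\<^sub>0 ^ q))"
    by (rule approx_mult[OF _ 1]) (simp add: approx_def wge_trivial)
  moreover have "wge a b (int (a * p + b * q) + 1) (subst2 (F - cst z * mon p q) P Q)"
    using approx_wge[OF P] approx_wge[OF Q] by (rule wge_subst2[OF _ _ F])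
  ultimately show ?thesis
    using wge_add[of a b "int (a * p + b * q) + 1" "cst z * (P ^ p * Q ^ q) - cst z * (P\<^sub>0 ^ p * Q\<^sub>0 ^ q)" "subst2 (F - cst z * mon p q) P Q"]
    by (simp add: approx_def c subst2_mon algebra_simps)
qed

definition strict :: "series2 \<Rightarrow> series2 \<Rightarrow> series2 \<Rightarrow> bool" where
  "strict P Q w \<longleftrightarrow> cf P 0 0 = 0 \<and> cf P 1 0 = 1 \<and> cf P 0 1 = 0 \<and>
     cf Q 0 0 = 0 \<and> cf Q 1 0 = 0 \<and> cf Q 0 1 = 1 \<and> cf w 0 0 = 1"

lemma cf_binomial:
  "cf ((varx + cst c * mon 0 r) ^ p) i j = (if i \<le> p \<and> j = r * (p - i) then of_nat (p choose i) * c ^ (p - i) else 0)"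
proof -
  have "(varx + cst c * mon 0 r) ^ p = (\<Sum>s\<le>p. cst (of_nat (p choose s) * c ^ (p - s)) * mon s (r * (p - s)))"
    unfolding binomial_ring
    by (rule sum.cong) (simp_all add: mon_def power_mult_distrib cst_of_nat cst_power mult_ac flip: power_mult)
  hence "cf ((varx + cst c * mon 0 r) ^ p) i j = (\<Sum>s\<le>p. cf (cst (of_nat (p choose s) * c ^ (p - s)) * mon s (r * (p - s))) i j)"
    by (simp only: cf_sum)
  also have "\<dots> = (\<Sum>s\<le>p. if i = s then (if j = r * (p - i) then of_nat (p choose i) * c ^ (p - i) else 0) else 0)"
    by (rule sum.cong) (auto simp: cf_mon simp del: cst_simps)
  finally show ?thesis by simp
qed

lemma not_less_weight: "\<not> int a + 1 \<le> int b \<Longrightarrow> b \<le> a"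
  by linarith

text \<open>
  If \<open>P\<close> contained a term \<open>\<gamma> y\<^sup>r\<close>, give \<open>x\<close> the weight \<open>r\<close> and \<open>y\<close> the weight \<open>1\<close> and compare the
  initial parts of the two forms. For \<open>l r > k\<close> the obstruction is that \<open>{x = 0}\<close> is invariant, and
  for \<open>l r \<le> k\<close> that a nonzero translation does not preserve a nonconstant polynomial.
\<close>

lemma axis_preserved:
  fixes \<omega> \<eta> :: form2
  assumes k: "k \<ge> 1" and l: "l \<ge> 1" and n: "n \<ge> 1"
    and ax: "axes_invariant \<omega>" "axes_invariant \<eta>"
    and \<omega>: "wgef k l (int (k * l * n + k + l)) \<omega>"
    and eq: "\<And>i j. k * i + l * j \<le> k * l * n + l \<Longrightarrow> cf (fst \<eta>) i j = cf (fst \<omega>) i j"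
    and A0: "cf (fst \<omega>) (l * n) 1 \<noteq> 0"
    and irr: "\<And>r. k < l * r \<Longrightarrow> of_nat r * cf (fst \<omega>) 0 (k * n + 1) + cf (snd \<omega>) 1 (k * n) \<noteq> 0"
    and strict: "strict P Q w" and \<eta>: "smul w (pullback (P, Q) \<omega>) = \<eta>"
  shows "cf P 0 j = 0"
proof (rule ccontr)
  assume "cf P 0 j \<noteq> 0"
  define r where "r = (LEAST j. cf P 0 j \<noteq> 0)"
  define \<gamma> where "\<gamma> = cf P 0 r"
  have \<gamma>: "\<gamma> \<noteq> 0" unfolding \<gamma>_def r_def by (rule LeastI[of "\<lambda>j. cf P 0 j \<noteq> 0"]) fact
  have less: "cf P 0 j = 0" if "j < r" for j using not_less_Least[OF that[unfolded r_def]] by simp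
  have "r \<noteq> 0" "r \<noteq> 1" using \<gamma> strict unfolding strict_def \<gamma>_def by metis+
  hence r: "r \<ge> 2" by linarith
  define P\<^sub>0 where "P\<^sub>0 = varx + cst \<gamma> * mon 0 r"
  have cP: "cf P 0 0 = 0" "cf Q 0 0 = 0" "cf P\<^sub>0 0 0 = 0" "cf vary 0 0 = 0"
    using strict r by (auto simp: strict_def P\<^sub>0_def cf_varx cf_vary cf_mon)
  have P: "approx r 1 (int r) P P\<^sub>0"
    unfolding approx_def
  proof
    show "wge r 1 (int r) P\<^sub>0" unfolding P\<^sub>0_def varx_mon by (intro wge_add wge_cst_mult wge_mon) simp_all
    show "wge r 1 (int r + 1) (P - P\<^sub>0)"
    proof (rule wgeI, rule ccontr)
      fix i j assume nz: "cf (P - P\<^sub>0) i j \<noteq> 0" and "\<not> int r + 1 \<le> int (r * i + 1 * j)"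
      hence lt: "r * i + j \<le> r" by linarith
      have "i = 0 \<or> i = 1 \<and> j = 0"
      proof (cases i)
        case (Suc i')
        thus ?thesis using lt r by (cases i') (auto simp: One_nat_def)
      qed simp
      thus False
      proof
        assume "i = 0"
        thus False using nz lt less[of j] by (cases "j = r") (auto simp: P\<^sub>0_def cf_varx cf_mon \<gamma>_def)
      next
        assume "i = 1 \<and> j = 0"
        thus False using nz strict by (auto simp: P\<^sub>0_def cf_varx cf_mon strict_def)
      qed
    qed
  qed
  have Q: "approx r 1 (int 1) Q vary"
    unfolding approx_def
  proof
    show "wge r 1 (int 1) vary" unfolding vary_mon by (intro wge_mon) simp
    show "wge r 1 (int 1 + 1) (Q - vary)"
    proof (rule wgeI, rule ccontr)
      fix i j assume nz: "cf (Q - vary) i j \<noteq> 0" and "\<not> int 1 + 1 \<le> int (r * i + 1 * j)"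
      hence lt: "r * i + j \<le> 1" by linarith
      hence "i = 0" using r by (cases i) auto
      moreover have "j = 0 \<or> j = 1" using lt by auto
      ultimately show False using nz strict by (auto simp: strict_def cf_vary)
    qed
  qed
  have w: "approx r 1 0 w 1"
    unfolding approx_def
  proof
    show "wge r 1 (0 + 1) (w - 1)"
    proof (rule wgeI, rule ccontr)
      fix i j assume nz: "cf (w - 1) i j \<noteq> 0" and "\<not> 0 + 1 \<le> int (r * i + 1 * j)"
      hence "r * i + j = 0" by linarith
      hence "i = 0" "j = 0" using r by auto
      thus False using nz strict by (simp add: strict_def cf_1)
    qed
  qed (simp add: wge_trivial)
  define a where "a = fst \<omega>"
  define b where "b = snd \<omega>"
  have a: "k * l * n + l \<le> k * i + l * j \<and> j \<ge> 1" if "cf a i j \<noteq> 0" for i j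
  proof
    have "wge k l (int (k * l * n + l)) a" using \<omega> by (simp add: wgef_def a_def algebra_simps)
    thus "k * l * n + l \<le> k * i + l * j" using that by (metis wgeD not_le of_nat_less_iff)
    show "j \<ge> 1" using that ax(1) by (cases j) (auto simp: axes_invariant_def a_def One_nat_def)
  qed
  have b: "k * l * n + k \<le> k * i + l * j \<and> i \<ge> 1" if "cf b i j \<noteq> 0" for i j
  proof
    have "wge k l (int (k * l * n + k)) b" using \<omega> by (simp add: wgef_def b_def algebra_simps)
    thus "k * l * n + k \<le> k * i + l * j" using that by (metis wgeD not_le of_nat_less_iff)
    show "i \<ge> 1" using that ax(1) by (cases i) (auto simp: axes_invariant_def b_def One_nat_def)
  qed
  show False
  proof (cases "k < l * r")
    \<comment> \<open>In the weights (r, 1) with k < l r, all possible initial terms reduce to one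
      monomial in each coefficient: y^(k n + 1) in front of dx and x y^(k n) in front of dy.\<close>
    case True
    have a': "wge r 1 (int (r * 0 + 1 * (k * n + 1)) + 1) (a - cst (cf a 0 (k * n + 1)) * mon 0 (k * n + 1))"
    proof (rule wgeI, rule ccontr)
      fix i j assume nz: "cf (a - cst (cf a 0 (k * n + 1)) * mon 0 (k * n + 1)) i j \<noteq> 0"
        and "\<not> int (r * 0 + 1 * (k * n + 1)) + 1 \<le> int (r * i + 1 * j)"
      hence lt: "r * i + j \<le> k * n + 1" using not_less_weight[of "r * 0 + 1 * (k * n + 1)" "r * i + 1 * j"] by simp
      have ne: "\<not> (i = 0 \<and> j = k * n + 1)" using nz by (auto simp: cf_mon)
      hence "cf a i j \<noteq> 0" using nz by (auto simp: cf_mon)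
      hence w: "k * l * n + l \<le> k * i + l * j" using a by blast
      have "l * (r * i + j) \<le> l * (k * n + 1)" using lt by (rule mult_le_mono2)
      hence 1: "l * r * i + l * j \<le> k * l * n + l" by (simp add: algebra_simps)
      have "i = 0"
      proof (rule ccontr)
        assume "i \<noteq> 0"
        hence "k * i < l * r * i" using True by simp
        thus False using 1 w by linarith
      qed
      hence "l * (k * n + 1) \<le> l * j" using w by (simp add: algebra_simps)
      hence "k * n + 1 \<le> j" using l by simp
      thus False using ne lt \<open>i = 0\<close> by simp
    qed
    have b': "wge r 1 (int (r * 1 + 1 * (k * n)) + 1) (b - cst (cf b 1 (k * n)) * mon 1 (k * n))"
    proof (rule wgeI, rule ccontr)
      fix i j assume nz: "cf (b - cst (cf b 1 (k * n)) * mon 1 (k * n)) i j \<noteq> 0"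
        and "\<not> int (r * 1 + 1 * (k * n)) + 1 \<le> int (r * i + 1 * j)"
      hence lt: "r * i + j \<le> r + k * n" using not_less_weight[of "r * 1 + 1 * (k * n)" "r * i + 1 * j"] by simp
      have ne: "\<not> (i = 1 \<and> j = k * n)" using nz by (auto simp: cf_mon)
      hence "cf b i j \<noteq> 0" using nz by (auto simp: cf_mon)
      hence w: "k * l * n + k \<le> k * i + l * j" and i: "i \<ge> 1" using b by blast+
      then obtain i' where i': "i = Suc i'" by (cases i) auto
      have "l * (r * i + j) \<le> l * (r + k * n)" using lt by (rule mult_le_mono2)
      hence 1: "l * r * i' + l * j \<le> k * l * n" by (simp add: i' algebra_simps)
      have 2: "k * l * n \<le> k * i' + l * j" using w by (simp add: i' algebra_simps)
      have "i' = 0"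
      proof (rule ccontr)
        assume "i' \<noteq> 0"
        hence "k * i' < l * r * i'" using True by simp
        thus False using 1 2 by linarith
      qed
      hence "l * (k * n) \<le> l * j" "l * j \<le> l * (k * n)" using 1 2 by (simp_all add: algebra_simps)
      hence "j = k * n" using l by auto
      thus False using ne i' \<open>i' = 0\<close> by (simp add: One_nat_def)
    qed
    have A: "approx r 1 (int (r * 0 + 1 * (k * n + 1))) (subst2 a P Q) (cst (cf a 0 (k * n + 1)) * (P\<^sub>0 ^ 0 * vary ^ (k * n + 1)))"
      by (rule approx_subst2_mon[OF P _ cP(1,2) a']) (use Q in simp)
    have B: "approx r 1 (int (r * 1 + 1 * (k * n))) (subst2 b P Q) (cst (cf b 1 (k * n)) * (P\<^sub>0 ^ 1 * vary ^ (k * n)))"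
      by (rule approx_subst2_mon[OF P _ cP(1,2) b']) (use Q in simp)
    have Py: "approx r 1 (int r - 1) (dy2 P) (dy2 P\<^sub>0)" and Qy: "approx r 1 0 (dy2 Q) 1"
      using P Q wge_dy2[of r 1] wge_dy2[of r 1 2 "Q - vary"] unfolding approx_def
      by (force simp: wge_trivial)+
    have "approx r 1 (0 + (int r + int (k * n))) (w * (subst2 a P Q * dy2 P + subst2 b P Q * dy2 Q))
       (1 * (cst (cf a 0 (k * n + 1)) * (P\<^sub>0 ^ 0 * vary ^ (k * n + 1)) * dy2 P\<^sub>0 + cst (cf b 1 (k * n)) * (P\<^sub>0 ^ 1 * vary ^ (k * n)) * 1))"
      using approx_mult[OF A Py] approx_mult[OF B Qy]
      by (intro approx_mult[OF w] approx_add) (simp_all add: algebra_simps)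
    \<comment> \<open>The term y^(k n + r) dy is absent from a form leaving x = 0 invariant, but its
      coefficient comes out as \<open>\<gamma>\<close> times the number excluded by
      \<open>irr\<close>.\<close>
    from approxD[OF this, of 0 "k * n + r"]
    have "cf (snd \<eta>) 0 (k * n + r) = cf (cst (cf a 0 (k * n + 1)) * (P\<^sub>0 ^ 0 * vary ^ (k * n + 1)) * dy2 P\<^sub>0 + cst (cf b 1 (k * n)) * (P\<^sub>0 ^ 1 * vary ^ (k * n)) * 1) 0 (k * n + r)"
      by (simp add: \<eta>[symmetric] a_def[symmetric] b_def[symmetric])
    also have "cst (cf a 0 (k * n + 1)) * (P\<^sub>0 ^ 0 * vary ^ (k * n + 1)) * dy2 P\<^sub>0 + cst (cf b 1 (k * n)) * (P\<^sub>0 ^ 1 * vary ^ (k * n)) * 1 =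
      cst (cf a 0 (k * n + 1)) * (mon 0 (k * n + 1) * (cst \<gamma> * (of_nat r * mon 0 (r - 1)))) + cst (cf b 1 (k * n)) * (mon 0 (k * n) * (varx + cst \<gamma> * mon 0 r))"
      by (simp add: P\<^sub>0_def dy2_power mon_def mult.assoc mult.commute)
    also have "cf \<dots> 0 (k * n + r) = \<gamma> * (of_nat r * cf a 0 (k * n + 1) + cf b 1 (k * n))"
      using r by (simp add: cf_mon_mult cf_mon cf_varx) (simp add: algebra_simps)
    finally show False using irr[OF True] \<gamma> ax(2) by (simp add: axes_invariant_def a_def b_def)
  next
    \<comment> \<open>Now many monomials may be initial. The one to watch is x^(l n - 1) y^(r + 1)
      in front of dx, which the translation x + \<open>\<gamma>\<close> y^r produces from x^(l n) y
      with the factor l n \<open>\<gamma>\<close>.\<close>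
    case False
    hence lr: "l * r \<le> k" by simp
    have ra: "r * (l * n) + 1 \<le> r * i + j" if "cf a i j \<noteq> 0" for i j
    proof -
      have "r * (k * l * n + l) \<le> r * (k * i + l * j)" using a[OF that] by (intro mult_le_mono2) blast
      also have "\<dots> \<le> k * (r * i) + k * j"
        using mult_le_mono1[OF lr, of j] by (simp add: algebra_simps)
      finally have "k * (r * (l * n)) + r * l \<le> k * (r * i + j)" by (simp add: algebra_simps)
      hence "k * (r * (l * n)) < k * (r * i + j)" using r l
        by (metis add_lessD1 add_le_same_cancel1 less_le_trans linorder_not_less mult_is_0 not_numeral_le_zero not_one_le_zero le_neq_implies_less le_add1 add_0_right add_left_cancel)
      thus ?thesis by simp
    qed
    have rb: "r * (l * n) + r \<le> r * i + j" if "cf b i j \<noteq> 0" for i j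
    proof -
      have "r * (k * l * n + k) \<le> r * (k * i + l * j)" using b[OF that] by (intro mult_le_mono2) blast
      also have "\<dots> \<le> k * (r * i) + k * j"
        using mult_le_mono1[OF lr, of j] by (simp add: algebra_simps)
      finally have "k * (r * (l * n) + r) \<le> k * (r * i + j)" by (simp add: algebra_simps)
      thus ?thesis using k by simp
    qed
    define M where "M = int (r * (l * n) + 1)"
    have wa: "wge r 1 M a"
    proof (rule wgeI)
      fix i j assume "cf a i j \<noteq> 0"
      hence "r * (l * n) + 1 \<le> r * i + j" by (rule ra)
      thus "M \<le> int (r * i + 1 * j)" unfolding M_def by linarith
    qed
    have wb: "wge r 1 (M - 1 + int r) b"
    proof (rule wgeI)
      fix i j assume "cf b i j \<noteq> 0"
      hence "r * (l * n) + r \<le> r * i + j" by (rule rb)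
      thus "M - 1 + int r \<le> int (r * i + 1 * j)" unfolding M_def by linarith
    qed
    have A: "approx r 1 M (subst2 a P Q) (subst2 a P\<^sub>0 vary)"
      by (rule approx_subst2[OF P _ cP wa]) (use Q in simp)
    have B: "wge r 1 (M - 1 + int r) (subst2 b P Q)"
      using approx_wge[OF P] approx_wge[OF Q] by (intro wge_subst2 wb) simp_all
    have Px: "approx r 1 0 (dx2 P) 1"
    proof -
      have "dx2 P\<^sub>0 = 1" by (simp add: P\<^sub>0_def dx2_mon)
      thus ?thesis using P wge_dx2[of r 1 "int r + 1" "P - P\<^sub>0"] unfolding approx_def by (simp add: wge_trivial)
    qed
    have Qx: "wge r 1 (2 - int r) (dx2 Q)"
      using Q wge_dx2[of r 1 2 "Q - vary"] unfolding approx_def by simp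
    have "approx r 1 M (subst2 b P Q * dx2 Q) 0"
      unfolding approx_def using wge_multI[OF B Qx, of "M + 1"] by simp
    from approx_mult[OF w approx_add[OF _ this]] approx_mult[OF A Px]
    have h: "approx r 1 (0 + M) (w * (subst2 a P Q * dx2 P + subst2 b P Q * dx2 Q)) (1 * (subst2 a P\<^sub>0 vary * 1 + 0))"
      by simp
    have ln: "1 \<le> l * n" using mult_le_mono[OF l n] by simp
    have ln': "r * (l * n - 1) + r = r * (l * n)"
      using ln by (metis le_add_diff_inverse2 distrib_left mult.right_neutral)
    have "r * (l * n - 1) + 1 * (r + 1) = r * (l * n) + 1" using ln' by simp
    hence lt: "int (r * (l * n - 1) + 1 * (r + 1)) < 0 + M + 1" unfolding M_def by linarith
    have "cf (fst \<eta>) (l * n - 1) (r + 1) = cf (subst2 a P\<^sub>0 vary) (l * n - 1) (r + 1)"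
      using approxD[OF h lt] by (simp add: \<eta>[symmetric] a_def[symmetric] b_def[symmetric])
    \<comment> \<open>Only two monomials of \<open>a\<close> contribute: x^(l n) y, through the
      linear term in \<open>\<gamma>\<close>, and the monomial itself. Higher powers of
      \<open>\<gamma>\<close> would bring at least y^(2 r), and 2 r > r + 1 as r >= 2.\<close>
    also have "\<dots> = (\<Sum>p\<le>l * n - 1 + (r + 1). \<Sum>q\<le>l * n - 1 + (r + 1).
        (if p = l * n then (if q = 1 then cf a (l * n) 1 * (of_nat (l * n) * \<gamma>) else 0) else 0) +
        (if p = l * n - 1 then (if q = r + 1 then cf a (l * n - 1) (r + 1) else 0) else 0))"
      unfolding cf_subst2
    proof (intro sum.cong refl)
      fix p q
      have c: "cf (P\<^sub>0 ^ p * vary ^ q) (l * n - 1) (r + 1) = (if q \<le> r + 1 then cf (P\<^sub>0 ^ p) (l * n - 1) (r + 1 - q) else 0)"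
        using cf_mon_mult[of 0 q "P\<^sub>0 ^ p" "l * n - 1" "r + 1"] by (simp add: mon_def mult.commute)
      have "cf (P\<^sub>0 ^ p * vary ^ q) (l * n - 1) (r + 1) = (if p = l * n \<and> q = 1 then of_nat (l * n) * \<gamma> else
          if p = l * n - 1 \<and> q = r + 1 then 1 else 0)"
      proof (cases "l * n - 1 \<le> p \<and> q \<le> r + 1")
        case True
        then obtain t where t: "p = l * n - 1 + t" using le_Suc_ex by blast
        have c2: "cf (P\<^sub>0 ^ p * vary ^ q) (l * n - 1) (r + 1) =
          (if r + 1 - q = r * t then of_nat (p choose (l * n - 1)) * \<gamma> ^ t else 0)"
          unfolding c unfolding P\<^sub>0_def cf_binomial using True t by simp
        consider "t = 0" | "t = 1" | "t \<ge> 2" by linarith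
        thus ?thesis
        proof cases
          case 3
          have "r * 2 \<le> r * t" using 3 by (rule mult_le_mono2)
          hence "r + 1 - q \<noteq> r * t" using r by linarith
          moreover have "p \<noteq> l * n" "p \<noteq> l * n - 1" using t 3 ln by linarith+
          ultimately show ?thesis unfolding c2 by simp
        next
          case 2
          hence p: "p = l * n" using t ln by linarith
          hence "p choose (l * n - 1) = l * n" using ln binomial_symmetric[of 1 "l * n"] by (simp add: choose_one)
          moreover have "r + 1 - q = r * t \<longleftrightarrow> q = 1" using 2 True by auto
          moreover have "p \<noteq> l * n - 1" using p ln by linarith
          ultimately show ?thesis unfolding c2 using p 2 by simp
        next
          case 1
          hence p: "p = l * n - 1" using t by simp
          moreover have "p \<noteq> l * n" using p ln by linarith
          moreover have "r + 1 - q = r * t \<longleftrightarrow> q = r + 1" using 1 True by auto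
          ultimately show ?thesis unfolding c2 using 1 by simp
        qed
      next
        case False
        hence "\<not> (p = l * n \<and> q = 1)" "\<not> (p = l * n - 1 \<and> q = r + 1)" using ln by auto
        moreover have "cf (P\<^sub>0 ^ p * vary ^ q) (l * n - 1) (r + 1) = 0"
          unfolding c unfolding P\<^sub>0_def cf_binomial using False by auto
        ultimately show ?thesis by (simp only: if_False)
      qed
      thus "cf a p q * cf (P\<^sub>0 ^ p * vary ^ q) (l * n - 1) (r + 1) =
        (if p = l * n then (if q = 1 then cf a (l * n) 1 * (of_nat (l * n) * \<gamma>) else 0) else 0) +
        (if p = l * n - 1 then (if q = r + 1 then cf a (l * n - 1) (r + 1) else 0) else 0)"
        using ln by auto
    qed
    also have "\<dots> = cf a (l * n) 1 * (of_nat (l * n) * \<gamma>) + cf a (l * n - 1) (r + 1)"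
    proof -
      have "(\<Sum>q\<le>l * n - 1 + (r + 1).
        (if p = l * n then (if q = 1 then cf a (l * n) 1 * (of_nat (l * n) * \<gamma>) else 0) else 0) +
        (if p = l * n - 1 then (if q = r + 1 then cf a (l * n - 1) (r + 1) else 0) else 0)) =
        (if p = l * n then cf a (l * n) 1 * (of_nat (l * n) * \<gamma>) else 0) +
        (if p = l * n - 1 then cf a (l * n - 1) (r + 1) else 0)" for p
        using r ln by (auto simp: sum.distrib)
      thus ?thesis using ln by (simp add: sum.distrib)
    qed
    finally have "cf (fst \<eta>) (l * n - 1) (r + 1) = cf a (l * n) 1 * (of_nat (l * n) * \<gamma>) + cf a (l * n - 1) (r + 1)" .
    \<comment> \<open>Since l r <= k, the monomial has a weight in which the two forms are known to
      coincide.\<close>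
    moreover have "k * (l * n - 1) + l * (r + 1) \<le> k * l * n + l"
    proof -
      have "k * (l * n - 1) + k = k * (l * n)" using ln by (metis le_add_diff_inverse2 distrib_left mult.right_neutral)
      thus ?thesis using lr by (simp add: algebra_simps)
    qed
    hence "cf (fst \<eta>) (l * n - 1) (r + 1) = cf a (l * n - 1) (r + 1)" unfolding a_def by (rule eq)
    ultimately have "cf a (l * n) 1 * (of_nat (l * n) * \<gamma>) = 0" by simp
    thus False using A0 \<gamma> l n by (auto simp: a_def)
  qed
qed

subsection \<open>Exchanging the variables\<close>

definition sw :: "series2 \<Rightarrow> series2" where
  "sw F = fps2 (\<lambda>i j. cf F j i)"

lemma cf_sw [simp]: "cf (sw F) i j = cf F j i"
  by (simp add: sw_def)

lemma sw_add: "sw (F + G) = sw F + sw G" and sw_mult: "sw (F * G) = sw F * sw G"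
  by (rule series2_eqI, simp) (rule series2_eqI, simp add: cf_mult, rule sum.swap)

lemma sw_power: "sw (F ^ m) = sw F ^ m"
proof (induction m)
  case 0
  show ?case by (rule series2_eqI) (simp add: cf_1)
qed (simp add: sw_mult)

lemma sw_subst2: "subst2 (sw F) (sw Q) (sw P) = sw (subst2 F P Q)"
proof (rule series2_eqI)
  fix i j
  have "cf (sw Q ^ p * sw P ^ q) i j = cf (P ^ q * Q ^ p) j i" for p q
    unfolding sw_power[symmetric] sw_mult[symmetric] by (simp add: mult.commute)
  thus "cf (subst2 (sw F) (sw Q) (sw P)) i j = cf (sw (subst2 F P Q)) i j"
    unfolding cf_sw cf_subst2 by (subst sum.swap) (simp add: add.commute)
qed

lemma sw_deriv: "dx2 (sw F) = sw (dy2 F)" "dy2 (sw F) = sw (dx2 F)"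
  by (rule series2_eqI; simp)+

definition swf :: "form2 \<Rightarrow> form2" where "swf \<omega> = (sw (snd \<omega>), sw (fst \<omega>))"

text \<open>Transfers the statement about the axis x = 0 to the axis y = 0.\<close>

lemma swf_pullback: "smul (sw w) (pullback (sw Q, sw P) (swf \<omega>)) = swf (smul w (pullback (P, Q) \<omega>))"
  by (rule prod_eqI) (simp_all add: swf_def sw_subst2 sw_deriv sw_mult sw_add add.commute)

lemma wge_sw: "wge a b m F \<Longrightarrow> wge b a m (sw F)"
  by (auto simp: wge_def add.commute)

context homological
begin

text \<open>Divisibility of P by x and of Q by y turns strictness, a condition on the ordinary
  degree, into closeness to the identity in the weights (k, l). For x = 0 the pair (1, -r) enters
  \<open>irr_n\<close>; for y = 0 the pair (r, -1) enters \<open>irr_0\<close>.\<close>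

lemma strict_axes:
  assumes \<omega>: "wgef k l (int d + 1) (\<omega> - wd)" "axes_invariant \<omega>"
    and \<eta>: "wgef k l (int d + 1) (\<eta> - wd)" "axes_invariant \<eta>"
    and st: "strict P Q w" and eq: "smul w (pullback (P, Q) \<omega>) = \<eta>"
  shows "\<exists>P' Q'. P = varx * P' \<and> Q = vary * Q' \<and> wge k l 1 (P' - 1) \<and> wge k l 1 (Q' - 1) \<and> wge k l 1 (w - 1)"
proof -
  have w\<omega>: "wgef k l (int (k * l * n + k + l)) \<omega>"
    using wgef_\<omega>[OF \<omega>] by (simp add: d_def N_def)
  have low: "cf (fst \<theta>) i j = cf (fst wd) i j" "cf (snd \<theta>) i' j' = cf (snd wd) i' j'"
    if "wgef k l (int d + 1) (\<theta> - wd)" "k * i + l * j \<le> N + l" "k * i' + l * j' \<le> N + k" for \<theta> i j i' j'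
  proof -
    have "wge k l (int d + 1 - int k) (fst \<theta> - fst wd)" "wge k l (int d + 1 - int l) (snd \<theta> - snd wd)"
      using that(1) by (simp_all add: wgef_def)
    note w = this
    have lt: "int (k * i + l * j) < int d + 1 - int k" "int (k * i' + l * j') < int d + 1 - int l"
      using that(2,3) unfolding d_def by linarith+
    show "cf (fst \<theta>) i j = cf (fst wd) i j" "cf (snd \<theta>) i' j' = cf (snd wd) i' j'"
      using wgeD[OF w(1) lt(1)] wgeD[OF w(2) lt(2)] by simp_all
  qed
  have cw: "cf (fst wd) (l * n) 1 = al 0" "cf (fst wd) 0 (k * n + 1) = al n"
    "cf (snd wd) 1 (k * n) = be n" "cf (snd wd) (l * n + 1) 0 = be 0"
    using cf_hs[of 0 al] cf_hs[of n al] cf_hs[of 0 be] cf_hs[of n be]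
    by (simp_all add: wd_def cf_vary_mult cf_varx_mult One_nat_def)
  have N: "k * (l * n) = N" "l * (k * n) = N" by (simp_all add: N_def)
  have cfs: "cf (fst \<omega>) (l * n) 1 = al 0" "cf (fst \<omega>) 0 (k * n + 1) = al n"
    "cf (snd \<omega>) 1 (k * n) = be n" "cf (snd \<omega>) (l * n + 1) 0 = be 0"
    using low[OF \<omega>(1), of "l * n" 1 1 "k * n"] low[OF \<omega>(1), of 0 "k * n + 1" "l * n + 1" 0] cw N
    by (simp_all add: distrib_left)
  have P0: "cf P 0 j = 0" for j
  proof (rule axis_preserved[OF k l n \<omega>(2) \<eta>(2) w\<omega> _ _ _ st eq])
    show "cf (fst \<eta>) i j = cf (fst \<omega>) i j" if "k * i + l * j \<le> k * l * n + l" for i j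
      using low(1)[OF \<omega>(1), of i j 0 0] low(1)[OF \<eta>(1), of i j 0 0] that by (simp add: N_def)
    show "cf (fst \<omega>) (l * n) 1 \<noteq> 0" using irr_0[of 0 1] l by (simp add: cfs)
    show "of_nat r * cf (fst \<omega>) 0 (k * n + 1) + cf (snd \<omega>) 1 (k * n) \<noteq> 0" if "k < l * r" for r
    proof -
      have "int k * 1 + int l * (- int r) \<noteq> 0" using that
        by (metis add.right_neutral diff_add_cancel less_irrefl mult.right_neutral mult_minus_right of_nat_eq_iff of_nat_mult uminus_add_conv_diff add.commute)
      from irr_n[OF this] show ?thesis unfolding cfs by (simp add: eq_neg_iff_add_eq_0 mult.commute add.commute)
    qed
  qed
  have Q0: "cf (sw Q) 0 j = 0" for j
  proof (rule axis_preserved[OF l k n, where \<omega> = "swf \<omega>" and \<eta> = "swf \<eta>" and Q = "sw P" and w = "sw w"])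
    show "axes_invariant (swf \<omega>)" "axes_invariant (swf \<eta>)"
      using \<omega>(2) \<eta>(2) by (auto simp: axes_invariant_def swf_def)
    show "wgef l k (int (l * k * n + l + k)) (swf \<omega>)"
      using w\<omega> by (auto simp: wgef_def swf_def algebra_simps dest: wge_sw)
    show "cf (fst (swf \<eta>)) i j = cf (fst (swf \<omega>)) i j" if "l * i + k * j \<le> l * k * n + k" for i j
      using low(2)[OF \<omega>(1), of 0 0 j i] low(2)[OF \<eta>(1), of 0 0 j i] that by (simp add: N_def swf_def algebra_simps)
    show "cf (fst (swf \<omega>)) (k * n) 1 \<noteq> 0" using irr_n[of 1 0] k by (simp add: cfs swf_def)
    show "of_nat r * cf (fst (swf \<omega>)) 0 (l * n + 1) + cf (snd (swf \<omega>)) 1 (l * n) \<noteq> 0" if "l < k * r" for r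
    proof -
      have "int k * int r + int l * (- 1) \<noteq> 0" using that
        by (metis add.right_neutral diff_add_cancel less_irrefl mult.right_neutral mult_minus_right of_nat_eq_iff of_nat_mult uminus_add_conv_diff add.commute)
      from irr_0[OF this] have "of_nat r * be 0 + al 0 \<noteq> 0" by (simp add: eq_neg_iff_add_eq_0 mult.commute)
      thus ?thesis by (simp add: cfs swf_def)
    qed
    show "strict (sw Q) (sw P) (sw w)" using st by (simp add: strict_def)
    show "smul (sw w) (pullback (sw Q, sw P) (swf \<omega>)) = swf \<eta>" by (simp add: swf_pullback eq)
  qed
  define P' where "P' = fps2 (\<lambda>i j. cf P (Suc i) j)"
  define Q' where "Q' = fps2 (\<lambda>i j. cf Q i (Suc j))"
  have P': "P = varx * P'"
    by (rule series2_eqI) (use P0 in \<open>auto simp: P'_def cf_varx_mult gr0_conv_Suc One_nat_def\<close>)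
  have Q': "Q = vary * Q'"
    by (rule series2_eqI) (use Q0 in \<open>auto simp: Q'_def cf_vary_mult gr0_conv_Suc One_nat_def\<close>)
  have one: "wge k l 1 (F - 1)" if "cf F 0 0 = 1" for F
  proof (rule wgeI)
    fix i j assume "cf (F - 1) i j \<noteq> 0"
    hence "i \<noteq> 0 \<or> j \<noteq> 0" using that by (cases "i = 0"; cases "j = 0") (auto simp: cf_1)
    hence "0 < k * i + l * j" using k l by auto
    thus "1 \<le> int (k * i + l * j)" by linarith
  qed
  have "cf P' 0 0 = 1" "cf Q' 0 0 = 1" "cf w 0 0 = 1"
    using st by (auto simp: strict_def P'_def Q'_def One_nat_def)
  thus ?thesis using P' Q' one by blast
qed

end

section \<open>Uniqueness of the normal form\<close>

lemma series2_unit: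
  assumes "cf U 0 0 \<noteq> 0"
  shows "\<exists>V. V * U = 1"
proof -
  have "inverse (fps_nth U 0) * fps_nth U 0 = 1"
    using assms by (intro inverse_mult_eq_1) (simp add: cf_def)
  from fps_left_inverse[OF this] show ?thesis by blast
qed

lemma wge_varx_multD: "wge k l (int k + c) (varx * F) \<Longrightarrow> wge k l c F"
proof (rule wgeI)
  fix i j assume "wge k l (int k + c) (varx * F)" "cf F i j \<noteq> 0"
  hence "int k + c \<le> int (k * Suc i + l * j)"
    unfolding wge_def by (metis cf_varx_mult diff_Suc_Suc diff_zero nat.distinct(1) One_nat_def)
  thus "c \<le> int (k * i + l * j)" by simp
qed

lemma wge_vary_multD: "wge k l (int l + c) (vary * F) \<Longrightarrow> wge k l c F"
proof (rule wgeI)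
  fix i j assume "wge k l (int l + c) (vary * F)" "cf F i j \<noteq> 0"
  hence "int l + c \<le> int (k * i + l * Suc j)"
    unfolding wge_def by (metis cf_vary_mult diff_Suc_Suc diff_zero nat.distinct(1) One_nat_def)
  thus "c \<le> int (k * i + l * j)" by simp
qed

definition hp :: "nat \<Rightarrow> nat \<Rightarrow> nat \<Rightarrow> series2 \<Rightarrow> series2" where
  "hp k l m F = fps2 (\<lambda>i j. if k * i + l * j = m then cf F i j else 0)"

lemma homog_hp: "homog k l m (hp k l m F)"
  by (simp add: homog_def hp_def)

lemma hp_diff: "wge k l (int m) F \<Longrightarrow> wge k l (int m + 1) (F - hp k l m F)"
proof (rule wgeI)
  fix i j assume F: "wge k l (int m) F" and nz: "cf (F - hp k l m F) i j \<noteq> 0"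
  hence "cf F i j \<noteq> 0" "k * i + l * j \<noteq> m" by (auto simp: hp_def split: if_splits)
  moreover have "int m \<le> int (k * i + l * j)" using F \<open>cf F i j \<noteq> 0\<close> unfolding wge_def by blast
  ultimately show "int m + 1 \<le> int (k * i + l * j)" by linarith
qed

context homological
begin

context
  fixes \<omega> :: form2
  assumes \<omega>: "wgef k l (int d + 1) (\<omega> - wd)" and ax: "axes_invariant \<omega>"
begin

definition brings_to :: "series2 \<Rightarrow> series2 \<Rightarrow> series2 \<Rightarrow> form2 \<Rightarrow> bool" where
  "brings_to P Q w \<eta> \<longleftrightarrow> wge k l 1 (P - 1) \<and> wge k l 1 (Q - 1) \<and> wge k l 1 (w - 1) \<and>
     smul w (pullback (varx * P, vary * Q) \<omega>) = \<eta>"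

definition agree :: "nat \<Rightarrow> series2 \<Rightarrow> series2 \<Rightarrow> series2 \<Rightarrow> series2 \<Rightarrow> series2 \<Rightarrow> series2 \<Rightarrow> bool" where
  "agree m P Q w P' Q' w' \<longleftrightarrow> wge k l (int m) (P' - P) \<and> wge k l (int m) (Q' - Q) \<and> wge k l (int m) (w' - w)"

text \<open>In weight d + M the two forms differ by \<open>lie\<close> of the leading discrepancy,
  and a difference of normal forms is normal. So \<open>homological_unique\<close> applies to the
  discrepancy: it is tangent to the foliation and invisible in the forms.\<close>

lemma agree_step:
  assumes b: "brings_to P Q w \<eta>" "brings_to P' Q' w' \<eta>'" and M: "M \<ge> 1"
    and a: "agree M P Q w P' Q' w'"
    and nf: "nf k l n (\<eta> - wd)" "nf k l n (\<eta>' - wd)"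
  shows "wgef k l (int d + int M + 1) (\<eta>' - \<eta>)"
    "\<exists>g. (\<forall>i j. cf g i j \<noteq> 0 \<longrightarrow> k * i + l * j + N = M) \<and>
      wge k l (int k + int M + 1) (varx * P' - varx * P + g * snd wd) \<and>
      wge k l (int l + int M + 1) (vary * Q' - vary * Q - g * fst wd) \<and>
      wge k l (int M + 1) (w' - w - g * curl wd)"
proof -
  have PQ: "wge k l 1 (P - 1)" "wge k l 1 (Q - 1)" "wge k l 1 (w - 1)"
    and \<eta>: "smul w (pullback (varx * P, vary * Q) \<omega>) = \<eta>" "smul w' (pullback (varx * P', vary * Q') \<omega>) = \<eta>'"
    using b by (auto simp: brings_to_def)
  have W: "wge k l (int M) (P' - P)" "wge k l (int M) (Q' - Q)" "wge k l (int M) (w' - w)"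
    using a by (auto simp: agree_def)
  define p where "p = hp k l M (P' - P)"
  define q where "q = hp k l M (Q' - Q)"
  define v where "v = hp k l M (w' - w)"
  have h: "homog k l M p" "homog k l M q" "homog k l M v"
    unfolding p_def q_def v_def by (rule homog_hp)+
  have W1: "wge k l (int M + 1) (P' - P - p)" "wge k l (int M + 1) (Q' - Q - q)" "wge k l (int M + 1) (w' - w - v)"
    unfolding p_def q_def v_def by (rule hp_diff[OF W(1)] hp_diff[OF W(2)] hp_diff[OF W(3)])+
  have 1: "wgef k l (int d + int M + 1) (\<eta>' - \<eta> - lie wd (varx * P' - varx * P) (vary * Q' - vary * Q) (w' - w))"
    unfolding \<eta>[symmetric]
    by (rule pullback_pert[OF k l _ near_id_stage[OF \<omega> ax PQ] close_stage[OF \<omega> ax W] wgef_\<omega>[OF \<omega> ax] \<omega>]) (use M in simp)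
  have x1: "varx * P' - varx * P - varx * p = varx * (P' - P - p)"
    "vary * Q' - vary * Q - vary * q = vary * (Q' - Q - q)" by (simp_all add: algebra_simps)
  have x2: "wge k l (int k + (int M + 1)) (varx * P' - varx * P - varx * p)"
    "wge k l (int l + (int M + 1)) (vary * Q' - vary * Q - vary * q)"
    unfolding x1 using wge_mult[OF wge_varx[OF \<omega> ax] W1(1)] wge_mult[OF wge_vary[OF \<omega> ax] W1(2)] by simp_all
  hence "close k l (int M + 1) (varx * P' - varx * P - varx * p) (vary * Q' - vary * Q - vary * q) (w' - w - v)"
    using W1(3) by (simp add: close_def)
  from wgef_lie[OF wgef_wd this]
  have 2: "wgef k l (int d + int M + 1) (lie wd (varx * P' - varx * P) (vary * Q' - vary * Q) (w' - w) - lie wd (varx * p) (vary * q) v)"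
    by (simp add: lie_diff add.assoc)
  define \<Lambda> where "\<Lambda> = lie wd (varx * p) (vary * q) v"
  have 3: "wgef k l (int d + int M + 1) (\<eta>' - \<eta> - \<Lambda>)" using wgef_add[OF 1 2] by (simp add: \<Lambda>_def)
  have "homogf k l (M + d) \<Lambda>" unfolding \<Lambda>_def
    using homog_mult[OF homog_varx[of k l] h(1)] homog_mult[OF homog_vary[of k l] h(2)] h(3)
    by (intro homogf_lie) (simp_all add: add.commute)
  hence "form_part k l (M + d) \<Lambda> = \<Lambda>" by (rule form_part_homogf)
  moreover have "form_part k l (M + d) (\<eta>' - \<eta>) = form_part k l (M + d) \<Lambda>"
    by (rule form_part_eq[OF 3]) simp
  moreover have "nf k l n (\<eta>' - \<eta>)" using nf_diff[OF nf(2,1)] by simp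
  hence "nf k l n (form_part k l (M + d) (\<eta>' - \<eta>))" by (rule nf_form_part)
  ultimately have "nf k l n \<Lambda>" by simp
  from homological_unique[OF M h this[unfolded \<Lambda>_def]] obtain g where
    L: "\<Lambda> = 0" and g: "\<And>i j. cf g i j \<noteq> 0 \<Longrightarrow> k * i + l * j + N = M"
    "varx * p = - (g * snd wd)" "vary * q = g * fst wd" "v = g * curl wd" unfolding \<Lambda>_def by blast
  show "wgef k l (int d + int M + 1) (\<eta>' - \<eta>)" using 3 L by simp
  show "\<exists>g. (\<forall>i j. cf g i j \<noteq> 0 \<longrightarrow> k * i + l * j + N = M) \<and>
      wge k l (int k + int M + 1) (varx * P' - varx * P + g * snd wd) \<and>
      wge k l (int l + int M + 1) (vary * Q' - vary * Q - g * fst wd) \<and>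
      wge k l (int M + 1) (w' - w - g * curl wd)"
    using x2 W1(3) g by (intro exI[of _ g]) (simp add: add.assoc)
qed

lemma order_\<omega>: "wge 1 1 2 (fst \<omega>)" "wge 1 1 2 (snd \<omega>)"
proof -
  have N: "N \<ge> 1" unfolding N_def using mult_le_mono[OF mult_le_mono[OF k l] n] by simp
  have w: "wge k l (int d - int k) (fst \<omega>)" "wge k l (int d - int l) (snd \<omega>)"
    using wgef_\<omega>[OF \<omega> ax] by (auto simp: wgef_def)
  show "wge 1 1 2 (fst \<omega>)"
  proof (rule wgeI, rule ccontr)
    fix i j assume nz: "cf (fst \<omega>) i j \<noteq> 0" and lt: "\<not> 2 \<le> int (1 * i + 1 * j)"
    have "j \<noteq> 0" using nz ax by (auto simp: axes_invariant_def intro: Nat.gr0I)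
    hence "i = 0" "j = 1" using lt by auto
    moreover have "int d - int k \<le> int (k * i + l * j)" using w(1) nz unfolding wge_def by blast
    ultimately show False using N by (simp add: d_def)
  qed
  show "wge 1 1 2 (snd \<omega>)"
  proof (rule wgeI, rule ccontr)
    fix i j assume nz: "cf (snd \<omega>) i j \<noteq> 0" and lt: "\<not> 2 \<le> int (1 * i + 1 * j)"
    have "i \<noteq> 0" using nz ax by (auto simp: axes_invariant_def intro: Nat.gr0I)
    hence "j = 0" "i = 1" using lt by auto
    moreover have "int d - int l \<le> int (k * i + l * j)" using w(2) nz unfolding wge_def by blast
    ultimately show False using N by (simp add: d_def)
  qed
qed

text \<open>Composing the second equivalence with the flow of the tangent field g (b, -a) cancels
  the discrepancy in weight M. The flow multiplies the form by a unit only, which is compensated in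
  the factor, so the target \<open>\<eta>'\<close> stays the same.\<close>

lemma improve_agreement:
  assumes b: "brings_to P Q w \<eta>" "brings_to P' Q' w' \<eta>'" and M: "M \<ge> 1"
    and a: "agree M P Q w P' Q' w'"
    and \<eta>: "\<eta> \<in> normal_forms k l n wd" "\<eta>' \<in> normal_forms k l n wd"
  shows "\<exists>P' Q' w'. brings_to P' Q' w' \<eta>' \<and> agree (Suc M) P Q w P' Q' w'"
proof -
  have nf: "nf k l n (\<eta> - wd)" "nf k l n (\<eta>' - wd)" "wgef k l (int d + 1) (\<eta>' - wd)"
    using \<eta> normal_forms_imp by blast+
  obtain g where g: "\<And>i j. cf g i j \<noteq> 0 \<Longrightarrow> k * i + l * j + N = M"
    "wge k l (int k + int M + 1) (varx * P' - varx * P + g * snd wd)"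
    "wge k l (int l + int M + 1) (vary * Q' - vary * Q - g * fst wd)"
    using agree_step(2)[OF b M a nf(1,2)] by blast
  have wg: "wge k l (int M - int N) g"
  proof (rule wgeI)
    fix i j assume "cf g i j \<noteq> 0"
    hence "k * i + l * j + N = M" by (rule g(1))
    thus "int M - int N \<le> int (k * i + l * j)" by linarith
  qed
  have w\<omega>: "wge k l (int d - int k) (fst \<omega>)" "wge k l (int d - int l) (snd \<omega>)"
    using wgef_\<omega>[OF \<omega> ax] by (auto simp: wgef_def)
  have w\<omega>d: "wge k l (int d + 1 - int k) (fst \<omega> - fst wd)" "wge k l (int d + 1 - int l) (snd \<omega> - snd wd)"
    using \<omega> by (auto simp: wgef_def)
  have ga: "wge k l (int l + int M) (g * fst \<omega>)" and gb: "wge k l (int k + int M) (g * snd \<omega>)"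
    by (rule wge_multI[OF wg w\<omega>(1)], simp add: d_def, rule wge_multI[OF wg w\<omega>(2)], simp add: d_def)
  have "wge k l (int N) (curl \<omega>)"
    using wge_dx2[OF w\<omega>(2)] wge_dy2[OF w\<omega>(1)] unfolding curl_def by (intro wge_diff) (simp_all add: d_def)
  from wge_multI[OF wg this, of "int M"] have gc: "wge k l (int M) (g * curl \<omega>)" by simp
  obtain A B U where U: "pullback (A, B) \<omega> = smul U \<omega>" "wge 1 1 2 (A - varx)" "wge 1 1 2 (B - vary)"
     "wge k l (int M) (U - 1)" "wge k l (int k + int M + 1) (A - varx - g * snd \<omega>)"
     "wge k l (int l + int M + 1) (B - vary + g * fst \<omega>)"
    using tangent_flow[OF order_\<omega> k l _ gb ga gc] M by auto
  have cA: "cf A 0 0 = 0" "cf B 0 0 = 0"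
    using wgeD[OF U(2), of 0 0] wgeD[OF U(3), of 0 0] by (simp_all add: cf_varx cf_vary)
  have U0: "cf U 0 0 = 1" using wgeD[OF U(4), of 0 0] M by (simp add: cf_1)
  obtain V where V: "V * U = 1" using series2_unit[of U] U0 by auto
  have V0: "cf V 0 0 = 1" using arg_cong[OF V, of "\<lambda>F. cf F 0 0"] U0 by (simp add: cf_1)
  have "V - 1 = V * - (U - 1)" using V by (simp add: algebra_simps)
  hence wV: "wge k l (int M) (V - 1)"
    using wge_mult[OF wge_trivial[of 0 k l V] wge_uminus[OF U(4)]] by simp
  have b': "wge k l 1 (P' - 1)" "wge k l 1 (Q' - 1)" "wge k l 1 (w' - 1)"
    "smul w' (pullback (varx * P', vary * Q') \<omega>) = \<eta>'"
    using b(2) by (auto simp: brings_to_def)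
  define X where "X = varx * P'"
  define Y where "Y = vary * Q'"
  have c: "cf X 0 0 = 0" "cf Y 0 0 = 0" by (simp_all add: X_def Y_def cf_varx cf_vary)
  have n1: "wge k l (int k + 1) (X - varx)" "wge k l (int l + 1) (Y - vary)"
    using near_id_stage[OF \<omega> ax b'(1-3)] by (simp_all add: near_id_def X_def Y_def)
  have XY: "wge k l (int k) X" "wge k l (int l) Y"
    using wge_add[OF wge_mono[OF n1(1), of "int k"] wge_varx[OF \<omega> ax]] wge_add[OF wge_mono[OF n1(2), of "int l"] wge_vary[OF \<omega> ax]]
    by simp_all
  define A3 where "A3 = subst2 A X Y"
  define B3 where "B3 = subst2 B X Y"
  \<comment> \<open>The unit produced by the flow is transported to the new coordinates and divided
    out.\<close>
  define w3 where "w3 = w' * subst2 V X Y"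
  have one: "cf P' 0 0 = 1" "cf Q' 0 0 = 1" "cf w' 0 0 = 1"
    using wgeD[OF b'(1), of 0 0] wgeD[OF b'(2), of 0 0] wgeD[OF b'(3), of 0 0] by (simp_all add: cf_1)
  have "pullback (A3, B3) \<omega> = pullback (X, Y) (pullback (A, B) \<omega>)"
    unfolding A3_def B3_def by (rule pullback_compose[OF cA c, symmetric])
  also have "\<dots> = smul (subst2 U X Y) (pullback (X, Y) \<omega>)" unfolding U(1) by (rule pullback_smul[OF c])
  finally have "smul w3 (pullback (A3, B3) \<omega>) = smul (w' * (subst2 V X Y * subst2 U X Y)) (pullback (X, Y) \<omega>)"
    by (simp add: smul_smul w3_def mult.assoc)
  also have "\<dots> = \<eta>'" unfolding subst2_mult[OF c, symmetric] V using b'(4) by (simp add: X_def Y_def subst2_1[OF c[unfolded X_def Y_def]])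
  finally have eq3: "smul w3 (pullback (A3, B3) \<omega>) = \<eta>'" .
  have A3: "A3 - X = subst2 (A - varx) X Y" "B3 - Y = subst2 (B - vary) X Y"
    by (simp_all add: A3_def B3_def subst2_diff[OF c] subst2_varx[OF c] subst2_vary[OF c])
  have "wge 1 1 2 (A3 - X)" "wge 1 1 2 (B3 - Y)"
    unfolding A3 using wge_const_free[OF c(1)] wge_const_free[OF c(2)] U(2,3) by (auto intro!: wge_subst2)
  hence low: "cf A3 i j = cf X i j" "cf B3 i j = cf Y i j" if "i + j \<le> 1" for i j
    using that wgeD[of 1 1 2 "A3 - X" i j] wgeD[of 1 1 2 "B3 - Y" i j] by simp_all
  have "strict A3 B3 w3"
    unfolding strict_def using low[of 0 0] low[of 1 0] low[of 0 1] one V0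
    by (simp add: X_def Y_def cf_varx_mult cf_vary_mult cf_varx cf_vary w3_def)
  \<comment> \<open>The composite is not visibly divisible by x and y. It is strict, because the
    flow starts in order two, and strict equivalences preserve the axes.\<close>
  from strict_axes[OF \<omega> ax nf(3) _ this eq3]
  obtain P3 Q3 where P3: "A3 = varx * P3" "B3 = vary * Q3" "wge k l 1 (P3 - 1)" "wge k l 1 (Q3 - 1)" "wge k l 1 (w3 - 1)"
    using axes_invariant_add[OF _ axes_invariant_wd, of "\<eta>' - wd"] nf(2) by (auto simp: nf_def)
  have b3: "brings_to P3 Q3 w3 \<eta>'" using P3 eq3 by (simp add: brings_to_def)
  have "wge k l (int k + int M + 1) (subst2 (A - varx - g * snd \<omega>) X Y)" "wge k l (int l + int M + 1) (subst2 (B - vary + g * fst \<omega>) X Y)"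
    by (intro wge_subst2 XY U)+
  moreover have "wge k l (int k + int M + 1) (subst2 (g * snd \<omega>) X Y - g * snd \<omega>)"
    "wge k l (int l + int M + 1) (subst2 (g * fst \<omega>) X Y - g * fst \<omega>)"
    by (rule subst2_initial[OF k l n1 gb] subst2_initial[OF k l n1 ga])+
  moreover have "wge k l (int k + int M + 1) (g * (snd \<omega> - snd wd))" "wge k l (int l + int M + 1) (g * (fst \<omega> - fst wd))"
    by (rule wge_multI[OF wg w\<omega>d(2)], simp add: d_def, rule wge_multI[OF wg w\<omega>d(1)], simp add: d_def)
  ultimately have "wge k l (int k + int M + 1) (subst2 (A - varx - g * snd \<omega>) X Y + (subst2 (g * snd \<omega>) X Y - g * snd \<omega>) +
       g * (snd \<omega> - snd wd) + (X - varx * P + g * snd wd))"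
    "wge k l (int l + int M + 1) (subst2 (B - vary + g * fst \<omega>) X Y - (subst2 (g * fst \<omega>) X Y - g * fst \<omega>) -
       g * (fst \<omega> - fst wd) + (Y - vary * Q - g * fst wd))"
    using g(2,3) by (auto intro!: wge_add wge_diff simp: X_def Y_def)
  moreover have "subst2 (A - varx - g * snd \<omega>) X Y + (subst2 (g * snd \<omega>) X Y - g * snd \<omega>) +
       g * (snd \<omega> - snd wd) + (X - varx * P + g * snd wd) = varx * P3 - varx * P"
    "subst2 (B - vary + g * fst \<omega>) X Y - (subst2 (g * fst \<omega>) X Y - g * fst \<omega>) -
       g * (fst \<omega> - fst wd) + (Y - vary * Q - g * fst wd) = vary * Q3 - vary * Q"
    unfolding P3(1,2)[symmetric] A3_def B3_def
    by (simp_all add: subst2_diff[OF c] subst2_add[OF c] subst2_varx[OF c] subst2_vary[OF c] algebra_simps)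
  ultimately have d3: "wge k l (int k + int M + 1) (varx * P3 - varx * P)" "wge k l (int l + int M + 1) (vary * Q3 - vary * Q)"
    by simp_all
  hence PP: "wge k l (int (Suc M)) (P3 - P)" "wge k l (int (Suc M)) (Q3 - Q)"
    using wge_varx_multD[of k l "int (Suc M)" "P3 - P"] wge_vary_multD[of k l "int (Suc M)" "Q3 - Q"]
    by (simp_all add: right_diff_distrib algebra_simps)
  have "wge k l (int M) (subst2 (V - 1) X Y)" by (intro wge_subst2 XY wV)
  from wge_mult[OF wge_trivial[of 0 k l w'] this] have "wge k l (int M) (w3 - w')"
    by (simp add: w3_def subst2_diff[OF c] subst2_1[OF c] algebra_simps)
  hence "wge k l (int M) (w3 - w)" using a wge_add[of k l "int M" "w3 - w'" "w' - w"] by (simp add: agree_def)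
  hence a3: "agree M P Q w P3 Q3 w3"
    using PP[THEN wge_mono, of "int M"] by (simp add: agree_def)
  \<comment> \<open>The discrepancy of the factors is not computed. A second use of
    \<open>agree_step\<close> expresses it through some \<open>g3\<close>, and the agreement already
    gained in the first coordinate forces \<open>g3 * snd wd\<close> = 0.\<close>
  obtain g3 where g3: "\<And>i j. cf g3 i j \<noteq> 0 \<Longrightarrow> k * i + l * j + N = M"
    "wge k l (int k + int M + 1) (varx * P3 - varx * P + g3 * snd wd)"
    "wge k l (int M + 1) (w3 - w - g3 * curl wd)"
    using agree_step(2)[OF b(1) b3 M a3 nf(1,2)] by blast
  have "g3 = 0"
  proof (rule ccontr)
    assume "g3 \<noteq> 0"
    then obtain i j where "cf g3 i j \<noteq> 0" using series2_eqI[of g3 0] by auto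
    hence "N \<le> M" using g3(1) by fastforce
    hence "homog k l (M - N) g3" using g3(1) unfolding homog_def by fastforce
    from homog_mult[OF this homog_wd(2)] have h: "homog k l (M + k) (g3 * snd wd)" using \<open>N \<le> M\<close> by simp
    have "wge k l (int k + int M + 1) (g3 * snd wd)" using wge_diff[OF g3(2) d3(1)] by simp
    hence "cf (g3 * snd wd) i j = 0" for i j
    proof (rule_tac ccontr)
      assume w: "wge k l (int k + int M + 1) (g3 * snd wd)" and nz: "cf (g3 * snd wd) i j \<noteq> 0"
      have "k * i + l * j = M + k" using h nz unfolding homog_def by blast
      moreover have "int k + int M + 1 \<le> int (k * i + l * j)" using w nz unfolding wge_def by blast
      ultimately show False by linarith
    qed
    hence "g3 * snd wd = 0" by (intro series2_eqI) simp
    moreover have "cf (snd wd) 1 (k * n) \<noteq> 0"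
      using cf_hs[of n be] irr_n[of 1 0] k by (simp add: wd_def cf_varx_mult)
    hence "snd wd \<noteq> 0" by auto
    ultimately show False using \<open>g3 \<noteq> 0\<close> by simp
  qed
  hence "wge k l (int (Suc M)) (w3 - w)" using g3(3) by (simp add: add.commute)
  thus ?thesis using PP b3 unfolding agree_def by blast
qed

theorem normal_form_unique:
  assumes b: "brings_to P Q w \<eta>" "brings_to P' Q' w' \<eta>'"
    and \<eta>: "\<eta> \<in> normal_forms k l n wd" "\<eta>' \<in> normal_forms k l n wd"
  shows "\<eta> = \<eta>'"
proof -
  have step: "\<exists>P' Q' w'. brings_to P' Q' w' \<eta>' \<and> agree (Suc m) P Q w P' Q' w'" for m
  proof (induction m)
    case 0
    have "agree (Suc 0) P Q w P' Q' w'"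
      using b wge_diff[of k l 1 "P' - 1" "P - 1"] wge_diff[of k l 1 "Q' - 1" "Q - 1"] wge_diff[of k l 1 "w' - 1" "w - 1"]
      by (simp add: agree_def brings_to_def)
    thus ?case using b(2) by blast
  next
    case (Suc m)
    then obtain P' Q' w' where 1: "brings_to P' Q' w' \<eta>'" "agree (Suc m) P Q w P' Q' w'" by blast
    show ?case by (rule improve_agreement[OF b(1) 1(1) _ 1(2) \<eta>]) simp
  qed
  have nf: "nf k l n (\<eta> - wd)" "nf k l n (\<eta>' - wd)" using \<eta> normal_forms_imp by blast+
  have "wgef k l (int m) (\<eta>' - \<eta>)" for m
  proof -
    obtain P' Q' w' where 1: "brings_to P' Q' w' \<eta>'" "agree (Suc m) P Q w P' Q' w'" using step by blast
    have "wgef k l (int d + int (Suc m) + 1) (\<eta>' - \<eta>)"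
      by (rule agree_step(1)[OF b(1) 1(1) _ 1(2) nf]) simp
    thus ?thesis by (rule wgef_mono) simp
  qed
  thus ?thesis using wgef_parts_eq[of k l \<eta>' \<eta>] by simp
qed

theorem unique_normal_form:
  "\<exists>!\<eta>. \<eta> \<in> normal_forms k l n wd \<and> strictly_formally_orbitally_equivalent \<omega> \<eta>"
proof -
  have equiv: "\<exists>P Q w. brings_to P Q w \<eta>"
    if \<eta>: "\<eta> \<in> normal_forms k l n wd" and e: "strictly_formally_orbitally_equivalent \<omega> \<eta>" for \<eta>
  proof -
    obtain P Q w where st: "strict P Q w" and eq: "smul w (pullback (P, Q) \<omega>) = \<eta>"
      using e unfolding strictly_formally_orbitally_equivalent_def strict_def by blast
    have nf: "wgef k l (int d + 1) (\<eta> - wd)" "nf k l n (\<eta> - wd)" using normal_forms_imp[OF \<eta>] by auto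
    have "axes_invariant \<eta>"
      using axes_invariant_add[OF _ axes_invariant_wd, of "\<eta> - wd"] nf(2) by (auto simp: nf_def)
    from strict_axes[OF \<omega> ax nf(1) this st eq] show ?thesis using eq by (auto simp: brings_to_def)
  qed
  obtain P Q w where PQ: "wge k l 1 (P - 1)" "wge k l 1 (Q - 1)" "wge k l 1 (w - 1)"
    "smul w (pullback (varx * P, vary * Q) \<omega>) \<in> normal_forms k l n wd"
    using normal_form_exists[OF \<omega> ax] by blast
  have one: "cf P 0 0 = 1" "cf Q 0 0 = 1" "cf w 0 0 = 1"
    using wgeD[OF PQ(1), of 0 0] wgeD[OF PQ(2), of 0 0] wgeD[OF PQ(3), of 0 0] by (simp_all add: cf_1)
  have "strictly_formally_orbitally_equivalent \<omega> (smul w (pullback (varx * P, vary * Q) \<omega>))"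
    unfolding strictly_formally_orbitally_equivalent_def
    by (rule exI[of _ "varx * P"], rule exI[of _ "vary * Q"], rule exI[of _ w])
      (use one in \<open>simp add: cf_varx_mult cf_vary_mult del: cf_00_mult\<close>)
  thus ?thesis using PQ(4) equiv normal_form_unique by (intro ex1I) (blast, metis)
qed

end

end

section \<open>Desingularization of the curve\<close>

subsection \<open>Convergence of polynomials and divisibility\<close>

text \<open>Polynomials, as a supply of convergent series for the units, coordinates and cofactors
  that \<open>normal_crossing\<close> and \<open>gdvd\<close> ask for.\<close>

definition finsupp2 :: "series2 \<Rightarrow> bool" where
  "finsupp2 F \<longleftrightarrow> (\<exists>B. \<forall>i j. B < i + j \<longrightarrow> cf F i j = 0)"

lemma finsupp2_basic: "finsupp2 varx" "finsupp2 vary" "finsupp2 (cst c)" "finsupp2 0" "finsupp2 1"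
  unfolding finsupp2_def by (rule exI[of _ 1]; auto simp: cf_varx cf_vary cf_cst cf_1)+

lemma finsupp2_add: "finsupp2 F \<Longrightarrow> finsupp2 G \<Longrightarrow> finsupp2 (F + G)"
  unfolding finsupp2_def
proof (elim exE)
  fix A B assume "\<forall>i j. A < i + j \<longrightarrow> cf F i j = 0" "\<forall>i j. B < i + j \<longrightarrow> cf G i j = 0"
  thus "\<exists>B. \<forall>i j. B < i + j \<longrightarrow> cf (F + G) i j = 0" by (intro exI[of _ "max A B"]) auto
qed

lemma finsupp2_mult: "finsupp2 F \<Longrightarrow> finsupp2 G \<Longrightarrow> finsupp2 (F * G)"
  unfolding finsupp2_def
proof (elim exE)
  fix A B assume F: "\<forall>i j. A < i + j \<longrightarrow> cf F i j = 0" and G: "\<forall>i j. B < i + j \<longrightarrow> cf G i j = 0"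
  have "cf (F * G) i j = 0" if "A + B < i + j" for i j
    unfolding cf_mult
  proof (intro sum.neutral ballI)
    fix p q assume "p \<in> {..i}" "q \<in> {..j}"
    hence "A < p + q \<or> B < (i - p) + (j - q)" using that by auto
    thus "cf F p q * cf G (i - p) (j - q) = 0" using F G by auto
  qed
  thus "\<exists>B. \<forall>i j. B < i + j \<longrightarrow> cf (F * G) i j = 0" by blast
qed

lemma finsupp2_diff: "finsupp2 F \<Longrightarrow> finsupp2 G \<Longrightarrow> finsupp2 (F - G)"
  using finsupp2_add[of F "cst (-1) * G"] finsupp2_mult[OF finsupp2_basic(3)[of "-1"], of G] by simp

lemma finsupp2_power: "finsupp2 F \<Longrightarrow> finsupp2 (F ^ m)"
  by (induction m) (simp_all add: finsupp2_basic finsupp2_mult)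

lemma finsupp2_prod: "(\<And>a. a \<in> A \<Longrightarrow> finsupp2 (f a)) \<Longrightarrow> finsupp2 (prod f A)"
  by (induction A rule: infinite_finite_induct) (auto simp: finsupp2_basic finsupp2_mult)

lemma finsupp2_sum: "(\<And>a. a \<in> A \<Longrightarrow> finsupp2 (f a)) \<Longrightarrow> finsupp2 (sum f A)"
  by (induction A rule: infinite_finite_induct) (auto simp: finsupp2_basic finsupp2_add)

lemmas finsupp2_intros = finsupp2_basic finsupp2_add finsupp2_mult finsupp2_diff finsupp2_power
  finsupp2_prod finsupp2_sum

lemma finsupp2_convergent2: "finsupp2 F \<Longrightarrow> convergent2 F"
proof -
  assume "finsupp2 F"
  then obtain B where B: "\<And>i j. B < i + j \<Longrightarrow> cf F i j = 0" unfolding finsupp2_def by blast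
  define C where "C = (\<Sum>i\<le>B. \<Sum>j\<le>B. norm (cf F i j))"
  have "norm (cf F i j) \<le> C * 1 ^ (i + j)" for i j
  proof (cases "i \<le> B \<and> j \<le> B")
    case True
    have "norm (cf F i j) \<le> (\<Sum>j\<le>B. norm (cf F i j))"
      by (rule member_le_sum) (use True in auto)
    also have "\<dots> \<le> C" unfolding C_def
      by (rule member_le_sum[of i "{..B}" "\<lambda>i. \<Sum>j\<le>B. norm (cf F i j)"]) (use True in \<open>auto intro: sum_nonneg\<close>)
    finally show ?thesis by simp
  next
    case False
    hence "cf F i j = 0" by (intro B) auto
    thus ?thesis by (simp add: C_def sum_nonneg)
  qed
  thus ?thesis unfolding convergent2_def by blast
qed

section \<open>Divisibility by the coordinates\<close>

lemma varx_dvd_iff: "varx dvd F \<longleftrightarrow> (\<forall>j. cf F 0 j = 0)"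
proof
  assume "\<forall>j. cf F 0 j = 0"
  hence "F = varx * fps2 (\<lambda>i j. cf F (Suc i) j)"
    by (intro series2_eqI) (auto simp: cf_varx_mult gr0_conv_Suc One_nat_def)
  thus "varx dvd F" by (metis dvd_triv_left)
qed (auto elim!: dvdE simp: cf_varx_mult)

lemma vary_dvd_iff: "vary dvd F \<longleftrightarrow> (\<forall>i. cf F i 0 = 0)"
proof
  assume "\<forall>i. cf F i 0 = 0"
  hence "F = vary * fps2 (\<lambda>i j. cf F i (Suc j))"
    by (intro series2_eqI) (auto simp: cf_vary_mult gr0_conv_Suc One_nat_def)
  thus "vary dvd F" by (metis dvd_triv_left)
qed (auto elim!: dvdE simp: cf_vary_mult)

lemma prime_vary: "prime_elem vary"
  unfolding prime_elem_def
proof (intro conjI allI impI)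
  show "vary \<noteq> 0" by (simp add: vary_def)
  show "\<not> vary dvd 1" by (auto simp: vary_dvd_iff cf_1)
  fix F G assume "vary dvd F * G"
  moreover have v: "vary dvd F \<longleftrightarrow> fps_nth F 0 = 0" for F by (simp add: vary_dvd_iff cf_def fps_eq_iff)
  ultimately show "vary dvd F \<or> vary dvd G" unfolding v by simp
qed

lemma prime_varx: "prime_elem varx"
  unfolding prime_elem_def
proof (intro conjI allI impI)
  show "varx \<noteq> 0" by (simp add: varx_def)
  show "\<not> varx dvd 1" by (auto simp: varx_dvd_iff cf_1 intro: exI[of _ 0])
  fix F G assume h: "varx dvd F * G"
  \<comment> \<open>Restriction to x = 0, a ring homomorphism into the domain C[[y]] whose kernel is
    generated by x.\<close>
  define r where "r F = Abs_fps (\<lambda>j. cf F 0 j)" for F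
  have v: "varx dvd F \<longleftrightarrow> r F = 0" for F by (simp add: varx_dvd_iff r_def fps_eq_iff)
  have "r (F * G) = r F * r G"
    by (rule fps_ext) (simp add: r_def cf_mult fps_mult_nth atLeast0AtMost)
  thus "varx dvd F \<or> varx dvd G" using h unfolding v by simp
qed

lemma unit_not_dvd: "cf U 0 0 \<noteq> 0 \<Longrightarrow> \<not> varx dvd U" "cf U 0 0 \<noteq> 0 \<Longrightarrow> \<not> vary dvd U"
  by (auto simp: varx_dvd_iff vary_dvd_iff)

lemma prime_power_cancel:
  fixes z :: series2
  assumes z: "prime_elem z" and eq: "z ^ a * A = z ^ b * B" and A: "\<not> z dvd A" and B: "\<not> z dvd B"
  shows "a = b \<and> A = B"
proof -
  have z0: "z \<noteq> 0" using z by (simp add: prime_elem_def)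
  have "\<not> a < b" if "z ^ a * A = z ^ b * B" "\<not> z dvd A" for a b A B
  proof
    assume "a < b"
    then obtain e where e: "b = a + Suc e" by (metis add_Suc_right less_imp_Suc_add)
    hence "z ^ a * A = z ^ a * (z * (z ^ e * B))" using that(1) by (simp add: power_add mult_ac)
    hence "A = z * (z ^ e * B)" using z0 by simp
    thus False using that(2) by simp
  qed
  from this[OF eq A] this[OF eq[symmetric] B] have "a = b" by simp
  thus ?thesis using eq z0 by simp
qed

lemma prime_not_dvd_prod:
  fixes z :: series2
  assumes z: "prime_elem z" and f: "\<And>i. i \<in> A \<Longrightarrow> \<not> z dvd f i"
  shows "\<not> z dvd prod f A"
proof -
  have "\<not> z dvd 1" using z by (simp add: prime_elem_def)
  thus ?thesis using f
    by (induction A rule: infinite_finite_induct) (auto simp: prime_elem_dvd_mult_iff[OF z])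
qed

lemma prime_dvd_powers:
  fixes z :: series2
  assumes z: "prime_elem z" and U: "\<not> z dvd U" and dvd: "z dvd U * X ^ a * Y ^ b"
  shows "z dvd X \<or> z dvd Y"
proof -
  have "z dvd X ^ a \<or> z dvd Y ^ b" using z U dvd by (simp add: prime_elem_dvd_mult_iff)
  thus ?thesis using prime_elem_dvd_power[OF z] by blast
qed

subsection \<open>The total transform along the Euclidean algorithm\<close>

text \<open>The shape that the total transform keeps along the Euclidean algorithm: the axes with
  multiplicities, and cusps with smaller exponents but the same constants.\<close>

definition total :: "nat \<Rightarrow> nat \<Rightarrow> nat \<Rightarrow> (nat \<Rightarrow> complex) \<Rightarrow> nat \<Rightarrow> nat \<Rightarrow> series2" where
  "total k l n c a b = varx ^ a * vary ^ b * (\<Prod>i=1..n. cusp k l (c i))"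

text \<open>The cusp y^k = c x^l is tangent to y = 0 if k < l and to x = 0 if l < k; the path
  follows this tangent. For coprime exponents it stops at (1, 1), where the branches are lines with
  distinct slopes. Blowing up this last point creates the principal component.\<close>

fun euclid :: "nat \<Rightarrow> nat \<Rightarrow> point" where
  "euclid k l = (if 0 < k \<and> k < l then Some 0 # euclid k (l - k)
     else if 0 < l \<and> l < k then None # euclid (k - l) l else [])"

declare euclid.simps [simp del]

lemma euclid_simps: "0 < k \<Longrightarrow> k < l \<Longrightarrow> euclid k l = Some 0 # euclid k (l - k)"
  "0 < l \<Longrightarrow> l < k \<Longrightarrow> euclid k l = None # euclid (k - l) l" "euclid k k = []"
  by (subst euclid.simps; simp)+

lemma coprime_euclid_cases:
  fixes k l :: nat
  assumes "coprime k l" "k \<ge> 1" "l \<ge> 1"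
  obtains "k = 1" "l = 1" | "k < l" "coprime k (l - k)" "l - k \<ge> 1" | "l < k" "coprime (k - l) l" "k - l \<ge> 1"
proof (rule linorder_cases[of k l])
  assume "k = l"
  hence "k = 1" "l = 1" using assms(1) by (simp_all add: One_nat_def)
  thus ?thesis by (rule that(1))
next
  assume h: "k < l"
  hence "coprime k (l - k)" using assms(1) gcd_diff1_nat[of k l] by (simp add: coprime_iff_gcd_eq_1 gcd.commute)
  thus ?thesis by (rule that(2)[OF h]) (use h in simp)
next
  assume h: "l < k"
  hence "coprime (k - l) l" using assms(1) gcd_diff1_nat[of l k] by (simp add: coprime_iff_gcd_eq_1)
  thus ?thesis by (rule that(3)[OF h]) (use h in simp)
qed

lemma blowup_map_Cons:
  "blowup_map (Some t # ts) = (fst (blowup_map ts), fst (blowup_map ts) * (snd (blowup_map ts) + cst t))"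
  "blowup_map (None # ts) = (fst (blowup_map ts) * snd (blowup_map ts), snd (blowup_map ts))"
  by (simp_all add: case_prod_beta)

lemma blowup_map_00: "cf (fst (blowup_map p)) 0 0 = 0 \<and> cf (snd (blowup_map p)) 0 0 = 0"
proof (induction p)
  case (Cons t p)
  thus ?case by (cases t) (simp_all only: blowup_map_Cons fst_conv snd_conv cf_00_mult; simp)+
qed (simp add: cf_varx cf_vary)

definition transform :: "series2 \<Rightarrow> point \<Rightarrow> series2" where
  "transform F p = subst2 F (fst (blowup_map p)) (snd (blowup_map p))"

lemma transform_Nil: "transform F [] = F"
  by (simp add: transform_def subst2_id)

lemma bm1: "blowup_map [Some t] = (varx, varx * (vary + cst t))" "blowup_map [None] = (varx * vary, vary)"
  by simp_all

lemma transform_Cons: "transform F (t # p) = transform (transform F [t]) p"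
proof -
  have 0: "cf (fst (blowup_map q)) 0 0 = 0" "cf (snd (blowup_map q)) 0 0 = 0" for q using blowup_map_00 by auto
  have c: "cf (varx * G) 0 0 = 0" "cf (varx :: series2) 0 0 = 0" "cf (vary :: series2) 0 0 = 0" for G
    by (simp_all add: cf_varx cf_vary)
  show ?thesis
    by (cases t) (simp_all only: transform_def blowup_map_Cons blowup_map.simps(1) fst_conv snd_conv subst2_compose[OF c(2,1) 0]
      subst2_compose[OF c(1,3) 0] subst2_varx[OF 0] subst2_vary[OF 0] subst2_mult[OF 0] subst2_add[OF 0] subst2_cst[OF 0])
qed

lemma cusp_transform:
  "transform (cusp k l c) [Some t] = (varx * (vary + cst t)) ^ k - cst c * varx ^ l"
  "transform (cusp k l c) [None] = vary ^ k - cst c * (varx * vary) ^ l"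
proof -
  have c: "cf (varx * G) 0 0 = 0" "cf (varx :: series2) 0 0 = 0" "cf (vary :: series2) 0 0 = 0" for G
    by (simp_all add: cf_varx cf_vary)
  show "transform (cusp k l c') [Some t] = (varx * (vary + cst t)) ^ k - cst c' * varx ^ l" for c'
    unfolding transform_def bm1 cusp_def
    by (simp add: subst2_diff[OF c(2,1)] subst2_power[OF c(2,1)] subst2_cst_mult[OF c(2,1)] subst2_varx[OF c(2,1)] subst2_vary[OF c(2,1)])
  show "transform (cusp k l c') [None] = vary ^ k - cst c' * (varx * vary) ^ l" for c'
    unfolding transform_def bm1 cusp_def
    by (simp add: subst2_diff[OF c(1,3)] subst2_power[OF c(1,3)] subst2_cst_mult[OF c(1,3)] subst2_varx[OF c(1,3)] subst2_vary[OF c(1,3)])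
qed

lemma total_transform:
  "transform (total k l n c a b) [Some t] = varx ^ a * (varx * (vary + cst t)) ^ b * (\<Prod>i=1..n. (varx * (vary + cst t)) ^ k - cst (c i) * varx ^ l)"
  "transform (total k l n c a b) [None] = (varx * vary) ^ a * vary ^ b * (\<Prod>i=1..n. vary ^ k - cst (c i) * (varx * vary) ^ l)"
proof -
  have c: "cf (varx * G) 0 0 = 0" "cf (varx :: series2) 0 0 = 0" "cf (vary :: series2) 0 0 = 0" for G
    by (simp_all add: cf_varx cf_vary)
  show "transform (total k l n c a b) [Some t] = varx ^ a * (varx * (vary + cst t)) ^ b * (\<Prod>i=1..n. (varx * (vary + cst t)) ^ k - cst (c i) * varx ^ l)"
    unfolding cusp_transform(1)[symmetric]
    by (simp add: total_def transform_def subst2_mult[OF c(2,1)] subst2_power[OF c(2,1)] subst2_prod[OF c(2,1)] subst2_varx[OF c(2,1)] subst2_vary[OF c(2,1)])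
  show "transform (total k l n c a b) [None] = (varx * vary) ^ a * vary ^ b * (\<Prod>i=1..n. vary ^ k - cst (c i) * (varx * vary) ^ l)"
    unfolding cusp_transform(2)[symmetric]
    by (simp add: total_def transform_def subst2_mult[OF c(1,3)] subst2_power[OF c(1,3)] subst2_prod[OF c(1,3)] subst2_varx[OF c(1,3)] subst2_vary[OF c(1,3)])
qed

lemma factor_prod:
  assumes "\<And>i. g i = (z :: series2) * h i"
  shows "(\<Prod>i=1..n. g i) = z ^ n * (\<Prod>i=1..n. h i)"
  using assms by (simp add: prod.distrib)

lemma total_step:
  "k < l \<Longrightarrow> transform (total k l n c a b) [Some 0] = total k (l - k) n c (a + b + k * n) b"
  "l < k \<Longrightarrow> transform (total k l n c a b) [None] = total (k - l) l n c a (a + b + l * n)"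
proof -
  assume "k < l"
  then obtain m where m: "l = k + m" using less_imp_add_positive by blast
  have "(\<Prod>i=1..n. (varx * (vary + cst 0)) ^ k - cst (c i) * varx ^ l) = (varx ^ k) ^ n * (\<Prod>i=1..n. cusp k m (c i))"
    by (rule factor_prod) (simp add: m cusp_def power_mult_distrib power_add algebra_simps)
  thus "transform (total k l n c a b) [Some 0] = total k (l - k) n c (a + b + k * n) b"
    unfolding total_transform m by (simp add: total_def power_mult_distrib power_add power_mult mult_ac)
next
  assume "l < k"
  then obtain m where m: "k = l + m" using less_imp_add_positive by blast
  have "(\<Prod>i=1..n. vary ^ k - cst (c i) * (varx * vary) ^ l) = (vary ^ l) ^ n * (\<Prod>i=1..n. cusp m l (c i))"
    by (rule factor_prod) (simp add: m cusp_def power_mult_distrib power_add algebra_simps)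
  thus "transform (total k l n c a b) [None] = total (k - l) l n c a (a + b + l * n)"
    unfolding total_transform m by (simp add: total_def power_mult_distrib power_add power_mult mult_ac)
qed

lemma cusp_not_dvd: "c \<noteq> 0 \<Longrightarrow> l \<ge> 1 \<Longrightarrow> k \<ge> 1 \<Longrightarrow> \<not> varx dvd cusp k l c \<and> \<not> vary dvd cusp k l c"
proof -
  assume h: "c \<noteq> 0" "l \<ge> 1" "k \<ge> 1"
  have e: "cusp k l c = mon 0 k - cst c * mon l 0" by (simp add: cusp_def mon_def)
  have "cf (cusp k l c) 0 k = 1" "cf (cusp k l c) l 0 = - c" using h unfolding e by (auto simp: cf_mon)
  thus ?thesis unfolding varx_dvd_iff vary_dvd_iff using h by (metis neg_equal_0_iff_equal zero_neq_one)
qed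

text \<open>Both axes and at least one cusp pass through the origin, but a normal crossing has at
  most two branches. The axes must be {X = 0} and {Y = 0}; cancelling them would make the product of
  the cusps a unit.\<close>

lemma total_not_normal_crossing:
  assumes k: "k \<ge> 1" and l: "l \<ge> 1" and n: "n \<ge> 1" and a: "a \<ge> 1" and b: "b \<ge> 1"
    and c: "\<And>i. i \<in> {1..n} \<Longrightarrow> c i \<noteq> 0"
  shows "\<not> normal_crossing (total k l n c a b)"
proof
  assume "normal_crossing (total k l n c a b)"
  then obtain U X Y \<alpha> \<beta> where U: "gunit U" and X0: "cf X 0 0 = 0" and Y0: "cf Y 0 0 = 0"
    and J: "cf X 1 0 * cf Y 0 1 - cf X 0 1 * cf Y 1 0 \<noteq> 0" and F: "total k l n c a b = U * X ^ \<alpha> * Y ^ \<beta>"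
    unfolding normal_crossing_def by blast
  have U0: "cf U 0 0 \<noteq> 0" using U by (simp add: gunit_def)
  define R where "R = (\<Prod>i=1..n. cusp k l (c i))"
  have R: "\<not> varx dvd R" "\<not> vary dvd R"
    unfolding R_def
    by (rule prime_not_dvd_prod[OF prime_varx], use cusp_not_dvd c l k in blast,
        rule prime_not_dvd_prod[OF prime_vary], use cusp_not_dvd c l k in blast)
  have "cf (cusp k l c') 0 0 = 0" for c' using k l by (simp add: cusp_def cf_varx cf_vary zero_power)
  hence R0: "cf R 0 0 = 0"
  proof -
    have "R = cusp k l (c 1) * (\<Prod>i\<in>{1..n} - {1}. cusp k l (c i))"
      unfolding R_def by (rule prod.remove) (use n in auto)
    thus ?thesis using \<open>\<And>c'. cf (cusp k l c') 0 0 = 0\<close> by simp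
  qed
  have "varx dvd total k l n c a b" using a by (auto simp: total_def intro!: dvd_mult2 dvd_power)
  hence "varx dvd X \<or> varx dvd Y" unfolding F
    by (rule prime_dvd_powers[OF prime_varx unit_not_dvd(1)[OF U0]])
  moreover have "vary dvd total k l n c a b" using b by (auto simp: total_def intro!: dvd_mult2 dvd_power dvd_mult)
  hence "vary dvd X \<or> vary dvd Y" unfolding F
    by (rule prime_dvd_powers[OF prime_vary unit_not_dvd(2)[OF U0]])
  moreover have "\<not> (varx dvd X \<and> vary dvd X)" "\<not> (varx dvd Y \<and> vary dvd Y)"
    using J by (auto simp: varx_dvd_iff vary_dvd_iff)
  ultimately have "varx dvd X \<and> vary dvd Y \<or> vary dvd X \<and> varx dvd Y" by blast
  hence "\<exists>W \<alpha>' \<beta>'. total k l n c a b = varx ^ \<alpha>' * (vary ^ \<beta>' * W) \<and> cf W 0 0 \<noteq> 0"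
  proof
    assume "varx dvd X \<and> vary dvd Y"
    then obtain X' Y' where XY: "X = varx * X'" "Y = vary * Y'" by (auto elim!: dvdE)
    have "cf X' 0 0 \<noteq> 0" "cf Y' 0 0 \<noteq> 0" using J by (auto simp: XY cf_varx_mult cf_vary_mult)
    hence "cf (U * X' ^ \<alpha> * Y' ^ \<beta>) 0 0 \<noteq> 0" using U0 by simp
    moreover have "total k l n c a b = varx ^ \<alpha> * (vary ^ \<beta> * (U * X' ^ \<alpha> * Y' ^ \<beta>))"
      unfolding F XY by (simp add: power_mult_distrib mult_ac)
    ultimately show ?thesis by blast
  next
    assume "vary dvd X \<and> varx dvd Y"
    then obtain X' Y' where XY: "X = vary * X'" "Y = varx * Y'" by (auto elim!: dvdE)
    have "cf X' 0 0 \<noteq> 0" "cf Y' 0 0 \<noteq> 0" using J by (auto simp: XY cf_varx_mult cf_vary_mult)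
    hence "cf (U * X' ^ \<alpha> * Y' ^ \<beta>) 0 0 \<noteq> 0" using U0 by simp
    moreover have "total k l n c a b = varx ^ \<beta> * (vary ^ \<alpha> * (U * X' ^ \<alpha> * Y' ^ \<beta>))"
      unfolding F XY by (simp add: power_mult_distrib mult_ac)
    ultimately show ?thesis by blast
  qed
  then obtain W \<alpha>' \<beta>' where W: "total k l n c a b = varx ^ \<alpha>' * (vary ^ \<beta>' * W)" "cf W 0 0 \<noteq> 0" by blast
  have xy: "\<not> varx dvd vary ^ e" for e
  proof -
    have "\<not> varx dvd vary" by (auto simp: varx_dvd_iff cf_vary)
    thus ?thesis using prime_elem_dvd_power[OF prime_varx, of vary e] by blast
  qed
  have "varx ^ a * (vary ^ b * R) = varx ^ \<alpha>' * (vary ^ \<beta>' * W)"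
    using W(1) by (simp add: total_def R_def mult.assoc)
  from prime_power_cancel[OF prime_varx this] have "vary ^ b * R = vary ^ \<beta>' * W"
    using xy R(1) unit_not_dvd(1)[OF W(2)] by (auto simp: prime_elem_dvd_mult_iff[OF prime_varx])
  from prime_power_cancel[OF prime_vary this] have "R = W"
    using R(2) unit_not_dvd(2)[OF W(2)] by auto
  thus False using R0 W(2) by simp
qed

lemma prefix_not_normal_crossing:
  assumes "coprime k l" "k \<ge> 1" "l \<ge> 1" "n \<ge> 1" "a \<ge> 1" "b \<ge> 1" "\<And>i. i \<in> {1..n} \<Longrightarrow> c i \<noteq> 0"
    "prefix p (euclid k l)"
  shows "\<not> normal_crossing (transform (total k l n c a b) p)"
  using assms
proof (induction "k + l" arbitrary: k l a b p rule: less_induct)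
  case less
  show ?case
  proof (cases p)
    case Nil
    thus ?thesis using total_not_normal_crossing[OF less.prems(2-7)] by (simp add: transform_Nil)
  next
    case (Cons t q)
    show ?thesis
    proof (rule coprime_euclid_cases[OF less.prems(1-3)])
      assume "k = 1" "l = 1"
      thus ?thesis using less.prems(8) Cons by (simp add: euclid_simps)
    next
      assume h: "k < l" "coprime k (l - k)" "l - k \<ge> 1"
      hence e: "euclid k l = Some 0 # euclid k (l - k)" using less.prems by (intro euclid_simps) auto
      hence t: "t = Some 0" "prefix q (euclid k (l - k))" using less.prems(8) Cons by auto
      have eq: "transform (total k l n c a b) p = transform (total k (l - k) n c (a + b + k * n) b) q"
        unfolding Cons t(1) by (subst transform_Cons) (simp only: total_step(1)[OF h(1)])
      show ?thesis unfolding eq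
        by (rule less.hyps) (use h less.prems t in auto)
    next
      assume h: "l < k" "coprime (k - l) l" "k - l \<ge> 1"
      hence e: "euclid k l = None # euclid (k - l) l" using less.prems by (intro euclid_simps) auto
      hence t: "t = None" "prefix q (euclid (k - l) l)" using less.prems(8) Cons by auto
      have eq: "transform (total k l n c a b) p = transform (total (k - l) l n c a (a + b + l * n)) q"
        unfolding Cons t(1) by (subst transform_Cons) (simp only: total_step(2)[OF h(1)])
      show ?thesis unfolding eq
        by (rule less.hyps) (use h less.prems t in auto)
    qed
  qed
qed

lemma normal_crossingI:
  assumes "finsupp2 U" "cf U 0 0 \<noteq> 0" "F = U * varx ^ \<alpha> * vary ^ \<beta>"
  shows "normal_crossing F"
  unfolding normal_crossing_def
  by (rule exI[of _ U], rule exI[of _ varx], rule exI[of _ vary], rule exI[of _ \<alpha>], rule exI[of _ \<beta>])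
    (use assms in \<open>simp add: gunit_def finsupp2_convergent2 finsupp2_basic cf_varx cf_vary\<close>)

lemma cf_00_prod: "cf (prod f A) 0 0 = (\<Prod>a\<in>A. cf (f a) 0 0)"
  by (induction A rule: infinite_finite_induct) (simp_all add: cf_1)

text \<open>Away from the common tangent the strict transforms of the cusps miss the point. After
  the last blow-up at most one of the distinct branches passes through it, transversally to the
  exceptional divisor and at a slope different from 0.\<close>

lemma leaving_normal_crossing:
  assumes kl: "k \<ge> 1" "l \<ge> 1" and c: "\<And>i. i \<in> {1..n} \<Longrightarrow> c i \<noteq> 0" "inj_on c {1..n}"
    and t: "k < l \<and> t \<noteq> Some 0 \<or> l < k \<and> t \<noteq> None \<or> k = 1 \<and> l = 1"
  shows "normal_crossing (transform (total k l n c a b) [t])"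
proof (cases t)
  case None
  hence "k \<le> l" using t by auto
  then obtain m where m: "l = k + m" using le_Suc_ex by blast
  define U where "U = (\<Prod>i=1..n. 1 - cst (c i) * varx ^ l * vary ^ m)"
  have "(\<Prod>i=1..n. vary ^ k - cst (c i) * (varx * vary) ^ l) = (vary ^ k) ^ n * U"
    unfolding U_def by (rule factor_prod) (simp add: m power_mult_distrib power_add algebra_simps)
  hence "transform (total k l n c a b) [t] = U * varx ^ a * vary ^ (a + b + k * n)"
    unfolding None total_transform by (simp add: power_mult_distrib power_add power_mult mult_ac)
  moreover have "finsupp2 U" unfolding U_def by (intro finsupp2_intros)
  moreover have "cf U 0 0 \<noteq> 0" using kl by (simp add: U_def cf_00_prod cf_1 cf_varx zero_power)
  ultimately show ?thesis by (intro normal_crossingI)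
next
  case (Some \<tau>)
  define Y where "Y = vary + cst \<tau>"
  have fY: "finsupp2 Y" unfolding Y_def by (intro finsupp2_intros)
  have Y0: "cf Y 0 0 = \<tau>" by (simp add: Y_def cf_vary cf_cst)
  have Yb: "\<exists>V \<beta>. Y ^ b = V * vary ^ \<beta> \<and> finsupp2 V \<and> cf V 0 0 \<noteq> 0"
  proof (cases "\<tau> = 0")
    case True
    show ?thesis by (rule exI[of _ 1], rule exI[of _ b]) (simp add: Y_def True finsupp2_basic cf_1)
  next
    case False
    show ?thesis by (rule exI[of _ "Y ^ b"], rule exI[of _ 0]) (simp add: Y0 False finsupp2_power fY)
  qed
  have "\<exists>V \<beta> e. (\<Prod>i=1..n. (varx * Y) ^ k - cst (c i) * varx ^ l) * Y ^ b = V * varx ^ e * vary ^ \<beta> \<and> finsupp2 V \<and> cf V 0 0 \<noteq> 0"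
  proof -
    consider "k < l" "\<tau> \<noteq> 0" | "l < k" | "k = 1" "l = 1" using t Some by auto
    thus ?thesis
    proof cases
      case 1
      then obtain m where m: "l = k + m" "m > 0" using less_imp_add_positive by blast
      define U where "U = (\<Prod>i=1..n. Y ^ k - cst (c i) * varx ^ m)"
      have "(\<Prod>i=1..n. (varx * Y) ^ k - cst (c i) * varx ^ l) = (varx ^ k) ^ n * U"
        unfolding U_def by (rule factor_prod) (simp add: m power_mult_distrib power_add algebra_simps)
      hence "(\<Prod>i=1..n. (varx * Y) ^ k - cst (c i) * varx ^ l) * Y ^ b = (U * Y ^ b) * varx ^ (k * n) * vary ^ 0"
        by (simp add: power_mult mult_ac)
      moreover have "finsupp2 (U * Y ^ b)" unfolding U_def by (intro finsupp2_intros fY)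
      moreover have "cf (U * Y ^ b) 0 0 \<noteq> 0" using 1 m by (simp add: U_def cf_00_prod Y0 cf_varx zero_power)
      ultimately show ?thesis by blast
    next
      case 2
      then obtain m where m: "k = l + m" "m > 0" using less_imp_add_positive by blast
      define U where "U = (\<Prod>i=1..n. varx ^ m * Y ^ k - cst (c i))"
      obtain V \<beta> where V: "Y ^ b = V * vary ^ \<beta>" "finsupp2 V" "cf V 0 0 \<noteq> 0" using Yb by blast
      have "(\<Prod>i=1..n. (varx * Y) ^ k - cst (c i) * varx ^ l) = (varx ^ l) ^ n * U"
        unfolding U_def by (rule factor_prod) (simp add: m power_mult_distrib power_add algebra_simps)
      hence "(\<Prod>i=1..n. (varx * Y) ^ k - cst (c i) * varx ^ l) * Y ^ b = (U * V) * varx ^ (l * n) * vary ^ \<beta>"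
        by (simp add: V power_mult mult_ac)
      moreover have "finsupp2 (U * V)" unfolding U_def by (intro finsupp2_intros fY V)
      moreover have "cf (U * V) 0 0 \<noteq> 0" using V m c(1) by (auto simp: U_def cf_00_prod Y0 cf_varx cf_cst zero_power)
      ultimately show ?thesis by blast
    next
      case 3
      have e: "(\<Prod>i=1..n. (varx * Y) ^ k - cst (c i) * varx ^ l) = varx ^ n * (\<Prod>i=1..n. Y - cst (c i))"
        by (rule factor_prod) (simp add: 3 algebra_simps)
      show ?thesis
      proof (cases "\<tau> \<in> c ` {1..n}")
        case False
        define U where "U = (\<Prod>i=1..n. Y - cst (c i))"
        obtain V \<beta> where V: "Y ^ b = V * vary ^ \<beta>" "finsupp2 V" "cf V 0 0 \<noteq> 0" using Yb by blast
        have "(\<Prod>i=1..n. (varx * Y) ^ k - cst (c i) * varx ^ l) * Y ^ b = (U * V) * varx ^ n * vary ^ \<beta>"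
          unfolding e by (simp add: V U_def mult_ac)
        moreover have "finsupp2 (U * V)" unfolding U_def by (intro finsupp2_intros fY V)
        moreover have "cf (U * V) 0 0 \<noteq> 0" using V False by (auto simp: U_def cf_00_prod Y0 cf_cst)
        ultimately show ?thesis by blast
      next
        case True
        then obtain i where i: "i \<in> {1..n}" "\<tau> = c i" by blast
        define U where "U = (\<Prod>j\<in>{1..n}-{i}. Y - cst (c j)) * Y ^ b"
        have "(\<Prod>i=1..n. Y - cst (c i)) = (Y - cst (c i)) * (\<Prod>j\<in>{1..n}-{i}. Y - cst (c j))"
          by (rule prod.remove) (use i in auto)
        hence "(\<Prod>i=1..n. (varx * Y) ^ k - cst (c i) * varx ^ l) * Y ^ b = U * varx ^ n * vary ^ 1"
          unfolding e U_def by (simp add: Y_def i(2) mult_ac)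
        moreover have "finsupp2 U" unfolding U_def by (intro finsupp2_intros fY)
        moreover have "cf U 0 0 \<noteq> 0" using i c inj_onD[OF c(2), of i] by (auto simp: U_def cf_00_prod Y0 cf_cst)
        ultimately show ?thesis by blast
      qed
    qed
  qed
  then obtain V \<beta> e where V: "(\<Prod>i=1..n. (varx * Y) ^ k - cst (c i) * varx ^ l) * Y ^ b = V * varx ^ e * vary ^ \<beta>" "finsupp2 V" "cf V 0 0 \<noteq> 0"
    by blast
  have "transform (total k l n c a b) [t] = varx ^ (a + b) * ((\<Prod>i=1..n. (varx * Y) ^ k - cst (c i) * varx ^ l) * Y ^ b)"
    unfolding Some total_transform Y_def by (simp add: power_mult_distrib power_add mult_ac)
  also have "\<dots> = V * varx ^ (a + b + e) * vary ^ \<beta>" unfolding V(1) by (simp add: power_add mult_ac)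
  finally show ?thesis by (rule normal_crossingI[OF V(2,3)])
qed

lemma fibre_normal_crossing:
  assumes "coprime k l" "k \<ge> 1" "l \<ge> 1" "\<And>i. i \<in> {1..n} \<Longrightarrow> c i \<noteq> 0" "inj_on c {1..n}"
    "\<not> prefix p (euclid k l)" "prefix (butlast p) (euclid k l)"
  shows "normal_crossing (transform (total k l n c a b) p)"
  using assms
proof (induction "k + l" arbitrary: k l a b p rule: less_induct)
  case less
  then obtain t q where p: "p = t # q" by (cases p) auto
  show ?case
  proof (rule coprime_euclid_cases[OF less.prems(1-3)])
    assume "k = 1" "l = 1"
    moreover from this have "q = []" using less.prems(7) p by (auto simp: euclid_simps split: if_splits)
    ultimately show ?thesis unfolding p by (simp only:) (intro leaving_normal_crossing less.prems(4,5); simp)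
  next
    assume h: "k < l" "coprime k (l - k)" "l - k \<ge> 1"
    hence e: "euclid k l = Some 0 # euclid k (l - k)" using less.prems by (intro euclid_simps) auto
    show ?thesis
    proof (cases "t = Some 0")
      case True
      hence q: "\<not> prefix q (euclid k (l - k))" "prefix (butlast q) (euclid k (l - k))"
        using less.prems(6,7) unfolding e p by (auto split: if_splits)
      have eq: "transform (total k l n c a b) p = transform (total k (l - k) n c (a + b + k * n) b) q"
        unfolding p True by (subst transform_Cons) (simp only: total_step(1)[OF h(1)])
      show ?thesis unfolding eq
        by (rule less.hyps) (use h less.prems q in auto)
    next
      case False
      hence q: "q = []" using less.prems(7) unfolding e p by (auto split: if_splits)
      show ?thesis unfolding p q by (rule leaving_normal_crossing[OF less.prems(2-5)]) (use h False in auto)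
    qed
  next
    assume h: "l < k" "coprime (k - l) l" "k - l \<ge> 1"
    hence e: "euclid k l = None # euclid (k - l) l" using less.prems by (intro euclid_simps) auto
    show ?thesis
    proof (cases "t = None")
      case True
      hence q: "\<not> prefix q (euclid (k - l) l)" "prefix (butlast q) (euclid (k - l) l)"
        using less.prems(6,7) unfolding e p by (auto split: if_splits)
      have eq: "transform (total k l n c a b) p = transform (total (k - l) l n c a (a + b + l * n)) q"
        unfolding p True by (subst transform_Cons) (simp only: total_step(2)[OF h(1)])
      show ?thesis unfolding eq
        by (rule less.hyps) (use h less.prems q in auto)
    next
      case False
      hence q: "q = []" using less.prems(7) unfolding e p by (auto split: if_splits)
      show ?thesis unfolding p q by (rule leaving_normal_crossing[OF less.prems(2-5)]) (use h False in auto)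
    qed
  qed
qed

text \<open>The points blown up are exactly the prefixes of the Euclidean path: blowing them up
  suffices, and at each of them the total transform does not have normal crossings. All points of
  the principal component therefore lie in the fibre.\<close>

theorem euclid_fibre:
  assumes kl: "coprime k l" "k \<ge> 1" "l \<ge> 1" and n: "n \<ge> 1"
    and c: "\<And>i. i \<in> {1..n} \<Longrightarrow> c i \<noteq> 0" "inj_on c {1..n}"
    and T: "minimal_desing_curve (curve_eq k l n c) T"
  shows "euclid k l @ [t] \<in> fibre T"
proof -
  have f: "curve_eq k l n c = total k l n c 1 1" by (simp add: curve_eq_def total_def)
  define T' where "T' = {p. prefix p (euclid k l)}"
  have "T' = set (prefixes (euclid k l))" by (auto simp: T'_def)
  hence "finite T'" by simp
  hence "blowup_tree T'" unfolding blowup_tree_def T'_def by (auto dest: append_prefixD)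
  moreover have "normal_crossing (transform (curve_eq k l n c) p)" if "p \<in> fibre T'" for p
    unfolding f by (rule fibre_normal_crossing) (use kl c that in \<open>auto simp: fibre_def T'_def\<close>)
  ultimately have "desing_curve (curve_eq k l n c) T'" by (simp add: desing_curve_def transform_def)
  hence sub: "T \<subseteq> T'" using T by (simp add: minimal_desing_curve_def)
  have nc: "normal_crossing (transform (curve_eq k l n c) p)" if "p \<in> fibre T" for p
    using T that by (simp add: minimal_desing_curve_def desing_curve_def transform_def)
  have "prefix p (euclid k l) \<Longrightarrow> p \<in> T" for p
  proof (induction p rule: rev_induct)
    case Nil
    have "[] \<notin> fibre T" using nc[of "[]"] prefix_not_normal_crossing[OF kl n _ _ c(1), where a = 1 and b = 1 and p = "[]"] f by auto
    thus ?case by (simp add: fibre_def)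
  next
    case (snoc t p)
    hence "p \<in> T" by (auto dest: append_prefixD)
    moreover have "p @ [t] \<notin> fibre T"
      using nc[of "p @ [t]"] prefix_not_normal_crossing[OF kl n _ _ c(1) snoc.prems, where a = 1 and b = 1] f by auto
    ultimately show ?case by (simp add: fibre_def)
  qed
  hence "euclid k l \<in> T" by simp
  moreover have "euclid k l @ [t] \<notin> T" using sub by (auto simp: T'_def dest: prefix_length_le)
  ultimately show ?thesis by (simp add: fibre_def)
qed

text \<open>A composition of monomial blow-ups has a unimodular exponent matrix. Given the column
  sums, both product equations say a e - b c = 1, in the forms used at the direction
  \<open>None\<close> and at the directions \<open>Some t\<close>.\<close>

lemma blowup_map_euclid:
  assumes "coprime k l" "k \<ge> 1" "l \<ge> 1"
  shows "\<exists>a b c e. a + b = k \<and> c + e = l \<and> l * a = k * c + 1 \<and> k * e = l * b + 1 \<and>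
    (\<forall>q. blowup_map (euclid k l @ q) =
      (fst (blowup_map q) ^ a * snd (blowup_map q) ^ b, fst (blowup_map q) ^ c * snd (blowup_map q) ^ e))"
  using assms
proof (induction "k + l" arbitrary: k l rule: less_induct)
  case less
  show ?case
  proof (rule coprime_euclid_cases[OF less.prems(1-3)])
    assume "k = 1" "l = 1"
    thus ?thesis by (intro exI[of _ 1] exI[of _ 0]) (simp add: euclid_simps)
  next
    assume h: "k < l" "coprime k (l - k)" "l - k \<ge> 1"
    hence e: "euclid k l = Some 0 # euclid k (l - k)" using less.prems by (intro euclid_simps) auto
    obtain a b c d where abc: "a + b = k" "c + d = l - k" "(l - k) * a = k * c + 1" "k * d = (l - k) * b + 1"
      "\<And>q. blowup_map (euclid k (l - k) @ q) =
      (fst (blowup_map q) ^ a * snd (blowup_map q) ^ b, fst (blowup_map q) ^ c * snd (blowup_map q) ^ d)"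
      using less.hyps[of k "l - k"] h less.prems by auto
    obtain m where m: "l = k + m" using h less_imp_add_positive by blast
    show ?thesis
    proof (intro exI conjI allI)
      show "a + b = k" by (rule abc)
      show "(a + c) + (b + d) = l" using abc(1,2) h by linarith
      show "l * a = k * (a + c) + 1" using abc(3) by (simp add: m algebra_simps)
      show "k * (b + d) = l * b + 1" using abc(4) by (simp add: m algebra_simps)
      show "blowup_map (euclid k l @ q) = (fst (blowup_map q) ^ a * snd (blowup_map q) ^ b, fst (blowup_map q) ^ (a + c) * snd (blowup_map q) ^ (b + d))" for q
        unfolding e append_Cons blowup_map_Cons abc(5) by (simp add: power_add mult_ac)
    qed
  next
    assume h: "l < k" "coprime (k - l) l" "k - l \<ge> 1"
    hence e: "euclid k l = None # euclid (k - l) l" using less.prems by (intro euclid_simps) auto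
    obtain a b c d where abc: "a + b = k - l" "c + d = l" "l * a = (k - l) * c + 1" "(k - l) * d = l * b + 1"
      "\<And>q. blowup_map (euclid (k - l) l @ q) =
      (fst (blowup_map q) ^ a * snd (blowup_map q) ^ b, fst (blowup_map q) ^ c * snd (blowup_map q) ^ d)"
      using less.hyps[of "k - l" l] h less.prems by auto
    obtain m where m: "k = l + m" using h less_imp_add_positive by blast
    show ?thesis
    proof (intro exI conjI allI)
      show "(a + c) + (b + d) = k" using abc(1,2) h by linarith
      show "c + d = l" by (rule abc)
      show "l * (a + c) = k * c + 1" using abc(3) by (simp add: m algebra_simps)
      show "k * d = l * (b + d) + 1" using abc(4) by (simp add: m algebra_simps)
      show "blowup_map (euclid k l @ q) = (fst (blowup_map q) ^ (a + c) * snd (blowup_map q) ^ (b + d), fst (blowup_map q) ^ c * snd (blowup_map q) ^ d)" for q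
        unfolding e append_Cons blowup_map_Cons abc(5) by (simp add: power_add mult_ac)
    qed
  qed
qed

section \<open>The form near the principal component\<close>

subsection \<open>Binary forms and polynomials\<close>

lemma hs_Suc_shift:
  assumes "\<And>i. i \<ge> Suc m \<Longrightarrow> q i = 0"
  shows "hs k l (Suc m) q = varx ^ l * hs k l m q"
    "hs k l (Suc m) (\<lambda>i. case i of 0 \<Rightarrow> 0 | Suc j \<Rightarrow> q j) = vary ^ k * hs k l m q"
proof -
  have "hs k l (Suc m) q = (\<Sum>i\<le>m. cst (q i) * mon (l * (Suc m - i)) (k * i))"
    using assms[of "Suc m"] by (simp add: hs_def)
  also have "\<dots> = (\<Sum>i\<le>m. varx ^ l * (cst (q i) * mon (l * (m - i)) (k * i)))"
    by (rule sum.cong) (auto simp: mon_def Suc_diff_le power_add mult_ac)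
  finally show "hs k l (Suc m) q = varx ^ l * hs k l m q" by (simp add: hs_def sum_distrib_left)
  have "hs k l (Suc m) (\<lambda>i. case i of 0 \<Rightarrow> 0 | Suc j \<Rightarrow> q j) = (\<Sum>i\<le>m. cst (q i) * mon (l * (m - i)) (k * Suc i))"
    unfolding hs_def sum.atMost_Suc_shift by simp
  also have "\<dots> = (\<Sum>i\<le>m. vary ^ k * (cst (q i) * mon (l * (m - i)) (k * i)))"
    by (rule sum.cong) (auto simp: mon_def power_add mult_ac)
  finally show "hs k l (Suc m) (\<lambda>i. case i of 0 \<Rightarrow> 0 | Suc j \<Rightarrow> q j) = vary ^ k * hs k l m q"
    by (simp add: hs_def sum_distrib_left)
qed

text \<open>Homogenization turns the factor z - t into y^k - t x^l.\<close>

lemma hs_linear_factor: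
  assumes "\<And>i. i \<ge> Suc m \<Longrightarrow> coeff q i = 0"
  shows "hs k l (Suc m) (coeff ([:-t, 1:] * q)) = cusp k l t * hs k l m (coeff q)"
proof -
  have *: "coeff ([:-t, 1:] * q) i = (case i of 0 \<Rightarrow> 0 | Suc j \<Rightarrow> coeff q j) - t * coeff q i" for i
    by (cases i) (simp_all add: One_nat_def)
  note shift = hs_Suc_shift[of m "coeff q" k l]
  have c: "coeff ([:-t, 1:] * q) = (\<lambda>i. (case i of 0 \<Rightarrow> 0 | Suc j \<Rightarrow> coeff q j) - t * coeff q i)"
    using * by (rule ext)
  have "hs k l (Suc m) (coeff ([:-t, 1:] * q)) =
      hs k l (Suc m) (\<lambda>i. case i of 0 \<Rightarrow> 0 | Suc j \<Rightarrow> coeff q j) - cst t * hs k l (Suc m) (coeff q)"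
    unfolding c by (simp only: hs_diff hs_cst)
  also have "\<dots> = cusp k l t * hs k l m (coeff q)"
    using assms by (simp only: shift) (simp add: cusp_def algebra_simps)
  finally show ?thesis .
qed

lemma hs_prod_cusp:
  assumes "finite A"
  shows "hs k l (card A) (coeff (\<Prod>a\<in>A. [:- c a, 1:])) = (\<Prod>a\<in>A. cusp k l (c a)) \<and>
    (\<forall>i>card A. coeff (\<Prod>a\<in>A. [:- c a, 1:]) i = 0)"
  using assms
proof (induction A)
  case empty
  show ?case by (simp add: hs_def)
next
  case (insert a A)
  let ?q = "\<Prod>a\<in>A. [:- c a, 1:]"
  have "hs k l (Suc (card A)) (coeff ([:- c a, 1:] * ?q)) = cusp k l (c a) * hs k l (card A) (coeff ?q)"
    by (rule hs_linear_factor) (use insert.IH in auto)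
  moreover have "coeff ([:- c a, 1:] * ?q) i = 0" if "Suc (card A) < i" for i
    using insert.IH that by (cases i) (simp_all add: One_nat_def)
  moreover have "(\<Prod>b\<in>insert a A. [:- c b, 1:]) = [:- c a, 1:] * ?q" "card (insert a A) = Suc (card A)"
    "(\<Prod>b\<in>insert a A. cusp k l (c b)) = cusp k l (c a) * (\<Prod>b\<in>A. cusp k l (c b))"
    using insert.hyps by (simp_all only: prod.insert card_insert_disjoint not_False_eq_True)
  ultimately show ?case using insert.IH by metis
qed

lemma finsupp2_hs: "finsupp2 (hs k l n c)"
  unfolding hs_def mon_def by (intro finsupp2_intros)

definition cpoly :: "nat \<Rightarrow> (nat \<Rightarrow> complex) \<Rightarrow> complex poly" where
  "cpoly n c = (\<Sum>i\<le>n. Polynomial.monom (c i) i)"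

lemma coeff_cpoly: "coeff (cpoly n c) i = (if i \<le> n then c i else 0)"
  by (simp add: cpoly_def coeff_sum coeff_monom)

lemma degree_cpoly: "degree (cpoly n c) \<le> n"
  by (rule degree_le) (simp add: coeff_cpoly)

lemma poly_cpoly: "poly (cpoly n c) z = (\<Sum>i\<le>n. c i * z ^ i)"
  by (simp add: cpoly_def poly_sum poly_monom)

lemma hs_cpoly: "hs k l n (coeff (cpoly n c)) = hs k l n c"
  by (rule hs_cong) (simp add: coeff_cpoly)

lemma cusp_dvd_hs:
  assumes n: "n \<ge> 1" and z: "poly (cpoly n c) t = 0"
  shows "\<exists>h. finsupp2 h \<and> hs k l n c = cusp k l t * h"
proof -
  obtain q where q: "cpoly n c = [:-t, 1:] * q" using z by (auto simp: poly_eq_0_iff_dvd)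
  obtain m where m: "n = Suc m" using n by (cases n) auto
  have "coeff q i = 0" if "i \<ge> Suc m" for i
  proof (cases "q = 0")
    case False
    hence "Suc (degree q) \<le> n"
      using degree_cpoly[of n c] unfolding q by (subst (asm) degree_mult_eq) (auto simp: One_nat_def)
    thus ?thesis using that m by (intro coeff_eq_0) simp
  qed simp
  from hs_linear_factor[OF this, of m k l t] have "hs k l n c = cusp k l t * hs k l m (coeff q)"
    unfolding q[symmetric] m[symmetric] hs_cpoly by simp
  thus ?thesis using finsupp2_hs by blast
qed

text \<open>The exponents are left open because a chart of the principal component has z or 1/z as
  its coordinate: the exponent is i in the first case and n - i in the second.\<close>

definition pol :: "nat \<Rightarrow> (nat \<Rightarrow> nat) \<Rightarrow> (nat \<Rightarrow> complex) \<Rightarrow> series2 \<Rightarrow> series2" where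
  "pol n \<pi> c Y = (\<Sum>i\<le>n. cst (c i) * Y ^ \<pi> i)"

lemma pol_linear: "of_nat a * pol n \<pi> c Y + of_nat b * pol n \<pi> c' Y = pol n \<pi> (\<lambda>i. of_nat a * c i + of_nat b * c' i) Y"
  by (simp add: pol_def sum_distrib_left sum.distrib cst_of_nat algebra_simps)

lemma subst2_hs:
  assumes c0: "cf U 0 0 = 0" "cf V 0 0 = 0" and U: "U = \<xi> ^ k * Y ^ b" and V: "V = \<xi> ^ l * Y ^ e"
    and \<pi>: "\<And>i. i \<le> n \<Longrightarrow> l * b * (n - i) + k * e * i = e0 + \<pi> i"
  shows "subst2 (hs k l n c) U V = \<xi> ^ (k * l * n) * Y ^ e0 * pol n \<pi> c Y"
proof -
  have "U ^ (l * (n - i)) * V ^ (k * i) = \<xi> ^ (k * l * n) * Y ^ (e0 + \<pi> i)" if "i \<le> n" for i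
  proof -
    have "U ^ (l * (n - i)) * V ^ (k * i) = \<xi> ^ (k * l * (n - i) + k * l * i) * Y ^ (l * b * (n - i) + k * e * i)"
      by (simp add: U V power_mult_distrib power_add mult_ac flip: power_mult)
    also have "k * l * (n - i) + k * l * i = k * l * n" using that by (simp flip: distrib_left)
    finally show ?thesis unfolding \<pi>[OF that] .
  qed
  thus ?thesis unfolding hs_def pol_def subst2_sum[OF c0] subst2_cst_mult[OF c0] subst2_mon[OF c0]
    by (simp add: sum_distrib_left power_add mult_ac)
qed

lemma derivation_power:
  assumes "\<And>F G. \<delta> (F * G) = \<delta> F * G + F * \<delta> (G :: series2)"
  shows "\<delta> (F ^ m) = of_nat m * F ^ (m - 1) * \<delta> F"
proof (induction m)
  case 0
  have "\<delta> 1 = \<delta> 1 + \<delta> 1" using assms[of 1 1] by simp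
  thus ?case by simp
next
  case (Suc m)
  show ?case by (cases m) (use Suc in \<open>simp_all add: assms algebra_simps One_nat_def\<close>)
qed

text \<open>\<open>\<delta>\<close> is either partial derivative, \<open>\<xi>\<close> the equation
  of the principal component and \<open>Y\<close> the coordinate along it. The two claims are the
  derivatives across and along the component.\<close>

lemma pullback_component:
  fixes \<delta> :: "series2 \<Rightarrow> series2"
  assumes \<delta>: "\<And>F G. \<delta> (F * G) = \<delta> F * G + F * \<delta> G"
    and kl: "k \<ge> 1" "l \<ge> 1" "b + e \<ge> 1"
    and U: "U = \<xi> ^ k * Y ^ b" and V: "V = \<xi> ^ l * Y ^ e"
  shows "\<delta> \<xi> = 1 \<Longrightarrow> \<delta> Y = 0 \<Longrightarrow> V * (Z * A) * \<delta> U + U * (Z * B) * \<delta> V =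
      Z * \<xi> ^ (k + l - 1) * Y ^ (b + e) * (of_nat k * A + of_nat l * B)"
    "\<delta> \<xi> = 0 \<Longrightarrow> \<delta> Y = 1 \<Longrightarrow> V * (Z * A) * \<delta> U + U * (Z * B) * \<delta> V =
      Z * \<xi> ^ (k + l) * Y ^ (b + e - 1) * (of_nat b * A + of_nat e * B)"
proof -
  note d = derivation_power[of \<delta>, OF \<delta>]
  have 1: "\<xi> ^ l * \<xi> ^ (k - 1) = \<xi> ^ (k + l - 1)" "\<xi> ^ k * \<xi> ^ (l - 1) = \<xi> ^ (k + l - 1)"
    using kl by (simp_all add: add.commute flip: power_add)
  have 2: "of_nat b * (Y ^ e * Y ^ (b - 1)) = of_nat b * Y ^ (b + e - 1)"
    "of_nat e * (Y ^ b * Y ^ (e - 1)) = of_nat e * Y ^ (b + e - 1)"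
    by (cases b; simp add: add.commute flip: power_add) (cases e; simp add: add.commute flip: power_add)
  show "V * (Z * A) * \<delta> U + U * (Z * B) * \<delta> V =
      Z * \<xi> ^ (k + l - 1) * Y ^ (b + e) * (of_nat k * A + of_nat l * B)" if "\<delta> \<xi> = 1" "\<delta> Y = 0"
  proof -
    have "V * (Z * A) * \<delta> U + U * (Z * B) * \<delta> V =
      Z * A * of_nat k * (\<xi> ^ l * \<xi> ^ (k - 1)) * Y ^ (b + e) + Z * B * of_nat l * (\<xi> ^ k * \<xi> ^ (l - 1)) * Y ^ (b + e)"
      by (simp add: U V \<delta> d that power_add mult_ac add.commute)
    thus ?thesis unfolding 1 by (simp add: algebra_simps)
  qed
  show "V * (Z * A) * \<delta> U + U * (Z * B) * \<delta> V =
      Z * \<xi> ^ (k + l) * Y ^ (b + e - 1) * (of_nat b * A + of_nat e * B)" if "\<delta> \<xi> = 0" "\<delta> Y = 1"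
  proof -
    have "V * (Z * A) * \<delta> U + U * (Z * B) * \<delta> V =
      Z * A * \<xi> ^ (k + l) * (of_nat b * (Y ^ e * Y ^ (b - 1))) + Z * B * \<xi> ^ (k + l) * (of_nat e * (Y ^ b * Y ^ (e - 1)))"
      by (simp add: U V \<delta> d that power_add mult_ac add.commute)
    thus ?thesis unfolding 2 by (simp add: algebra_simps)
  qed
qed

text \<open>Serves all charts at once: \<open>\<xi>\<close> and \<open>Y\<close> may be the
  coordinates in either order, and \<open>Y\<close> may be y + t. Up to the common factor the
  pullback is Y P(Y) d\<open>\<xi>\<close> + \<open>\<xi>\<close> N(Y) dY with P = k
  \<open>al\<close> + l \<open>be\<close> and N = b \<open>al\<close> + e \<open>be\<close>.\<close>

lemma pullback_hs:
  fixes al be :: "nat \<Rightarrow> complex"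
  assumes kl: "k \<ge> 1" "l \<ge> 1" "b + e \<ge> 1"
    and c0: "cf U 0 0 = 0" "cf V 0 0 = 0" and U: "U = \<xi> ^ k * Y ^ b" and V: "V = \<xi> ^ l * Y ^ e"
    and \<pi>: "\<And>i. i \<le> n \<Longrightarrow> l * b * (n - i) + k * e * i = e0 + \<pi> i"
  defines "\<Omega> \<equiv> (vary * hs k l n al, varx * hs k l n be)"
  defines "M \<equiv> k * l * n + (k + l - 1)" and "m \<equiv> e0 + (b + e - 1)"
  shows "dx2 \<xi> = 1 \<Longrightarrow> dx2 Y = 0 \<Longrightarrow> dy2 \<xi> = 0 \<Longrightarrow> dy2 Y = 1 \<Longrightarrow> pullback (U, V) \<Omega> =
      (\<xi> ^ M * (Y ^ m * (Y * pol n \<pi> (\<lambda>i. of_nat k * al i + of_nat l * be i) Y)),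
       \<xi> ^ M * (Y ^ m * (\<xi> * pol n \<pi> (\<lambda>i. of_nat b * al i + of_nat e * be i) Y)))"
    "dx2 \<xi> = 0 \<Longrightarrow> dx2 Y = 1 \<Longrightarrow> dy2 \<xi> = 1 \<Longrightarrow> dy2 Y = 0 \<Longrightarrow> pullback (U, V) \<Omega> =
      (\<xi> ^ M * (Y ^ m * (\<xi> * pol n \<pi> (\<lambda>i. of_nat b * al i + of_nat e * be i) Y)),
       \<xi> ^ M * (Y ^ m * (Y * pol n \<pi> (\<lambda>i. of_nat k * al i + of_nat l * be i) Y)))"
proof -
  define Z where "Z = \<xi> ^ (k * l * n) * Y ^ e0"
  have f: "fst (pullback (U, V) \<Omega>) = V * (Z * pol n \<pi> al Y) * dx2 U + U * (Z * pol n \<pi> be Y) * dx2 V"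
    "snd (pullback (U, V) \<Omega>) = V * (Z * pol n \<pi> al Y) * dy2 U + U * (Z * pol n \<pi> be Y) * dy2 V"
    unfolding \<Omega>_def pullback_simps fst_conv snd_conv subst2_mult[OF c0] subst2_varx[OF c0] subst2_vary[OF c0]
      Z_def by (simp_all add: subst2_hs[OF c0 U V, of n e0 \<pi>] \<pi>)
  have s: "Z * \<xi> ^ (k + l - 1) * Y ^ (b + e) = \<xi> ^ M * (Y ^ m * Y)"
    "Z * \<xi> ^ (k + l) * Y ^ (b + e - 1) = \<xi> ^ M * (Y ^ m * \<xi>)"
  proof -
    obtain q where q: "b + e = Suc q" using kl(3) by (cases "b + e") auto
    show "Z * \<xi> ^ (k + l - 1) * Y ^ (b + e) = \<xi> ^ M * (Y ^ m * Y)"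
      by (simp add: Z_def M_def m_def q power_add mult_ac)
    obtain q where q: "k + l = Suc q" using kl by (cases "k + l") auto
    show "Z * \<xi> ^ (k + l) * Y ^ (b + e - 1) = \<xi> ^ M * (Y ^ m * \<xi>)"
      by (simp add: Z_def M_def m_def q power_add mult_ac)
  qed
  show "pullback (U, V) \<Omega> =
      (\<xi> ^ M * (Y ^ m * (Y * pol n \<pi> (\<lambda>i. of_nat k * al i + of_nat l * be i) Y)),
       \<xi> ^ M * (Y ^ m * (\<xi> * pol n \<pi> (\<lambda>i. of_nat b * al i + of_nat e * be i) Y)))"
    if "dx2 \<xi> = 1" "dx2 Y = 0" "dy2 \<xi> = 0" "dy2 Y = 1"
    by (rule prod_eqI; simp only: f fst_conv snd_conv pullback_component(1)[OF dx2_mult kl U V that(1,2)]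
      pullback_component(2)[OF dy2_mult kl U V that(3,4)] s pol_linear) (simp_all only: mult.assoc)
  show "pullback (U, V) \<Omega> =
      (\<xi> ^ M * (Y ^ m * (\<xi> * pol n \<pi> (\<lambda>i. of_nat b * al i + of_nat e * be i) Y)),
       \<xi> ^ M * (Y ^ m * (Y * pol n \<pi> (\<lambda>i. of_nat k * al i + of_nat l * be i) Y)))"
    if "dx2 \<xi> = 0" "dx2 Y = 1" "dy2 \<xi> = 1" "dy2 Y = 0"
    by (rule prod_eqI; simp only: f fst_conv snd_conv pullback_component(2)[OF dx2_mult kl U V that(1,2)]
      pullback_component(1)[OF dy2_mult kl U V that(3,4)] s pol_linear) (simp_all only: mult.assoc)
qed

subsection \<open>Saddle-nodes\<close>

lemma saddle_nodeI:
  assumes "cf (fst \<omega>) 0 0 = 0" "cf (snd \<omega>) 0 0 = 0" "cf (fst \<omega>) 1 0 = 0" "cf (snd \<omega>) 0 1 = 0"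
    and one: "cf (snd \<omega>) 1 0 = 0 \<and> cf (fst \<omega>) 0 1 \<noteq> 0 \<or> cf (snd \<omega>) 1 0 \<noteq> 0 \<and> cf (fst \<omega>) 0 1 = 0"
  shows "saddle_node \<omega>"
proof -
  define p where "p = - cf (snd \<omega>) 1 0"
  define q where "q = cf (fst \<omega>) 0 1"
  have L: "linear_part \<omega> = mat_of_rows_list 2 [[p, 0], [0, q]]"
    by (simp add: linear_part_def assms p_def q_def)
  have c: "char_poly (linear_part \<omega>) = (\<Prod>a\<leftarrow>diag_mat (linear_part \<omega>). [:- a, 1:])"
  proof (rule char_poly_upper_triangular)
    show "linear_part \<omega> \<in> carrier_mat 2 2" unfolding L by (simp add: mat_of_rows_list_def numeral_2_eq_2)
    show "upper_triangular (linear_part \<omega>)"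
      unfolding L upper_triangular_def mat_of_rows_list_def
      by (auto simp: numeral_2_eq_2 less_Suc_eq)
  qed
  have "diag_mat (linear_part \<omega>) = [p, q]"
    unfolding L diag_mat_def mat_of_rows_list_def by (simp add: numeral_2_eq_2 One_nat_def)
  hence c: "char_poly (linear_part \<omega>) = [:- p, 1:] * [:- q, 1:]" using c by simp
  have "\<exists>\<nu>. eigenvalue_pair \<omega> 0 \<nu> \<and> \<nu> \<noteq> 0"
    using one unfolding eigenvalue_pair_def c
    by (elim disjE) (rule exI[of _ q], simp add: p_def q_def, rule exI[of _ p], simp add: p_def q_def mult.commute)
  thus ?thesis using assms by (simp add: saddle_node_def singular_form_def)
qed

lemma cf_mult_10: "cf (F * G) 1 0 = cf F 0 0 * cf G 1 0 + cf F 1 0 * cf G 0 0"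
  and cf_mult_01: "cf (F * G) 0 1 = cf F 0 0 * cf G 0 1 + cf F 0 1 * cf G 0 0"
  by (simp_all add: cf_mult One_nat_def atMost_Suc)

text \<open>The local generator in \<open>foliation_at\<close> is known only through an unspecified
  multiplier \<open>g\<close>. Since the generator has no factor z, the whole power of z sits in
  \<open>g\<close>.\<close>

lemma remove_prime:
  fixes z :: series2
  assumes z: "prime_elem z" and n: "\<not> (z dvd A1 \<and> z dvd A2)"
  shows "g * A1 = z ^ m * B1 \<Longrightarrow> g * A2 = z ^ m * B2 \<Longrightarrow> \<exists>g'. g' * A1 = B1 \<and> g' * A2 = B2"
proof (induction m arbitrary: g)
  case 0
  thus ?case by auto
next
  case (Suc m)
  have "z dvd g * A1" "z dvd g * A2" using Suc.prems by simp_all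
  hence "z dvd g" using n z by (auto simp: prime_elem_dvd_mult_iff)
  then obtain g1 where g1: "g = z * g1" by blast
  have "z \<noteq> 0" using z by (simp add: prime_elem_def)
  hence "g1 * A1 = z ^ m * B1" "g1 * A2 = z ^ m * B2"
    using Suc.prems unfolding g1 by (simp_all add: mult.assoc)
  thus ?case by (rule Suc.IH)
qed

text \<open>Coprimality is stated for convergent factors. Dividing a convergent series by x or y
  only shifts its coefficients, so the quotient converges again.\<close>

lemma coprime_form_axes:
  assumes "coprime_form (A1, A2)"
  shows "\<not> (varx dvd A1 \<and> varx dvd A2)" "\<not> (vary dvd A1 \<and> vary dvd A2)"
proof -
  have cv: "convergent2 A1" "convergent2 A2" and u: "\<And>g. convergent2 g \<Longrightarrow> gdvd g A1 \<Longrightarrow> gdvd g A2 \<Longrightarrow> gunit g"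
    using assms by (auto simp: coprime_form_def)
  have shift: "convergent2 h" if F: "convergent2 F" and h: "\<And>i j. cf h i j = cf F (i + a) (j + b)" for F h a b
  proof -
    obtain C R where CR: "\<And>i j. norm (cf F i j) \<le> C * R ^ (i + j)" using F unfolding convergent2_def by blast
    have "norm (cf h i j) \<le> (C * R ^ (a + b)) * R ^ (i + j)" for i j
      using CR[of "i + a" "j + b"] by (simp add: h power_add mult_ac)
    thus ?thesis unfolding convergent2_def by blast
  qed
  have "gdvd varx F" if "convergent2 F" "varx dvd F" for F
  proof -
    obtain h where h: "F = varx * h" using \<open>varx dvd F\<close> by blast
    hence "cf h i j = cf F (i + 1) (j + 0)" for i j by (simp add: cf_varx_mult)
    from shift[OF that(1) this] show ?thesis unfolding gdvd_def using h by blast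
  qed
  moreover have "gdvd vary F" if "convergent2 F" "vary dvd F" for F
  proof -
    obtain h where h: "F = vary * h" using \<open>vary dvd F\<close> by blast
    hence "cf h i j = cf F (i + 0) (j + 1)" for i j by (simp add: cf_vary_mult)
    from shift[OF that(1) this] show ?thesis unfolding gdvd_def using h by blast
  qed
  moreover have "\<not> gunit varx" "\<not> gunit vary" by (simp_all add: gunit_def cf_varx cf_vary)
  ultimately show "\<not> (varx dvd A1 \<and> varx dvd A2)" "\<not> (vary dvd A1 \<and> vary dvd A2)"
    using u cv finsupp2_convergent2 finsupp2_basic by blast+
qed

text \<open>As z does not divide g, it must divide \<open>A2\<close>; after cancelling it, g divides
  the unit \<open>\<tau>\<close>.\<close>

lemma unit_multiplier:
  fixes z :: series2
  assumes z: "prime_elem z" and eq: "g * A1 = B1" "g * A2 = z * \<tau>" and B: "\<not> z dvd B1" and \<tau>: "cf \<tau> 0 0 \<noteq> 0"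
  shows "cf g 0 0 \<noteq> 0"
proof -
  have "\<not> z dvd g" using eq(1) B by auto
  moreover have "z dvd g * A2" using eq(2) by simp
  ultimately have "z dvd A2" using z by (simp add: prime_elem_dvd_mult_iff)
  then obtain \<sigma> where "A2 = z * \<sigma>" by blast
  hence "z * (g * \<sigma>) = z * \<tau>" using eq(2) by (simp add: mult.left_commute)
  hence "g * \<sigma> = \<tau>" using z by (auto simp: prime_elem_def)
  thus ?thesis using \<tau> by auto
qed

lemma saddle_node_transfer:
  assumes eq: "g * A1 = B1" "g * A2 = B2" and g: "cf g 0 0 \<noteq> 0"
    and B: "cf B1 0 0 = 0" "cf B2 0 0 = 0" "cf B1 1 0 = 0" "cf B2 0 1 = 0"
    and one: "cf B2 1 0 = 0 \<and> cf B1 0 1 \<noteq> 0 \<or> cf B2 1 0 \<noteq> 0 \<and> cf B1 0 1 = 0"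
  shows "saddle_node (A1, A2)"
proof -
  have A: "cf A1 0 0 = 0" "cf A2 0 0 = 0" using B(1,2) g unfolding eq[symmetric] by auto
  show ?thesis
    by (rule saddle_nodeI) (use A B(3,4) one g in \<open>auto simp: eq[symmetric] cf_mult_10 cf_mult_01\<close>)
qed

context
  fixes k l n :: nat and al be :: "nat \<Rightarrow> complex" and \<Omega> :: form2
  assumes k: "k \<ge> 1" and l: "l \<ge> 1" and n: "n \<ge> 1" and kl: "coprime k l"
    and \<Omega>: "\<Omega> = (vary * hs k l n al, varx * hs k l n be)" and cop: "coprime_form \<Omega>"
begin

text \<open>A common zero t would give the two coefficients of the form the common factor y^k - t
  x^l.\<close>

lemma no_common_zero: "poly (cpoly n al) t \<noteq> 0 \<or> poly (cpoly n be) t \<noteq> 0"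
proof (rule ccontr)
  assume "\<not> ?thesis"
  then obtain g h where g: "finsupp2 g" "hs k l n al = cusp k l t * g" and h: "finsupp2 h" "hs k l n be = cusp k l t * h"
    using cusp_dvd_hs[OF n, of al t] cusp_dvd_hs[OF n, of be t] by blast
  have "convergent2 (vary * g)" "convergent2 (varx * h)" "convergent2 (cusp k l t)"
    unfolding cusp_def using g h by (auto intro!: finsupp2_convergent2 finsupp2_intros)
  moreover have "vary * hs k l n al = cusp k l t * (vary * g)" "varx * hs k l n be = cusp k l t * (varx * h)"
    by (simp_all add: g h mult_ac)
  ultimately have "gdvd (cusp k l t) (fst \<Omega>)" "gdvd (cusp k l t) (snd \<Omega>)" "convergent2 (cusp k l t)"
    unfolding gdvd_def \<Omega> fst_conv snd_conv by blast+
  hence "gunit (cusp k l t)" using cop unfolding coprime_form_def by blast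
  thus False using k l by (simp add: gunit_def cusp_def cf_varx cf_vary zero_power)
qed

lemma cf_hs_corner: "cf (hs k l n c) 0 j = (if j = k * n then c n else 0)"
proof -
  have "cf (hs k l n c) 0 j = (\<Sum>i\<le>n. if i = n then (if j = k * n then c n else 0) else 0)"
    unfolding hs_def cf_sum by (rule sum.cong) (use l in \<open>auto simp: cf_mon\<close>)
  thus ?thesis by simp
qed

lemma no_common_infinity: "al n \<noteq> 0 \<or> be n \<noteq> 0"
proof (rule ccontr)
  assume a: "\<not> ?thesis"
  have "varx dvd vary * hs k l n al" "varx dvd varx * hs k l n be"
    using a by (simp_all add: varx_dvd_iff cf_vary_mult cf_varx_mult cf_hs_corner)
  thus False using coprime_form_axes(1)[of "vary * hs k l n al" "varx * hs k l n be"] cop \<Omega> by simp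
qed

definition "Pp = cpoly n (\<lambda>i. of_nat k * al i + of_nat l * be i)"

lemma poly_Pp: "poly Pp z = of_nat k * poly (cpoly n al) z + of_nat l * poly (cpoly n be) z"
  by (simp add: Pp_def poly_cpoly sum_distrib_left sum.distrib algebra_simps)

text \<open>If k \<open>al\<close> + l \<open>be\<close> vanished, every zero of \<open>al\<close>
  would be a zero of \<open>be\<close>, and \<open>al\<close> would have one because its degree is n
  >= 1.\<close>

lemma Pp_nonzero: "Pp \<noteq> 0"
proof
  assume P: "Pp = 0"
  have c: "of_nat k * al i + of_nat l * be i = 0" if "i \<le> n" for i
    using arg_cong[OF P, of "\<lambda>p. coeff p i"] that by (simp add: Pp_def coeff_cpoly)
  have an: "al n \<noteq> 0" using c[of n] no_common_infinity l by auto
  have "degree (cpoly n al) = n"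
    using degree_cpoly[of n al] le_degree[of "cpoly n al" n] an by (simp add: coeff_cpoly)
  hence "\<not> constant (poly (cpoly n al))" using n by (simp add: constant_degree)
  then obtain t where t: "poly (cpoly n al) t = 0" using fundamental_theorem_of_algebra by blast
  moreover have "poly (cpoly n be) t = 0" using poly_Pp[of t] P t l by auto
  ultimately show False using no_common_zero by blast
qed

lemma pol_corner: "cf (pol n \<pi> c Y) 0 0 = (\<Sum>i\<le>n. c i * cf Y 0 0 ^ \<pi> i)"
  by (simp add: pol_def cf_cst)

text \<open>At a zero t of P the pullback has, up to common factors, a diagonal linear part whose
  entries are -N(t) and the derivative of Y P(Y). The first is nonzero by unimodularity and
  \<open>no_common_zero\<close>; the second vanishes if t = 0 or if the root is multiple, and then
  the point is a saddle-node. The direction \<open>None\<close> is the same argument at z =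
  infinity.\<close>

lemma simple_roots:
  assumes leaves: "\<And>t. \<exists>\<omega>'. foliation_at \<Omega> (euclid k l @ [t]) \<omega>' \<and> \<not> saddle_node \<omega>'"
  shows "of_nat k * al n + of_nat l * be n \<noteq> 0"
    "poly Pp t = 0 \<Longrightarrow> t \<noteq> 0 \<and> poly (pderiv Pp) t \<noteq> 0"
proof -
  obtain a b c e where abc: "a + b = k" "c + e = l" "l * a = k * c + 1" "k * e = l * b + 1"
    and bm: "\<And>q. blowup_map (euclid k l @ q) =
      (fst (blowup_map q) ^ a * snd (blowup_map q) ^ b, fst (blowup_map q) ^ c * snd (blowup_map q) ^ e)"
    using blowup_map_euclid[OF kl k l] by blast
  \<comment> \<open>Both coefficient matrices are unimodular by the two product equations for the
    exponents.\<close>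
  have det: "\<And>A B :: complex. of_nat k * A + of_nat l * B = 0 \<Longrightarrow> of_nat b * A + of_nat e * B = 0 \<Longrightarrow> A = 0 \<and> B = 0"
    "\<And>A B :: complex. of_nat k * A + of_nat l * B = 0 \<Longrightarrow> of_nat a * A + of_nat c * B = 0 \<Longrightarrow> A = 0 \<and> B = 0"
  proof -
    have ke: "of_nat k * of_nat e = of_nat l * of_nat b + (1 :: complex)"
      "of_nat l * of_nat a = of_nat k * of_nat c + (1 :: complex)"
      using arg_cong[OF abc(4), of "of_nat :: nat \<Rightarrow> complex"] arg_cong[OF abc(3), of "of_nat :: nat \<Rightarrow> complex"] by simp_all
    fix A B :: complex
    assume 1: "of_nat k * A + of_nat l * B = 0"
    show "A = 0 \<and> B = 0" if 2: "of_nat b * A + of_nat e * B = 0"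
    proof -
      have "of_nat e * (of_nat k * A + of_nat l * B) - of_nat l * (of_nat b * A + of_nat e * B) =
        (of_nat k * of_nat e - of_nat l * of_nat b) * A"
        "of_nat k * (of_nat b * A + of_nat e * B) - of_nat b * (of_nat k * A + of_nat l * B) =
        (of_nat k * of_nat e - of_nat l * of_nat b) * B" by (simp_all add: algebra_simps)
      thus ?thesis unfolding 1 2 ke by simp
    qed
    show "A = 0 \<and> B = 0" if 2: "of_nat a * A + of_nat c * B = 0"
    proof -
      have "of_nat l * (of_nat a * A + of_nat c * B) - of_nat c * (of_nat k * A + of_nat l * B) =
        (of_nat l * of_nat a - of_nat k * of_nat c) * A"
        "of_nat a * (of_nat k * A + of_nat l * B) - of_nat k * (of_nat a * A + of_nat c * B) =
        (of_nat l * of_nat a - of_nat k * of_nat c) * B" by (simp_all add: algebra_simps)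
      thus ?thesis unfolding 1 2 ke by simp
    qed
  qed
  show Pn: "of_nat k * al n + of_nat l * be n \<noteq> 0"
  proof
    assume P0: "of_nat k * al n + of_nat l * be n = 0"
    obtain \<omega>' where "foliation_at \<Omega> (euclid k l @ [None]) \<omega>'" "\<not> saddle_node \<omega>'" using leaves by blast
    moreover obtain A1 A2 where A: "\<omega>' = (A1, A2)" by (cases \<omega>')
    ultimately have ns: "\<not> saddle_node (A1, A2)" and cA: "coprime_form (A1, A2)"
      and ex: "\<exists>g. pullback (blowup_map (euclid k l @ [None])) \<Omega> = smul g (A1, A2)"
      by (auto simp: foliation_at_def)
    obtain g where g: "pullback (blowup_map (euclid k l @ [None])) \<Omega> = smul g (A1, A2)" using ex by blast
    define N where "N = (\<lambda>i. of_nat a * al i + of_nat c * be i)"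
    define P where "P = (\<lambda>i. of_nat k * al i + of_nat l * be i)"
    define \<pi> where "\<pi> = (\<lambda>i. n - i)"
    have U: "(varx * vary) ^ a * vary ^ b = vary ^ k * varx ^ a" "(varx * vary) ^ c * vary ^ e = vary ^ l * varx ^ c"
      by (simp_all add: abc(1,2)[symmetric] power_mult_distrib power_add mult_ac)
    have exps: "l * a * (n - i) + k * c * i = k * c * n + \<pi> i" if "i \<le> n" for i
    proof -
      have "l * a * (n - i) + k * c * i = k * c * ((n - i) + i) + (n - i)"
        unfolding abc(3) by (simp add: algebra_simps)
      thus ?thesis using that by (simp add: \<pi>_def)
    qed
    have "a \<noteq> 0" using abc(3) by (intro notI) simp
    hence ac: "a + c \<ge> 1" by simp
    have "\<exists>M m'. pullback (blowup_map (euclid k l @ [None])) \<Omega> =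
      (vary ^ M * (varx ^ m' * (vary * pol n \<pi> N varx)), vary ^ M * (varx ^ m' * (varx * pol n \<pi> P varx)))"
      unfolding bm \<Omega> bm1 fst_conv snd_conv N_def P_def
      by (intro exI, rule pullback_hs(2)[OF k l ac _ _ U exps]) (use k l in \<open>simp_all add: U cf_vary zero_power\<close>)
    then obtain M m' where "g * A1 = vary ^ M * (varx ^ m' * (vary * pol n \<pi> N varx))"
      "g * A2 = vary ^ M * (varx ^ m' * (varx * pol n \<pi> P varx))"
      unfolding g by (auto simp: smul_def)
    from remove_prime[OF prime_vary coprime_form_axes(2)[OF cA] this] obtain g1 where
      "g1 * A1 = varx ^ m' * (vary * pol n \<pi> N varx)" "g1 * A2 = varx ^ m' * (varx * pol n \<pi> P varx)" by blast
    from remove_prime[OF prime_varx coprime_form_axes(1)[OF cA] this] obtain g2 where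
      g2: "g2 * A1 = vary * pol n \<pi> N varx" "g2 * A2 = varx * pol n \<pi> P varx" by blast
    have N0: "cf (pol n \<pi> N varx) 0 0 \<noteq> 0"
    proof -
      have "(\<Sum>i\<le>n. N i * 0 ^ \<pi> i) = (\<Sum>i\<le>n. if i = n then N n else 0)"
        by (rule sum.cong) (auto simp: \<pi>_def zero_power)
      hence "cf (pol n \<pi> N varx) 0 0 = N n" by (simp add: pol_corner cf_varx)
      thus ?thesis using det(2)[OF P0] no_common_infinity by (auto simp: N_def)
    qed
    have Pc: "cf (pol n \<pi> P varx) i j = (if j = 0 \<and> i \<le> n then P (n - i) else 0)" for i j
    proof -
      have "cf (pol n \<pi> P varx) i j = (\<Sum>s\<le>n. if s = n - i then (if j = 0 \<and> i \<le> n then P (n - i) else 0) else 0)"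
        unfolding pol_def cf_sum
      proof (rule sum.cong)
        fix s assume s: "s \<in> {..n}"
        have "cst (P s) * varx ^ \<pi> s = cst (P s) * mon (\<pi> s) 0" by (simp add: mon_def)
        thus "cf (cst (P s) * varx ^ \<pi> s) i j = (if s = n - i then (if j = 0 \<and> i \<le> n then P (n - i) else 0) else 0)"
          using s by (simp only:) (auto simp: cf_mon \<pi>_def simp del: cst_simps)
      qed simp
      thus ?thesis by simp
    qed
    have B2: "\<not> vary dvd varx * pol n \<pi> P varx"
    proof
      assume "vary dvd varx * pol n \<pi> P varx"
      hence "cf (varx * pol n \<pi> P varx) (Suc i) 0 = 0" for i by (simp add: vary_dvd_iff)
      hence z: "cf (pol n \<pi> P varx) i 0 = 0" for i by (simp add: cf_varx_mult)
      have "P i = 0" if "i \<le> n" for i using z[of "n - i"] that by (simp add: Pc)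
      hence "Pp = 0" unfolding Pp_def by (simp add: cpoly_def P_def)
      thus False using Pp_nonzero by simp
    qed
    have gu: "cf g2 0 0 \<noteq> 0" by (rule unit_multiplier[OF prime_vary g2(2,1) B2 N0])
    have Pn0: "P n = 0" using P0 by (simp add: P_def)
    have "saddle_node (A1, A2)"
      by (rule saddle_node_transfer[OF g2 gu])
        (use N0 Pn0 in \<open>auto simp: cf_mult_10 cf_mult_01 cf_varx cf_vary Pc\<close>)
    thus False using ns by simp
  qed
  show "t \<noteq> 0 \<and> poly (pderiv Pp) t \<noteq> 0" if root: "poly Pp t = 0"
  proof (rule ccontr)
    assume bad: "\<not> (t \<noteq> 0 \<and> poly (pderiv Pp) t \<noteq> 0)"
    obtain \<omega>' where "foliation_at \<Omega> (euclid k l @ [Some t]) \<omega>'" "\<not> saddle_node \<omega>'" using leaves by blast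
    moreover obtain A1 A2 where A: "\<omega>' = (A1, A2)" by (cases \<omega>')
    ultimately have ns: "\<not> saddle_node (A1, A2)" and cA: "coprime_form (A1, A2)"
      and ex: "\<exists>g. pullback (blowup_map (euclid k l @ [Some t])) \<Omega> = smul g (A1, A2)"
      by (auto simp: foliation_at_def)
    obtain g where g: "pullback (blowup_map (euclid k l @ [Some t])) \<Omega> = smul g (A1, A2)" using ex by blast
    define N where "N = (\<lambda>i. of_nat b * al i + of_nat e * be i)"
    define P where "P = (\<lambda>i. of_nat k * al i + of_nat l * be i)"
    define Y where "Y = vary + cst t"
    have Y: "dx2 Y = 0" "dy2 Y = 1" "cf Y 0 0 = t" "cf Y 0 1 = 1" "cf Y 1 0 = 0"
      by (simp_all add: Y_def cf_vary cf_cst)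
    have U: "varx ^ a * (varx * Y) ^ b = varx ^ k * Y ^ b" "varx ^ c * (varx * Y) ^ e = varx ^ l * Y ^ e"
      by (simp_all add: abc(1,2)[symmetric] power_mult_distrib power_add mult_ac)
    have exps: "l * b * (n - i) + k * e * i = l * b * n + (\<lambda>i. i) i" if "i \<le> n" for i
    proof -
      have "l * b * (n - i) + k * e * i = l * b * ((n - i) + i) + i"
        unfolding abc(4) by (simp add: algebra_simps)
      thus ?thesis using that by simp
    qed
    have "e \<noteq> 0" using abc(4) by (intro notI) simp
    hence be1: "b + e \<ge> 1" by simp
    have "\<exists>M m'. pullback (blowup_map (euclid k l @ [Some t])) \<Omega> =
      (varx ^ M * (Y ^ m' * (Y * pol n (\<lambda>i. i) P Y)), varx ^ M * (Y ^ m' * (varx * pol n (\<lambda>i. i) N Y)))"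
      unfolding bm \<Omega> bm1 fst_conv snd_conv N_def P_def Y_def[symmetric]
      by (intro exI, rule pullback_hs(1)[OF k l be1 _ _ U exps]) (use k l Y in \<open>simp_all add: U cf_varx zero_power\<close>)
    then obtain M m' where "g * A1 = varx ^ M * (Y ^ m' * (Y * pol n (\<lambda>i. i) P Y))"
      "g * A2 = varx ^ M * (Y ^ m' * (varx * pol n (\<lambda>i. i) N Y))"
      unfolding g by (auto simp: smul_def)
    from remove_prime[OF prime_varx coprime_form_axes(1)[OF cA] this] obtain g1 where
      g1: "g1 * A1 = Y ^ m' * (Y * pol n (\<lambda>i. i) P Y)" "g1 * A2 = Y ^ m' * (varx * pol n (\<lambda>i. i) N Y)" by blast
    \<comment> \<open>For t different from 0 the factor \<open>Y\<close> is a unit and may stay; for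
      t = 0 it is the coordinate y and has to be cancelled.\<close>
    have "\<exists>g2 m2. g2 * A1 = Y ^ m2 * (Y * pol n (\<lambda>i. i) P Y) \<and> g2 * A2 = Y ^ m2 * (varx * pol n (\<lambda>i. i) N Y) \<and>
        (t = 0 \<longrightarrow> m2 = 0)"
    proof (cases "t = 0")
      case True
      hence "Y = vary" by (simp add: Y_def)
      from remove_prime[OF prime_vary coprime_form_axes(2)[OF cA] g1[unfolded this]] \<open>Y = vary\<close>
      show ?thesis by (metis mult_1 power_0)
    qed (use g1 in blast)
    then obtain g2 m2 where g2: "g2 * A1 = Y ^ m2 * (Y * pol n (\<lambda>i. i) P Y)" "g2 * A2 = varx * (Y ^ m2 * pol n (\<lambda>i. i) N Y)"
      and m2: "t = 0 \<longrightarrow> m2 = 0" by (auto simp: mult_ac)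
    have polv: "cf (pol n (\<lambda>i. i) c Y) 0 0 = poly (cpoly n c) t" for c
      by (simp add: pol_corner Y poly_cpoly)
    have "poly (cpoly n N) t \<noteq> 0"
    proof
      assume "poly (cpoly n N) t = 0"
      hence "of_nat b * poly (cpoly n al) t + of_nat e * poly (cpoly n be) t = 0"
        by (simp add: N_def poly_cpoly sum_distrib_left sum.distrib algebra_simps)
      from det(1)[OF root[unfolded poly_Pp] this] show False using no_common_zero by blast
    qed
    hence \<tau>: "cf (Y ^ m2 * pol n (\<lambda>i. i) N Y) 0 0 \<noteq> 0" using m2 by (simp add: polv Y)
    have dx0: "dx2 (pol n (\<lambda>i. i) c Y) = 0" for c
      by (simp add: pol_def lincont_sum[OF lincont_dx2] dx2_power Y)
    have dyp: "cf (dy2 (pol n (\<lambda>i. i) P Y)) 0 0 = poly (pderiv Pp) t"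
    proof -
      have "cf (dy2 (pol n (\<lambda>i. i) P Y)) 0 0 = (\<Sum>i\<le>n. P i * (of_nat i * t ^ (i - 1)))"
        by (simp add: pol_def lincont_sum[OF lincont_dy2] dy2_power Y cf_cst flip: cst_of_nat)
      also have "\<dots> = poly (pderiv Pp) t"
        by (simp add: Pp_def cpoly_def P_def pderiv_sum poly_sum pderiv_monom poly_monom mult_ac)
      finally show ?thesis .
    qed
    have B1x: "dx2 (Y ^ m2 * (Y * pol n (\<lambda>i. i) P Y)) = 0"
      by (simp add: dx2_mult dx2_power Y dx0)
    have B1: "\<not> varx dvd Y ^ m2 * (Y * pol n (\<lambda>i. i) P Y)"
    proof -
      have "\<not> varx dvd Y" using Y(4) unfolding varx_dvd_iff by (metis zero_neq_one)
      moreover have "\<not> varx dvd pol n (\<lambda>i. i) P Y"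
      proof
        assume "varx dvd pol n (\<lambda>i. i) P Y"
        then obtain h where h: "pol n (\<lambda>i. i) P Y = varx * h" by blast
        have "cf (pol n (\<lambda>i. i) P Y) i j = 0" for i j
        proof (cases i)
          case (Suc i')
          have "cf (dx2 (pol n (\<lambda>i. i) P Y)) i' j = 0" by (simp add: dx0)
          thus ?thesis by (simp add: Suc del: of_nat_Suc)
        qed (simp add: h cf_varx_mult)
        hence z: "cf (pol n (\<lambda>i. i) P Y) 0 n = 0" by blast
        have top: "cf (Y ^ i) 0 n = (if i = n then 1 else 0)" if "i \<le> n" for i
        proof -
          have "Y ^ i = (\<Sum>s\<le>i. cst (of_nat (i choose s) * t ^ (i - s)) * mon 0 s)"
            unfolding Y_def binomial_ring by (rule sum.cong) (simp_all add: mon_def cst_of_nat cst_power mult_ac)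
          hence "cf (Y ^ i) 0 n = (\<Sum>s\<le>i. cf (cst (of_nat (i choose s) * t ^ (i - s)) * mon 0 s) 0 n)"
            by (simp only: cf_sum)
          also have "\<dots> = (\<Sum>s\<le>i. if s = n then of_nat (i choose s) * t ^ (i - s) else 0)"
            by (rule sum.cong) (auto simp: cf_mon simp del: cst_simps)
          finally show ?thesis using that by auto
        qed
        have "cf (pol n (\<lambda>i. i) P Y) 0 n = (\<Sum>i\<le>n. P i * (if i = n then 1 else 0))"
          unfolding pol_def cf_sum by (rule sum.cong) (simp_all add: top)
        thus False using z Pn by (simp add: P_def if_distrib cong: if_cong)
      qed
      ultimately show ?thesis using prime_varx prime_elem_dvd_power[OF prime_varx, of Y m2]
        by (auto simp: prime_elem_dvd_mult_iff)
    qed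
    have gu: "cf g2 0 0 \<noteq> 0" by (rule unit_multiplier[OF prime_varx g2 B1 \<tau>])
    have P00: "cf (pol n (\<lambda>i. i) P Y) 0 0 = 0" using root by (simp add: polv Pp_def P_def)
    have "saddle_node (A1, A2)"
    proof (rule saddle_node_transfer[OF g2 gu])
      show "cf (Y ^ m2 * (Y * pol n (\<lambda>i. i) P Y)) 0 0 = 0" using P00 by simp
      show "cf (varx * (Y ^ m2 * pol n (\<lambda>i. i) N Y)) 0 0 = 0" by (simp add: cf_varx)
      have "cf (dx2 (Y ^ m2 * (Y * pol n (\<lambda>i. i) P Y))) 0 0 = 0" unfolding B1x by simp
      thus "cf (Y ^ m2 * (Y * pol n (\<lambda>i. i) P Y)) 1 0 = 0" unfolding cf_dx2 by (simp add: One_nat_def)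
      show "cf (varx * (Y ^ m2 * pol n (\<lambda>i. i) N Y)) 0 1 = 0" by (simp add: cf_varx_mult)
      have "cf (dy2 (Y ^ m2 * (Y * pol n (\<lambda>i. i) P Y))) 0 0 = t ^ m2 * (t * poly (pderiv Pp) t)"
        unfolding dy2_mult using P00 dyp by (simp add: Y del: cf_dy2)
      hence "cf (dy2 (Y ^ m2 * (Y * pol n (\<lambda>i. i) P Y))) 0 0 = 0" using bad by auto
      hence "cf (Y ^ m2 * (Y * pol n (\<lambda>i. i) P Y)) 0 1 = 0" unfolding cf_dy2 by (simp add: One_nat_def)
      moreover have "cf (varx * (Y ^ m2 * pol n (\<lambda>i. i) N Y)) 1 0 \<noteq> 0" using \<tau> by (simp add: cf_varx_mult del: cf_00_mult)
      ultimately show "cf (varx * (Y ^ m2 * pol n (\<lambda>i. i) N Y)) 1 0 = 0 \<and> cf (Y ^ m2 * (Y * pol n (\<lambda>i. i) P Y)) 0 1 \<noteq> 0 \<or>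
        cf (varx * (Y ^ m2 * pol n (\<lambda>i. i) N Y)) 1 0 \<noteq> 0 \<and> cf (Y ^ m2 * (Y * pol n (\<lambda>i. i) P Y)) 0 1 = 0" by blast
    qed
    thus False using ns by simp
  qed
qed

end

subsection \<open>Camacho--Sad indices\<close>

lemma eval2_sum_mon:
  fixes p :: "nat \<Rightarrow> nat"
  shows "eval2 (\<Sum>s\<le>n. cst (c s) * mon (p s) q) (x, y) = (\<Sum>s\<le>n. c s * x ^ p s) * y ^ q"
proof -
  define t where "t = (\<lambda>F (z :: nat \<times> nat). cf F (fst z) (snd z) * x ^ fst z * y ^ snd z)"
  have one: "(t (cst (c s) * mon (p s) q) has_sum c s * x ^ p s * y ^ q) UNIV" for s
    by (rule has_sum_finite_neutralI[of "{(p s, q)}"]) (auto simp: t_def cf_mon simp del: cst_simps)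
  have "(t (\<Sum>s\<le>m. cst (c s) * mon (p s) q) has_sum (\<Sum>s\<le>m. c s * x ^ p s * y ^ q)) UNIV" for m :: nat
  proof (induction m)
    case 0
    show ?case using one[of 0] by simp
  next
    case (Suc m)
    have "t (\<Sum>s\<le>Suc m. cst (c s) * mon (p s) q) =
      (\<lambda>z. t (\<Sum>s\<le>m. cst (c s) * mon (p s) q) z + t (cst (c (Suc m)) * mon (p (Suc m)) q) z)"
      unfolding t_def by (rule ext) (simp only: sum.atMost_Suc cf_add distrib_right)
    thus ?case unfolding sum.atMost_Suc using has_sum_add[OF Suc.IH one] by simp
  qed
  note sum = infsumI[OF this]
  have "eval2 F (x, y) = infsum (t F) UNIV" for F
    by (simp add: eval2_def t_def case_prod_unfold)
  thus ?thesis by (simp only: sum sum_distrib_right)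
qed

lemma residue_simple_root:
  assumes "poly q t = 0" "poly (pderiv q) t \<noteq> 0"
  shows "residue (\<lambda>x. poly p x / poly q x) t = poly p t / poly (pderiv q) t"
proof -
  obtain r where q: "q = [:- t, 1:] * r" using assms(1) by (auto simp: poly_eq_0_iff_dvd)
  have rt: "poly r t = poly (pderiv q) t" unfolding q by (simp only: pderiv_mult) (simp add: pderiv_pCons)
  have "open {x. poly r x \<noteq> 0}"
    by (rule open_Collect_neq) (auto intro!: continuous_intros)
  moreover have "t \<in> {x. poly r x \<noteq> 0}" using assms(2) rt by simp
  moreover have "(\<lambda>x. poly p x / poly r x) holomorphic_on {x. poly r x \<noteq> 0}"
    by (auto intro!: holomorphic_intros)
  ultimately have "residue (\<lambda>x. poly p x / poly r x / (x - t)) t = poly p t / poly r t"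
    by (rule residue_simple)
  moreover have "poly p x / poly q x = poly p x / poly r x / (x - t)" for x
  proof -
    have "poly q x = poly r x * (x - t)" by (simp add: q algebra_simps)
    thus ?thesis by simp
  qed
  ultimately show ?thesis by (simp only: rt)
qed

definition ppol :: "nat \<Rightarrow> (nat \<Rightarrow> nat) \<Rightarrow> (nat \<Rightarrow> complex) \<Rightarrow> complex poly" where
  "ppol n \<pi> c = (\<Sum>i\<le>n. Polynomial.monom (c i) (\<pi> i))"

lemma poly_ppol: "poly (ppol n \<pi> c) x = (\<Sum>i\<le>n. c i * x ^ \<pi> i)"
  by (simp add: ppol_def poly_sum poly_monom)

text \<open>Where \<open>x = 0\<close> or \<open>y = 0\<close> both sides of the quotient formula are \<open>0\<close>.\<close>

lemma cs_index_eq: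
  assumes pb: "pullback \<sigma> \<Omega> = (vary ^ M * (varx ^ m * (vary * pol n \<pi> N varx)),
      vary ^ M * (varx ^ m * (varx * pol n \<pi> P varx)))" and M: "M \<ge> 1"
    and root: "t = 0 \<or> poly (ppol n \<pi> P) t = 0" "poly (pderiv (pCons 0 (ppol n \<pi> P))) t \<noteq> 0"
  shows "cs_index \<sigma> \<Omega> t = - poly (ppol n \<pi> N) t / poly (pderiv (pCons 0 (ppol n \<pi> P))) t"
proof -
  have "vary ^ M * (varx ^ m * (vary * pol n \<pi> N varx)) = (\<Sum>i\<le>n. cst (N i) * mon (m + \<pi> i) (Suc M))"
    "vary ^ M * (varx ^ m * (varx * pol n \<pi> P varx)) = (\<Sum>i\<le>n. cst (P i) * mon (Suc m + \<pi> i) M)"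
    by (simp_all add: pol_def sum_distrib_left mon_def power_add mult_ac)
  hence e: "eval2 (fst (pullback \<sigma> \<Omega>)) (x, y) = x ^ m * poly (ppol n \<pi> N) x * y ^ Suc M"
    "eval2 (snd (pullback \<sigma> \<Omega>)) (x, y) = x ^ m * poly (pCons 0 (ppol n \<pi> P)) x * y ^ M" for x y
    unfolding pb by (simp_all add: eval2_sum_mon poly_ppol sum_distrib_left power_add mult_ac)
  have quot: "eval2 (fst (pullback \<sigma> \<Omega>)) (x, y) / eval2 (snd (pullback \<sigma> \<Omega>)) (x, y) =
      poly (ppol n \<pi> N) x / poly (pCons 0 (ppol n \<pi> P)) x * y" for x y
    unfolding e using M by (cases "x = 0"; cases "y = 0") (auto simp: power_0_left)
  have "deriv (\<lambda>y. z * y) 0 = z" for z :: complex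
    by (rule DERIV_imp_deriv) (auto intro!: derivative_eq_intros)
  hence "cs_index \<sigma> \<Omega> t = - residue (\<lambda>x. poly (ppol n \<pi> N) x / poly (pCons 0 (ppol n \<pi> P)) x) t"
    by (simp only: cs_index_def quot)
  thus ?thesis using residue_simple_root[OF _ root(2)] root(1) by auto
qed

text \<open>The chart coordinate is x_c = 1/z, so polynomials in z appear reversed and the root c
  sits at 1/c.\<close>

lemma ppol_reflect:
  assumes "c \<noteq> 0"
  shows "poly (ppol n (\<lambda>i. n - i) a) (1 / c) = poly (cpoly n a) c / c ^ n"
proof -
  have "a i * (1 / c) ^ (n - i) = a i * c ^ i / c ^ n" if "i \<le> n" for i
    using assms that by (simp add: power_diff power_one_over field_simps)
  thus ?thesis by (simp add: poly_ppol poly_cpoly sum_divide_distrib)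
qed

lemma sum_top: "(\<Sum>i\<le>n. a i * 0 ^ (n - i)) = (a n :: complex)"
proof -
  have "(\<Sum>i\<le>n. a i * 0 ^ (n - i)) = (\<Sum>i\<le>n. if i = n then a n else 0)"
    by (rule sum.cong) (auto simp: zero_power)
  thus ?thesis by simp
qed

lemma poly_pderiv_ppol: "poly (pderiv (ppol n \<pi> a)) x = (\<Sum>i\<le>n. of_nat (\<pi> i) * a i * x ^ (\<pi> i - 1))"
  by (simp add: ppol_def pderiv_sum poly_sum pderiv_monom poly_monom)

lemma poly_pderiv_cpoly: "x * poly (pderiv (cpoly n a)) x = (\<Sum>i\<le>n. of_nat i * a i * x ^ i)"
proof -
  have "x * (of_nat i * a i * x ^ (i - 1)) = of_nat i * a i * x ^ i" for i
    by (cases i) simp_all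
  moreover have "poly (pderiv (cpoly n a)) x = (\<Sum>i\<le>n. of_nat i * a i * x ^ (i - 1))"
    by (simp add: cpoly_def pderiv_sum poly_sum pderiv_monom poly_monom)
  ultimately show ?thesis by (simp only: sum_distrib_left)
qed

lemma pderiv_reflect:
  assumes c: "c \<noteq> 0" and root: "poly (cpoly n a) c = 0"
  shows "poly (pderiv (pCons 0 (ppol n (\<lambda>i. n - i) a))) (1 / c) = - (c * poly (pderiv (cpoly n a)) c) / c ^ n"
proof -
  have "1 / c * (of_nat (n - i) * a i * (1 / c) ^ (n - i - 1)) = of_nat (n - i) * a i * c ^ i / c ^ n"
    if "i \<le> n" for i
  proof (cases "i = n")
    case False
    then obtain j where j: "n = Suc (i + j)" using \<open>i \<le> n\<close> less_imp_Suc_add[of i n] by auto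
    have "c ^ i / c ^ n = 1 / c * (1 / c) ^ j"
      using c by (simp add: j power_add power_one_over)
    moreover have "1 / c * (z * (1 / c) ^ (n - i - 1)) = z * (1 / c * (1 / c) ^ j)" for z
      unfolding j by (simp add: mult_ac)
    ultimately show ?thesis by (metis times_divide_eq_right)
  qed simp
  hence "1 / c * poly (pderiv (ppol n (\<lambda>i. n - i) a)) (1 / c) = (\<Sum>i\<le>n. of_nat (n - i) * a i * c ^ i) / c ^ n"
    unfolding poly_pderiv_ppol sum_distrib_left sum_divide_distrib by (intro sum.cong) auto
  also have "(\<Sum>i\<le>n. of_nat (n - i) * a i * c ^ i) = of_nat n * poly (cpoly n a) c - c * poly (pderiv (cpoly n a)) c"
    unfolding poly_pderiv_cpoly poly_cpoly sum_distrib_left sum_subtractf[symmetric]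
    by (rule sum.cong) (auto simp: of_nat_diff algebra_simps)
  finally show ?thesis
    using ppol_reflect[OF c, of n a] root by (simp add: pderiv_pCons)
qed

section \<open>Camacho-Sad indices and the logarithmic expression\<close>

context
  fixes k l n u v :: nat and al be :: "nat \<Rightarrow> complex" and \<Omega> :: form2
  assumes k: "k \<ge> 1" and l: "l \<ge> 1" and uv: "k * u = l * v + 1" "u \<le> l" "v \<le> k"
    and \<Omega>: "\<Omega> = (vary * hs k l n al, varx * hs k l n be)"
begin

abbreviation "pc \<equiv> \<lambda>i. of_nat k * al i + of_nat l * be i"
abbreviation "nc \<equiv> \<lambda>i. of_nat (k - v) * al i + of_nat (l - u) * be i"
abbreviation "ni \<equiv> \<lambda>i. of_nat v * al i + of_nat u * be i"

lemma uv': "l * (k - v) = k * (l - u) + 1"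
proof -
  obtain v' u' where "k = v + v'" "l = u + u'" using uv le_Suc_ex by metis
  thus ?thesis using uv(1) by (simp add: algebra_simps)
qed

lemma index_c:
  assumes root: "t = 0 \<or> poly (ppol n (\<lambda>i. n - i) pc) t = 0" "poly (pderiv (pCons 0 (ppol n (\<lambda>i. n - i) pc))) t \<noteq> 0"
  shows "cs_index (chart_c k l u v) \<Omega> t =
    - poly (ppol n (\<lambda>i. n - i) nc) t / poly (pderiv (pCons 0 (ppol n (\<lambda>i. n - i) pc))) t"
proof -
  have exps: "l * (k - v) * (n - i) + k * (l - u) * i = k * (l - u) * n + (n - i)" if "i \<le> n" for i
  proof -
    have "l * (k - v) * (n - i) + k * (l - u) * i = k * (l - u) * ((n - i) + i) + (n - i)"
      unfolding uv' by (simp only: distrib_left distrib_right mult_1)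
    thus ?thesis using that by simp
  qed
  have "k - v \<noteq> 0" using uv' by (intro notI) simp
  hence be1: "(k - v) + (l - u) \<ge> 1" by simp
  show ?thesis
    unfolding chart_c_def \<Omega>
    by (rule cs_index_eq[OF pullback_hs(2)[OF k l be1 _ _ mult.commute mult.commute exps] _ root])
      (use k l in \<open>simp_all add: cf_vary zero_power\<close>)
qed

lemma index_0: "pc n \<noteq> 0 \<Longrightarrow> cs_index (chart_c k l u v) \<Omega> 0 = - nc n / pc n"
  using index_c[of 0] by (simp add: pderiv_pCons poly_ppol sum_top)

lemma index_root:
  assumes "c \<noteq> 0" "poly (cpoly n pc) c = 0" "poly (pderiv (cpoly n pc)) c \<noteq> 0"
  shows "cs_index (chart_c k l u v) \<Omega> (1 / c) = poly (cpoly n nc) c / (c * poly (pderiv (cpoly n pc)) c)"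
proof -
  have "cs_index (chart_c k l u v) \<Omega> (1 / c) =
    - (poly (cpoly n nc) c / c ^ n) / (- (c * poly (pderiv (cpoly n pc)) c) / c ^ n)"
    using index_c[of "1 / c"] assms by (simp add: pderiv_reflect ppol_reflect del: of_nat_diff)
  thus ?thesis using assms(1) by simp
qed

lemma index_inf: "pc 0 \<noteq> 0 \<Longrightarrow> cs_index (chart_inf k l u v) \<Omega> 0 = - ni 0 / pc 0"
proof -
  assume P: "pc 0 \<noteq> 0"
  have exps: "l * v * (n - i) + k * u * i = l * v * n + i" if "i \<le> n" for i
  proof -
    have "l * v * (n - i) + k * u * i = l * v * ((n - i) + i) + i"
      unfolding uv(1) by (simp only: distrib_left distrib_right mult_1)
    thus ?thesis using that by simp
  qed
  have "u \<noteq> 0" using uv(1) by (intro notI) simp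
  hence be1: "v + u \<ge> 1" by simp
  have bot: "(\<Sum>i\<le>n. a i * 0 ^ i) = a 0" for a :: "nat \<Rightarrow> complex"
    using sum_zero_power[of a "{..n}"] by simp
  have "cs_index (chart_inf k l u v) \<Omega> 0 =
    - poly (ppol n (\<lambda>i. i) ni) 0 / poly (pderiv (pCons 0 (ppol n (\<lambda>i. i) pc))) 0"
    unfolding chart_inf_def \<Omega>
    by (rule cs_index_eq[OF pullback_hs(2)[OF k l be1 _ _ mult.commute mult.commute exps]])
      (use k l P in \<open>simp_all add: cf_vary zero_power pderiv_pCons poly_ppol bot\<close>)
  thus ?thesis by (simp add: pderiv_pCons poly_ppol bot)
qed

text \<open>Inverts the passage from (\<open>al\<close>, \<open>be\<close>) to the pairs formed by P
  and the numerator of an index, using l (k - v) - k (l - u) = 1 and k u - l v = 1.\<close>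

lemma coefficient_relations:
  "al i = of_nat l * nc i - of_nat (l - u) * pc i" "be i = of_nat (k - v) * pc i - of_nat k * nc i"
  "be i = of_nat k * ni i - of_nat v * pc i"
proof -
  have 1: "of_nat l * of_nat (k - v) = of_nat k * of_nat (l - u) + (1 :: complex)"
    "of_nat k * of_nat u = of_nat l * of_nat v + (1 :: complex)"
    using arg_cong[OF uv', of "of_nat :: nat \<Rightarrow> complex"] arg_cong[OF uv(1), of "of_nat :: nat \<Rightarrow> complex"]
    by (simp_all del: of_nat_diff)
  have "of_nat l * nc i - of_nat (l - u) * pc i = (of_nat l * of_nat (k - v) - of_nat k * of_nat (l - u)) * al i"
    by (simp add: algebra_simps del: of_nat_diff)
  thus "al i = of_nat l * nc i - of_nat (l - u) * pc i" unfolding 1 by simp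
  have "of_nat (k - v) * pc i - of_nat k * nc i = (of_nat l * of_nat (k - v) - of_nat k * of_nat (l - u)) * be i"
    by (simp add: algebra_simps del: of_nat_diff)
  thus "be i = of_nat (k - v) * pc i - of_nat k * nc i" unfolding 1 by simp
  have "of_nat k * ni i - of_nat v * pc i = (of_nat k * of_nat u - of_nat l * of_nat v) * be i"
    by (simp add: algebra_simps)
  thus "be i = of_nat k * ni i - of_nat v * pc i" unfolding 1 by simp
qed

lemma poly_relations:
  "poly (cpoly n al) z = of_nat l * poly (cpoly n nc) z - of_nat (l - u) * poly (cpoly n pc) z"
  "poly (cpoly n be) z = of_nat (k - v) * poly (cpoly n pc) z - of_nat k * poly (cpoly n nc) z"
proof -
  have "poly (cpoly n al) z = (\<Sum>i\<le>n. (of_nat l * nc i - of_nat (l - u) * pc i) * z ^ i)"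
    "poly (cpoly n be) z = (\<Sum>i\<le>n. (of_nat (k - v) * pc i - of_nat k * nc i) * z ^ i)"
    by (simp_all only: poly_cpoly coefficient_relations(1,2)[symmetric])
  thus "poly (cpoly n al) z = of_nat l * poly (cpoly n nc) z - of_nat (l - u) * poly (cpoly n pc) z"
    "poly (cpoly n be) z = of_nat (k - v) * poly (cpoly n pc) z - of_nat k * poly (cpoly n nc) z"
    by (simp_all only: poly_cpoly left_diff_distrib sum_subtractf sum_distrib_left mult.assoc)
qed

text \<open>Polynomials of degree at most n in z are compared at the n roots of P, where a single
  summand survives and the residue formula gives lambda_i. The missing condition is taken where the
  sum over i drops out: the leading coefficient for dx, which yields lambda_0, and z = 0 for dy,
  which yields lambda_infinity.\<close>

lemma eq_log_form:
  assumes n: "n \<ge> 1" and c: "inj_on c {1..n}" "\<And>i. i \<in> {1..n} \<Longrightarrow> c i \<noteq> 0"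
    and Pn: "pc n \<noteq> 0" and factor: "cpoly n pc = Polynomial.smult (pc n) (\<Prod>i\<in>{1..n}. [:- c i, 1:])"
  shows "\<Omega> = log_form k l n (- pc n) c (\<lambda>i. cs_index (chart_c k l u v) \<Omega> (1 / c i))
      (of_nat l * cs_index (chart_c k l u v) \<Omega> 0 + of_nat l - of_nat u)
      (of_nat k * cs_index (chart_inf k l u v) \<Omega> 0 + of_nat v)"
proof -
  define R where "R = (\<Prod>i\<in>{1..n}. [:- c i, 1:])"
  define S where "S = (\<lambda>i. \<Prod>j\<in>{1..n} - {i}. [:- c j, 1:])"
  define lam where "lam = (\<lambda>i. cs_index (chart_c k l u v) \<Omega> (1 / c i))"
  define \<alpha> where "\<alpha> = of_nat l * cs_index (chart_c k l u v) \<Omega> 0 + of_nat l - of_nat u"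
  define \<beta> where "\<beta> = of_nat k * cs_index (chart_inf k l u v) \<Omega> 0 + of_nat v"
  obtain m where m: "n = Suc m" using n by (cases n) auto
  have R: "hs k l n (coeff R) = (\<Prod>i\<in>{1..n}. cusp k l (c i))" "\<And>j. j > n \<Longrightarrow> coeff R j = 0"
    using hs_prod_cusp[of "{1..n}" k l c] by (simp_all add: R_def)
  have S: "hs k l m (coeff (S i)) = (\<Prod>j\<in>{1..n} - {i}. cusp k l (c j))" "\<And>j. j > m \<Longrightarrow> coeff (S i) j = 0"
    if "i \<in> {1..n}" for i
    using hs_prod_cusp[of "{1..n} - {i}" k l c] that m by (simp_all add: S_def One_nat_def)
  have RS: "R = [:- c i, 1:] * S i" if "i \<in> {1..n}" for i
    unfolding R_def S_def using that by (simp only: prod.remove[of "{1..n}" i] finite_atLeastAtMost)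
  have P: "cpoly n pc = Polynomial.smult (pc n) R" unfolding factor R_def ..
  have Sj: "poly (S i) (c j) = 0" if "i \<in> {1..n}" "j \<in> {1..n}" "i \<noteq> j" for i j
    unfolding S_def poly_prod using that by (intro prod_zero) auto
  have Si: "poly (S i) (c i) \<noteq> 0" if "i \<in> {1..n}" for i
    unfolding S_def poly_prod using that c(1) by (auto dest: inj_onD)
  have root: "poly R (c i) = 0" if "i \<in> {1..n}" for i by (simp add: RS[OF that])
  have deriv: "poly (pderiv (cpoly n pc)) (c i) = pc n * poly (S i) (c i)" if "i \<in> {1..n}" for i
    unfolding P RS[OF that] by (simp only: pderiv_smult pderiv_mult) (simp add: pderiv_pCons)
  have clear: "p * x * q * s = y" if "p \<noteq> 0" "q \<noteq> 0" "s \<noteq> 0" "x = y / (q * (p * s))" for p q s x y :: complex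
    using that by simp
  have clear': "- p * (a * (- x / p) + b) = a * x - b * p" "(a * (- x / p) + b) * p = - a * x + b * p"
    if "p \<noteq> 0" for p a b x :: complex
    using that by (simp_all add: field_simps)
  define p where "p = pc n"
  have lam: "p * lam i * c i * poly (S i) (c i) = poly (cpoly n nc) (c i)" if i: "i \<in> {1..n}" for i
  proof -
    have "poly (cpoly n pc) (c i) = 0" using root[OF i] by (simp add: P)
    moreover have "poly (pderiv (cpoly n pc)) (c i) \<noteq> 0" unfolding deriv[OF i] using Pn Si[OF i] by simp
    ultimately have "lam i = poly (cpoly n nc) (c i) / (c i * (pc n * poly (S i) (c i)))"
      unfolding lam_def deriv[OF i, symmetric] by (rule index_root[OF c(2)[OF i]])
    thus ?thesis unfolding p_def by (rule clear[OF Pn c(2)[OF i] Si[OF i]])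
  qed
  have Rn: "coeff R n = 1"
    using arg_cong[OF P, of "\<lambda>p. coeff p n"] Pn by (simp add: coeff_cpoly)
  have P0: "pc 0 = p * poly R 0"
    unfolding p_def using arg_cong[OF P, of "\<lambda>p. poly p 0"] by (simp add: poly_0_coeff_0 coeff_cpoly)
  have R0: "poly R 0 \<noteq> 0" unfolding R_def poly_prod using c(2) by auto
  have sum: "(\<Sum>i=1..n. a i * poly (S i) (c j)) = a j * poly (S j) (c j)" if j: "j \<in> {1..n}" for a j
  proof -
    have "(\<Sum>i=1..n. a i * poly (S i) (c j)) = (\<Sum>i=1..n. if i = j then a j * poly (S j) (c j) else 0)"
      by (rule sum.cong) (use Sj j in auto)
    thus ?thesis using j by simp
  qed
  \<comment> \<open>\<open>A\<close> and \<open>B\<close> are the dehomogenized coefficients of the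
    logarithmic form. The operator x d/dx sends y^k - c x^l to -l c x^l, and y d/dy sends it to k
    y^k, whence the additional factor z in \<open>B\<close>.\<close>
  define A where "A = Polynomial.smult (- p) ((\<Sum>i=1..n. Polynomial.smult (- (of_nat l * lam i * c i)) (S i)) + Polynomial.smult \<alpha> R)"
  define B where "B = Polynomial.smult (- p) ((\<Sum>i=1..n. Polynomial.smult (of_nat k * lam i) (pCons 0 (S i))) + Polynomial.smult \<beta> R)"
  have card: "card (c ` {1..n}) = n" using c(1) by (simp add: card_image)
  have dS: "coeff (S i) j = 0" "coeff (pCons 0 (S i)) (Suc j) = 0" if "i \<in> {1..n}" "j > m" for i j using S(2) that by simp_all
  have al: "cpoly n al = A"
  proof (rule poly_eqI_degree_lead_coeff[of _ n _ "c ` {1..n}"])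
    have "(\<Sum>i=1..n. - (of_nat l * lam i * c i) * coeff (S i) n) = 0"
      by (rule sum.neutral) (use dS m in auto)
    hence "coeff A n = - p * \<alpha>" by (simp add: A_def coeff_sum Rn)
    also have "\<dots> = of_nat l * nc n - of_nat (l - u) * pc n"
    proof -
      have "\<alpha> = of_nat l * (- nc n / pc n) + of_nat (l - u)"
        unfolding \<alpha>_def index_0[OF Pn] of_nat_diff[OF uv(2)] by (rule add_diff_eq[symmetric])
      thus ?thesis unfolding p_def by (simp only: clear'(1)[OF Pn])
    qed
    also have "\<dots> = coeff (cpoly n al) n" by (simp only: coefficient_relations(1)[symmetric] coeff_cpoly) simp
    finally show "coeff (cpoly n al) n = coeff A n" ..
    show "degree A \<le> n"
      by (rule degree_le) (use dS m R(2) in \<open>auto simp: A_def coeff_sum intro!: sum.neutral\<close>)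
    show "poly (cpoly n al) z = poly A z" if z: "z \<in> c ` {1..n}" for z
    proof -
      obtain j where j: "j \<in> {1..n}" "z = c j" using z by blast
      have "poly A z = of_nat l * (p * lam j * c j * poly (S j) (c j))"
        using sum[OF j(1), of "\<lambda>i. - (of_nat l * lam i * c i)"] root[OF j(1)] by (simp add: A_def poly_sum j(2) mult_ac)
      also have "\<dots> = poly (cpoly n al) z"
        unfolding lam[OF j(1)] poly_relations P using root[OF j(1)] by (simp add: j(2))
      finally show ?thesis ..
    qed
  qed (use card degree_cpoly in auto)
  have be: "cpoly n be = B"
  proof (rule poly_eqI_degree[of "insert 0 (c ` {1..n})"])
    have card': "card (insert 0 (c ` {1..n})) = Suc n" using card c(2) by (subst card_insert_disjoint) auto
    show "degree (cpoly n be) < card (insert 0 (c ` {1..n}))" using degree_cpoly[of n be] card' by simp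
    have "degree B \<le> n"
    proof (rule degree_le, intro allI impI)
      fix j assume j: "n < j"
      then obtain j' where j': "j = Suc j'" by (cases j) auto
      have "(\<Sum>i=1..n. of_nat k * lam i * coeff (pCons 0 (S i)) j) = 0"
        unfolding j' by (rule sum.neutral) (use dS(2) j j' m in auto)
      thus "coeff B j = 0" using R(2)[OF j] by (simp add: B_def coeff_sum del: smult_pCons)
    qed
    thus "degree B < card (insert 0 (c ` {1..n}))" using card' by simp
    fix z assume z: "z \<in> insert 0 (c ` {1..n})"
    show "poly (cpoly n be) z = poly B z"
    proof (cases "z = 0")
      case True
      have "pc 0 \<noteq> 0" unfolding P0 p_def using Pn R0 by simp
      have "\<beta> * pc 0 = - of_nat k * ni 0 + of_nat v * pc 0"
        unfolding \<beta>_def index_inf[OF \<open>pc 0 \<noteq> 0\<close>] by (rule clear'(2)[OF \<open>pc 0 \<noteq> 0\<close>])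
      also have "\<dots> = - be 0"
      proof -
        have "- a * x + b * y = - z" if "z = a * x - b * y" for a b x y z :: complex using that by simp
        thus ?thesis using coefficient_relations(3) by blast
      qed
      finally have "- (p * (\<beta> * poly R 0)) = be 0"
        unfolding P0 by (metis minus_minus mult.left_commute)
      thus ?thesis by (simp add: True B_def poly_0_coeff_0 coeff_sum coeff_cpoly)
    next
      case False
      then obtain j where j: "j \<in> {1..n}" "z = c j" using z by blast
      have "poly B z = - of_nat k * (p * lam j * c j * poly (S j) (c j))"
        using sum[OF j(1), of "\<lambda>i. of_nat k * lam i * c j"] root[OF j(1)] by (simp add: B_def poly_sum j(2) mult_ac)
      also have "\<dots> = poly (cpoly n be) z"
        unfolding lam[OF j(1)] poly_relations P using root[OF j(1)] by (simp add: j(2))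
      finally show ?thesis ..
    qed
  qed
  have lin: "hs k l n (coeff (Polynomial.smult a p)) = cst a * hs k l n (coeff p)"
    "hs k l n (coeff (p + q)) = hs k l n (coeff p) + hs k l n (coeff q)"
    "hs k l n (coeff (\<Sum>i\<in>I. f i)) = (\<Sum>i\<in>I. hs k l n (coeff (f i)))" for a p q f and I :: "nat set"
  proof -
    show "hs k l n (coeff (Polynomial.smult a p)) = cst a * hs k l n (coeff p)"
      unfolding hs_cst by (rule hs_cong) simp
    show add: "hs k l n (coeff (p + q)) = hs k l n (coeff p) + hs k l n (coeff q)" for p q
      unfolding hs_add by (rule hs_cong) simp
    show "hs k l n (coeff (\<Sum>i\<in>I. f i)) = (\<Sum>i\<in>I. hs k l n (coeff (f i)))"
    proof (induction I rule: infinite_finite_induct)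
      case (insert i I)
      thus ?case unfolding sum.insert[OF insert.hyps(1,2)] add by simp
    qed (simp_all add: hs_def)
  qed
  have shift: "hs k l n (coeff (S i)) = varx ^ l * (\<Prod>j\<in>{1..n} - {i}. cusp k l (c j))"
    "hs k l n (coeff (pCons 0 (S i))) = vary ^ k * (\<Prod>j\<in>{1..n} - {i}. cusp k l (c j))" if i: "i \<in> {1..n}" for i
  proof -
    have S0: "coeff (S i) j = 0" if "j \<ge> Suc m" for j using S(2)[OF i] that by simp
    have "coeff (pCons 0 (S i)) = (\<lambda>j. case j of 0 \<Rightarrow> 0 | Suc j \<Rightarrow> coeff (S i) j)"
      by (rule ext) (simp add: coeff_pCons)
    thus "hs k l n (coeff (S i)) = varx ^ l * (\<Prod>j\<in>{1..n} - {i}. cusp k l (c j))"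
      "hs k l n (coeff (pCons 0 (S i))) = vary ^ k * (\<Prod>j\<in>{1..n} - {i}. cusp k l (c j))"
      using hs_Suc_shift[of m "coeff (S i)" k l, OF S0] unfolding m[symmetric] S(1)[OF i] by simp_all
  qed
  have dcusp: "varx * dx2 (cusp k l t) = - cst (of_nat l * t) * varx ^ l" "vary * dy2 (cusp k l t) = of_nat k * vary ^ k" for t
  proof -
    have p: "varx ^ l = varx * varx ^ (l - 1)" "vary ^ k = vary * vary ^ (k - 1)"
      using k l by (simp_all flip: power_Suc)
    have d: "dx2 (cusp k l t) = - (cst t * (of_nat l * varx ^ (l - 1)))" "dy2 (cusp k l t) = of_nat k * vary ^ (k - 1)"
      by (simp_all add: cusp_def dx2_power dy2_power)
    show "varx * dx2 (cusp k l t) = - cst (of_nat l * t) * varx ^ l" "vary * dy2 (cusp k l t) = of_nat k * vary ^ k"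
      unfolding d p by (simp_all add: cst_of_nat mult_ac)
  qed
  have "fst (log_form k l n (- p) c lam \<alpha> \<beta>) = vary * hs k l n (coeff A)"
  proof -
    have "(cst (lam i) * varx * vary * X) * dx2 (cusp k l (c i)) =
      vary * (cst (- (of_nat l * lam i * c i)) * (varx ^ l * X))" for i X
    proof -
      have "(cst (lam i) * varx * vary * X) * dx2 (cusp k l (c i)) = vary * (cst (lam i) * (varx * dx2 (cusp k l (c i))) * X)"
        by (simp only: mult_ac)
      thus ?thesis unfolding dcusp by (simp add: mult_ac)
    qed
    hence "(\<Sum>i=1..n. (cst (lam i) * varx * vary * (\<Prod>j\<in>{1..n}-{i}. cusp k l (c j))) * dx2 (cusp k l (c i))) =
      vary * (\<Sum>i=1..n. cst (- (of_nat l * lam i * c i)) * hs k l n (coeff (S i)))"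
      unfolding sum_distrib_left by (intro sum.cong) (simp_all only: shift)
    moreover have "hs k l n (coeff A) =
      cst (- p) * ((\<Sum>i=1..n. cst (- (of_nat l * lam i * c i)) * hs k l n (coeff (S i))) + cst \<alpha> * hs k l n (coeff R))"
      unfolding A_def lin ..
    ultimately show ?thesis
      by (simp add: log_form_def fst_sum smul_def ext_d_def R(1)[symmetric] distrib_left right_diff_distrib mult_ac)
  qed
  moreover have "snd (log_form k l n (- p) c lam \<alpha> \<beta>) = varx * hs k l n (coeff B)"
  proof -
    have "(cst (lam i) * varx * vary * X) * dy2 (cusp k l (c i)) =
      varx * (cst (of_nat k * lam i) * (vary ^ k * X))" for i X
    proof -
      have "(cst (lam i) * varx * vary * X) * dy2 (cusp k l (c i)) = varx * (cst (lam i) * (vary * dy2 (cusp k l (c i))) * X)"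
        by (simp only: mult_ac)
      thus ?thesis unfolding dcusp by (simp add: mult_ac cst_of_nat)
    qed
    hence "(\<Sum>i=1..n. (cst (lam i) * varx * vary * (\<Prod>j\<in>{1..n}-{i}. cusp k l (c j))) * dy2 (cusp k l (c i))) =
      varx * (\<Sum>i=1..n. cst (of_nat k * lam i) * hs k l n (coeff (pCons 0 (S i))))"
      unfolding sum_distrib_left by (intro sum.cong) (simp_all only: shift)
    moreover have "hs k l n (coeff B) =
      cst (- p) * ((\<Sum>i=1..n. cst (of_nat k * lam i) * hs k l n (coeff (pCons 0 (S i)))) + cst \<beta> * hs k l n (coeff R))"
      unfolding B_def lin ..
    ultimately show ?thesis
      by (simp add: log_form_def snd_sum smul_def ext_d_def R(1)[symmetric] distrib_left right_diff_distrib mult_ac)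
  qed
  ultimately have "\<Omega> = log_form k l n (- p) c lam \<alpha> \<beta>"
    by (intro prod_eqI) (simp_all add: \<Omega> hs_cpoly flip: al be)
  thus ?thesis unfolding p_def lam_def \<alpha>_def \<beta>_def .
qed

end

subsection \<open>Initial parts\<close>

text \<open>By coprimality k i + l j = k l n forces l to divide i and k to divide j.\<close>

lemma homog_eq_hs:
  assumes k: "k \<ge> 1" and l: "l \<ge> 1" and kl: "coprime k l" and F: "homog k l (k * l * n) F"
  shows "F = hs k l n (\<lambda>s. cf F (l * (n - s)) (k * s))"
proof (rule series2_eqI)
  fix i j
  show "cf F i j = cf (hs k l n (\<lambda>s. cf F (l * (n - s)) (k * s))) i j"
  proof (cases "k * i + l * j = k * l * n")
    case True
    have "k * i = l * (k * n - j)" "l * j = k * (l * n - i)"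
      using True by (simp_all add: diff_mult_distrib2 mult_ac)
    hence "l dvd k * i" "k dvd l * j" by (metis dvd_triv_left)+
    hence "l dvd i" "k dvd j"
      using kl by (auto simp: coprime_dvd_mult_right_iff coprime_commute)
    then obtain i' s where ij: "i = l * i'" "j = k * s" by (elim dvdE)
    have "k * l * (i' + s) = k * l * n" using True ij by (simp add: algebra_simps)
    hence s: "i' = n - s" "s \<le> n" using k l by simp_all
    have "cf (hs k l n c) (l * (n - s)) (k * s) = (\<Sum>t\<le>n. if t = s then c s else 0)" for c
      unfolding hs_def cf_sum by (rule sum.cong) (use k s(2) in \<open>auto simp: cf_mon simp del: cst_simps\<close>)
    thus ?thesis using s by (simp add: ij)
  next
    case False
    thus ?thesis using F homog_hs unfolding homog_def by metis
  qed
qed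

lemma axes_invariant_of_curve:
  assumes "invariant_curve \<omega> (varx * vary)"
  shows "axes_invariant \<omega>"
proof -
  obtain h where "fst \<omega> * dy2 (varx * vary) - snd \<omega> * dx2 (varx * vary) = varx * vary * h"
    using assms unfolding invariant_curve_def gdvd_def by blast
  hence h: "varx * fst \<omega> - vary * snd \<omega> = varx * (vary * h)"
    by (simp add: dx2_mult dy2_mult mult_ac)
  have "cf (varx * fst \<omega> - vary * snd \<omega>) (Suc i) 0 = 0" "cf (varx * fst \<omega> - vary * snd \<omega>) 0 (Suc j) = 0" for i j
    unfolding h by (simp_all add: cf_varx_mult cf_vary_mult)
  thus ?thesis by (simp add: axes_invariant_def cf_varx_mult cf_vary_mult)
qed

lemma wgef_initial_part:
  assumes low: "\<And>m. m < D \<Longrightarrow> form_part k l m \<omega> = 0" and part: "form_part k l D \<omega> = \<omega>\<^sub>0"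
  shows "wgef k l (int D + 1) (\<omega> - \<omega>\<^sub>0)"
proof -
  have *: "cf (fst (form_part k l D' \<omega>)) i j = 0" "cf (snd (form_part k l D' \<omega>)) i j = 0" if "D' < D" for D' i j
    unfolding low[OF that] by simp_all
  have 1: "cf (fst (\<omega> - \<omega>\<^sub>0)) i j = 0" if "k * i + l * j + k \<le> D" for i j
    using *(1)[of "k * i + l * j + k" i j] that
    by (cases "k * i + l * j + k = D") (auto simp: cf_form_part part[symmetric])
  have 2: "cf (snd (\<omega> - \<omega>\<^sub>0)) i j = 0" if "k * i + l * j + l \<le> D" for i j
    using *(2)[of "k * i + l * j + l" i j] that
    by (cases "k * i + l * j + l = D") (auto simp: cf_form_part part[symmetric])
  have "wge k l (int D + 1 - int k) (fst (\<omega> - \<omega>\<^sub>0))"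
  proof (rule wgeI)
    fix i j assume "cf (fst (\<omega> - \<omega>\<^sub>0)) i j \<noteq> 0"
    hence "\<not> k * i + l * j + k \<le> D" using 1 by blast
    thus "int D + 1 - int k \<le> int (k * i + l * j)" by linarith
  qed
  moreover have "wge k l (int D + 1 - int l) (snd (\<omega> - \<omega>\<^sub>0))"
  proof (rule wgeI)
    fix i j assume "cf (snd (\<omega> - \<omega>\<^sub>0)) i j \<noteq> 0"
    hence "\<not> k * i + l * j + l \<le> D" using 2 by blast
    thus "int D + 1 - int l \<le> int (k * i + l * j)" by linarith
  qed
  ultimately show ?thesis by (simp add: wgef_def)
qed

lemma form_eq_hs:
  assumes kl: "k \<ge> 1" "l \<ge> 1" "coprime k l" and ax: "axes_invariant \<omega>"
    and part: "form_part k l (k * l * n + k + l) \<omega> = \<omega>"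
  shows "\<exists>al be. \<omega> = (vary * hs k l n al, varx * hs k l n be)"
proof -
  obtain A B where AB: "\<omega> = (vary * A, varx * B)" using ax axes_invariant_iff by blast
  have fp: "homogf k l (k * l * n + k + l) \<omega>" using homogf_form_part[of k l _ \<omega>] part by metis
  have "homog k l (k * l * n) A"
    unfolding homog_def
  proof (intro allI impI)
    fix i j assume "cf A i j \<noteq> 0"
    hence "cf (fst \<omega>) i (Suc j) \<noteq> 0" by (simp add: AB cf_vary_mult)
    hence "k * i + l * Suc j + k = k * l * n + k + l" using fp unfolding homogf_def by blast
    thus "k * i + l * j = k * l * n" by simp
  qed
  moreover have "homog k l (k * l * n) B"
    unfolding homog_def
  proof (intro allI impI)
    fix i j assume "cf B i j \<noteq> 0"
    hence "cf (snd \<omega>) (Suc i) j \<noteq> 0" by (simp add: AB cf_varx_mult)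
    hence "k * Suc i + l * j + l = k * l * n + k + l" using fp unfolding homogf_def by blast
    thus "k * i + l * j = k * l * n" by simp
  qed
  ultimately show ?thesis using homog_eq_hs[OF kl] AB by metis
qed

text \<open>The hypothesis makes the vectors (a, b) and (i, j) proportional, so the quotient equals
  the same quotient at (i, j), whose denominator is the nonzero integer k i + l j.\<close>

lemma index_rational:
  fixes a b :: complex and i j :: int
  assumes "b * of_int i = a * of_int j" "int k * i + int l * j \<noteq> 0" "of_nat k * a + of_nat l * b \<noteq> 0"
  shows "- (of_nat p * a + of_nat q * b) / (of_nat k * a + of_nat l * b) \<in> \<rat>"
proof -
  define w where "w = int k * i + int l * j"
  have "(of_nat p * a + of_nat q * b) * of_int w - of_int (int p * i + int q * j) * (of_nat k * a + of_nat l * b) =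
    (of_nat l * of_nat p - of_nat k * of_nat q) * (a * of_int j - b * of_int i)"
    by (simp add: w_def algebra_simps)
  hence eq: "(of_nat p * a + of_nat q * b) * of_int w = of_int (int p * i + int q * j) * (of_nat k * a + of_nat l * b)"
    using assms(1) by simp
  have w: "(of_int w :: complex) \<noteq> 0" using assms(2) unfolding w_def of_int_eq_0_iff .
  have "(of_nat p * a + of_nat q * b) / (of_nat k * a + of_nat l * b) = of_int (int p * i + int q * j) / of_int w"
    by (rule frac_eq_eq[THEN iffD2, OF assms(3) w eq])
  hence "- (of_nat p * a + of_nat q * b) / (of_nat k * a + of_nat l * b) = - (of_int (int p * i + int q * j) / of_int w)"
    unfolding minus_divide_left[symmetric] by (rule arg_cong)
  also have "\<dots> \<in> \<rat>" by (intro Rats_minus_iff[THEN iffD2] Rats_divide Rats_of_int)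
  finally show ?thesis .
qed

lemma distinct_roots_enumeration:
  fixes p :: "complex poly"
  assumes "degree p = n" "\<And>z. poly p z = 0 \<Longrightarrow> poly (pderiv p) z \<noteq> 0"
  shows "\<exists>c. inj_on c {1..n} \<and> p = Polynomial.smult (coeff p n) (\<Prod>i\<in>{1..n}. [:- c i, 1:]) \<and>
    (\<forall>i\<in>{1..n}. poly p (c i) = 0)"
proof -
  define Z where "Z = {z. poly p z = 0}"
  have "p \<noteq> 0" using assms(2)[of 0] by auto
  hence "finite Z" unfolding Z_def by (rule poly_roots_finite)
  have "rsquarefree p" using assms(2) by (auto simp: rsquarefree_roots)
  hence dec: "Polynomial.smult (coeff p n) (\<Prod>z\<in>Z. [:- z, 1:]) = p"
    using complex_poly_decompose_rsquarefree[of p] assms(1) by (simp add: Z_def)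
  have "degree (\<Prod>z\<in>Z. [:- z, 1:]) = (\<Sum>z\<in>Z. degree [:- z, 1:])" by (rule degree_prod_sum_eq) simp
  hence "degree (\<Prod>z\<in>Z. [:- z, 1:]) = card Z" by simp
  moreover have "coeff p n \<noteq> 0" using \<open>p \<noteq> 0\<close> assms(1) by auto
  ultimately have "card Z = n" using arg_cong[OF dec, of degree] assms(1) by simp
  then obtain c where c: "bij_betw c {1..n} Z" using ex_bij_betw_nat_finite_1[OF \<open>finite Z\<close>] by blast
  have "(\<Prod>i\<in>{1..n}. [:- c i, 1:]) = (\<Prod>z\<in>Z. [:- z, 1:])"
    by (rule prod.reindex_bij_betw[OF c])
  thus ?thesis using c dec by (intro exI[of _ c]) (auto simp: bij_betw_def Z_def)
qed

text \<open>A common zero z of the polynomials of A / y and B / x is a root of P, and there the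
  first equation becomes m N(z) = z P'(z). So the index at 1/z would be the rational number 1/m.
  Similarly a rational ratio of extreme coefficients would make lambda_0 or lambda_infinity
  rational.\<close>

lemma homological_of_generic:
  assumes k: "k \<ge> 1" and l: "l \<ge> 1" and n: "n \<ge> 1" and kl: "coprime k l"
    and uv: "k * u = l * v + 1" "u \<le> l" "v \<le> k"
    and \<Omega>: "\<Omega> = (vary * hs k l n al, varx * hs k l n be)" and gen: "generic k l n u v \<Omega>"
    and Pn: "of_nat k * al n + of_nat l * be n \<noteq> 0"
    and roots: "\<And>z. poly (cpoly n (\<lambda>i. of_nat k * al i + of_nat l * be i)) z = 0 \<Longrightarrow>
      z \<noteq> 0 \<and> poly (pderiv (cpoly n (\<lambda>i. of_nat k * al i + of_nat l * be i))) z \<noteq> 0"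
  shows "homological k l n al be"
proof
  define P where "P = (\<lambda>i. of_nat k * al i + of_nat l * be i)"
  define N where "N = (\<lambda>i. of_nat (k - v) * al i + of_nat (l - u) * be i)"
  note roots = roots[folded P_def]
  have Pi: "of_nat k * al i + of_nat l * be i = P i" for i by (simp add: P_def)
  have P0: "of_nat k * al 0 + of_nat l * be 0 \<noteq> 0"
    using roots[of 0] by (auto simp: poly_0_coeff_0 coeff_cpoly P_def)
  note ctx = k l uv \<Omega>
  show "be n * of_int i \<noteq> al n * of_int j" if "int k * i + int l * j \<noteq> 0" for i j
    using index_rational[OF _ that Pn, of "k - v" "l - u"] gen index_0[OF ctx Pn] unfolding generic_def by auto
  show "be 0 * of_int i \<noteq> al 0 * of_int j" if "int k * i + int l * j \<noteq> 0" for i j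
    using index_rational[OF _ that P0, of v u] gen index_inf[OF ctx P0] unfolding generic_def by auto
  show "Determinant.det (M_mat k l n (vary * hs k l n al, varx * hs k l n be) m) \<noteq> 0" if "1 \<le> m" "m < k * l * n" for m
    using gen that unfolding generic_def \<Omega> by blast
  show "(\<Sum>i\<le>n. (of_nat m * be i + (1 + of_nat (k * i)) * (of_nat k * al i + of_nat l * be i)) * z ^ i) \<noteq> 0"
    if m: "m \<ge> 1" and 1: "(\<Sum>i\<le>n. (of_nat m * al i + (1 + of_nat (l * (n - i))) * (of_nat k * al i + of_nat l * be i)) * z ^ i) = 0"
    for m z
  proof
    assume 2: "(\<Sum>i\<le>n. (of_nat m * be i + (1 + of_nat (k * i)) * (of_nat k * al i + of_nat l * be i)) * z ^ i) = 0"
    define a b p p' where "a = poly (cpoly n al) z" and "b = poly (cpoly n be) z" and "p = poly (cpoly n P) z"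
      and "p' = z * poly (pderiv (cpoly n P)) z"
    have "(\<Sum>i\<le>n. (of_nat m * al i + (1 + of_nat (l * (n - i))) * P i) * z ^ i) =
      (\<Sum>i\<le>n. of_nat m * (al i * z ^ i) + (1 + of_nat (l * n)) * (P i * z ^ i) - of_nat l * (of_nat i * P i * z ^ i))"
      by (rule sum.cong) (auto simp: of_nat_diff algebra_simps)
    hence a: "of_nat m * a + (1 + of_nat (l * n)) * p - of_nat l * p' = 0"
      using 1 unfolding Pi a_def p_def p'_def poly_pderiv_cpoly poly_cpoly
      by (simp only: sum_subtractf sum.distrib sum_distrib_left)
    have "(\<Sum>i\<le>n. (of_nat m * be i + (1 + of_nat (k * i)) * P i) * z ^ i) =
      (\<Sum>i\<le>n. of_nat m * (be i * z ^ i) + P i * z ^ i + of_nat k * (of_nat i * P i * z ^ i))"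
      by (rule sum.cong) (auto simp: algebra_simps)
    hence b: "of_nat m * b + p + of_nat k * p' = 0"
      using 2 unfolding Pi b_def p_def p'_def poly_pderiv_cpoly poly_cpoly
      by (simp only: sum.distrib sum_distrib_left)
    have pab: "p = of_nat k * a + of_nat l * b"
      by (simp add: p_def a_def b_def poly_cpoly P_def sum_distrib_left sum.distrib algebra_simps)
    \<comment> \<open>The combination that eliminates P'(z); its value is (m + d) P(z) with d = k l
      n + k + l.\<close>
    have "of_nat k * (of_nat m * a + (1 + of_nat (l * n)) * p - of_nat l * p') + of_nat l * (of_nat m * b + p + of_nat k * p') =
      of_nat m * (of_nat k * a + of_nat l * b) + of_nat (k + k * l * n + l) * p"
      by (simp add: algebra_simps)
    hence "of_nat (m + (k + k * l * n + l)) * p = 0"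
      unfolding a b pab[symmetric] by (simp add: algebra_simps)
    hence p: "p = 0" using m by (simp del: of_nat_add add: of_nat_eq_0_iff)
    hence z: "z \<noteq> 0" "poly (pderiv (cpoly n P)) z \<noteq> 0" using roots[of z] by (auto simp: p_def)
    have "a = of_nat l * poly (cpoly n N) z"
      using poly_relations(1)[OF ctx, of z] p unfolding P_def[symmetric] N_def[symmetric] a_def p_def by simp
    hence "of_nat l * (of_nat m * poly (cpoly n N) z) = of_nat l * p'" using a p by (simp add: algebra_simps)
    hence "of_nat m * poly (cpoly n N) z = p'" using l by simp
    hence "poly (cpoly n N) z / p' = 1 / of_nat m" using m z by (auto simp: p'_def field_simps)
    hence "cs_index (chart_c k l u v) \<Omega> (1 / z) = 1 / of_nat m"
      using index_root[OF ctx z(1)] p z(2) unfolding P_def[symmetric] N_def[symmetric] p_def p'_def by simp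
    moreover have "1 / of_nat m \<in> (\<rat> :: complex set)" by simp
    moreover have "cusp k l z dvd q_of k l \<Omega>"
    proof -
      obtain h where "hs k l n P = cusp k l z * h" using cusp_dvd_hs[OF n] p unfolding p_def by blast
      moreover have "q_of k l \<Omega> = varx * vary * hs k l n P"
        by (simp add: q_of_def \<Omega> P_def hs_of_nat[symmetric] hs_add[symmetric] algebra_simps)
      ultimately show ?thesis by (metis dvd_triv_left mult.left_commute)
    qed
    ultimately show False using gen z(1) unfolding generic_def by metis
  qed
qed (use assms in auto)

theorem theorem1:
  fixes k l n u v d :: nat and fc :: "nat \<Rightarrow> complex" and f :: series2 and \<omega>\<^sub>d :: form2
  assumes "k \<ge> 1" "l \<ge> 1" "coprime k l" "n \<ge> 1"
    and "int k * int u - int l * int v = 1" "u \<le> l" "v \<le> k"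
    and "\<forall>i\<in>{1..n}. fc i \<noteq> 0" "inj_on fc {1..n}"
    and "f = curve_eq k l n fc"
    and "d = k * l * n + k + l"
    and "\<omega>\<^sub>d \<in> Qd k l d f"
    and "generic k l n u v \<omega>\<^sub>d"
  shows
    "(\<exists>c\<^sub>0 c. c\<^sub>0 \<noteq> 0 \<and> (\<forall>i\<in>{1..n}. c i \<noteq> 0) \<and> inj_on c {1..n} \<and>
        q_of k l \<omega>\<^sub>d = - cst c\<^sub>0 * curve_eq k l n c \<and>
        \<omega>\<^sub>d = log_form k l n c\<^sub>0 c
               (\<lambda>i. cs_index (chart_c k l u v) \<omega>\<^sub>d (1 / c i))
               (of_nat l * cs_index (chart_c k l u v) \<omega>\<^sub>d 0 + of_nat l - of_nat u)
               (of_nat k * cs_index (chart_inf k l u v) \<omega>\<^sub>d 0 + of_nat v)) \<and>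
     (\<forall>\<omega> \<in> Qinit k l d f \<omega>\<^sub>d.
        \<exists>!\<eta>. \<eta> \<in> normal_forms k l n \<omega>\<^sub>d \<and> strictly_formally_orbitally_equivalent \<omega> \<eta>)"
proof -
  note k = assms(1) and l = assms(2) and kl = assms(3) and n = assms(4)
  have "int (k * u) = int (l * v + 1)" using assms(5) by simp
  hence ku: "k * u = l * v + 1" unfolding of_nat_eq_iff .
  have Q: "\<omega>\<^sub>d \<in> Qset f" "form_part k l d \<omega>\<^sub>d = \<omega>\<^sub>d" using assms(12) by (auto simp: Qd_def)
  obtain T where T: "minimal_desing_curve (curve_eq k l n fc) T" "no_saddle_nodes \<omega>\<^sub>d T"
    using Q(1) unfolding Qset_def assms(10) by blast
  have cop: "coprime_form \<omega>\<^sub>d" and ax: "axes_invariant \<omega>\<^sub>d"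
    using Q(1) axes_invariant_of_curve by (auto simp: Qset_def)
  obtain al be where \<Omega>: "\<omega>\<^sub>d = (vary * hs k l n al, varx * hs k l n be)"
    using form_eq_hs[OF k l kl ax] Q(2) assms(11) by blast
  define P where "P = (\<lambda>i. of_nat k * al i + of_nat l * be i)"
  have leaves: "\<exists>\<omega>'. foliation_at \<omega>\<^sub>d (euclid k l @ [t]) \<omega>' \<and> \<not> saddle_node \<omega>'" for t
  proof -
    have "euclid k l @ [t] \<in> fibre T"
      by (rule euclid_fibre[OF kl k l n _ assms(9) T(1)]) (use assms(8) in blast)
    thus ?thesis using T(2) unfolding no_saddle_nodes_def by blast
  qed
  note ctx = k l n kl \<Omega> cop
  note sr = simple_roots[OF ctx leaves, unfolded Pp_def[OF ctx]]
  have Pn: "P n \<noteq> 0" unfolding P_def by (rule sr(1))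
  have roots: "poly (cpoly n P) z = 0 \<Longrightarrow> z \<noteq> 0 \<and> poly (pderiv (cpoly n P)) z \<noteq> 0" for z
    unfolding P_def by (rule sr(2))
  have "degree (cpoly n P) = n"
    using degree_cpoly[of n P] le_degree[of "cpoly n P" n] Pn by (simp add: coeff_cpoly)
  from distinct_roots_enumeration[OF this] obtain c where c: "inj_on c {1..n}"
    and factor: "cpoly n P = Polynomial.smult (coeff (cpoly n P) n) (\<Prod>i\<in>{1..n}. [:- c i, 1:])"
    and cr: "\<forall>i\<in>{1..n}. poly (cpoly n P) (c i) = 0"
    using roots by blast
  have "coeff (cpoly n P) n = P n" by (simp add: coeff_cpoly)
  note factor = factor[unfolded this]
  have c0: "c i \<noteq> 0" if "i \<in> {1..n}" for i using cr roots that by blast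
  have "hs k l n P = cst (P n) * (\<Prod>i\<in>{1..n}. cusp k l (c i))"
  proof -
    have "hs k l n P = cst (P n) * hs k l n (coeff (\<Prod>i\<in>{1..n}. [:- c i, 1:]))"
      unfolding hs_cst hs_cpoly[of k l n P, symmetric] factor by (rule hs_cong) simp
    thus ?thesis using hs_prod_cusp[of "{1..n}" k l c] by simp
  qed
  moreover have "q_of k l \<omega>\<^sub>d = varx * vary * hs k l n P"
    by (simp add: q_of_def \<Omega> P_def hs_of_nat[symmetric] hs_add[symmetric] algebra_simps)
  \<comment> \<open>This fixes the constant of the logarithmic form as -P_n, the value that occurs
    in \<open>eq_log_form\<close>.\<close>
  ultimately have q: "q_of k l \<omega>\<^sub>d = - cst (- P n) * curve_eq k l n c"
    by (simp add: curve_eq_def mult_ac)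
  have Pn_eq: "of_nat k * al n + of_nat l * be n = P n" by (simp add: P_def)
  note log = eq_log_form[OF k l ku assms(6,7) \<Omega> n c c0 Pn[unfolded P_def] factor[unfolded P_def],
    unfolded Pn_eq]
  interpret H: homological k l n al be
    by (rule homological_of_generic[OF k l n kl ku assms(6,7) \<Omega> assms(13) Pn[unfolded P_def]])
      (use roots in \<open>simp add: P_def\<close>)
  have wd: "H.wd = \<omega>\<^sub>d" "H.d = d" by (simp_all add: H.wd_def \<Omega> H.d_def H.N_def assms(11))
  have "\<exists>!\<eta>. \<eta> \<in> normal_forms k l n \<omega>\<^sub>d \<and> strictly_formally_orbitally_equivalent \<omega> \<eta>"
    if "\<omega> \<in> Qinit k l d f \<omega>\<^sub>d" for \<omega>
  proof -
    have "wgef k l (int d + 1) (\<omega> - \<omega>\<^sub>d)" "axes_invariant \<omega>"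
      using that by (auto simp: Qinit_def Qset_def intro: axes_invariant_of_curve wgef_initial_part)
    thus ?thesis using H.unique_normal_form unfolding wd by blast
  qed
  moreover have "- P n \<noteq> 0" "\<forall>i\<in>{1..n}. c i \<noteq> 0" using Pn c0 by simp_all
  ultimately show ?thesis using c q log by blast
qed

end
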